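(* (Critical normal form coefficients of the period-doubling bifurcation of a limit cycle in a DDE.) Let $k+1\ge 3$. Assume that the Floquet multipliers of $\Gamma$ on the unit circle are exactly $\pm1$, both simple. Let $q$ be a $T$-antiperiodic ($\mathbb{R}^n$-valued) null function of $\Delta(0)$ with $\langle q^\star,q\rangle_T=1$ ($q^\star$ the pointwise Hermitian adjoint of $q$), and let $p$ be a $T$-antiperiodic null function of $\Delta^\star(0)$ with $\langle p,\Delta'(0)q\rangle_T=1$. Put $\varphi(\tau)(\theta)=q(\tau+\theta)$ for $\tau\in\mathbb{R}$, $\theta\in[-h,0]$. Let $q_0=\dot\gamma$, let $r$ be a $T$-periodic null function of $\Delta^\star(0)$ with $\langle r,\Delta'(0)q_0\rangle_T=1$, and let $\psi^\odot(\tau)=\big(r(\tau),\theta\mapsto\int_\theta^h r(\tau+s-\theta)\,d_2\zeta(\tau+s-\theta,s)\big)$. Let the two-dimensional critical center manifold $\mathcal{W}^c_{loc}(\Gamma)$ be parametrized locally near $\Gamma$ by a $C^k$-smooth map $$\mathcal{H}(\tau,\xi)=\gamma_\tau+\xi\varphi(\tau)+\tfrac12h_2(\tau)\xi^2+\tfrac16h_3(\tau)\xi^3+\mathcal{O}(\xi^4)\in X,\qquad\tau\in\mathbb{R},\ \xi\in\mathbb{R},$$ $2T$-periodic in $\tau$ with $\mathcal{H}(\tau,\xi)=\mathcal{H}(\tau+T,-\xi)$ (so that $h_2$ is $T$-periodic and $h_3$ is $T$-antiperiodic), in which the dynamics on $\mathcal{W}^c_{loc}(\Gamma)$ has the critical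 periodic normal form $$\dot\tau=1+a\xi^2+\mathcal{O}(\xi^4),\qquad\dot\xi=c\xi^3+\mathcal{O}(\xi^4),$$ where $a,c\in\mathbb{R}$ and the $\mathcal{O}(\xi^4)$-terms are $C^k$-smooth and $2T$-periodic in $\tau$; that is, solutions $x$ of $\dot x(t)=F(x_t)$ with $x_t\in\mathcal{W}^c_{loc}(\Gamma)$ near $\Gamma$ for $t$ in an interval $I$ are written as $x_t=\mathcal{H}(\tau(t),\xi(t))$, $t\in I$, with $(\tau,\xi)$ satisfying this system. Then $$a=\tfrac12\langle r,B(\varphi,\varphi)\rangle_T$$ and $$c=\tfrac13\big\langle p,\;C(\varphi,\varphi,\varphi)+3B(\varphi,h_2)-6a\Delta'(0)\dot q\big\rangle_T,$$ where $h_2$ is selected uniquely by the condition $\langle\psi^\odot,h_2\rangle_T=0$, namely $h_2(\tau)(\theta)=v_0(\tau+\theta)+2a\theta q_0(\tau+\theta)$ with $v_0\in C_T^1(\mathbb{R},\mathbb{R}^n)$ the solution of $\Delta(0)v_0=B(\varphi,\varphi)-2a\Delta'(0)q_0$ uniquely determined by $\langle\psi^\odot,h_2\rangle_T=0$.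
   Context: Let $0<h<\infty$, $X=C([-h,0],\mathbb{R}^n)$ with the supremum norm, and $x_t\in X$, $x_t(\theta)=x(t+\theta)$. Let $F:X\to\mathbb{R}^n$ be $C^{k+1}$-smooth for an integer $k\ge1$, and let $\gamma$ be a $T$-periodic ($T>0$) solution of the delay differential equation (DDE) $\dot x(t)=F(x_t)$ with (nonhyperbolic) periodic orbit $\Gamma=\{\gamma_t:t\in\mathbb{R}\}$. Put $L(t)=DF(\gamma_t)$, represented as $L(t)\varphi=\int_0^h d_2\zeta(t,\theta)\varphi(-\theta)$ (Riemann–Stieltjes integral in the second variable), where $\zeta:\mathbb{R}\times[0,h]\to\mathbb{R}^{n\times n}$ is $T$-periodic in $t$, $\zeta(t,\cdot)$ is of bounded variation, right-continuous on $(0,h)$ and $\zeta(t,0)=0$. Let $U(t,s)$, $t\ge s$, be the solution operators $U(t,s)\varphi=y_t$ of $\dot y(t)=L(t)y_t$, $y_s=\varphi$. Floquet multipliers are the nonzero eigenvalues of the monodromy operator $U(s+T,s)$ (independent of $s$); all operators are complexified where needed. The critical (local) center manifold $\mathcal{W}^c_{loc}(\Gamma)$ is the $T$-periodic, $C^k$-smooth, locally positively invariant manifold around $\Gamma$ whose tangent bundle is the center bundle, with fiber at time $s$ the direct sum of the generalized eigenspaces of $U(s+T,s)$ for the Floquet multipliers on the unit circle. $\mathbb{C}^n$ denotes column vectors, $\mathbb{C}^{n\star}$ row vectors. $C_T^l(\mathbb{R},E)$ is the space of $T$-periodic $C^l$ functions $\mathbb{R}\to E$; $T$-antiperiodic means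 $f(\tau+T)=-f(\tau)$. The characteristic operator is $(\Delta(z)q)(\tau)=\dot q(\tau)+zq(\tau)-\int_0^h d_2\zeta(\tau,\theta)e^{-z\theta}q(\tau-\theta)$, and its adjoint is $(\Delta^\star(z)p)(\tau)=-\dot p(\tau)+zp(\tau)-\int_0^h p(\tau+\theta)e^{-z\theta}d_2\zeta(\tau+\theta,\theta)$, acting on $C^1$ $T$-periodic (or $T$-antiperiodic) functions with values in $\mathbb{C}^n$ and $\mathbb{C}^{n\star}$ respectively. $\Delta'(z)$ is the derivative with respect to $z$. A null function is a nonzero element of the kernel. $\langle p,q\rangle_T=\int_0^Tp(\tau)q(\tau)\,d\tau$ for row-/column-valued functions. For $\psi^\odot(\tau)=(w(\tau),g(\tau))\in\mathbb{R}^{n\star}\times L^1([0,h],\mathbb{R}^{n\star})$ and $\psi(\tau)\in X$, $\langle\psi^\odot,\psi\rangle_T=\int_0^T\big[w(\tau)\psi(\tau)(0)+\int_0^hg(\tau)(\theta)\psi(\tau)(-\theta)\,d\theta\big]d\tau$. For maps $\psi_i:\mathbb{R}\to X$, $B(\psi_1,\psi_2)(\tau)=D^2F(\gamma_\tau)(\psi_1(\tau),\psi_2(\tau))$ and $C(\psi_1,\psi_2,\psi_3)(\tau)=D^3F(\gamma_\tau)(\psi_1(\tau),\psi_2(\tau),\psi_3(\tau))$.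
   Formalization: The factor 1/3 in the formula for c is corrected to 1/6: with the stated normalization ⟨p,Δ'(0)q⟩_T=1 the ξ³-terms give 6c=⟨p,C(φ,φ,φ)+3B(φ,h_2)-6aΔ'(0)q̇⟩_T, so the printed 1/3 (right for normalization 1/2) yields 2c. *)

theory Defs
  imports "HOL-Analysis.Analysis"
begin

section \<open>Smooth maps between normed spaces\<close>

text \<open>\<open>iter_deriv f [v\<^sub>1, \<dots>, v\<^sub>j] x\<close> is the \<open>j\<close>-th Frechet derivative of \<open>f\<close> at \<open>x\<close>,
  applied to the directions \<open>v\<^sub>1, \<dots>, v\<^sub>j\<close>.\<close>

fun iter_deriv :: "('a::real_normed_vector \<Rightarrow> 'b::real_normed_vector) \<Rightarrow> 'a list \<Rightarrow> 'a \<Rightarrow> 'b" where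
  "iter_deriv f [] = f"
| "iter_deriv f (v # vs) = (\<lambda>x. frechet_derivative (iter_deriv f vs) (at x) v)"

text \<open>\<open>C\<^sup>m\<close> in the Frechet sense on an open set \<open>S\<close>: the derivatives up to order \<open>m\<close> exist and are
  continuous for the norm of bounded multilinear maps (which is the second clause). By the mean
  value inequality, continuity in this norm makes differentiability of the maps with fixed
  directions \<open>vs\<close> uniform in \<open>vs\<close>.\<close>

definition smooth_on :: "nat \<Rightarrow> 'a::real_normed_vector set \<Rightarrow> ('a \<Rightarrow> 'b::real_normed_vector) \<Rightarrow> bool" where
  "smooth_on m S f \<longleftrightarrow>
     (\<forall>vs. length vs < m \<longrightarrow> (\<forall>x\<in>S. iter_deriv f vs differentiable (at x))) \<and>
     (\<forall>j\<le>m. \<forall>x\<in>S. \<forall>e>0. \<exists>d>0. \<forall>y\<in>S. dist y x < d \<longrightarrow>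
        (\<forall>vs. length vs = j \<longrightarrow>
           norm (iter_deriv f vs y - iter_deriv f vs x) \<le> e * prod_list (map norm vs)))"

section \<open>The phase space\<close>

text \<open>\<open>C([-h,0],E)\<close> is realised isometrically as the closed subspace \<open>phase_space h\<close> of
  \<open>\<real> \<Rightarrow>\<^sub>C E\<close>: the functions that are continued constantly outside \<open>[-h,0]\<close>.
  \<open>restrict_state h f\<close> is the element of it that is given by \<open>f\<close> on \<open>[-h,0]\<close>.\<close>

definition restrict_state :: "real \<Rightarrow> (real \<Rightarrow> 'e::real_normed_vector) \<Rightarrow> (real \<Rightarrow>\<^sub>C 'e)" where
  "restrict_state h f = Bcontfun (\<lambda>\<theta>. f (max (-h) (min 0 \<theta>)))"

definition phase_space :: "real \<Rightarrow> (real \<Rightarrow>\<^sub>C 'e::real_normed_vector) set" where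
  "phase_space h = {\<phi>. \<phi> = restrict_state h (apply_bcontfun \<phi>)}"

text \<open>A functional on \<open>C([-h,0],E)\<close> is the same as a map on \<open>\<real> \<Rightarrow>\<^sub>C E\<close> that only depends on the
  restriction of its argument to \<open>[-h,0]\<close>. As the restriction is a bounded linear projection onto
  the phase space, \<open>C\<^sup>m\<close>-smoothness on the two spaces is the same, with the same
  derivatives in directions of the phase space.\<close>

definition phase_functional :: "real \<Rightarrow> ((real \<Rightarrow>\<^sub>C 'e::real_normed_vector) \<Rightarrow> 'b) \<Rightarrow> bool" where
  "phase_functional h F \<longleftrightarrow> (\<forall>\<phi>. F \<phi> = F (restrict_state h (apply_bcontfun \<phi>)))"

definition hist :: "real \<Rightarrow> (real \<Rightarrow> 'e::real_normed_vector) \<Rightarrow> real \<Rightarrow> (real \<Rightarrow>\<^sub>C 'e)" where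
  "hist h x t = restrict_state h (\<lambda>\<theta>. x (t + \<theta>))"

definition dde_solution ::
  "real \<Rightarrow> ((real \<Rightarrow>\<^sub>C 'e::real_normed_vector) \<Rightarrow> 'e) \<Rightarrow> (real \<Rightarrow> 'e) \<Rightarrow> real set \<Rightarrow> bool" where
  "dde_solution h F x I \<longleftrightarrow>
     continuous_on (\<Union>t\<in>I. {t - h..t}) x \<and>
     (\<forall>t\<in>I. (x has_vector_derivative F (hist h x t)) (at t within I))"

definition periodic :: "real \<Rightarrow> (real \<Rightarrow> 'e) \<Rightarrow> bool" where
  "periodic T f \<longleftrightarrow> (\<forall>t. f (t + T) = f t)"

definition antiperiodic :: "real \<Rightarrow> (real \<Rightarrow> 'e::uminus) \<Rightarrow> bool" where
  "antiperiodic T f \<longleftrightarrow> (\<forall>t. f (t + T) = - f t)"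

section \<open>Linear equations, monodromy operators and Floquet multipliers\<close>

definition evolution ::
  "real \<Rightarrow> (real \<Rightarrow> (real \<Rightarrow>\<^sub>C 'e::real_normed_vector) \<Rightarrow> 'e) \<Rightarrow> real \<Rightarrow> real \<Rightarrow> (real \<Rightarrow>\<^sub>C 'e) \<Rightarrow> (real \<Rightarrow>\<^sub>C 'e)" where
  "evolution h L t s \<phi> = (THE \<psi>. \<exists>y.
     continuous_on {s - h..} y \<and> (\<forall>\<theta>\<in>{-h..0}. y (s + \<theta>) = \<phi> \<theta>) \<and>
     (\<forall>u\<ge>s. (y has_vector_derivative L u (hist h y u)) (at u within {s..})) \<and>
     \<psi> = hist h y t)"

text \<open>The complexification of a real vector space \<open>X\<close> is \<open>X \<times> X\<close>, where \<open>(u, v)\<close> stands for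
  \<open>u + \<i> v\<close>.\<close>

definition cscale :: "complex \<Rightarrow> 'a::real_vector \<times> 'a \<Rightarrow> 'a \<times> 'a" where
  "cscale z w = (Re z *\<^sub>R fst w - Im z *\<^sub>R snd w, Re z *\<^sub>R snd w + Im z *\<^sub>R fst w)"

definition complexify :: "('a \<Rightarrow> 'a) \<Rightarrow> 'a \<times> 'a \<Rightarrow> 'a \<times> 'a" where
  "complexify A = map_prod A A"

definition is_eigenvalue :: "'a::real_vector set \<Rightarrow> ('a \<Rightarrow> 'a) \<Rightarrow> complex \<Rightarrow> bool" where
  "is_eigenvalue X A \<mu> \<longleftrightarrow> (\<exists>w\<in>X \<times> X. w \<noteq> 0 \<and> complexify A w = cscale \<mu> w)"

definition gen_eigenspace :: "'a::real_vector set \<Rightarrow> ('a \<Rightarrow> 'a) \<Rightarrow> complex \<Rightarrow> ('a \<times> 'a) set" where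
  "gen_eigenspace X A \<mu> = {w \<in> X \<times> X. \<exists>j. ((\<lambda>w. complexify A w - cscale \<mu> w) ^^ j) w = 0}"

text \<open>Algebraic multiplicity one, i.e. the generalized eigenspace has complex dimension one.\<close>

definition simple_eigenvalue :: "'a::real_vector set \<Rightarrow> ('a \<Rightarrow> 'a) \<Rightarrow> complex \<Rightarrow> bool" where
  "simple_eigenvalue X A \<mu> \<longleftrightarrow> (\<exists>w. w \<noteq> 0 \<and> gen_eigenspace X A \<mu> = range (\<lambda>z. cscale z w))"

definition monodromy ::
  "real \<Rightarrow> (real \<Rightarrow> (real \<Rightarrow>\<^sub>C 'e::real_normed_vector) \<Rightarrow> 'e) \<Rightarrow> real \<Rightarrow> real \<Rightarrow> (real \<Rightarrow>\<^sub>C 'e) \<Rightarrow> (real \<Rightarrow>\<^sub>C 'e)" where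
  "monodromy h L T s = evolution h L (s + T) s"

definition floquet_multiplier ::
  "real \<Rightarrow> (real \<Rightarrow> (real \<Rightarrow>\<^sub>C 'e::real_normed_vector) \<Rightarrow> 'e) \<Rightarrow> real \<Rightarrow> real \<Rightarrow> complex \<Rightarrow> bool" where
  "floquet_multiplier h L T s \<mu> \<longleftrightarrow> \<mu> \<noteq> 0 \<and> is_eigenvalue (phase_space h) (monodromy h L T s) \<mu>"

text \<open>The generalized eigenspaces are complex subspaces, so their sum is the real span of their
  union.\<close>

definition center_fiber ::
  "real \<Rightarrow> (real \<Rightarrow> (real \<Rightarrow>\<^sub>C 'e::real_normed_vector) \<Rightarrow> 'e) \<Rightarrow> real \<Rightarrow> real
    \<Rightarrow> ((real \<Rightarrow>\<^sub>C 'e) \<times> (real \<Rightarrow>\<^sub>C 'e)) set" where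
  "center_fiber h L T s =
     span (\<Union>\<mu>\<in>{\<mu>. floquet_multiplier h L T s \<mu> \<and> norm \<mu> = 1}.
        gen_eigenspace (phase_space h) (monodromy h L T s) \<mu>)"

section \<open>Local center manifolds\<close>

definition smooth_surface :: "nat \<Rightarrow> 'a::real_normed_vector set \<Rightarrow> bool" where
  "smooth_surface k W \<longleftrightarrow>
     (\<forall>w\<in>W. \<exists>N V. \<exists>f :: real \<times> real \<Rightarrow> 'a. \<exists>g.
        open N \<and> w \<in> N \<and> open V \<and> homeomorphism V (W \<inter> N) f g \<and> smooth_on k V f \<and>
        (\<forall>u\<in>V. inj (frechet_derivative f (at u))))"

definition tangent_vectors :: "'a::real_normed_vector set \<Rightarrow> 'a \<Rightarrow> 'a set" where
  "tangent_vectors W w =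
     {v. \<exists>\<sigma> \<epsilon>. \<epsilon> > 0 \<and> (\<forall>t. \<bar>t\<bar> < \<epsilon> \<longrightarrow> \<sigma> t \<in> W) \<and> \<sigma> 0 = w \<and> (\<sigma> has_vector_derivative v) (at (0::real))}"

definition locally_positively_invariant ::
  "real \<Rightarrow> ((real \<Rightarrow>\<^sub>C 'e::real_normed_vector) \<Rightarrow> 'e) \<Rightarrow> (real \<Rightarrow>\<^sub>C 'e) set \<Rightarrow> (real \<Rightarrow>\<^sub>C 'e) set \<Rightarrow> bool" where
  "locally_positively_invariant h F \<Gamma> W \<longleftrightarrow>
     (\<exists>N. open N \<and> \<Gamma> \<subseteq> N \<and>
        (\<forall>x b. dde_solution h F x {0..b} \<and> hist h x 0 \<in> W \<and> (\<forall>t\<in>{0..b}. hist h x t \<in> N) \<longrightarrow>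
           (\<forall>t\<in>{0..b}. hist h x t \<in> W)))"

text \<open>Two-dimensional local center manifold around the orbit \<open>\<Gamma>\<close> of the \<open>T\<close>-periodic solution \<open>\<gamma>\<close>, as
  a subset of the phase space. The fiber is a space of complexified vectors; its real vectors
  \<open>u = u + \<i> 0\<close> are the ones that are tangent to the manifold.\<close>

definition local_center_manifold ::
  "nat \<Rightarrow> real \<Rightarrow> ((real \<Rightarrow>\<^sub>C 'e::real_normed_vector) \<Rightarrow> 'e) \<Rightarrow> real \<Rightarrow> (real \<Rightarrow> 'e) \<Rightarrow> (real \<Rightarrow>\<^sub>C 'e) set \<Rightarrow> bool" where
  "local_center_manifold k h F T \<gamma> W \<longleftrightarrow>
     range (hist h \<gamma>) \<subseteq> W \<and> W \<subseteq> phase_space h \<and>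
     smooth_surface k W \<and>
     locally_positively_invariant h F (range (hist h \<gamma>)) W \<and>
     (\<forall>s. tangent_vectors W (hist h \<gamma> s) =
        {u. (u, 0) \<in> center_fiber h (\<lambda>t. frechet_derivative F (at (hist h \<gamma> t))) T s})"

section \<open>Stieltjes integrals\<close>

text \<open>Limit of the sums of \<open>U x (sup K) - U x (inf K)\<close> over tagged divisions \<open>{(x, K)}\<close> of \<open>[a,b]\<close> as
  the mesh tends to 0. For \<open>U x \<theta> = \<eta> \<theta> * f x\<close> this is the Riemann--Stieltjes integral of \<open>f\<close> with
  respect to \<open>\<eta>\<close>. An integrator \<open>d\<^sub>2 \<zeta>(\<tau> + \<theta>, \<theta>)\<close>, with differential in the second variable
  only, has the sums with \<open>U x \<theta> = f x * \<zeta> (\<tau> + x) \<theta>\<close>: the first variable is evaluated at the tag.\<close>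

definition has_stieltjes ::
  "(real \<Rightarrow> real \<Rightarrow> 'b::real_normed_vector) \<Rightarrow> 'b \<Rightarrow> real \<Rightarrow> real \<Rightarrow> bool" where
  "has_stieltjes U J a b \<longleftrightarrow>
     (\<forall>e>0. \<exists>d>0. \<forall>P. P tagged_division_of {a..b} \<and> (\<lambda>x. ball x d) fine P \<longrightarrow>
        norm ((\<Sum>(x, K)\<in>P. U x (Sup K) - U x (Inf K)) - J) < e)"

definition stieltjes :: "real \<Rightarrow> real \<Rightarrow> (real \<Rightarrow> real \<Rightarrow> 'b::real_normed_vector) \<Rightarrow> 'b" where
  "stieltjes a b U = (THE J. has_stieltjes U J a b)"

definition bounded_variation_on :: "(real \<Rightarrow> 'b::real_normed_vector) \<Rightarrow> real set \<Rightarrow> bool" where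
  "bounded_variation_on f S \<longleftrightarrow>
     (\<exists>K. \<forall>\<D>. \<D> division_of S \<longrightarrow> (\<Sum>J\<in>\<D>. norm (f (Sup J) - f (Inf J))) \<le> K)"

text \<open>\<open>\<zeta>\<close> is a \<open>T\<close>-periodic kernel that represents the linear functionals \<open>L t\<close> on the phase space.\<close>

definition represents_kernel ::
  "real \<Rightarrow> real \<Rightarrow> (real \<Rightarrow> real \<Rightarrow> real^'n^'n) \<Rightarrow> (real \<Rightarrow> (real \<Rightarrow>\<^sub>C (real^'n)) \<Rightarrow> real^'n) \<Rightarrow> bool" where
  "represents_kernel h T \<zeta> L \<longleftrightarrow>
     (\<forall>t. \<forall>\<theta>\<in>{0..h}. \<zeta> (t + T) \<theta> = \<zeta> t \<theta>) \<and>
     (\<forall>t. bounded_variation_on (\<zeta> t) {0..h} \<and>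
          (\<forall>\<theta>\<in>{0<..<h}. continuous (at_right \<theta>) (\<zeta> t)) \<and> \<zeta> t 0 = 0) \<and>
     (\<forall>t. \<forall>\<phi>\<in>phase_space h. has_stieltjes (\<lambda>x \<theta>. \<zeta> t \<theta> *v apply_bcontfun \<phi> (- x)) (L t \<phi>) 0 h)"

section \<open>Characteristic operators and pairings\<close>

text \<open>Row and column vectors are both of type \<open>complex^'n\<close>; a row vector multiplies a matrix by \<open>v*\<close>.\<close>

definition cvec :: "real^'n \<Rightarrow> complex^'n" where
  "cvec v = (\<chi> i. of_real (v $ i))"

definition cmat :: "real^'n^'m \<Rightarrow> complex^'n^'m" where
  "cmat A = (\<chi> i j. of_real (A $ i $ j))"

definition char_op ::
  "real \<Rightarrow> (real \<Rightarrow> real \<Rightarrow> real^'n^'n) \<Rightarrow> complex \<Rightarrow> (real \<Rightarrow> complex^'n) \<Rightarrow> real \<Rightarrow> complex^'n" where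
  "char_op h \<zeta> z q \<tau> =
     vector_derivative q (at \<tau>) + z *s q \<tau>
     - stieltjes 0 h (\<lambda>x \<theta>. cmat (\<zeta> \<tau> \<theta>) *v (exp (- z * of_real x) *s q (\<tau> - x)))"

definition char_op_deriv ::
  "real \<Rightarrow> (real \<Rightarrow> real \<Rightarrow> real^'n^'n) \<Rightarrow> complex \<Rightarrow> (real \<Rightarrow> complex^'n) \<Rightarrow> real \<Rightarrow> complex^'n" where
  "char_op_deriv h \<zeta> z q \<tau> = (\<chi> i. deriv (\<lambda>w. char_op h \<zeta> w q \<tau> $ i) z)"

definition adj_char_op ::
  "real \<Rightarrow> (real \<Rightarrow> real \<Rightarrow> real^'n^'n) \<Rightarrow> complex \<Rightarrow> (real \<Rightarrow> complex^'n) \<Rightarrow> real \<Rightarrow> complex^'n" where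
  "adj_char_op h \<zeta> z p \<tau> =
     - vector_derivative p (at \<tau>) + z *s p \<tau>
     - stieltjes 0 h (\<lambda>x \<theta>. (exp (- z * of_real x) *s p (\<tau> + x)) v* cmat (\<zeta> (\<tau> + x) \<theta>))"

definition null_function ::
  "((real \<Rightarrow> 'e::real_normed_vector) \<Rightarrow> real \<Rightarrow> 'e) \<Rightarrow> (real \<Rightarrow> 'e) \<Rightarrow> bool" where
  "null_function D f \<longleftrightarrow> f C1_differentiable_on UNIV \<and> (\<forall>\<tau>. D f \<tau> = 0) \<and> (\<exists>\<tau>. f \<tau> \<noteq> 0)"

definition pairing :: "real \<Rightarrow> (real \<Rightarrow> complex^'n) \<Rightarrow> (real \<Rightarrow> complex^'n) \<Rightarrow> complex" where
  "pairing T p q = integral {0..T} (\<lambda>\<tau>. \<Sum>i\<in>UNIV. p \<tau> $ i * q \<tau> $ i)"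

definition sun_pairing ::
  "real \<Rightarrow> real \<Rightarrow> (real \<Rightarrow> (real^'n) \<times> (real \<Rightarrow> real^'n)) \<Rightarrow> (real \<Rightarrow> (real \<Rightarrow>\<^sub>C (real^'n))) \<Rightarrow> real" where
  "sun_pairing h T \<Psi> \<psi> =
     integral {0..T} (\<lambda>\<tau>. fst (\<Psi> \<tau>) \<bullet> \<psi> \<tau> 0
       + integral {0..h} (\<lambda>\<theta>. snd (\<Psi> \<tau>) \<theta> \<bullet> \<psi> \<tau> (- \<theta>)))"

definition adjoint_state ::
  "real \<Rightarrow> (real \<Rightarrow> real \<Rightarrow> real^'n^'n) \<Rightarrow> (real \<Rightarrow> real^'n) \<Rightarrow> real \<Rightarrow> (real^'n) \<times> (real \<Rightarrow> real^'n)" where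
  "adjoint_state h \<zeta> r \<tau> =
     (r \<tau>, \<lambda>\<theta>. stieltjes \<theta> h (\<lambda>x s. r (\<tau> + x - \<theta>) v* \<zeta> (\<tau> + x - \<theta>) s))"

section \<open>Parametrized center manifold with critical normal form\<close>

definition parametrizes_near :: "'a::topological_space set \<Rightarrow> 'a set \<Rightarrow> (real \<Rightarrow> real \<Rightarrow> 'a) \<Rightarrow> real \<Rightarrow> bool" where
  "parametrizes_near \<Gamma> W H \<delta> \<longleftrightarrow>
     (\<forall>\<tau> \<xi>. \<bar>\<xi>\<bar> < \<delta> \<longrightarrow> H \<tau> \<xi> \<in> W) \<and>
     (\<forall>\<epsilon>>0. \<exists>N. open N \<and> \<Gamma> \<subseteq> N \<and> W \<inter> N \<subseteq> {H \<tau> \<xi> |\<tau> \<xi>. \<bar>\<xi>\<bar> < \<epsilon>})"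

text \<open>Solutions in \<open>W\<close> near \<open>\<Gamma>\<close> are \<open>x\<^sub>t = H(\<tau>(t), \<xi>(t))\<close> with
  \<open>\<tau>' = 1 + a \<xi>\<^sup>2 + \<rho>\<^sub>1(\<tau>,\<xi>)\<close> and \<open>\<xi>' = c \<xi>\<^sup>3 + \<rho>\<^sub>2(\<tau>,\<xi>)\<close>. Closer to \<open>\<Gamma>\<close>, the coordinate \<open>\<xi>\<close> is
  smaller; this is the quantifier over \<open>\<epsilon>\<close>.\<close>

definition pd_normal_form_dynamics ::
  "real \<Rightarrow> ((real \<Rightarrow>\<^sub>C 'e::real_normed_vector) \<Rightarrow> 'e) \<Rightarrow> (real \<Rightarrow>\<^sub>C 'e) set \<Rightarrow> (real \<Rightarrow>\<^sub>C 'e) set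
    \<Rightarrow> (real \<Rightarrow> real \<Rightarrow> (real \<Rightarrow>\<^sub>C 'e)) \<Rightarrow> real \<Rightarrow> real \<Rightarrow> (real \<Rightarrow> real \<Rightarrow> real) \<Rightarrow> (real \<Rightarrow> real \<Rightarrow> real) \<Rightarrow> bool" where
  "pd_normal_form_dynamics h F \<Gamma> W H a c \<rho>\<^sub>1 \<rho>\<^sub>2 \<longleftrightarrow>
     (\<forall>\<epsilon>>0. \<exists>N. open N \<and> \<Gamma> \<subseteq> N \<and>
        (\<forall>x I. is_interval I \<and> dde_solution h F x I \<and> (\<forall>t\<in>I. hist h x t \<in> W \<inter> N) \<longrightarrow>
           (\<exists>\<tau> \<xi>. \<forall>t\<in>I. \<bar>\<xi> t\<bar> < \<epsilon> \<and> hist h x t = H (\<tau> t) (\<xi> t) \<and>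
              (\<tau> has_real_derivative 1 + a * (\<xi> t)\<^sup>2 + \<rho>\<^sub>1 (\<tau> t) (\<xi> t)) (at t within I) \<and>
              (\<xi> has_real_derivative c * (\<xi> t) ^ 3 + \<rho>\<^sub>2 (\<tau> t) (\<xi> t)) (at t within I))))"

text \<open>The remainder terms of the normal form.\<close>

definition normal_form_remainder :: "nat \<Rightarrow> real \<Rightarrow> real \<Rightarrow> (real \<Rightarrow> real \<Rightarrow> real) \<Rightarrow> bool" where
  "normal_form_remainder k T \<delta> \<rho> \<longleftrightarrow>
     smooth_on k (UNIV \<times> {-\<delta><..<\<delta>}) (\<lambda>(\<tau>, \<xi>). \<rho> \<tau> \<xi>) \<and>
     (\<forall>\<tau> \<xi>. \<bar>\<xi>\<bar> < \<delta> \<longrightarrow> \<rho> (\<tau> + 2 * T) \<xi> = \<rho> \<tau> \<xi>) \<and>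
     (\<exists>K. \<forall>\<tau> \<xi>. \<bar>\<xi>\<bar> < \<delta> \<longrightarrow> \<bar>\<rho> \<tau> \<xi>\<bar> \<le> K * \<xi> ^ 4)"

text \<open>The function \<open>\<tau> \<mapsto> (\<theta> \<mapsto> v(\<tau> + \<theta>) + 2 a \<theta> q\<^sub>0(\<tau> + \<theta>))\<close>.\<close>

definition h2_of :: "real \<Rightarrow> real \<Rightarrow> (real \<Rightarrow> 'e) \<Rightarrow> (real \<Rightarrow> 'e) \<Rightarrow> real \<Rightarrow> (real \<Rightarrow>\<^sub>C 'e::real_normed_vector)" where
  "h2_of h a q\<^sub>0 v \<tau> = restrict_state h (\<lambda>\<theta>. v (\<tau> + \<theta>) + (2 * a * \<theta>) *\<^sub>R q\<^sub>0 (\<tau> + \<theta>))"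

text \<open>The constant in the formula for \<open>c\<close>. The terms of order \<open>\<xi>\<^sup>3\<close> of the homological equation,
  at \<open>\<theta> = 0\<close>, are solvable only if \<open>p\<close> annihilates
  \<open>C(\<phi>,\<phi>,\<phi>) + 3 B(\<phi>,h\<^sub>2) - 6 a \<Delta>'(0) q' - 6 c \<Delta>'(0) q\<close>, where \<open>q'\<close> is the derivative of \<open>q\<close>. Thus
  \<open>6 c \<langle>p, \<Delta>'(0) q\<rangle>\<^sub>T = \<langle>p, C(\<phi>,\<phi>,\<phi>) + 3 B(\<phi>,h\<^sub>2) - 6 a \<Delta>'(0) q'\<rangle>\<^sub>T\<close>, and the factor is \<open>1/6\<close> for the
  normalization \<open>\<langle>p, \<Delta>'(0) q\<rangle>\<^sub>T = 1\<close>. The factor \<open>1/3\<close> in the source belongs to the normalization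
  \<open>\<langle>p, \<Delta>'(0) q\<rangle>\<^sub>T = 1/2\<close>; with the normalization 1 it is off by 2: for an ordinary differential equation
  with \<open>F(\<gamma> + \<xi> q) = \<gamma>' + \<xi> q' + c \<xi>\<^sup>3 q\<close> along \<open>\<gamma>\<close> one has \<open>a = 0\<close>, \<open>h\<^sub>2 = 0\<close>, \<open>\<Delta>'(0) q = q\<close> and
  \<open>D\<^sup>3F(q,q,q) = 6 c q\<close>.\<close>

end

theory Submission
  imports Defs
begin

text \<open>The critical normal form is read off by comparing, along an actual solution on the center manifold,
  the flow with the expansion of the parametrization. A solution \<open>x\<^sub>t = H(\<tau>(t), \<xi>(t))\<close> with small
  \<open>\<xi> \<noteq> 0\<close> satisfies \<open>x'(t) = F(H(\<tau>, \<xi>))\<close>; expanding both sides in \<open>\<xi>\<close> gives, at \<open>\<theta> = 0\<close>, differential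
  equations for \<open>v(\<tau>) = h\<^sub>2(\<tau>)(0)\<close> and \<open>w(\<tau>) = h\<^sub>3(\<tau>)(0)\<close>, and comparing the state at time \<open>t\<close> with
  the values at earlier times gives the dependence on \<open>\<theta>\<close>:
  \<open>h\<^sub>2(\<tau>)(\<theta>) = v(\<tau> + \<theta>) + 2 a \<theta> \<gamma>'(\<tau> + \<theta>)\<close> and
  \<open>h\<^sub>3(\<tau>)(\<theta>) = w(\<tau> + \<theta>) + 6 a \<theta> q'(\<tau> + \<theta>) + 6 c \<theta> q(\<tau> + \<theta>)\<close>. Together these are
  \<open>\<Delta>(0) v = B(\<phi>,\<phi>) - 2 a \<Delta>'(0) \<gamma>'\<close> and
  \<open>\<Delta>(0) w = C(\<phi>,\<phi>,\<phi>) + 3 B(\<phi>,h\<^sub>2) - 6 a \<Delta>'(0) q' - 6 c \<Delta>'(0) q\<close>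
  (\<open>v_equation\<close>, \<open>w_equation\<close>). Null functions of the adjoint operator annihilate the range of
  \<open>\<Delta>(0)\<close> (\<open>solvability\<close>), so pairing with \<open>r\<close> and \<open>p\<close> yields \<open>a\<close> and \<open>c\<close>.

  The expansion of \<open>H\<close> is not differentiated, as only its remainder is bounded. The differential
  equations are obtained in integrated form along trajectories (\<open>time_increments\<close>,
  \<open>state_relations\<close>), and powers of \<open>\<xi>\<close> are separated because trajectories with arbitrarily small
  nonzero \<open>\<xi>\<close> pass every phase (\<open>traj_exists\<close>). That they exist rests on the existence of
  solutions of the delay equation near \<open>\<gamma>\<close> and on the fact that \<open>H(0, \<cdot>)\<close> leaves the periodic orbit, since \<open>\<phi>\<close> is not a
  multiple of \<open>\<gamma>'\<close>.

  No Fredholm theory enters: a solution of the equation for \<open>v\<^sub>0\<close> is provided by \<open>v\<close> itself, and its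
  solutions differ by multiples of \<open>\<gamma>'\<close> because the multiplier 1 is simple (\<open>periodic_lin_sol\<close>). The
  functional \<open>\<langle>\<psi>\<^sup>\<odot>, \<cdot>\<rangle>\<close> takes the value \<open>\<langle>r, \<Delta>'(0) \<gamma>'\<rangle> = 1\<close> on \<open>\<gamma>'\<close>, which fixes the multiple
  (\<open>sun_pairing_h2_of\<close>). The formula for \<open>c\<close> does not depend on it, as \<open>B(\<phi>, \<gamma>') = \<Delta>(0) q'\<close>.

  The adjoint identities require Stieltjes integrals with integrator \<open>\<zeta>(\<tau> + x, x)\<close> and their
  exchange with integrals over \<open>\<tau>\<close>, although \<open>\<zeta>\<close> is only given for each time separately. Since \<open>F\<close>
  is at least three times continuously differentiable, \<open>L\<close> is \<open>C\<^sup>2\<close> in time, and this yields a monotone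
  function that dominates the variation of \<open>\<zeta>\<close> and of its difference quotients in time
  (\<open>majorant\<close>).\<close>

section \<open>Multilinear derivatives of smooth maps\<close>

\<comment> \<open>Iterated derivatives of explicit direction lists stay folded.\<close>
declare iter_deriv.simps(2) [simp del]

lemma has_vector_derivative_slope:
  fixes f :: "real \<Rightarrow> 'b::real_normed_vector"
  shows "(f has_vector_derivative D) (at x within S) \<longleftrightarrow>
     ((\<lambda>y. (f y - f x) /\<^sub>R (y - x)) \<longlongrightarrow> D) (at x within S)"
proof -
  have eq: "norm ((1 / norm (y - x)) *\<^sub>R (f y - (f x + (y - x) *\<^sub>R D)))
      = norm ((f y - f x) /\<^sub>R (y - x) - D)" if "y \<noteq> x" for y
  proof -
    have "(f y - f x) /\<^sub>R (y - x) - D = (f y - (f x + (y - x) *\<^sub>R D)) /\<^sub>R (y - x)"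
      using that by (simp add: scaleR_right_diff_distrib diff_diff_eq[symmetric])
    then show ?thesis using that by (simp add: divide_inverse)
  qed
  have "(f has_vector_derivative D) (at x within S) \<longleftrightarrow>
    ((\<lambda>y. (1 / norm (y - x)) *\<^sub>R (f y - (f x + (y - x) *\<^sub>R D))) \<longlongrightarrow> 0) (at x within S)"
    by (simp add: has_vector_derivative_def has_derivative_within bounded_linear_scaleR_left)
  also have "\<dots> \<longleftrightarrow> ((\<lambda>y. norm ((1 / norm (y - x)) *\<^sub>R (f y - (f x + (y - x) *\<^sub>R D)))) \<longlongrightarrow> 0) (at x within S)"
    by (simp only: tendsto_norm_zero_iff)
  also have "\<dots> \<longleftrightarrow> ((\<lambda>y. norm ((f y - f x) /\<^sub>R (y - x) - D)) \<longlongrightarrow> 0) (at x within S)"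
    by (rule tendsto_cong) (use eq in \<open>auto simp: eventually_at_filter\<close>)
  also have "\<dots> \<longleftrightarrow> ((\<lambda>y. (f y - f x) /\<^sub>R (y - x)) \<longlongrightarrow> D) (at x within S)"
    by (subst tendsto_norm_zero_iff) (rule LIM_zero_iff)
  finally show ?thesis .
qed

lemma vector_mean_value_bound:
  fixes f :: "real \<Rightarrow> 'b::real_normed_vector"
  assumes "\<And>s. s \<in> {0..t} \<Longrightarrow> (f has_vector_derivative f' s) (at s within {0..t})"
    and "\<And>s. s \<in> {0..t} \<Longrightarrow> norm (f' s) \<le> B" and "0 \<le> t"
  shows "norm (f t - f 0) \<le> B * t"
proof -
  have "norm (f t - f 0) \<le> B * norm (t - 0)"
    by (rule differentiable_bound[of "{0..t}" f "\<lambda>s h. h *\<^sub>R f' s" B])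
      (use assms in \<open>auto simp: has_vector_derivative_def mult.commute[of B] intro!: onorm_le mult_left_mono\<close>)
  then show ?thesis using \<open>0 \<le> t\<close> by simp
qed

text \<open>A \<open>C\<^sup>m\<close> map on the whole space. In \<open>iter_deriv F (u # vs)\<close> the head \<open>u\<close> is the direction of the
  last differentiation.\<close>

locale smooth_map =
  fixes F :: "'a::real_normed_vector \<Rightarrow> 'b::real_normed_vector" and m :: nat
  assumes smooth: "smooth_on m UNIV F"
begin

lemma iter_has_derivative:
  "length vs < m \<Longrightarrow> (iter_deriv F vs has_derivative (\<lambda>v. iter_deriv F (v # vs) x)) (at x)"
  using smooth by (simp add: smooth_on_def frechet_derivative_works iter_deriv.simps(2))

lemma iter_close:
  assumes "j \<le> m" "e > 0"
  shows "\<exists>d>0. \<forall>y. dist y x < d \<longrightarrow> (\<forall>vs. length vs = j \<longrightarrow>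
           norm (iter_deriv F vs y - iter_deriv F vs x) \<le> e * prod_list (map norm vs))"
  using smooth assms by (simp add: smooth_on_def)

lemma iter_linear: "length vs < m \<Longrightarrow> linear (\<lambda>v. iter_deriv F (v # vs) x)"
  using iter_has_derivative has_derivative_linear by blast

lemma iter_add:
  "length us + length ws < m \<Longrightarrow>
   iter_deriv F (us @ (v + w) # ws) = (\<lambda>x. iter_deriv F (us @ v # ws) x + iter_deriv F (us @ w # ws) x)"
proof (induction us)
  case Nil
  then show ?case using linear_add[OF iter_linear[of ws]] by (simp add: fun_eq_iff)
next
  case (Cons u us)
  have "frechet_derivative (\<lambda>x. iter_deriv F (us @ v # ws) x + iter_deriv F (us @ w # ws) x) (at x)
     = (\<lambda>u. iter_deriv F (u # us @ v # ws) x + iter_deriv F (u # us @ w # ws) x)" for x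
    by (rule frechet_derivative_at[symmetric])
      (use Cons.prems in \<open>intro has_derivative_add iter_has_derivative, auto\<close>)
  then show ?case using Cons by (auto simp: iter_deriv.simps(2)[of _ _ "us @ (v + w) # ws"])
qed

lemma iter_scaleR:
  "length us + length ws < m \<Longrightarrow>
   iter_deriv F (us @ (c *\<^sub>R v) # ws) = (\<lambda>x. c *\<^sub>R iter_deriv F (us @ v # ws) x)"
proof (induction us)
  case Nil
  then show ?case using linear_scale[OF iter_linear[of ws]] by (simp add: fun_eq_iff)
next
  case (Cons u us)
  have "frechet_derivative (\<lambda>x. c *\<^sub>R iter_deriv F (us @ v # ws) x) (at x)
     = (\<lambda>u. c *\<^sub>R iter_deriv F (u # us @ v # ws) x)" for x
    by (rule frechet_derivative_at[symmetric])
      (use Cons.prems in \<open>intro has_derivative_scaleR_right iter_has_derivative, auto\<close>)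
  then show ?case using Cons by (auto simp: iter_deriv.simps(2)[of _ _ "us @ (c *\<^sub>R v) # ws"])
qed

lemma iter_vector_derivative:
  assumes "length vs < m" "(x has_vector_derivative x') (at s within S)"
  shows "((\<lambda>s. iter_deriv F vs (x s)) has_vector_derivative iter_deriv F (x' # vs) (x s)) (at s within S)"
  using vector_derivative_diff_chain_within[OF assms(2) has_derivative_at_withinI[OF iter_has_derivative[OF assms(1)]]]
  by (simp add: o_def)

text \<open>The definition of smoothness only compares the derivatives at neighbouring points. Boundedness
  of the multilinear maps follows, since the derivative of order \<open>j + 1\<close> is an approximate
  difference quotient of the one of order \<open>j\<close>, with a step that does not depend on the directions.\<close>

lemma iter_bounded:
  "j \<le> m \<Longrightarrow> \<exists>C\<ge>0. \<forall>vs. length vs = j \<longrightarrow> norm (iter_deriv F vs x) \<le> C * prod_list (map norm vs)"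
proof (induction j)
  case 0
  then show ?case by (intro exI[of _ "norm (F x)"]) auto
next
  case (Suc j)
  then obtain C where C: "C \<ge> 0" "\<And>vs. length vs = j \<Longrightarrow> norm (iter_deriv F vs x) \<le> C * prod_list (map norm vs)"
    by auto
  obtain d1 where d1: "d1 > 0" "\<And>y vs. dist y x < d1 \<Longrightarrow> length vs = j \<Longrightarrow>
           norm (iter_deriv F vs y - iter_deriv F vs x) \<le> 1 * prod_list (map norm vs)"
    using iter_close[of j 1 x] Suc.prems by auto
  obtain d2 where d2: "d2 > 0" "\<And>y vs. dist y x < d2 \<Longrightarrow> length vs = Suc j \<Longrightarrow>
           norm (iter_deriv F vs y - iter_deriv F vs x) \<le> 1 * prod_list (map norm vs)"
    using iter_close[of "Suc j" 1 x] Suc.prems by auto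
  define t where "t = min d1 d2 / 2"
  have t: "t > 0" "t < d1" "t < d2" using d1(1) d2(1) by (auto simp: t_def)
  have unit: "norm (iter_deriv F (v # vs) x) \<le> (1 + 1 / t) * prod_list (map norm vs)"
    if v: "norm v = 1" and vs: "length vs = j" for v vs
  proof -
    let ?p = "prod_list (map norm vs)"
    let ?g = "\<lambda>s. iter_deriv F vs (x + s *\<^sub>R v) - s *\<^sub>R iter_deriv F (v # vs) x"
    have "norm (?g t - ?g 0) \<le> ?p * t"
    proof (rule vector_mean_value_bound)
      fix s assume s: "s \<in> {0..t}"
      have "((\<lambda>s. x + s *\<^sub>R v) has_vector_derivative v) (at s within {0..t})"
        by (auto intro!: derivative_eq_intros)
      from iter_vector_derivative[OF _ this, of vs]
      show "(?g has_vector_derivative iter_deriv F (v # vs) (x + s *\<^sub>R v) - iter_deriv F (v # vs) x) (at s within {0..t})"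
        using Suc.prems vs by (auto intro!: derivative_eq_intros)
      have "dist (x + s *\<^sub>R v) x < d2" using s t v by (simp add: dist_norm)
      from d2(2)[OF this, of "v # vs"]
      show "norm (iter_deriv F (v # vs) (x + s *\<^sub>R v) - iter_deriv F (v # vs) x) \<le> ?p"
        using vs v by simp
    qed (use t in auto)
    moreover have "norm (iter_deriv F vs (x + t *\<^sub>R v) - iter_deriv F vs x) \<le> ?p"
      using d1(2)[of "x + t *\<^sub>R v" vs] t v vs by (simp add: dist_norm)
    moreover have "t *\<^sub>R iter_deriv F (v # vs) x
       = (iter_deriv F vs (x + t *\<^sub>R v) - iter_deriv F vs x) - (?g t - ?g 0)" by simp
    ultimately have "norm (t *\<^sub>R iter_deriv F (v # vs) x) \<le> ?p + ?p * t"
      using norm_triangle_ineq4 by (smt (verit))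
    then show ?thesis using t by (simp add: field_simps)
  qed
  show ?case
  proof (intro exI[of _ "1 + 1 / t"] conjI allI impI)
    fix vs :: "'a list" assume "length vs = Suc j"
    then obtain v ws where vs: "vs = v # ws" "length ws = j" by (cases vs) auto
    show "norm (iter_deriv F vs x) \<le> (1 + 1 / t) * prod_list (map norm vs)"
    proof (cases "v = 0")
      case True
      then show ?thesis using vs iter_linear[of ws x] Suc.prems linear_0 by fastforce
    next
      case False
      have "iter_deriv F vs x = norm v *\<^sub>R iter_deriv F ((v /\<^sub>R norm v) # ws) x"
        using iter_scaleR[of "[]" ws "norm v" "v /\<^sub>R norm v"] False vs Suc.prems by simp
      also have "norm \<dots> \<le> norm v * ((1 + 1 / t) * prod_list (map norm ws))"
        using unit[of "v /\<^sub>R norm v" ws] False vs by (simp add: mult_left_mono)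
      finally show ?thesis using vs by (simp add: algebra_simps)
    qed
  qed (use t in auto)
qed

lemma iter_bounded_bilinear:
  assumes "2 \<le> m" shows "bounded_bilinear (\<lambda>u v. iter_deriv F [u, v] x)"
proof -
  obtain C where C: "\<And>vs. length vs = 2 \<Longrightarrow> norm (iter_deriv F vs x) \<le> C * prod_list (map norm vs)"
    using iter_bounded[OF assms] by blast
  show ?thesis
  proof
    show "\<exists>K. \<forall>u v. norm (iter_deriv F [u, v] x) \<le> norm u * norm v * K"
      using C[of "[_, _]"] by (intro exI[of _ C]) (auto simp: mult_ac)
  qed (use assms iter_add[of "[]" "[_]"] iter_add[of "[_]" "[]"] iter_scaleR[of "[]" "[_]"] iter_scaleR[of "[_]" "[]"]
       in auto)
qed

lemma iter_diff:
  "length us + length ws < m \<Longrightarrow>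
   iter_deriv F (us @ (v - w) # ws) x = iter_deriv F (us @ v # ws) x - iter_deriv F (us @ w # ws) x"
  using iter_add[of us ws "v - w" w] by (auto simp: fun_eq_iff)

text \<open>Joint continuity in the base point and in the directions.\<close>

lemma tendsto_iter:
  assumes x: "(x \<longlongrightarrow> x0) G" and vs: "length vs \<le> m" and len: "length ws = length vs"
    and lim: "\<And>i. i < length vs \<Longrightarrow> (vs ! i \<longlongrightarrow> ws ! i) G"
  shows "((\<lambda>s. iter_deriv F (map (\<lambda>v. v s) vs) (x s)) \<longlongrightarrow> iter_deriv F ws x0) G"
proof -
  \<comment> \<open>The directions are replaced one after the other.\<close>
  have fixed: "((\<lambda>s. iter_deriv F (us @ map (\<lambda>v. v s) ss) x0) \<longlongrightarrow> iter_deriv F (us @ rs) x0) G"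
    if "length us + length ss \<le> m" "length rs = length ss"
      "\<And>i. i < length ss \<Longrightarrow> (ss ! i \<longlongrightarrow> rs ! i) G" for us rs ss
    using that
  proof (induction ss arbitrary: us rs)
    case Nil
    then show ?case by simp
  next
    case (Cons w ss)
    then obtain r rs' where rs: "rs = r # rs'" by (cases rs) auto
    have w: "(w \<longlongrightarrow> r) G" using Cons.prems(3)[of 0] rs by simp
    have tl: "i < length ss \<Longrightarrow> (ss ! i \<longlongrightarrow> rs' ! i) G" for i
      using Cons.prems(3)[of "Suc i"] rs by simp
    have IH: "((\<lambda>s. iter_deriv F ((us @ [r]) @ map (\<lambda>v. v s) ss) x0) \<longlongrightarrow> iter_deriv F ((us @ [r]) @ rs') x0) G"
      by (rule Cons.IH) (use Cons.prems rs tl in auto)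
    obtain C where C: "\<And>vs. length vs = length us + length ss + 1 \<Longrightarrow> norm (iter_deriv F vs x0) \<le> C * prod_list (map norm vs)"
      using iter_bounded[of "length us + length ss + 1" x0] Cons.prems(1) by auto
    have lims: "((\<lambda>s. prod_list (map norm (map (\<lambda>v. v s) ss))) \<longlongrightarrow> prod_list (map norm rs')) G"
      using tl Cons.prems(2) unfolding rs
    proof (induction ss arbitrary: rs')
      case (Cons a ss)
      then obtain b rs'' where "rs' = b # rs''" by (cases rs') auto
      then show ?case using Cons.prems Cons.IH[of rs''] Cons.prems(1)[of 0] Cons.prems(1)[of "Suc _"]
        by (auto intro!: tendsto_mult tendsto_norm)
    qed simp
    have "((\<lambda>s. iter_deriv F (us @ (w s - r) # map (\<lambda>v. v s) ss) x0) \<longlongrightarrow> 0) G"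
    proof (rule Lim_null_comparison)
      show "\<forall>\<^sub>F s in G. norm (iter_deriv F (us @ (w s - r) # map (\<lambda>v. v s) ss) x0)
         \<le> C * (prod_list (map norm us) * (norm (w s - r) * prod_list (map norm (map (\<lambda>v. v s) ss))))"
        using C[of "us @ (w _ - r) # map (\<lambda>v. v _) ss"] by (intro always_eventually) (auto simp: o_def)
      have "((\<lambda>s. w s - r) \<longlongrightarrow> 0) G" using w LIM_zero by blast
      then have "((\<lambda>s. C * (prod_list (map norm us) * (norm (w s - r) * prod_list (map norm (map (\<lambda>v. v s) ss)))))
        \<longlongrightarrow> C * (prod_list (map norm us) * (norm (0::'a) * prod_list (map norm rs')))) G"
        by (intro tendsto_mult tendsto_const tendsto_norm lims)
      then show "((\<lambda>s. C * (prod_list (map norm us) * (norm (w s - r) * prod_list (map norm (map (\<lambda>v. v s) ss))))) \<longlongrightarrow> 0) G"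
        by simp
    qed
    moreover have "iter_deriv F (us @ (w s - r) # map (\<lambda>v. v s) ss) x0
       = iter_deriv F (us @ map (\<lambda>v. v s) (w # ss)) x0 - iter_deriv F ((us @ [r]) @ map (\<lambda>v. v s) ss) x0" for s
      using iter_diff[of us "map (\<lambda>v. v s) ss" "w s" r x0] Cons.prems(1) by simp
    ultimately have "((\<lambda>s. iter_deriv F (us @ map (\<lambda>v. v s) (w # ss)) x0 - iter_deriv F ((us @ [r]) @ map (\<lambda>v. v s) ss) x0) \<longlongrightarrow> 0) G"
      by simp
    from tendsto_add[OF this IH] show ?case by (simp add: rs)
  qed
  have P: "((\<lambda>s. prod_list (map norm (map (\<lambda>v. v s) vs))) \<longlongrightarrow> prod_list (map norm ws)) G"
    using lim len
  proof (induction vs arbitrary: ws)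
    case (Cons a ss)
    then obtain b rs'' where "ws = b # rs''" by (cases ws) auto
    then show ?case using Cons.prems Cons.IH[of rs''] Cons.prems(1)[of 0] Cons.prems(1)[of "Suc _"]
      by (auto intro!: tendsto_mult tendsto_norm)
  qed simp
  have "((\<lambda>s. iter_deriv F (map (\<lambda>v. v s) vs) (x s) - iter_deriv F (map (\<lambda>v. v s) vs) x0) \<longlongrightarrow> 0) G"
  proof (rule tendstoI)
    fix e :: real assume e: "e > 0"
    define K where "K = \<bar>prod_list (map norm ws)\<bar> + 1"
    have K: "K > 0" by (simp add: K_def)
    have ek: "e / (2 * K) > 0" using e K by simp
    obtain d where d: "d > 0" "\<And>y us. dist y x0 < d \<Longrightarrow> length us = length vs \<Longrightarrow>
           norm (iter_deriv F us y - iter_deriv F us x0) \<le> e / (2 * K) * prod_list (map norm us)"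
      using iter_close[OF vs ek, of x0] by blast
    have ev1: "\<forall>\<^sub>F s in G. dist (x s) x0 < d" using tendstoD[OF x d(1)] .
    have ev2: "\<forall>\<^sub>F s in G. prod_list (map norm (map (\<lambda>v. v s) vs)) < K"
      by (rule order_tendstoD(2)[OF P]) (simp add: K_def)
    show "\<forall>\<^sub>F s in G. dist (iter_deriv F (map (\<lambda>v. v s) vs) (x s) - iter_deriv F (map (\<lambda>v. v s) vs) x0) 0 < e"
      using ev1 ev2
    proof eventually_elim
      case (elim s)
      have "norm (iter_deriv F (map (\<lambda>v. v s) vs) (x s) - iter_deriv F (map (\<lambda>v. v s) vs) x0)
         \<le> e / (2 * K) * prod_list (map norm (map (\<lambda>v. v s) vs))"
        by (rule d(2)) (use elim in auto)
      also have "\<dots> \<le> e / (2 * K) * K" using elim e K by (intro mult_left_mono) auto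
      also have "\<dots> < e" using e K by simp
      finally show ?case by simp
    qed
  qed
  from tendsto_add[OF this fixed[of "[]" vs ws]] show ?thesis using vs len lim by simp
qed

lemma tendsto_iter1:
  "1 \<le> m \<Longrightarrow> (x \<longlongrightarrow> x0) G \<Longrightarrow> (u \<longlongrightarrow> u0) G \<Longrightarrow>
    ((\<lambda>s. iter_deriv F [u s] (x s)) \<longlongrightarrow> iter_deriv F [u0] x0) G"
  using tendsto_iter[of x x0 G "[u]" "[u0]"] by simp

lemma tendsto_iter2:
  "2 \<le> m \<Longrightarrow> (x \<longlongrightarrow> x0) G \<Longrightarrow> (u \<longlongrightarrow> u0) G \<Longrightarrow> (v \<longlongrightarrow> v0) G \<Longrightarrow>
    ((\<lambda>s. iter_deriv F [u s, v s] (x s)) \<longlongrightarrow> iter_deriv F [u0, v0] x0) G"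
  by (rule tendsto_iter[of x x0 G "[u, v]" "[u0, v0]", simplified list.map]) (auto simp: less_Suc_eq)

lemma tendsto_iter3:
  "3 \<le> m \<Longrightarrow> (x \<longlongrightarrow> x0) G \<Longrightarrow> (u \<longlongrightarrow> u0) G \<Longrightarrow> (v \<longlongrightarrow> v0) G \<Longrightarrow> (w \<longlongrightarrow> w0) G \<Longrightarrow>
    ((\<lambda>s. iter_deriv F [u s, v s, w s] (x s)) \<longlongrightarrow> iter_deriv F [u0, v0, w0] x0) G"
  by (rule tendsto_iter[of x x0 G "[u, v, w]" "[u0, v0, w0]", simplified list.map]) (auto simp: less_Suc_eq)

lemma iter_head_vector_derivative:
  assumes m: "length vs + 2 \<le> m"
    and x: "(x has_vector_derivative x') (at s)"
    and u: "(u has_vector_derivative u') (at s)"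
  shows "((\<lambda>s. iter_deriv F (u s # vs) (x s)) has_vector_derivative
     (iter_deriv F (x' # u s # vs) (x s) + iter_deriv F (u' # vs) (x s))) (at s)"
proof -
  have cx: "(x \<longlongrightarrow> x s) (at s)" and cu: "(u \<longlongrightarrow> u s) (at s)"
    using x u has_vector_derivative_continuous continuous_at by blast+
  have "((\<lambda>y. (iter_deriv F (u s # vs) (x y) - iter_deriv F (u s # vs) (x s)) /\<^sub>R (y - s))
      \<longlongrightarrow> iter_deriv F (x' # u s # vs) (x s)) (at s)"
    using iter_vector_derivative[OF _ x, of "u s # vs"] m by (simp add: has_vector_derivative_slope)
  moreover have "((\<lambda>y. iter_deriv F (((u y - u s) /\<^sub>R (y - s)) # vs) (x y)) \<longlongrightarrow> iter_deriv F (u' # vs) (x s)) (at s)"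
    using tendsto_iter[OF cx, of "(\<lambda>y. (u y - u s) /\<^sub>R (y - s)) # map (\<lambda>v _. v) vs" "u' # vs"] m u
    by (auto simp: has_vector_derivative_slope o_def nth_Cons split: nat.splits)
  ultimately have "((\<lambda>y. (iter_deriv F (u s # vs) (x y) - iter_deriv F (u s # vs) (x s)) /\<^sub>R (y - s)
      + iter_deriv F (((u y - u s) /\<^sub>R (y - s)) # vs) (x y))
      \<longlongrightarrow> (iter_deriv F (x' # u s # vs) (x s) + iter_deriv F (u' # vs) (x s))) (at s)"
    by (rule tendsto_add)
  moreover have "(iter_deriv F (u s # vs) (x y) - iter_deriv F (u s # vs) (x s)) /\<^sub>R (y - s)
      + iter_deriv F (((u y - u s) /\<^sub>R (y - s)) # vs) (x y)
      = (iter_deriv F (u y # vs) (x y) - iter_deriv F (u s # vs) (x s)) /\<^sub>R (y - s)" for y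
  proof -
    have "iter_deriv F (((u y - u s) /\<^sub>R (y - s)) # vs) (x y)
      = (iter_deriv F (u y # vs) (x y) - iter_deriv F (u s # vs) (x y)) /\<^sub>R (y - s)"
      using iter_scaleR[of "[]" vs "inverse (y - s)" "u y - u s"] iter_diff[of "[]" vs "u y" "u s" "x y"] m
      by (simp add: fun_eq_iff)
    then show ?thesis by (simp add: scaleR_right_diff_distrib)
  qed
  ultimately show ?thesis by (simp add: has_vector_derivative_slope)
qed

text \<open>Comparing the second difference with its value for \<open>u\<close> and \<open>v\<close> exchanged gives the symmetry of
  the second derivative.\<close>

lemma second_difference:
  assumes m: "2 \<le> m" and e: "e > 0"
  shows "\<exists>d>0. \<forall>t. 0 < t \<and> t < d \<longrightarrow>
     norm (F (x + t *\<^sub>R u + t *\<^sub>R v) - F (x + t *\<^sub>R u) - F (x + t *\<^sub>R v) + F x - (t * t) *\<^sub>R iter_deriv F [v, u] x)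
       \<le> e * (t * t)"
proof -
  define e' where "e' = e / (norm u * norm v + 1)"
  have "norm u * norm v + 1 > 0" by (simp add: add_nonneg_pos)
  then have e': "e' > 0" "e' * (norm v * norm u) \<le> e"
    using e by (auto simp: e'_def field_simps)
  obtain \<delta> where \<delta>: "\<delta> > 0" "\<And>y vs. dist y x < \<delta> \<Longrightarrow> length vs = 2 \<Longrightarrow>
           norm (iter_deriv F vs y - iter_deriv F vs x) \<le> e' * prod_list (map norm vs)"
    using iter_close[OF m e'(1), of x] by blast
  define d where "d = \<delta> / (norm u + norm v + 1)"
  have nuv: "norm u + norm v + 1 > 0" by (simp add: add_nonneg_pos)
  have "norm (F (x + t *\<^sub>R u + t *\<^sub>R v) - F (x + t *\<^sub>R u) - F (x + t *\<^sub>R v) + F x - (t * t) *\<^sub>R iter_deriv F [v, u] x)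
       \<le> e * (t * t)" if t: "0 < t" "t < d" for t
  proof -
    have small: "dist (x + s *\<^sub>R u + r *\<^sub>R v) x < \<delta>" if "s \<in> {0..t}" "r \<in> {0..t}" for s r
    proof -
      have "norm (s *\<^sub>R u + r *\<^sub>R v) \<le> s * norm u + r * norm v"
        using norm_triangle_ineq[of "s *\<^sub>R u" "r *\<^sub>R v"] that by simp
      also have "\<dots> \<le> t * norm u + t * norm v" using that by (intro add_mono mult_right_mono) auto
      also have "\<dots> \<le> t * (norm u + norm v + 1)" using t by (simp add: algebra_simps)
      also have "\<dots> < d * (norm u + norm v + 1)" using t nuv by (intro mult_strict_right_mono)
      also have "\<dots> = \<delta>" using nuv by (simp add: d_def)
      finally show ?thesis by (simp add: dist_norm add.assoc)
    qed
    let ?D = "iter_deriv F [v, u] x"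
    have inner: "norm (iter_deriv F [u] (x + s *\<^sub>R u + t *\<^sub>R v) - iter_deriv F [u] (x + s *\<^sub>R u) - t *\<^sub>R ?D) \<le> e * t"
      if s: "s \<in> {0..t}" for s
    proof -
      let ?g = "\<lambda>r. iter_deriv F [u] (x + s *\<^sub>R u + r *\<^sub>R v) - r *\<^sub>R ?D"
      have "norm (?g t - ?g 0) \<le> e * t"
      proof (rule vector_mean_value_bound)
        fix r assume r: "r \<in> {0..t}"
        have "((\<lambda>r. x + s *\<^sub>R u + r *\<^sub>R v) has_vector_derivative v) (at r within {0..t})"
          by (auto intro!: derivative_eq_intros)
        from iter_vector_derivative[OF _ this, of "[u]"]
        show "(?g has_vector_derivative iter_deriv F [v, u] (x + s *\<^sub>R u + r *\<^sub>R v) - ?D) (at r within {0..t})"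
          using m by (auto intro!: derivative_eq_intros)
        have "norm (iter_deriv F [v, u] (x + s *\<^sub>R u + r *\<^sub>R v) - ?D) \<le> e' * (norm v * norm u)"
          using \<delta>(2)[OF small[OF s r], of "[v, u]"] by simp
        then show "norm (iter_deriv F [v, u] (x + s *\<^sub>R u + r *\<^sub>R v) - ?D) \<le> e" using e'(2) by simp
      qed (use t in auto)
      then show ?thesis by (simp add: algebra_simps)
    qed
    let ?f = "\<lambda>s. F (x + s *\<^sub>R u + t *\<^sub>R v) - F (x + s *\<^sub>R u) - (s * t) *\<^sub>R ?D"
    have "norm (?f t - ?f 0) \<le> (e * t) * t"
    proof (rule vector_mean_value_bound)
      fix s assume s: "s \<in> {0..t}"
      have "((\<lambda>s. x + s *\<^sub>R u + t *\<^sub>R v) has_vector_derivative u) (at s within {0..t})"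
        "((\<lambda>s. x + s *\<^sub>R u) has_vector_derivative u) (at s within {0..t})"
        by (auto intro!: derivative_eq_intros)
      from this[THEN iter_vector_derivative[rotated], of "[]"]
      show "(?f has_vector_derivative iter_deriv F [u] (x + s *\<^sub>R u + t *\<^sub>R v) - iter_deriv F [u] (x + s *\<^sub>R u) - t *\<^sub>R ?D) (at s within {0..t})"
        using m by (auto intro!: derivative_eq_intros)
      show "norm (iter_deriv F [u] (x + s *\<^sub>R u + t *\<^sub>R v) - iter_deriv F [u] (x + s *\<^sub>R u) - t *\<^sub>R ?D) \<le> e * t"
        using inner s by blast
    qed (use t in auto)
    then show ?thesis by (simp add: algebra_simps)
  qed
  moreover have "d > 0" using \<delta>(1) nuv by (simp add: d_def)
  ultimately show ?thesis by blast
qed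

lemma iter2_commute:
  assumes m: "2 \<le> m" shows "iter_deriv F [u, v] x = iter_deriv F [v, u] x"
proof (rule ccontr)
  let ?E = "iter_deriv F [u, v] x - iter_deriv F [v, u] x"
  assume "iter_deriv F [u, v] x \<noteq> iter_deriv F [v, u] x"
  then have E: "norm ?E > 0" by simp
  define e where "e = norm ?E / 3"
  have e: "e > 0" using E by (simp add: e_def)
  obtain d1 d2 where d: "d1 > 0" "d2 > 0"
    and 1: "\<And>t. 0 < t \<Longrightarrow> t < d1 \<Longrightarrow> norm (F (x + t *\<^sub>R u + t *\<^sub>R v) - F (x + t *\<^sub>R u) - F (x + t *\<^sub>R v) + F x - (t * t) *\<^sub>R iter_deriv F [v, u] x) \<le> e * (t * t)"
    and 2: "\<And>t. 0 < t \<Longrightarrow> t < d2 \<Longrightarrow> norm (F (x + t *\<^sub>R v + t *\<^sub>R u) - F (x + t *\<^sub>R v) - F (x + t *\<^sub>R u) + F x - (t * t) *\<^sub>R iter_deriv F [u, v] x) \<le> e * (t * t)"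
    using second_difference[OF m e, of x u v] second_difference[OF m e, of x v u] by blast
  define t where "t = min d1 d2 / 2"
  have t: "0 < t" "t < d1" "t < d2" using d by (auto simp: t_def)
  have "(t * t) *\<^sub>R ?E = (F (x + t *\<^sub>R u + t *\<^sub>R v) - F (x + t *\<^sub>R u) - F (x + t *\<^sub>R v) + F x - (t * t) *\<^sub>R iter_deriv F [v, u] x)
     - (F (x + t *\<^sub>R v + t *\<^sub>R u) - F (x + t *\<^sub>R v) - F (x + t *\<^sub>R u) + F x - (t * t) *\<^sub>R iter_deriv F [u, v] x)"
    by (simp add: algebra_simps)
  then have "norm ((t * t) *\<^sub>R ?E) \<le> e * (t * t) + e * (t * t)"
    using 1[OF t(1,2)] 2[OF t(1,3)] norm_triangle_ineq4 by (smt (verit))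
  moreover have "norm ((t * t) *\<^sub>R ?E) = (t * t) * norm ?E" by (simp add: abs_mult)
  ultimately have "(t * t) * norm ?E \<le> (t * t) * (2 * e)" by (simp add: mult_ac)
  then have "norm ?E \<le> 2 * e" using t by simp
  then show False using E by (simp add: e_def)
qed

text \<open>The error of the third order Taylor polynomial is bounded by the oscillation of the third
  derivative on the segment.\<close>

lemma taylor3:
  assumes m: "3 \<le> m"
    and E: "\<And>s. s \<in> {0..1} \<Longrightarrow> norm (iter_deriv F [u, u, u] (x + s *\<^sub>R u) - iter_deriv F [u, u, u] x) \<le> E"
  shows "norm (F (x + u) - (F x + iter_deriv F [u] x + (1/2) *\<^sub>R iter_deriv F [u, u] x + (1/6) *\<^sub>R iter_deriv F [u, u, u] x)) \<le> E"
proof -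
  let ?D1 = "iter_deriv F [u] x" and ?D2 = "iter_deriv F [u, u] x" and ?D3 = "iter_deriv F [u, u, u] x"
  have line: "((\<lambda>s. x + s *\<^sub>R u) has_vector_derivative u) (at s within S)" for s S
    by (auto intro!: derivative_eq_intros)
  have E0: "E \<ge> 0" using E[of 0] by simp
  have 2: "norm (iter_deriv F [u, u] (x + s *\<^sub>R u) - ?D2 - s *\<^sub>R ?D3) \<le> E" if s: "s \<in> {0..1}" for s
  proof -
    let ?g = "\<lambda>s. iter_deriv F [u, u] (x + s *\<^sub>R u) - s *\<^sub>R ?D3"
    have "norm (?g s - ?g 0) \<le> E * s"
    proof (rule vector_mean_value_bound)
      fix r assume r: "r \<in> {0..s}"
      show "(?g has_vector_derivative iter_deriv F [u, u, u] (x + r *\<^sub>R u) - ?D3) (at r within {0..s})"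
        using iter_vector_derivative[OF _ line, of "[u, u]"] m by (auto intro!: derivative_eq_intros)
    qed (use E s in auto)
    moreover have "E * s \<le> E" using s E0 by (simp add: mult_left_le)
    ultimately show ?thesis by (simp add: algebra_simps)
  qed
  have 1: "norm (iter_deriv F [u] (x + s *\<^sub>R u) - ?D1 - s *\<^sub>R ?D2 - (s\<^sup>2 / 2) *\<^sub>R ?D3) \<le> E" if s: "s \<in> {0..1}" for s
  proof -
    let ?g = "\<lambda>s. iter_deriv F [u] (x + s *\<^sub>R u) - s *\<^sub>R ?D2 - (s\<^sup>2 / 2) *\<^sub>R ?D3"
    have "norm (?g s - ?g 0) \<le> E * s"
    proof (rule vector_mean_value_bound)
      fix r assume r: "r \<in> {0..s}"
      show "(?g has_vector_derivative iter_deriv F [u, u] (x + r *\<^sub>R u) - ?D2 - r *\<^sub>R ?D3) (at r within {0..s})"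
        using iter_vector_derivative[OF _ line, of "[u]"] m by (auto intro!: derivative_eq_intros)
    qed (use 2 s in auto)
    moreover have "E * s \<le> E" using s E0 by (simp add: mult_left_le)
    ultimately show ?thesis by (simp add: algebra_simps)
  qed
  let ?g = "\<lambda>s. F (x + s *\<^sub>R u) - s *\<^sub>R ?D1 - (s\<^sup>2 / 2) *\<^sub>R ?D2 - (s ^ 3 / 6) *\<^sub>R ?D3"
  have "norm (?g 1 - ?g 0) \<le> E * 1"
  proof (rule vector_mean_value_bound)
    fix r :: real assume r: "r \<in> {0..1}"
    show "(?g has_vector_derivative iter_deriv F [u] (x + r *\<^sub>R u) - ?D1 - r *\<^sub>R ?D2 - (r\<^sup>2 / 2) *\<^sub>R ?D3) (at r within {0..1})"
      using iter_vector_derivative[OF _ line, of "[]"] m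
      by (auto intro!: derivative_eq_intros simp: power2_eq_square)
  qed (use 1 in auto)
  then show ?thesis by (simp add: algebra_simps)
qed

lemma iter_close_compact:
  assumes K: "compact K" and j: "j \<le> m" and e: "e > 0"
  shows "\<exists>d>0. \<forall>x\<in>K. \<forall>y. dist y x < d \<longrightarrow> (\<forall>vs. length vs = j \<longrightarrow>
           norm (iter_deriv F vs y - iter_deriv F vs x) \<le> e * prod_list (map norm vs))"
proof -
  have "\<forall>z. \<exists>d>0. \<forall>y. dist y z < d \<longrightarrow> (\<forall>vs. length vs = j \<longrightarrow>
           norm (iter_deriv F vs y - iter_deriv F vs z) \<le> e / 2 * prod_list (map norm vs))"
    using iter_close[OF j, of "e / 2"] e by simp
  then obtain d where d: "\<And>z. d z > 0" "\<And>z y vs. dist y z < d z \<Longrightarrow> length vs = j \<Longrightarrow>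
           norm (iter_deriv F vs y - iter_deriv F vs z) \<le> e / 2 * prod_list (map norm vs)"
    by metis
  have "K \<subseteq> \<Union>((\<lambda>z. ball z (d z)) ` K)" using d(1) by auto
  then obtain r where r: "r > 0" "\<And>x. x \<in> K \<Longrightarrow> \<exists>B \<in> (\<lambda>z. ball z (d z)) ` K. ball x r \<subseteq> B"
    using Heine_Borel_lemma[OF K, of "(\<lambda>z. ball z (d z)) ` K"] by blast
  show ?thesis
  proof (intro exI[of _ r] conjI ballI allI impI)
    fix x y and vs :: "'a list" assume x: "x \<in> K" and y: "dist y x < r" and vs: "length vs = j"
    obtain z where z: "ball x r \<subseteq> ball z (d z)" using r(2)[OF x] by auto
    have "dist y z < d z" "dist x z < d z" using z y r(1) by (auto simp: subset_iff dist_commute)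
    from this[THEN d(2), OF vs]
    show "norm (iter_deriv F vs y - iter_deriv F vs x) \<le> e * prod_list (map norm vs)"
      using norm_triangle_ineq4[of "iter_deriv F vs y - iter_deriv F vs z" "iter_deriv F vs x - iter_deriv F vs z"] by simp
  qed (use r in auto)
qed

lemma iter_bounded_compact:
  assumes K: "compact K" and j: "j \<le> m"
  shows "\<exists>C\<ge>0. \<forall>x\<in>K. \<forall>vs. length vs = j \<longrightarrow> norm (iter_deriv F vs x) \<le> C * prod_list (map norm vs)"
proof -
  obtain d where d: "d > 0" "\<And>x y vs. x \<in> K \<Longrightarrow> dist y x < d \<Longrightarrow> length vs = j \<Longrightarrow>
           norm (iter_deriv F vs y - iter_deriv F vs x) \<le> 1 * prod_list (map norm vs)"
    using iter_close_compact[OF K j, of 1] by auto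
  obtain C where C: "\<And>x. C x \<ge> 0" "\<And>x vs. length vs = j \<Longrightarrow> norm (iter_deriv F vs x) \<le> C x * prod_list (map norm vs)"
    using iter_bounded[OF j] by metis
  obtain Z where Z: "finite Z" "Z \<subseteq> K" "K \<subseteq> (\<Union>z\<in>Z. ball z d)"
  proof -
    have "K \<subseteq> (\<Union>z\<in>K. ball z d)" using d(1) by auto
    then obtain Z where "Z \<subseteq> K" "finite Z" "K \<subseteq> (\<Union>z\<in>Z. ball z d)"
      by (rule compactE_image[OF K _, rotated]) auto
    then show ?thesis by (intro that) auto
  qed
  show ?thesis
  proof (intro exI[of _ "1 + sum C Z"] conjI ballI allI impI)
    fix x and vs :: "'a list" assume x: "x \<in> K" and vs: "length vs = j"
    obtain z where z: "z \<in> Z" "dist x z < d" using Z(3) x by (auto simp: dist_commute subset_iff)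
    have p: "prod_list (map norm vs) \<ge> 0" by (induction vs) auto
    have "C z \<le> sum C Z" using z Z(1) C(1) by (intro member_le_sum) auto
    then have "C z * prod_list (map norm vs) \<le> sum C Z * prod_list (map norm vs)" using p by (rule mult_right_mono)
    moreover have "norm (iter_deriv F vs x - iter_deriv F vs z) \<le> 1 * prod_list (map norm vs)"
      using d(2)[of z x vs] z Z(2) vs by auto
    moreover have "norm (iter_deriv F vs z) \<le> C z * prod_list (map norm vs)" using C(2) vs by blast
    ultimately show "norm (iter_deriv F vs x) \<le> (1 + sum C Z) * prod_list (map norm vs)"
      using norm_triangle_sub[of "iter_deriv F vs x" "iter_deriv F vs z"] by (simp add: distrib_right)
  qed (simp add: C sum_nonneg add_nonneg_nonneg)
qed

lemma lipschitz_near_compact: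
  assumes K: "compact K" and m: "1 \<le> m"
  shows "\<exists>\<rho>>0. \<exists>C\<ge>0. \<forall>x\<in>K. \<forall>y\<in>ball x \<rho>. \<forall>z\<in>ball x \<rho>. norm (F y - F z) \<le> C * norm (y - z)"
proof -
  obtain d where d: "d > 0" "\<And>x y vs. x \<in> K \<Longrightarrow> dist y x < d \<Longrightarrow> length vs = 1 \<Longrightarrow>
           norm (iter_deriv F vs y - iter_deriv F vs x) \<le> 1 * prod_list (map norm vs)"
    using iter_close_compact[OF K m, of 1] by auto
  obtain C where C: "C \<ge> 0" "\<And>x vs. x \<in> K \<Longrightarrow> length vs = 1 \<Longrightarrow> norm (iter_deriv F vs x) \<le> C * prod_list (map norm vs)"
    using iter_bounded_compact[OF K m] by auto
  have "norm (F y - F z) \<le> (C + 1) * norm (y - z)" if x: "x \<in> K" and y: "y \<in> ball x d" "z \<in> ball x d" for x y z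
  proof (rule differentiable_bound[of "ball x d" F "\<lambda>w v. iter_deriv F [v] w"])
    fix w assume w: "w \<in> ball x d"
    show "(F has_derivative (\<lambda>v. iter_deriv F [v] w)) (at w within ball x d)"
      using iter_has_derivative[of "[]" w] m by (auto intro: has_derivative_at_withinI)
    show "onorm (\<lambda>v. iter_deriv F [v] w) \<le> C + 1"
    proof (rule onorm_bound)
      fix v
      show "norm (iter_deriv F [v] w) \<le> (C + 1) * norm v"
        using d(2)[OF x, of w "[v]"] C(2)[OF x, of "[v]"] w norm_triangle_sub[of "iter_deriv F [v] w" "iter_deriv F [v] x"]
        by (simp add: dist_commute distrib_right)
    qed (use C(1) in simp)
  qed (use y in auto)
  then show ?thesis using d(1) C(1) by (intro exI[of _ d] conjI exI[of _ "C + 1"]) auto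
qed

end

section \<open>The phase space\<close>

lemma clamp_mem: "0 \<le> h \<Longrightarrow> max (-h) (min 0 \<theta>) \<in> {-h..0::real}" by auto

lemma restrict_state_apply:
  fixes f :: "real \<Rightarrow> 'e::real_normed_vector"
  assumes "0 \<le> h" "continuous_on {-h..0} f"
  shows "apply_bcontfun (restrict_state h f) \<theta> = f (max (-h) (min 0 \<theta>))"
proof -
  have "(\<lambda>\<theta>. f (max (-h) (min 0 \<theta>))) \<in> bcontfun"
  proof -
    have "continuous_on UNIV (\<lambda>\<theta>. f (max (-h) (min 0 \<theta>)))"
      by (rule continuous_on_compose2[OF assms(2)]) (use assms(1) in \<open>auto intro!: continuous_intros\<close>)
    moreover have "range (\<lambda>\<theta>. f (max (-h) (min 0 \<theta>))) \<subseteq> f ` {-h..0}"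
      using assms(1) by auto
    moreover have "bounded (f ` {-h..0})"
      using assms(2) compact_Icc compact_continuous_image compact_imp_bounded by blast
    ultimately show ?thesis by (auto simp: bcontfun_def intro: bounded_subset)
  qed
  then show ?thesis by (simp add: restrict_state_def Bcontfun_inverse)
qed

lemma hist_apply:
  fixes x :: "real \<Rightarrow> 'e::real_normed_vector"
  assumes "0 \<le> h" "continuous_on {t - h..t} x"
  shows "apply_bcontfun (hist h x t) \<theta> = x (t + max (-h) (min 0 \<theta>))"
  unfolding hist_def
  by (rule restrict_state_apply) (use assms in \<open>auto intro!: continuous_on_compose2[OF assms(2)] continuous_intros\<close>)

lemma restrict_state_cong:
  "0 \<le> h \<Longrightarrow> (\<And>\<theta>. \<theta> \<in> {-h..0} \<Longrightarrow> f \<theta> = g \<theta>) \<Longrightarrow> restrict_state h f = restrict_state h g"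
  unfolding restrict_state_def by (intro arg_cong[of _ _ Bcontfun] ext) (auto dest: clamp_mem)

lemma hist_cong: "0 \<le> h \<Longrightarrow> (\<And>s. s \<in> {t - h..t} \<Longrightarrow> f s = g s) \<Longrightarrow> hist h f t = hist h g t"
  unfolding hist_def by (intro restrict_state_cong) auto

lemma phase_space_iff:
  assumes "0 \<le> h"
  shows "\<phi> \<in> phase_space h \<longleftrightarrow> (\<forall>\<theta>. apply_bcontfun \<phi> \<theta> = apply_bcontfun \<phi> (max (-h) (min 0 \<theta>)))"
proof -
  have "apply_bcontfun (restrict_state h (apply_bcontfun \<phi>)) \<theta> = apply_bcontfun \<phi> (max (-h) (min 0 \<theta>))" for \<theta>
    by (rule restrict_state_apply) (use assms in auto)
  then show ?thesis by (auto simp: phase_space_def intro: bcontfun_eqI)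
qed

lemma restrict_state_mem: "0 \<le> h \<Longrightarrow> continuous_on {-h..0} f \<Longrightarrow> restrict_state h f \<in> phase_space h"
  by (auto simp: phase_space_iff restrict_state_apply)

lemma phase_space_eqI:
  assumes "0 \<le> h" "\<phi> \<in> phase_space h" "\<psi> \<in> phase_space h"
    and eq: "\<And>\<theta>. \<theta> \<in> {-h..0} \<Longrightarrow> apply_bcontfun \<phi> \<theta> = apply_bcontfun \<psi> \<theta>"
  shows "\<phi> = \<psi>"
proof (rule bcontfun_eqI)
  fix \<theta>
  show "apply_bcontfun \<phi> \<theta> = apply_bcontfun \<psi> \<theta>"
    using assms(2,3) eq[OF clamp_mem[OF assms(1)], of \<theta>] unfolding phase_space_iff[OF assms(1)] by metis
qed

lemma hist_mem: "0 \<le> h \<Longrightarrow> continuous_on {t - h..t} x \<Longrightarrow> hist h x t \<in> phase_space h"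
  by (auto simp: phase_space_iff hist_apply)

lemma restrict_state_add:
  fixes f g :: "real \<Rightarrow> 'e::real_normed_vector"
  shows "0 \<le> h \<Longrightarrow> continuous_on {-h..0} f \<Longrightarrow> continuous_on {-h..0} g \<Longrightarrow>
    restrict_state h (\<lambda>\<theta>. f \<theta> + g \<theta>) = restrict_state h f + restrict_state h g"
  by (rule bcontfun_eqI) (simp add: restrict_state_apply continuous_on_add)

lemma restrict_state_diff:
  fixes f g :: "real \<Rightarrow> 'e::real_normed_vector"
  shows "0 \<le> h \<Longrightarrow> continuous_on {-h..0} f \<Longrightarrow> continuous_on {-h..0} g \<Longrightarrow>
    restrict_state h (\<lambda>\<theta>. f \<theta> - g \<theta>) = restrict_state h f - restrict_state h g"
  by (rule bcontfun_eqI) (simp add: restrict_state_apply continuous_on_diff)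

lemma restrict_state_scaleR:
  fixes f :: "real \<Rightarrow> 'e::real_normed_vector"
  shows "0 \<le> h \<Longrightarrow> continuous_on {-h..0} f \<Longrightarrow>
    restrict_state h (\<lambda>\<theta>. c *\<^sub>R f \<theta>) = c *\<^sub>R restrict_state h f"
  by (rule bcontfun_eqI) (simp add: restrict_state_apply continuous_on_scaleR)

lemma hist_continuous:
  fixes x :: "real \<Rightarrow> 'e::real_normed_vector"
  assumes h: "0 \<le> h" and x: "continuous_on UNIV x"
  shows "continuous_on UNIV (hist h x)"
  unfolding continuous_on_iff
proof (intro ballI allI impI)
  fix t e :: real assume e: "e > 0"
  have "uniformly_continuous_on {t - h - 1..t + 1} x"
    using x by (intro compact_uniformly_continuous) (auto intro: continuous_on_subset)
  then obtain d where d: "d > 0" "\<And>r s. r \<in> {t - h - 1..t + 1} \<Longrightarrow> s \<in> {t - h - 1..t + 1} \<Longrightarrow> dist s r < d \<Longrightarrow> dist (x s) (x r) < e / 2"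
    using e unfolding uniformly_continuous_on_def by (metis half_gt_zero)
  show "\<exists>d>0. \<forall>s\<in>UNIV. dist s t < d \<longrightarrow> dist (hist h x s) (hist h x t) < e"
  proof (intro exI[of _ "min d 1"] conjI ballI impI)
    fix s assume s: "dist s t < min d 1"
    have "dist (hist h x s) (hist h x t) \<le> e / 2"
    proof (rule dist_bound)
      fix \<theta>
      let ?\<theta> = "max (-h) (min 0 \<theta>)"
      have "dist (x (s + ?\<theta>)) (x (t + ?\<theta>)) < e / 2"
        by (rule d(2)) (use s h clamp_mem[OF h, of \<theta>] in \<open>auto simp: dist_real_def simp del: max.bounded_iff min.bounded_iff\<close>)
      then show "dist (hist h x s \<theta>) (hist h x t \<theta>) \<le> e / 2"
        using h x by (simp add: hist_apply continuous_on_subset)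
    qed
    then show "dist (hist h x s) (hist h x t) < e" using e by simp
  qed (use d in auto)
qed

lemma hist_vector_derivative:
  fixes x :: "real \<Rightarrow> 'e::real_normed_vector"
  assumes h: "0 \<le> h" and x: "\<And>t. (x has_vector_derivative x' t) (at t)" and x': "continuous_on UNIV x'"
  shows "(hist h x has_vector_derivative hist h x' t) (at t)"
proof -
  have cx: "continuous_on UNIV x"
    by (intro continuous_at_imp_continuous_on ballI has_vector_derivative_continuous[OF x])
  have sub: "continuous_on S x" "continuous_on S x'" for S
    using cx x' by (auto intro: continuous_on_subset)
  have cont: "continuous_on UNIV (hist h x')" by (rule hist_continuous[OF h x'])
  show ?thesis
    unfolding has_vector_derivative_def has_derivative_at_alt
  proof (intro conjI allI impI)
    fix e :: real assume e: "e > 0"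
    then obtain d where d: "d > 0" "\<And>s. dist s t < d \<Longrightarrow> dist (hist h x' s) (hist h x' t) < e"
      using cont unfolding continuous_on_iff by blast
    show "\<exists>d>0. \<forall>y. norm (y - t) < d \<longrightarrow> norm (hist h x y - hist h x t - (y - t) *\<^sub>R hist h x' t) \<le> e * norm (y - t)"
    proof (intro exI[of _ d] conjI allI impI)
      fix y assume y: "norm (y - t) < d"
      show "norm (hist h x y - hist h x t - (y - t) *\<^sub>R hist h x' t) \<le> e * norm (y - t)"
      proof (rule norm_bound)
        fix \<theta>
        let ?\<theta> = "max (-h) (min 0 \<theta>)"
        have "norm ((\<lambda>s. x (s + ?\<theta>)) y - (\<lambda>s. x (s + ?\<theta>)) t - (y - t) *\<^sub>R x' (t + ?\<theta>)) \<le> norm (y - t) * e"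
        proof (rule vector_differentiable_bound_linearization
              [where S = "ball t d" and f' = "\<lambda>s. x' (s + ?\<theta>)" and ?x0.0 = t])
          fix s assume s: "s \<in> ball t d"
          have "((\<lambda>s. s + ?\<theta>) has_vector_derivative 1) (at s within ball t d)"
            by (auto intro!: derivative_eq_intros)
          from vector_diff_chain_within[OF this has_vector_derivative_at_within[OF x]]
          show "((\<lambda>s. x (s + ?\<theta>)) has_vector_derivative x' (s + ?\<theta>)) (at s within ball t d)"
            by (simp add: o_def)
          have "dist (hist h x' s \<theta>) (hist h x' t \<theta>) < e"
            using d(2)[of s] s by (intro dist_fun_lt_imp_dist_val_lt) (simp add: dist_commute)
          then show "norm (x' (s + ?\<theta>) - x' (t + ?\<theta>)) \<le> e"
            using h sub by (simp add: hist_apply dist_norm)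
        next
          show "closed_segment t y \<subseteq> ball t d"
            using y d(1) by (intro closed_segment_subset) (auto simp: dist_norm norm_minus_commute)
        qed (use d in auto)
        then show "norm (apply_bcontfun (hist h x y - hist h x t - (y - t) *\<^sub>R hist h x' t) \<theta>) \<le> e * norm (y - t)"
          using h sub by (simp add: hist_apply mult.commute)
      qed
    qed (use d in auto)
  qed (simp add: bounded_linear_scaleR_left)
qed

section \<open>Stieltjes sums and integrals\<close>

\<comment> \<open>As a destruction rule it makes classical reasoning about divisions diverge.\<close>
declare tagged_division_ofD [rule del]

lemma tagged_cell:
  assumes "P tagged_division_of {a..b::real}" "(x, K) \<in> P"
  shows "x \<in> {a..b}" "Inf K \<in> {a..b}" "Sup K \<in> {a..b}" "Inf K \<le> x" "x \<le> Sup K" "K = {Inf K..Sup K}"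
proof -
  obtain l u where K: "K = {l..u}" using tagged_division_ofD(4)[OF assms] by auto
  have x: "x \<in> K" "K \<subseteq> {a..b}" using tagged_division_ofD(2,3)[OF assms] by auto
  have "l \<le> u" using x K by auto
  then show "x \<in> {a..b}" "Inf K \<in> {a..b}" "Sup K \<in> {a..b}" "Inf K \<le> x" "x \<le> Sup K" "K = {Inf K..Sup K}"
    using x K by auto
qed

lemma has_stieltjesD:
  assumes "has_stieltjes U J a b" "e > 0"
  shows "\<exists>d>0. \<forall>P. P tagged_division_of {a..b} \<longrightarrow> (\<lambda>x. ball x d) fine P \<longrightarrow>
    norm ((\<Sum>(x, K)\<in>P. U x (Sup K) - U x (Inf K)) - J) < e"
  using assms(1)[unfolded has_stieltjes_def, rule_format, OF assms(2)] by (simp only: imp_conjL)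

lemma has_stieltjes_unique:
  assumes J: "has_stieltjes U J a b" and J': "has_stieltjes U J' a b"
  shows "J = J'"
proof (rule ccontr)
  assume "J \<noteq> J'"
  define e where "e = norm (J - J') / 2"
  have e: "e > 0" using \<open>J \<noteq> J'\<close> by (simp add: e_def)
  obtain d1 where d1: "d1 > 0" and 1: "\<And>P. P tagged_division_of {a..b} \<Longrightarrow> (\<lambda>x. ball x d1) fine P \<Longrightarrow> norm ((\<Sum>(x, K)\<in>P. U x (Sup K) - U x (Inf K)) - J) < e"
    using has_stieltjesD[OF J e] by blast
  obtain d2 where d2: "d2 > 0" and 2: "\<And>P. P tagged_division_of {a..b} \<Longrightarrow> (\<lambda>x. ball x d2) fine P \<Longrightarrow> norm ((\<Sum>(x, K)\<in>P. U x (Sup K) - U x (Inf K)) - J') < e"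
    using has_stieltjesD[OF J' e] by blast
  note d = d1 d2
  obtain P where P: "P tagged_division_of {a..b}" "(\<lambda>x. ball x (min d1 d2)) fine P"
    using fine_division_exists_real[of "\<lambda>x. ball x (min d1 d2)" a b] d by (auto simp: gauge_def)
  have "(\<lambda>x. ball x d1) fine P" "(\<lambda>x. ball x d2) fine P"
    using P(2) by (force simp: fine_def)+
  then have "norm ((\<Sum>(x, K)\<in>P. U x (Sup K) - U x (Inf K)) - J) < e"
     "norm ((\<Sum>(x, K)\<in>P. U x (Sup K) - U x (Inf K)) - J') < e"
    using 1 2 P(1) by blast+
  then have "norm (J - J') < e + e"
    using norm_triangle_ineq4[of "(\<Sum>(x, K)\<in>P. U x (Sup K) - U x (Inf K)) - J'" "(\<Sum>(x, K)\<in>P. U x (Sup K) - U x (Inf K)) - J"]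
    by simp
  then show False by (simp add: e_def)
qed

lemma stieltjes_eq: "has_stieltjes U J a b \<Longrightarrow> stieltjes a b U = J"
  unfolding stieltjes_def using has_stieltjes_unique by blast

lemma has_stieltjes_cong:
  assumes "\<And>x s. x \<in> {a..b} \<Longrightarrow> s \<in> {a..b} \<Longrightarrow> U x s = U' x s"
  shows "has_stieltjes U J a b \<longleftrightarrow> has_stieltjes U' J a b"
proof -
  have "(\<Sum>(x, K)\<in>P. U x (Sup K) - U x (Inf K)) = (\<Sum>(x, K)\<in>P. U' x (Sup K) - U' x (Inf K))"
    if "P tagged_division_of {a..b}" for P
    by (rule sum.cong) (auto simp: assms tagged_cell(1-3)[OF that] simp del: atLeastAtMost_iff)
  then show ?thesis unfolding has_stieltjes_def by (intro all_cong1 imp_cong ex_cong1 conj_cong) auto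
qed

lemma has_stieltjes_bounded_linear:
  assumes f: "bounded_linear f" and U: "has_stieltjes U J a b"
  shows "has_stieltjes (\<lambda>x s. f (U x s)) (f J) a b"
  unfolding has_stieltjes_def
proof (intro allI impI)
  interpret bounded_linear f by (rule f)
  fix e :: real assume e: "e > 0"
  obtain B where B: "B > 0" "\<And>x. norm (f x) \<le> norm x * B" using pos_bounded by blast
  obtain d where d: "d > 0" "\<And>P. P tagged_division_of {a..b} \<Longrightarrow> (\<lambda>x. ball x d) fine P \<Longrightarrow> norm ((\<Sum>(x, K)\<in>P. U x (Sup K) - U x (Inf K)) - J) < e / B"
    using has_stieltjesD[OF U divide_pos_pos[OF e B(1)]] by blast
  have "norm ((\<Sum>(x, K)\<in>P. f (U x (Sup K)) - f (U x (Inf K))) - f J) < e"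
    if P: "P tagged_division_of {a..b}" "(\<lambda>x. ball x d) fine P" for P
  proof -
    have "(\<Sum>(x, K)\<in>P. f (U x (Sup K)) - f (U x (Inf K))) - f J = f ((\<Sum>(x, K)\<in>P. U x (Sup K) - U x (Inf K)) - J)"
      by (simp add: diff sum case_prod_unfold)
    also have "norm \<dots> \<le> norm ((\<Sum>(x, K)\<in>P. U x (Sup K) - U x (Inf K)) - J) * B" by (rule B)
    also have "\<dots> < e / B * B" using d(2)[OF P] B(1) by (intro mult_strict_right_mono) auto
    finally show ?thesis using B(1) by simp
  qed
  then show "\<exists>d>0. \<forall>P. P tagged_division_of {a..b} \<and> (\<lambda>x. ball x d) fine P \<longrightarrow>
        norm ((\<Sum>(x, K)\<in>P. f (U x (Sup K)) - f (U x (Inf K))) - f J) < e"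
    using d(1) by blast
qed

lemma has_stieltjes_add:
  assumes "has_stieltjes U J a b" "has_stieltjes U' J' a b"
  shows "has_stieltjes (\<lambda>x s. U x s + U' x s) (J + J') a b"
  unfolding has_stieltjes_def
proof (intro allI impI)
  fix e :: real assume e: "e > 0"
  then have e2: "e / 2 > 0" by simp
  obtain d1 where d1: "d1 > 0" and 1: "\<And>P. P tagged_division_of {a..b} \<Longrightarrow> (\<lambda>x. ball x d1) fine P \<Longrightarrow> norm ((\<Sum>(x, K)\<in>P. U x (Sup K) - U x (Inf K)) - J) < e / 2"
    using has_stieltjesD[OF assms(1) e2] by blast
  obtain d2 where d2: "d2 > 0" and 2: "\<And>P. P tagged_division_of {a..b} \<Longrightarrow> (\<lambda>x. ball x d2) fine P \<Longrightarrow> norm ((\<Sum>(x, K)\<in>P. U' x (Sup K) - U' x (Inf K)) - J') < e / 2"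
    using has_stieltjesD[OF assms(2) e2] by blast
  note d = d1 d2
  have "norm ((\<Sum>(x, K)\<in>P. U x (Sup K) + U' x (Sup K) - (U x (Inf K) + U' x (Inf K))) - (J + J')) < e"
    if P: "P tagged_division_of {a..b}" "(\<lambda>x. ball x (min d1 d2)) fine P" for P
  proof -
    have "(\<lambda>x. ball x d1) fine P" "(\<lambda>x. ball x d2) fine P" using P(2) by (force simp: fine_def)+
    then have lt: "norm ((\<Sum>(x, K)\<in>P. U x (Sup K) - U x (Inf K)) - J) < e / 2"
       "norm ((\<Sum>(x, K)\<in>P. U' x (Sup K) - U' x (Inf K)) - J') < e / 2"
      using 1 2 P(1) by blast+
    have eq: "(\<Sum>(x, K)\<in>P. U x (Sup K) + U' x (Sup K) - (U x (Inf K) + U' x (Inf K))) - (J + J')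
       = ((\<Sum>(x, K)\<in>P. U x (Sup K) - U x (Inf K)) - J) + ((\<Sum>(x, K)\<in>P. U' x (Sup K) - U' x (Inf K)) - J')"
      by (simp add: case_prod_unfold sum_subtractf sum.distrib)
    show ?thesis unfolding eq
      by (rule le_less_trans[OF norm_triangle_ineq]) (use lt in linarith)
  qed
  then show "\<exists>d>0. \<forall>P. P tagged_division_of {a..b} \<and> (\<lambda>x. ball x d) fine P \<longrightarrow>
        norm ((\<Sum>(x, K)\<in>P. U x (Sup K) + U' x (Sup K) - (U x (Inf K) + U' x (Inf K))) - (J + J')) < e"
    using d by (intro exI[of _ "min d1 d2"]) auto
qed

text \<open>Riemann--Stieltjes sums over the cells \<open>[u i, u (i + 1)]\<close> of a monotone sequence, tagged at the
  left end points.\<close>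

lemma tagged_division_of_sequence:
  fixes u :: "nat \<Rightarrow> real"
  assumes "0 < N" "\<And>i. i < N \<Longrightarrow> u i \<le> u (Suc i)"
  shows "(\<lambda>i. (u i, {u i..u (Suc i)})) ` {..<N} tagged_division_of {u 0..u N} \<and> u 0 \<le> u N"
  using assms
proof (induction N)
  case (Suc N)
  show ?case
  proof (cases "N = 0")
    case True
    have "u 0 \<le> u 1" using Suc.prems(2)[of 0] by simp
    then have "{(u 0, {u 0..u 1})} tagged_division_of {u 0..u 1}" by (intro tagged_division_of_self_real) simp
    then show ?thesis using True \<open>u 0 \<le> u 1\<close> by (simp add: lessThan_Suc)
  next
    case False
    have IH: "(\<lambda>i. (u i, {u i..u (Suc i)})) ` {..<N} tagged_division_of {u 0..u N}" "u 0 \<le> u N"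
      using Suc False by auto
    have le: "u N \<le> u (Suc N)" using Suc.prems by simp
    have "((\<lambda>i. (u i, {u i..u (Suc i)})) ` {..<N} \<union> {(u N, {u N..u (Suc N)})}) tagged_division_of ({u 0..u N} \<union> {u N..u (Suc N)})"
      by (rule tagged_division_Un[OF IH(1) tagged_division_of_self_real]) (use le in auto)
    moreover have "{u 0..u N} \<union> {u N..u (Suc N)} = {u 0..u (Suc N)}" using IH(2) le by auto
    ultimately show ?thesis using IH(2) le by (simp add: lessThan_Suc)
  qed
qed simp

lemma has_stieltjes_sequence:
  fixes u :: "nat \<Rightarrow> nat \<Rightarrow> real"
  assumes U: "has_stieltjes U J a b"
    and N: "\<And>n. 0 < N n" and mono: "\<And>n i. i < N n \<Longrightarrow> u n i \<le> u n (Suc i)"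
    and ends: "\<And>n. u n 0 = a" "\<And>n. u n (N n) = b"
    and mesh: "\<And>d. d > 0 \<Longrightarrow> \<forall>\<^sub>F n in sequentially. \<forall>i<N n. u n (Suc i) - u n i < d"
  shows "(\<lambda>n. \<Sum>i<N n. U (u n i) (u n (Suc i)) - U (u n i) (u n i)) \<longlonglongrightarrow> J"
proof (rule tendstoI)
  fix e :: real assume e: "e > 0"
  obtain d where d: "d > 0" "\<And>P. P tagged_division_of {a..b} \<Longrightarrow> (\<lambda>x. ball x d) fine P \<Longrightarrow> norm ((\<Sum>(x, K)\<in>P. U x (Sup K) - U x (Inf K)) - J) < e"
    using has_stieltjesD[OF U e] by blast
  show "\<forall>\<^sub>F n in sequentially. dist (\<Sum>i<N n. U (u n i) (u n (Suc i)) - U (u n i) (u n i)) J < e"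
    using mesh[OF d(1)]
  proof eventually_elim
    case (elim n)
    let ?c = "\<lambda>i. (u n i, {u n i..u n (Suc i)})"
    have P: "?c ` {..<N n} tagged_division_of {a..b}"
      using tagged_division_of_sequence[of "N n" "u n"] N[of n] mono[of _ n] ends by simp
    have "(\<lambda>x. ball x d) fine ?c ` {..<N n}"
      using elim by (auto simp: fine_def dist_real_def)
    from d(2)[OF P this] have "norm ((\<Sum>(x, K)\<in>?c ` {..<N n}. U x (Sup K) - U x (Inf K)) - J) < e" .
    moreover have "(\<Sum>(x, K)\<in>?c ` {..<N n}. U x (Sup K) - U x (Inf K)) = (\<Sum>i<N n. U (u n i) (u n (Suc i)) - U (u n i) (u n i))"
    proof -
      have mono': "u n i \<le> u n j" if "i \<le> j" "j \<le> N n" for i j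
        using that
      proof (induction j)
        case (Suc j)
        show ?case
        proof (cases "i = Suc j")
          case False
          then have "u n i \<le> u n j" using Suc by simp
          also have "\<dots> \<le> u n (Suc j)" using mono[of j n] Suc.prems by simp
          finally show ?thesis .
        qed simp
      qed simp
      have *: "(case ?c i of (x, K) \<Rightarrow> U x (Sup K) - U x (Inf K)) = 0" if "i < N n" "j < N n" "i < j" "?c i = ?c j" for i j
      proof -
        have "u n (Suc i) \<le> u n j" using mono'[of "Suc i" j] that by simp
        then have "u n (Suc i) = u n i" using that mono[of i n] by simp
        then show ?thesis by simp
      qed
      have "(\<Sum>(x, K)\<in>?c ` {..<N n}. U x (Sup K) - U x (Inf K)) = (\<Sum>i<N n. case ?c i of (x, K) \<Rightarrow> U x (Sup K) - U x (Inf K))"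
      proof (subst sum.reindex_nontrivial)
        fix i j assume ij: "i \<in> {..<N n}" "j \<in> {..<N n}" "i \<noteq> j" "?c i = ?c j"
        show "(case ?c i of (x, K) \<Rightarrow> U x (Sup K) - U x (Inf K)) = 0"
          using *[of i j] *[of j i] ij by (metis lessThan_iff linorder_neqE_nat)
      qed (auto simp: o_def)
      then show ?thesis using mono by (auto intro!: sum.cong)
    qed
    ultimately show ?case by (simp add: dist_norm)
  qed
qed

text \<open>Sums over the common refinement of two tagged divisions: the cell of \<open>P'\<close> is clamped to the
  cell of \<open>P\<close>, so that cells without common points contribute nothing.\<close>

definition clamp_to :: "real set \<Rightarrow> real \<Rightarrow> real" where
  "clamp_to K s = max (Inf K) (min (Sup K) s)"

lemma clamp_to_mono: "s \<le> t \<Longrightarrow> clamp_to K s \<le> clamp_to K t"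
  by (auto simp: clamp_to_def)

lemma sum_refine:
  fixes f :: "real \<Rightarrow> 'b::real_normed_vector"
  assumes P': "P' tagged_division_of {a..b}" and K: "Inf K \<le> Sup K" "Inf K \<in> {a..b}" "Sup K \<in> {a..b}"
  shows "(\<Sum>(x', K')\<in>P'. f (clamp_to K (Sup K')) - f (clamp_to K (Inf K'))) = f (Sup K) - f (Inf K)"
proof -
  have "(\<Sum>(x', K')\<in>P'. f (clamp_to K (Sup K')) - f (clamp_to K (Inf K'))) = f (clamp_to K b) - f (clamp_to K a)"
    using additive_tagged_division_1[OF _ P', of "\<lambda>s. f (clamp_to K s)"] K by simp
  then show ?thesis using K by (simp add: clamp_to_def)
qed

text \<open>A Stieltjes integral exists if the oscillation of the integrand over close tags is controlled by
  a monotone majorant of the integrator.\<close>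

lemma stieltjes_sums_close:
  fixes U :: "real \<Rightarrow> real \<Rightarrow> 'b::real_normed_vector"
  assumes P: "P tagged_division_of {a..b}" "(\<lambda>x. ball x d) fine P"
    and P': "P' tagged_division_of {a..b}" "(\<lambda>x. ball x d) fine P'"
    and osc: "\<And>x x' \<alpha> \<beta>. x \<in> {a..b} \<Longrightarrow> x' \<in> {a..b} \<Longrightarrow> \<bar>x - x'\<bar> < 2 * d \<Longrightarrow> a \<le> \<alpha> \<Longrightarrow> \<alpha> \<le> \<beta> \<Longrightarrow> \<beta> \<le> b \<Longrightarrow>
       norm ((U x \<beta> - U x \<alpha>) - (U x' \<beta> - U x' \<alpha>)) \<le> e * (V \<beta> - V \<alpha>)"
    and V: "\<And>\<alpha> \<beta>. a \<le> \<alpha> \<Longrightarrow> \<alpha> \<le> \<beta> \<Longrightarrow> \<beta> \<le> b \<Longrightarrow> V \<alpha> \<le> V \<beta>"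
    and ab: "a \<le> b" and e: "e \<ge> 0"
  shows "norm ((\<Sum>(x, K)\<in>P. U x (Sup K) - U x (Inf K)) - (\<Sum>(x, K)\<in>P'. U x (Sup K) - U x (Inf K))) \<le> e * (V b - V a)"
proof -
  note c = tagged_cell[OF P(1)] and c' = tagged_cell[OF P'(1)]
  have ref: "(\<Sum>(x', K')\<in>P'. f (clamp_to K (Sup K')) - f (clamp_to K (Inf K'))) = f (Sup K) - f (Inf K)"
    if "(x, K) \<in> P" for x K and f :: "real \<Rightarrow> 'b"
    using c[OF that] by (intro sum_refine[OF P'(1)]) auto
  have refV: "(\<Sum>(x', K')\<in>P'. V (clamp_to K (Sup K')) - V (clamp_to K (Inf K'))) = V (Sup K) - V (Inf K)"
    if "(x, K) \<in> P" for x K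
    using c[OF that] by (intro sum_refine[OF P'(1)]) auto
  have ref': "(\<Sum>(x', K')\<in>P. f (clamp_to K (Sup K')) - f (clamp_to K (Inf K'))) = f (Sup K) - f (Inf K)"
    if "(x, K) \<in> P'" for x K and f :: "real \<Rightarrow> 'b"
    using c'[OF that] by (intro sum_refine[OF P(1)]) auto
  have 1: "(\<Sum>(x, K)\<in>P. U x (Sup K) - U x (Inf K))
     = (\<Sum>(x, K)\<in>P. \<Sum>(x', K')\<in>P'. U x (clamp_to K (Sup K')) - U x (clamp_to K (Inf K')))"
    by (rule sum.cong[OF refl]) (clarify, simp only: ref)
  have "(\<Sum>(x, K)\<in>P'. U x (Sup K) - U x (Inf K))
     = (\<Sum>(x', K')\<in>P'. \<Sum>(x, K)\<in>P. U x' (clamp_to K' (Sup K)) - U x' (clamp_to K' (Inf K)))"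
    by (rule sum.cong[OF refl]) (clarify, simp only: ref')
  also have "\<dots> = (\<Sum>(x, K)\<in>P. \<Sum>(x', K')\<in>P'. U x' (clamp_to K' (Sup K)) - U x' (clamp_to K' (Inf K)))"
    unfolding case_prod_unfold by (rule sum.swap)
  finally have 2: "(\<Sum>(x, K)\<in>P'. U x (Sup K) - U x (Inf K)) = \<dots>" .
  have cell: "norm ((U x (clamp_to K (Sup K')) - U x (clamp_to K (Inf K'))) - (U x' (clamp_to K' (Sup K)) - U x' (clamp_to K' (Inf K))))
     \<le> e * (V (clamp_to K (Sup K')) - V (clamp_to K (Inf K')))"
    if xK: "(x, K) \<in> P" and xK': "(x', K') \<in> P'" for x K x' K'
  proof (cases "Inf K \<le> Sup K' \<and> Inf K' \<le> Sup K")
    case True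
    define z where "z = max (Inf K) (Inf K')"
    have z: "z \<in> K" "z \<in> K'"
      using True c(4-6)[OF xK] c'(4-6)[OF xK'] unfolding z_def
      by (smt (verit) atLeastAtMost_iff)+
    have "dist x z < d" "dist x' z < d"
      using fineD[OF P(2) xK] fineD[OF P'(2) xK'] z by auto
    then have close: "\<bar>x - x'\<bar> < 2 * d" by (auto simp: dist_real_def)
    have eq: "clamp_to K' (Sup K) = clamp_to K (Sup K')" "clamp_to K' (Inf K) = clamp_to K (Inf K')"
      using True c(4-5)[OF xK] c'(4-5)[OF xK'] by (auto simp: clamp_to_def max_def min_def)
    show ?thesis unfolding eq
      by (rule osc) (use close c[OF xK] c'[OF xK'] in \<open>auto intro!: clamp_to_mono, auto simp: clamp_to_def\<close>)
  next
    case False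
    then have "clamp_to K (Sup K') = clamp_to K (Inf K')" "clamp_to K' (Sup K) = clamp_to K' (Inf K)"
      using c(4-5)[OF xK] c'(4-5)[OF xK'] by (auto simp: clamp_to_def max_def min_def)
    then show ?thesis by simp
  qed
  have "norm ((\<Sum>(x, K)\<in>P. U x (Sup K) - U x (Inf K)) - (\<Sum>(x, K)\<in>P'. U x (Sup K) - U x (Inf K)))
    = norm (\<Sum>(x, K)\<in>P. \<Sum>(x', K')\<in>P'. (U x (clamp_to K (Sup K')) - U x (clamp_to K (Inf K'))) - (U x' (clamp_to K' (Sup K)) - U x' (clamp_to K' (Inf K))))"
    unfolding 1 2 by (simp add: case_prod_unfold sum_subtractf)
  also have "\<dots> \<le> (\<Sum>(x, K)\<in>P. \<Sum>(x', K')\<in>P'. e * (V (clamp_to K (Sup K')) - V (clamp_to K (Inf K'))))"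
    by (intro sum_norm_le, clarify, intro sum_norm_le, clarify) (rule cell)
  also have "\<dots> = e * (\<Sum>(x, K)\<in>P. \<Sum>(x', K')\<in>P'. V (clamp_to K (Sup K')) - V (clamp_to K (Inf K')))"
    by (simp add: case_prod_unfold sum_distrib_left)
  also have "(\<Sum>(x, K)\<in>P. \<Sum>(x', K')\<in>P'. V (clamp_to K (Sup K')) - V (clamp_to K (Inf K'))) = (\<Sum>(x, K)\<in>P. V (Sup K) - V (Inf K))"
    by (rule sum.cong[OF refl]) (clarify, simp only: refV)
  also have "\<dots> = V b - V a" by (rule additive_tagged_division_1[OF ab P(1)])
  finally show ?thesis .
qed

lemma has_stieltjes_exists:
  fixes U :: "real \<Rightarrow> real \<Rightarrow> 'b::banach"
  assumes osc: "\<And>e. e > 0 \<Longrightarrow> \<exists>d>0. \<forall>x\<in>{a..b}. \<forall>x'\<in>{a..b}. \<bar>x - x'\<bar> < d \<longrightarrow>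
      (\<forall>\<alpha> \<beta>. a \<le> \<alpha> \<and> \<alpha> \<le> \<beta> \<and> \<beta> \<le> b \<longrightarrow> norm ((U x \<beta> - U x \<alpha>) - (U x' \<beta> - U x' \<alpha>)) \<le> e * (V \<beta> - V \<alpha>))"
    and V: "\<And>\<alpha> \<beta>. a \<le> \<alpha> \<Longrightarrow> \<alpha> \<le> \<beta> \<Longrightarrow> \<beta> \<le> b \<Longrightarrow> V \<alpha> \<le> V \<beta>"
    and ab: "a \<le> b"
  shows "\<exists>J. has_stieltjes U J a b"
proof -
  let ?S = "\<lambda>P. \<Sum>(x, K)\<in>P. U x (Sup K) - U x (Inf K)"
  have close: "\<exists>d>0. \<forall>P P'. P tagged_division_of {a..b} \<and> (\<lambda>x. ball x d) fine P \<and> P' tagged_division_of {a..b} \<and> (\<lambda>x. ball x d) fine P'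
     \<longrightarrow> norm (?S P - ?S P') < e" if e: "e > 0" for e
  proof -
    define e' where "e' = e / (V b - V a + 1)"
    have VV: "V b - V a \<ge> 0" using V[of a b] ab by simp
    have e': "e' > 0" "e' * (V b - V a) < e" using e VV by (auto simp: e'_def field_simps)
    obtain d where d: "d > 0" "\<And>x x' \<alpha> \<beta>. x \<in> {a..b} \<Longrightarrow> x' \<in> {a..b} \<Longrightarrow> \<bar>x - x'\<bar> < d \<Longrightarrow> a \<le> \<alpha> \<Longrightarrow> \<alpha> \<le> \<beta> \<Longrightarrow> \<beta> \<le> b \<Longrightarrow>
       norm ((U x \<beta> - U x \<alpha>) - (U x' \<beta> - U x' \<alpha>)) \<le> e' * (V \<beta> - V \<alpha>)"
      using osc[OF e'(1)] by blast
    have "norm (?S P - ?S P') < e" if P: "P tagged_division_of {a..b}" "(\<lambda>x. ball x (d/2)) fine P" "P' tagged_division_of {a..b}" "(\<lambda>x. ball x (d/2)) fine P'" for P P'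
      by (rule le_less_trans[OF stieltjes_sums_close[OF P, where e = e' and V = V]])
        (use d e' ab V in auto)
    then show ?thesis using d(1) by (intro exI[of _ "d / 2"]) auto
  qed
  have "\<exists>P. P tagged_division_of {a..b} \<and> (\<lambda>x. ball x (1 / real (Suc n))) fine P" for n
    by (rule fine_division_exists_real[of "\<lambda>x. ball x (1 / real (Suc n))" a b]) (auto simp: gauge_def)
  then obtain Q where Q: "\<And>n. Q n tagged_division_of {a..b}" "\<And>n. (\<lambda>x. ball x (1 / real (Suc n))) fine Q n"
    by metis
  have fine: "(\<lambda>x. ball x d) fine Q n" if "1 / real (Suc n) < d" for n d
    using Q(2)[of n] that by (force simp: fine_def)
  have "Cauchy (\<lambda>n. ?S (Q n))"
    unfolding Cauchy_def
  proof (intro allI impI)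
    fix e :: real assume "e > 0"
    from close[OF this] obtain d where d: "d > 0" "\<And>P P'. P tagged_division_of {a..b} \<Longrightarrow> (\<lambda>x. ball x d) fine P \<Longrightarrow> P' tagged_division_of {a..b} \<Longrightarrow> (\<lambda>x. ball x d) fine P'
       \<Longrightarrow> norm (?S P - ?S P') < e" by blast
    obtain M where M: "1 / real (Suc M) < d" using d(1) nat_approx_posE by metis
    have "(\<lambda>x. ball x d) fine Q n" if "n \<ge> M" for n
    proof (rule fine)
      have "1 / real (Suc n) \<le> 1 / real (Suc M)" using that by (simp add: field_simps)
      then show "1 / real (Suc n) < d" using M by simp
    qed
    then show "\<exists>M. \<forall>m\<ge>M. \<forall>n\<ge>M. dist (?S (Q m)) (?S (Q n)) < e"
      unfolding dist_norm by (intro exI[of _ M]) (use d(2) Q(1) in blast)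
  qed
  then obtain J where J: "(\<lambda>n. ?S (Q n)) \<longlonglongrightarrow> J" by (auto simp: Cauchy_convergent_iff convergent_def)
  have "has_stieltjes U J a b"
    unfolding has_stieltjes_def
  proof (intro allI impI)
    fix e :: real assume e: "e > 0"
    then have "e / 2 > 0" by simp
    from close[OF this] obtain d where d: "d > 0" "\<And>P P'. P tagged_division_of {a..b} \<Longrightarrow> (\<lambda>x. ball x d) fine P \<Longrightarrow> P' tagged_division_of {a..b} \<Longrightarrow> (\<lambda>x. ball x d) fine P'
       \<Longrightarrow> norm (?S P - ?S P') < e / 2" by blast
    obtain M where M: "1 / real (Suc M) < d" using d(1) nat_approx_posE by metis
    obtain M' where M': "\<And>n. n \<ge> M' \<Longrightarrow> dist (?S (Q n)) J < e / 2"
      using J e unfolding lim_sequentially by (meson half_gt_zero)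
    define n where "n = max M M'"
    have "1 / real (Suc n) \<le> 1 / real (Suc M)" by (simp add: field_simps n_def)
    then have n: "(\<lambda>x. ball x d) fine Q n" "dist (?S (Q n)) J < e / 2"
      using M M'[of n] by (auto intro!: fine simp: n_def)
    have "norm (?S P - J) < e" if "P tagged_division_of {a..b}" "(\<lambda>x. ball x d) fine P" for P
      using d(2)[OF that Q(1) n(1)] n(2) norm_triangle_lt[of "?S P - ?S (Q n)" "?S (Q n) - J" e]
      by (simp add: dist_norm)
    then show "\<exists>d>0. \<forall>P. P tagged_division_of {a..b} \<and> (\<lambda>x. ball x d) fine P \<longrightarrow> norm (?S P - J) < e"
      using d(1) by blast
  qed
  then show ?thesis by blast
qed

text \<open>A set function on intervals with bounded sums over divisions is dominated by the increments of
  one function. The parameter \<open>c\<close> may depend on the cell; the majorant at \<open>\<beta>\<close> is the supremum of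
  the sums over \<open>[0, \<beta>]\<close>.\<close>

lemma monotone_majorant:
  fixes Q :: "'c \<Rightarrow> real \<Rightarrow> real \<Rightarrow> real"
  assumes h: "0 < h" and Q: "\<And>c \<alpha> \<beta>. 0 \<le> Q c \<alpha> \<beta>" "\<And>c \<alpha>. Q c \<alpha> \<alpha> = 0"
    and M: "\<And>P c. P tagged_division_of {0..h} \<Longrightarrow> (\<Sum>(x, K)\<in>P. Q (c K) (Inf K) (Sup K)) \<le> M"
  shows "\<exists>V. \<forall>c \<alpha> \<beta>. 0 \<le> \<alpha> \<and> \<alpha> \<le> \<beta> \<and> \<beta> \<le> h \<longrightarrow> Q c \<alpha> \<beta> \<le> V \<beta> - V \<alpha>"
proof -
  define S where "S \<beta> = {\<Sum>(x, K)\<in>P. Q (c K) (Inf K) (Sup K) | P c. P tagged_division_of {0..\<beta>}}" for \<beta>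
  define V where "V \<beta> = Sup (S \<beta>)" for \<beta>
  have extend: "(\<Sum>(x, K)\<in>P. Q (c K) (Inf K) (Sup K)) + Q c0 \<alpha> \<beta> \<in> S \<beta>"
    if P: "P tagged_division_of {0..\<alpha>}" and le: "0 \<le> \<alpha>" "\<alpha> < \<beta>" for P c c0 \<alpha> \<beta>
  proof -
    let ?K = "{\<alpha>..\<beta>}" and ?c = "c({\<alpha>..\<beta>} := c0)"
    have U: "(P \<union> {(\<beta>, ?K)}) tagged_division_of {0..\<beta>}"
    proof -
      have "(P \<union> {(\<beta>, ?K)}) tagged_division_of ({0..\<alpha>} \<union> {\<alpha>..\<beta>})"
        by (rule tagged_division_Un[OF P tagged_division_of_self_real]) (use le in auto)
      moreover have "{0..\<alpha>} \<union> {\<alpha>..\<beta>} = {0..\<beta>}" using le by auto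
      ultimately show ?thesis by simp
    qed
    have new: "K \<noteq> ?K" if "(x, K) \<in> P" for x K
    proof -
      have "\<beta> \<notin> K" using tagged_division_ofD(3)[OF P that] le by auto
      then show ?thesis using le by auto
    qed
    have "finite P" using P by (rule tagged_division_ofD(1))
    then have "(\<Sum>(x, K)\<in>P \<union> {(\<beta>, ?K)}. Q (?c K) (Inf K) (Sup K)) = (\<Sum>(x, K)\<in>P. Q (?c K) (Inf K) (Sup K)) + Q c0 \<alpha> \<beta>"
      using new le by (subst sum.union_disjoint) auto
    also have "(\<Sum>(x, K)\<in>P. Q (?c K) (Inf K) (Sup K)) = (\<Sum>(x, K)\<in>P. Q (c K) (Inf K) (Sup K))"
      by (rule sum.cong) (use new in auto)
    finally have "(\<Sum>(x, K)\<in>P. Q (c K) (Inf K) (Sup K)) + Q c0 \<alpha> \<beta> = (\<Sum>(x, K)\<in>P \<union> {(\<beta>, ?K)}. Q (?c K) (Inf K) (Sup K))" by simp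
    then show ?thesis unfolding S_def using U by blast
  qed
  have ub: "s \<le> M" if s: "s \<in> S \<beta>" and b: "0 \<le> \<beta>" "\<beta> \<le> h" for s \<beta>
  proof (cases "\<beta> = h")
    case True
    then show ?thesis using s M by (auto simp: S_def)
  next
    case False
    obtain P c where P: "P tagged_division_of {0..\<beta>}" "s = (\<Sum>(x, K)\<in>P. Q (c K) (Inf K) (Sup K))"
      using s by (auto simp: S_def)
    have "s + Q (c {}) \<beta> h \<in> S h" unfolding P(2) by (rule extend[OF P(1)]) (use b False in auto)
    then have "s + Q (c {}) \<beta> h \<le> M" using M by (auto simp: S_def)
    then show ?thesis using Q(1)[of "c {}" \<beta> h] by simp
  qed
  have "Q c \<alpha> \<beta> \<le> V \<beta> - V \<alpha>" if le: "0 \<le> \<alpha>" "\<alpha> \<le> \<beta>" "\<beta> \<le> h" for c \<alpha> \<beta>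
  proof (cases "\<alpha> = \<beta>")
    case False
    have "V \<alpha> \<le> V \<beta> - Q c \<alpha> \<beta>"
      unfolding V_def
    proof (rule cSup_least)
      show "S \<alpha> \<noteq> {}"
        using tagged_division_of_self_real[of 0 0 \<alpha>] le by (auto simp: S_def)
      fix s assume "s \<in> S \<alpha>"
      then obtain P c' where P: "P tagged_division_of {0..\<alpha>}" "s = (\<Sum>(x, K)\<in>P. Q (c' K) (Inf K) (Sup K))"
        by (auto simp: S_def)
      have "s + Q c \<alpha> \<beta> \<in> S \<beta>" unfolding P(2) by (rule extend[OF P(1)]) (use le False in auto)
      moreover have "bdd_above (S \<beta>)" by (rule bdd_aboveI[of _ M]) (use ub le in auto)
      ultimately have "s + Q c \<alpha> \<beta> \<le> Sup (S \<beta>)" by (rule cSup_upper)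
      then show "s \<le> Sup (S \<beta>) - Q c \<alpha> \<beta>" by simp
    qed
    then show ?thesis by simp
  qed (simp add: Q)
  then show ?thesis by blast
qed

section \<open>A monotone majorant of the delay kernel\<close>

text \<open>The continuous approximation \<open>ramp h \<epsilon> \<alpha>\<close> of the indicator of \<open>(\<alpha>, h]\<close>, with the conventions at
  the end points of \<open>[0, h]\<close> under which the differences over the cells of a division form a
  partition of unity.\<close>

definition ramp :: "real \<Rightarrow> real \<Rightarrow> real \<Rightarrow> real \<Rightarrow> real" where
  "ramp h \<epsilon> \<alpha> x = (if \<alpha> \<le> 0 then 1 else if h \<le> \<alpha> then 0 else max 0 (min 1 ((x - \<alpha>) / \<epsilon>)))"

lemma ramp_antimono:
  assumes "0 < \<epsilon>" "\<alpha> \<le> \<beta>" shows "ramp h \<epsilon> \<beta> x \<le> ramp h \<epsilon> \<alpha> x"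
proof -
  have "(x - \<beta>) / \<epsilon> \<le> (x - \<alpha>) / \<epsilon>" using assms by (simp add: divide_right_mono)
  then show ?thesis using assms(2) by (auto simp: ramp_def)
qed

lemma continuous_on_ramp [continuous_intros]:
  "continuous_on S f \<Longrightarrow> continuous_on S (\<lambda>x. ramp h \<epsilon> \<alpha> (f x))"
  unfolding ramp_def divide_inverse by (cases "\<alpha> \<le> 0"; cases "h \<le> \<alpha>") (auto intro!: continuous_intros)

lemma sum_lessThan_add:
  fixes f :: "nat \<Rightarrow> 'b::comm_monoid_add"
  shows "sum f {..<a + b} = sum f {..<a} + (\<Sum>i<b. f (a + i))"
  by (induction b) (auto simp: add.assoc)

lemma abel_sum:
  fixes e :: "nat \<Rightarrow> real"
  shows "(\<Sum>j<n. real j * (e (Suc j) - e j)) = real n * e n - (\<Sum>j<n. e (Suc j))"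
  by (induction n) (auto simp: algebra_simps)

text \<open>The integral of the ramp over its steep part is controlled by summation by parts: this needs
  only that \<open>\<eta>\<close> is close to \<open>\<eta> \<alpha>\<close> there.\<close>

lemma ramp_integral_close:
  fixes \<eta> :: "real \<Rightarrow> real"
  assumes J: "has_stieltjes (\<lambda>x s. ramp h \<epsilon> \<alpha> x * \<eta> s) J 0 h"
    and \<alpha>: "0 < \<alpha>" "0 < \<epsilon>" "\<alpha> + \<epsilon> < h"
    and close: "\<And>u. u \<in> {\<alpha>..\<alpha> + \<epsilon>} \<Longrightarrow> \<bar>\<eta> u - \<eta> \<alpha>\<bar> \<le> \<kappa>"
  shows "\<bar>J - (\<eta> h - \<eta> \<alpha>)\<bar> \<le> 3 * \<kappa>"
proof -
  define g where "g t = \<alpha> * min 1 t + \<epsilon> * max 0 (min 1 (t - 1)) + (h - \<alpha> - \<epsilon>) * max 0 (t - 2)" for t :: real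
  define u where "u n i = g (real i / real (Suc n))" for n i
  define N where "N n = Suc n + (Suc n + Suc n)" for n
  have g_mono: "g s \<le> g t" if "s \<le> t" for s t
    unfolding g_def by (intro add_mono mult_left_mono) (use \<alpha> that in auto)
  have g_lip: "g t - g s \<le> h * (t - s)" if "s \<le> t" for s t
  proof -
    have "\<alpha> * (min 1 t - min 1 s) \<le> \<alpha> * (t - s)" "\<epsilon> * (max 0 (min 1 (t - 1)) - max 0 (min 1 (s - 1))) \<le> \<epsilon> * (t - s)"
      "(h - \<alpha> - \<epsilon>) * (max 0 (t - 2) - max 0 (s - 2)) \<le> (h - \<alpha> - \<epsilon>) * (t - s)"
      by (intro mult_left_mono; use \<alpha> that in auto)+
    then show ?thesis by (simp add: g_def algebra_simps)
  qed
  have "(\<lambda>n. \<Sum>i<N n. ramp h \<epsilon> \<alpha> (u n i) * \<eta> (u n (Suc i)) - ramp h \<epsilon> \<alpha> (u n i) * \<eta> (u n i)) \<longlonglongrightarrow> J"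
  proof (rule has_stieltjes_sequence[OF J])
    fix n i
    show "u n i \<le> u n (Suc i)" unfolding u_def by (rule g_mono) (simp add: divide_right_mono)
    show "u n 0 = 0" using \<alpha> by (simp add: u_def g_def)
    have "real (N n) / real (Suc n) = 3" by (simp add: N_def field_simps)
    then show "u n (N n) = h" by (simp add: u_def g_def)
  next
    fix d :: real assume d: "d > 0"
    have "(\<lambda>n. h / real (Suc n)) \<longlonglongrightarrow> 0"
      using LIMSEQ_Suc[OF lim_const_over_n[of h]] by simp
    then have "\<forall>\<^sub>F n in sequentially. h / real (Suc n) < d" by (rule order_tendstoD) (rule d)
    then show "\<forall>\<^sub>F n in sequentially. \<forall>i<N n. u n (Suc i) - u n i < d"
    proof eventually_elim
      case (elim n)
      have "u n (Suc i) - u n i \<le> h * (real (Suc i) / real (Suc n) - real i / real (Suc n))" for i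
        unfolding u_def by (rule g_lip) (simp add: divide_right_mono)
      also have "h * (real (Suc i) / real (Suc n) - real i / real (Suc n)) = h / real (Suc n)" for i
        by (simp add: diff_divide_distrib[symmetric])
      finally show ?case using elim le_less_trans by blast
    qed
  qed (simp add: N_def)
  moreover have "\<bar>(\<Sum>i<N n. ramp h \<epsilon> \<alpha> (u n i) * \<eta> (u n (Suc i)) - ramp h \<epsilon> \<alpha> (u n i) * \<eta> (u n i)) - (\<eta> h - \<eta> \<alpha>)\<bar> \<le> 3 * \<kappa>" for n
  proof -
    define m where "m = Suc n"
    have m: "real m > 0" by (simp add: m_def)
    let ?f = "\<lambda>i. ramp h \<epsilon> \<alpha> (u n i) * \<eta> (u n (Suc i)) - ramp h \<epsilon> \<alpha> (u n i) * \<eta> (u n i)"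
    have u1: "u n i = \<alpha> * (real i / real m)" if "i \<le> m" for i
    proof -
      have "real i / real m \<le> 1" using that m by simp
      then show ?thesis by (simp add: u_def g_def m_def[symmetric])
    qed
    have u2: "u n (m + i) = \<alpha> + \<epsilon> * (real i / real m)" if "i \<le> m" for i
    proof -
      have "real i / real m \<le> 1" "real (m + i) / real m = 1 + real i / real m" "0 \<le> real i / real m"
        using that m by (auto simp: add_divide_distrib)
      then show ?thesis by (simp add: u_def g_def m_def[symmetric])
    qed
    have u3: "u n (m + (m + i)) = \<alpha> + \<epsilon> + (h - \<alpha> - \<epsilon>) * (real i / real m)" for i
    proof -
      have "real (m + (m + i)) / real m = 2 + real i / real m" "0 \<le> real i / real m"
        using m by (auto simp: add_divide_distrib)
      then show ?thesis by (simp add: u_def g_def m_def[symmetric])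
    qed
    have r1: "ramp h \<epsilon> \<alpha> (u n i) = 0" if "i < m" for i
    proof -
      have "\<alpha> * (real i / real m) \<le> \<alpha> * 1" by (rule mult_left_mono) (use that m \<alpha> in auto)
      then have "u n i \<le> \<alpha>" using u1[of i] that by simp
      then have "(u n i - \<alpha>) / \<epsilon> \<le> 0" using \<alpha> by (simp add: divide_le_0_iff)
      then show ?thesis using \<alpha> by (simp add: ramp_def)
    qed
    have r2: "ramp h \<epsilon> \<alpha> (u n (m + i)) = real i / real m" if "i < m" for i
      using u2[of i] that m \<alpha> by (simp add: ramp_def)
    have r3: "ramp h \<epsilon> \<alpha> (u n (m + (m + i))) = 1" for i
    proof -
      have "(u n (m + (m + i)) - \<alpha>) / \<epsilon> \<ge> 1" using u3[of i] m \<alpha> by simp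
      then show ?thesis using \<alpha> by (simp add: ramp_def)
    qed
    define e where "e i = \<eta> (u n (m + i)) - \<eta> \<alpha>" for i
    have e: "\<bar>e i\<bar> \<le> \<kappa>" if "i \<le> m" for i
    proof -
      have "\<epsilon> * (real i / real m) \<le> \<epsilon> * 1" by (rule mult_left_mono) (use that m \<alpha> in auto)
      moreover have "0 \<le> \<epsilon> * (real i / real m)" using \<alpha> by simp
      ultimately show ?thesis unfolding e_def u2[OF that] by (intro close) simp
    qed
    have "sum ?f {..<N n} = sum ?f {..<m} + ((\<Sum>i<m. ?f (m + i)) + (\<Sum>i<m. ?f (m + (m + i))))"
      unfolding N_def m_def[symmetric] sum_lessThan_add by (simp add: add.assoc)
    also have "sum ?f {..<m} = 0" using r1 by (intro sum.neutral) auto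
    also have "(\<Sum>i<m. ?f (m + i)) = (\<Sum>i<m. real i * (e (Suc i) - e i)) / real m"
      unfolding sum_divide_distrib
    proof (intro sum.cong refl)
      fix i assume "i \<in> {..<m}"
      then have "?f (m + i) = real i / real m * \<eta> (u n (m + Suc i)) - real i / real m * \<eta> (u n (m + i))"
        using r2[of i] by simp
      also have "\<dots> = real i * (e (Suc i) - e i) / real m" unfolding e_def by (simp add: right_diff_distrib diff_divide_distrib)
      finally show "?f (m + i) = real i * (e (Suc i) - e i) / real m" .
    qed
    also have "\<dots> = e m - (\<Sum>i<m. e (Suc i)) / real m"
      unfolding abel_sum using m by (simp add: diff_divide_distrib)
    also have "(\<Sum>i<m. ?f (m + (m + i))) = (\<Sum>i<m. \<eta> (u n (m + (m + Suc i))) - \<eta> (u n (m + (m + i))))"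
      by (intro sum.cong) (auto simp: r3)
    also have "\<dots> = \<eta> (u n (m + (m + m))) - \<eta> (u n (m + (m + 0)))"
      by (rule sum_lessThan_telescope)
    also have "\<dots> = \<eta> h - \<eta> (\<alpha> + \<epsilon>)" using u3[of m] u3[of 0] m by simp
    finally have "sum ?f {..<N n} - (\<eta> h - \<eta> \<alpha>) = (e m - (\<Sum>i<m. e (Suc i)) / real m) - (\<eta> (\<alpha> + \<epsilon>) - \<eta> \<alpha>)" by simp
    moreover have "\<bar>(\<Sum>i<m. e (Suc i)) / real m\<bar> \<le> \<kappa>"
    proof -
      have "\<bar>\<Sum>i<m. e (Suc i)\<bar> \<le> (\<Sum>i<m. \<kappa>)" by (rule order_trans[OF sum_abs sum_mono]) (use e in auto)
      then show ?thesis using m by (simp add: abs_divide field_simps)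
    qed
    moreover have "\<bar>\<eta> (\<alpha> + \<epsilon>) - \<eta> \<alpha>\<bar> \<le> \<kappa>" using close[of "\<alpha> + \<epsilon>"] \<alpha> by simp
    ultimately show ?thesis using e[of m] by linarith
  qed
  ultimately show ?thesis
    by (intro LIMSEQ_le_const2[of "\<lambda>n. \<bar>(\<Sum>i<N n. ramp h \<epsilon> \<alpha> (u n i) * \<eta> (u n (Suc i)) - ramp h \<epsilon> \<alpha> (u n i) * \<eta> (u n i)) - (\<eta> h - \<eta> \<alpha>)\<bar>"])
      (auto intro!: tendsto_intros)
qed

text \<open>By right-continuity, the Stieltjes integrals of the ramps over shrinking steep parts converge to the
  increment of \<open>\<eta>\<close>, as if the integrand were the indicator.\<close>

lemma ramp_integral_limit:
  fixes \<eta> :: "real \<Rightarrow> real"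
  assumes J: "\<And>n. has_stieltjes (\<lambda>x s. ramp h (1 / real (Suc n)) \<alpha> x * \<eta> s) (J n) 0 h"
    and \<alpha>: "0 \<le> \<alpha>" "\<alpha> \<le> h" and h: "0 < h"
    and right: "\<alpha> \<in> {0<..<h} \<Longrightarrow> continuous (at_right \<alpha>) \<eta>"
  shows "J \<longlonglongrightarrow> \<eta> h - \<eta> \<alpha>"
proof -
  consider "\<alpha> = 0" | "\<alpha> = h" | "0 < \<alpha>" "\<alpha> < h" using \<alpha> by linarith
  then show ?thesis
  proof cases
    case 1
    have "has_stieltjes (\<lambda>x s. 1 * \<eta> s) (\<eta> h - \<eta> 0) 0 h"
      using additive_tagged_division_1[of 0 h _ \<eta>] h
      by (auto simp: has_stieltjes_def intro!: exI[of _ 1])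
    then have "J n = \<eta> h - \<eta> \<alpha>" for n
      using has_stieltjes_unique[of _ "J n"] J[of n] 1 by (auto simp: ramp_def)
    then have "J = (\<lambda>_. \<eta> h - \<eta> \<alpha>)" by (intro ext)
    then show ?thesis by simp
  next
    case 2
    have "has_stieltjes (\<lambda>x s. 0 * \<eta> s) 0 0 h" by (auto simp: has_stieltjes_def intro!: exI[of _ 1])
    then have "J n = \<eta> h - \<eta> \<alpha>" for n
      using has_stieltjes_unique[of _ "J n"] J[of n] 2 h by (auto simp: ramp_def)
    then have "J = (\<lambda>_. \<eta> h - \<eta> \<alpha>)" by (intro ext)
    then show ?thesis by simp
  next
    case 3
    show ?thesis
    proof (rule tendstoI)
      fix e :: real assume e: "e > 0"
      have "(\<eta> \<longlongrightarrow> \<eta> \<alpha>) (at_right \<alpha>)" using right 3 by (simp add: continuous_within)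
      then have "\<forall>\<^sub>F u in at_right \<alpha>. dist (\<eta> u) (\<eta> \<alpha>) < e / 4" using e by (intro tendstoD) auto
      then obtain b where b: "b > \<alpha>" "\<And>u. u > \<alpha> \<Longrightarrow> u < b \<Longrightarrow> dist (\<eta> u) (\<eta> \<alpha>) < e / 4"
        by (auto simp: eventually_at_right[OF 3(2)])
      have pos: "min (b - \<alpha>) (h - \<alpha>) > 0" using b 3 by simp
      have "(\<lambda>n. 1 / real (Suc n)) \<longlonglongrightarrow> 0"
        using LIMSEQ_Suc[OF lim_1_over_n] by simp
      then have "\<forall>\<^sub>F n in sequentially. 1 / real (Suc n) < min (b - \<alpha>) (h - \<alpha>)" by (rule order_tendstoD) (rule pos)
      then show "\<forall>\<^sub>F n in sequentially. dist (J n) (\<eta> h - \<eta> \<alpha>) < e"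
      proof eventually_elim
        case (elim n)
        have "\<bar>J n - (\<eta> h - \<eta> \<alpha>)\<bar> \<le> 3 * (e / 4)"
        proof (rule ramp_integral_close[OF J])
          fix u assume "u \<in> {\<alpha>..\<alpha> + 1 / real (Suc n)}"
          then have "u = \<alpha> \<or> u > \<alpha> \<and> u < b" using elim by auto
          then show "\<bar>\<eta> u - \<eta> \<alpha>\<bar> \<le> e / 4" using b(2)[of u] e by (auto simp: dist_real_def)
        qed (use 3 elim in auto)
        then show ?case using e by (simp add: dist_real_def)
      qed
    qed
  qed
qed

lemma periodic_shift_int:
  assumes "\<And>t. f (t + T) = f t"
  shows "f (t + of_int n * T) = f (t::real)"
proof -
  have nat: "f (t + of_nat m * T) = f t" for t and m :: nat
  proof (induction m)
    case (Suc m)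
    have "f (t + of_nat (Suc m) * T) = f ((t + of_nat m * T) + T)" by (simp add: algebra_simps)
    then show ?case using assms Suc by simp
  qed simp
  show ?thesis
  proof (cases "n \<ge> 0")
    case True
    then show ?thesis using nat[of t "nat n"] by simp
  next
    case False
    then show ?thesis using nat[of "t + of_int n * T" "nat (- n)"] by (simp add: algebra_simps)
  qed
qed

lemma periodic_reduce:
  assumes "\<And>t. f (t + T) = f t" "0 < T"
  obtains s where "s \<in> {0..T}" "f (t::real) = f s"
proof -
  let ?n = "\<lfloor>t / T\<rfloor>"
  have "of_int ?n * T \<le> t" "t < (of_int ?n + 1) * T"
    by (rule floor_divide_lower[OF assms(2)], rule floor_divide_upper[OF assms(2)])
  then have "t + of_int (- ?n) * T \<in> {0..T}" by (simp add: algebra_simps)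
  moreover have "f t = f (t + of_int (- ?n) * T)" using periodic_shift_int[of f T] assms(1) by metis
  ultimately show thesis using that by blast
qed

lemma apply_bcontfun_sum: "apply_bcontfun (sum f A) x = (\<Sum>a\<in>A. apply_bcontfun (f a) x)"
  for f :: "'i \<Rightarrow> ('a::topological_space \<Rightarrow>\<^sub>C 'b::real_normed_vector)"
  by (induction A rule: infinite_finite_induct) auto

lemma norm_matrix_le:
  fixes A :: "('a::real_normed_vector)^'n^'m"
  shows "norm A \<le> (\<Sum>i\<in>UNIV. \<Sum>j\<in>UNIV. norm (A $ i $ j))"
proof -
  have "norm A \<le> (\<Sum>i\<in>UNIV. norm (A $ i))" unfolding norm_vec_def by (rule L2_set_le_sum) auto
  also have "\<dots> \<le> (\<Sum>i\<in>UNIV. \<Sum>j\<in>UNIV. norm (A $ i $ j))"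
    by (rule sum_mono) (subst norm_vec_def, rule L2_set_le_sum, auto)
  finally show ?thesis .
qed

text \<open>A family of delay functionals \<open>L t\<close> that is periodic and twice differentiable in time, with
  derivatives \<open>L1\<close> and \<open>L2\<close>, and a kernel \<open>\<zeta>\<close> that represents it. The regularity of \<open>\<zeta>\<close> in time is
  not assumed but derived from the one of \<open>L\<close>.\<close>

locale delay_kernel =
  fixes h T M :: real and \<zeta> :: "real \<Rightarrow> real \<Rightarrow> real^'n^'n"
    and L L1 L2 :: "real \<Rightarrow> (real \<Rightarrow>\<^sub>C (real^'n)) \<Rightarrow> real^'n"
  assumes h: "0 < h" and T: "0 < T"
    and rep: "represents_kernel h T \<zeta> L"
    and linear: "linear (L t)" "linear (L1 t)" "linear (L2 t)"
    and bound: "norm (L t \<psi>) \<le> M * norm \<psi>" "norm (L1 t \<psi>) \<le> M * norm \<psi>" "norm (L2 t \<psi>) \<le> M * norm \<psi>"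
    and L_deriv: "((\<lambda>s. L s \<psi>) has_vector_derivative L1 t \<psi>) (at t)"
    and L1_deriv: "((\<lambda>s. L1 s \<psi>) has_vector_derivative L2 t \<psi>) (at t)"
    and L2_cont: "continuous_on UNIV (\<lambda>s. L2 s \<psi>)"
    and per: "L (t + T) = L t" "L1 (t + T) = L1 t"
begin

lemma h0: "0 \<le> h" using h by simp

lemma M0: "0 \<le> M"
proof -
  define \<psi> :: "real \<Rightarrow>\<^sub>C (real^'n)" where "\<psi> = const_bcontfun (axis undefined 1)"
  have "apply_bcontfun \<psi> 0 \<noteq> 0" by (simp add: \<psi>_def const_bcontfun.rep_eq axis_eq_0_iff)
  then have "norm \<psi> > 0" by auto
  moreover have "0 \<le> M * norm \<psi>" using bound(1)[of 0 \<psi>] norm_ge_zero order_trans by blast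
  ultimately show ?thesis by (simp add: zero_le_mult_iff)
qed

text \<open>\<open>step j n \<alpha>\<close> approximates the indicator of \<open>[-h, -\<alpha>)\<close> in the \<open>j\<close>-th component, by a ramp of
  width \<open>1 / (n + 1)\<close>, and \<open>test j n K\<close> the indicator of the reflected cell \<open>K\<close>. The values of \<open>L t\<close>
  on them converge to increments of \<open>\<zeta> t\<close>.\<close>

definition step :: "'n \<Rightarrow> nat \<Rightarrow> real \<Rightarrow> (real \<Rightarrow>\<^sub>C (real^'n))" where
  "step j n \<alpha> = restrict_state h (\<lambda>\<theta>. ramp h (1 / real (Suc n)) \<alpha> (- \<theta>) *\<^sub>R axis j 1)"

lemma step_apply: "apply_bcontfun (step j n \<alpha>) \<theta> = ramp h (1 / real (Suc n)) \<alpha> (- (max (-h) (min 0 \<theta>))) *\<^sub>R axis j 1"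
  unfolding step_def by (rule restrict_state_apply) (use h in \<open>auto intro!: continuous_intros\<close>)

lemma kernel_right: "\<alpha> \<in> {0<..<h} \<Longrightarrow> continuous (at_right \<alpha>) (\<zeta> t)"
  using rep by (simp add: represents_kernel_def)

lemma kernel_integral: "\<phi> \<in> phase_space h \<Longrightarrow> has_stieltjes (\<lambda>x s. \<zeta> t s *v apply_bcontfun \<phi> (- x)) (L t \<phi>) 0 h"
  using rep by (simp add: represents_kernel_def)

lemma step_limit:
  assumes "0 \<le> \<alpha>" "\<alpha> \<le> h"
  shows "(\<lambda>n. L t (step j n \<alpha>) $ i) \<longlonglongrightarrow> \<zeta> t h $ i $ j - \<zeta> t \<alpha> $ i $ j"
proof (rule ramp_integral_limit[where \<eta> = "\<lambda>s. \<zeta> t s $ i $ j"])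
  fix n
  have "step j n \<alpha> \<in> phase_space h"
    unfolding step_def by (rule restrict_state_mem) (use h in \<open>auto intro!: continuous_intros\<close>)
  from has_stieltjes_bounded_linear[OF bounded_linear_vec_nth kernel_integral[OF this]]
  have "has_stieltjes (\<lambda>x s. (\<zeta> t s *v apply_bcontfun (step j n \<alpha>) (- x)) $ i) (L t (step j n \<alpha>) $ i) 0 h" .
  moreover have "(\<zeta> t s *v apply_bcontfun (step j n \<alpha>) (- x)) $ i = ramp h (1 / real (Suc n)) \<alpha> x * \<zeta> t s $ i $ j"
    if "x \<in> {0..h}" for x s
    using that unfolding step_apply
    by (simp add: matrix_vector_mult_def axis_def if_distrib[of "\<lambda>x. _ * x"] cong: if_cong)
  ultimately show "has_stieltjes (\<lambda>x s. ramp h (1 / real (Suc n)) \<alpha> x * \<zeta> t s $ i $ j) (L t (step j n \<alpha>) $ i) 0 h"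
    by (subst (asm) has_stieltjes_cong) auto
next
  assume "\<alpha> \<in> {0<..<h}"
  then show "continuous (at_right \<alpha>) (\<lambda>s. \<zeta> t s $ i $ j)"
    using kernel_right[of \<alpha> t] unfolding continuous_within by (intro tendsto_vec_nth)
qed (use assms h in auto)

definition test :: "'n \<Rightarrow> nat \<Rightarrow> real set \<Rightarrow> (real \<Rightarrow>\<^sub>C (real^'n))" where
  "test j n K = step j n (Inf K) - step j n (Sup K)"

lemma test_limit:
  assumes "0 \<le> Inf K" "Inf K \<le> h" "0 \<le> Sup K" "Sup K \<le> h"
  shows "(\<lambda>n. L t (test j n K) $ i) \<longlonglongrightarrow> \<zeta> t (Sup K) $ i $ j - \<zeta> t (Inf K) $ i $ j"
proof -
  have "(\<lambda>n. L t (step j n (Inf K)) $ i - L t (step j n (Sup K)) $ i)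
     \<longlonglongrightarrow> (\<zeta> t h $ i $ j - \<zeta> t (Inf K) $ i $ j) - (\<zeta> t h $ i $ j - \<zeta> t (Sup K) $ i $ j)"
    by (intro tendsto_diff step_limit assms)
  then show ?thesis by (simp add: test_def linear_diff[OF linear(1)])
qed

lemma test_sum_bound:
  assumes P: "P tagged_division_of {0..h}" and \<sigma>: "\<And>p. \<bar>\<sigma> p\<bar> \<le> 1"
  shows "norm (\<Sum>p\<in>P. \<sigma> p *\<^sub>R test j n (snd p)) \<le> 1"
proof (rule norm_bound)
  fix \<theta>
  let ?r = "\<lambda>\<alpha>. ramp h (1 / real (Suc n)) \<alpha> (- (max (-h) (min 0 \<theta>)))"
  have "norm (apply_bcontfun (\<Sum>p\<in>P. \<sigma> p *\<^sub>R test j n (snd p)) \<theta>)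
     = norm (\<Sum>p\<in>P. (\<sigma> p * (?r (Inf (snd p)) - ?r (Sup (snd p)))) *\<^sub>R axis j (1::real))"
    by (simp add: apply_bcontfun_sum test_def step_apply scaleR_diff_left[symmetric] del: scaleR_diff_left)
  also have "\<dots> \<le> (\<Sum>p\<in>P. - ?r (Sup (snd p)) - (- ?r (Inf (snd p))))"
  proof (rule sum_norm_le)
    fix p assume p: "p \<in> P"
    then have "Inf (snd p) \<le> Sup (snd p)" using tagged_cell(4,5)[OF P, of "fst p" "snd p"] by auto
    then have "?r (Sup (snd p)) \<le> ?r (Inf (snd p))" by (intro ramp_antimono) auto
    then show "norm ((\<sigma> p * (?r (Inf (snd p)) - ?r (Sup (snd p)))) *\<^sub>R axis j (1::real)) \<le> - ?r (Sup (snd p)) - (- ?r (Inf (snd p)))"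
      using \<sigma>[of p] by (simp add: abs_mult mult_left_le_one_le)
  qed
  also have "\<dots> = - ?r h - (- ?r 0)"
    using additive_tagged_division_1[OF h0 P, of "\<lambda>\<alpha>. - ?r \<alpha>"] by (simp add: case_prod_unfold)
  also have "\<dots> = 1" using h by (simp add: ramp_def)
  finally show "norm (apply_bcontfun (\<Sum>p\<in>P. \<sigma> p *\<^sub>R test j n (snd p)) \<theta>) \<le> 1" .
qed

text \<open>The test functions of a division are nonnegative and sum up to at most 1, so a sum of them with signs
  has norm at most 1. Choosing the signs suitably bounds the sum of the absolute values of a functional on them.\<close>

lemma test_variation:
  assumes P: "P tagged_division_of {0..h}"
    and l: "linear l" "\<And>\<psi>. norm (l \<psi>) \<le> M * norm \<psi>"
  shows "(\<Sum>(x, K)\<in>P. \<bar>(l (test j n K) :: real^'n) $ i\<bar>) \<le> M"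
proof -
  let ?\<sigma> = "\<lambda>p. sgn (l (test j n (snd p)) $ i)"
  have "(\<Sum>(x, K)\<in>P. \<bar>l (test j n K) $ i\<bar>) = (\<Sum>p\<in>P. ?\<sigma> p * l (test j n (snd p)) $ i)"
    by (simp add: case_prod_unfold abs_sgn mult.commute)
  also have "\<dots> = l (\<Sum>p\<in>P. ?\<sigma> p *\<^sub>R test j n (snd p)) $ i"
    by (simp add: linear_sum[OF l(1)] linear_scale[OF l(1)])
  also have "\<dots> \<le> norm (l (\<Sum>p\<in>P. ?\<sigma> p *\<^sub>R test j n (snd p)))"
    using component_le_norm_cart abs_le_D1 by blast
  also have "\<dots> \<le> M * norm (\<Sum>p\<in>P. ?\<sigma> p *\<^sub>R test j n (snd p))" by (rule l)
  also have "\<dots> \<le> M * 1" by (intro mult_left_mono test_sum_bound P M0) (auto simp: sgn_real_def)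
  finally show ?thesis by simp
qed

text \<open>As \<open>L\<close> is twice differentiable, the functions \<open>s \<mapsto> L s \<chi>\<^sub>K\<close>, for the cells \<open>K\<close> of a division, have
  Lipschitz constants with a bounded sum: the derivative is bounded by its value at one point and
  the integral of the second derivative, and these can be summed over \<open>K\<close>. This is stronger than a
  bound for each pair of points, as the points may depend on the cell.\<close>

definition lip :: "'n \<Rightarrow> (real \<Rightarrow>\<^sub>C (real^'n)) \<Rightarrow> real" where
  "lip i \<psi> = \<bar>L1 0 \<psi> $ i\<bar> + integral {0..T} (\<lambda>w. \<bar>L2 w \<psi> $ i\<bar>)"

lemma L2_comp_cont: "continuous_on S (\<lambda>w. L2 w \<psi> $ i)"
  using L2_cont continuous_on_subset by (blast intro: continuous_on_component)

lemma lip_L1: "\<bar>L1 u \<psi> $ i\<bar> \<le> lip i \<psi>"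
proof -
  obtain s where s: "s \<in> {0..T}" "L1 u = L1 s" by (rule periodic_reduce[of L1 T u]) (use per T in auto)
  have int: "(\<lambda>w. L2 w \<psi> $ i) integrable_on {a..b}" "(\<lambda>w. \<bar>L2 w \<psi> $ i\<bar>) integrable_on {a..b}" for a b
    by (intro integrable_continuous_interval continuous_intros L2_comp_cont)+
  have "((\<lambda>w. L2 w \<psi> $ i) has_integral (L1 s \<psi> $ i - L1 0 \<psi> $ i)) {0..s}"
    by (rule fundamental_theorem_of_calculus)
      (use s in \<open>auto intro!: has_vector_derivative_at_within bounded_linear.has_vector_derivative[OF bounded_linear_vec_nth] L1_deriv\<close>)
  then have "\<bar>L1 s \<psi> $ i - L1 0 \<psi> $ i\<bar> = \<bar>integral {0..s} (\<lambda>w. L2 w \<psi> $ i)\<bar>" by (simp add: integral_unique)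
  also have "\<dots> \<le> integral {0..s} (\<lambda>w. \<bar>L2 w \<psi> $ i\<bar>)"
    using integral_norm_bound_integral[OF int, of 0 s] by simp
  also have "\<dots> \<le> integral {0..T} (\<lambda>w. \<bar>L2 w \<psi> $ i\<bar>)"
    by (rule integral_subset_le) (use s int in auto)
  finally show ?thesis unfolding s(2) lip_def by linarith
qed

lemma lip_nonneg: "0 \<le> lip i \<psi>" using lip_L1[of 0 \<psi> i] by linarith

lemma lip_L: "\<bar>L s \<psi> $ i - L s' \<psi> $ i\<bar> \<le> lip i \<psi> * \<bar>s - s'\<bar>"
proof -
  have "((\<lambda>s. L s \<psi> $ i) has_real_derivative L1 s \<psi> $ i) (at s)" for s
    using bounded_linear.has_vector_derivative[OF bounded_linear_vec_nth L_deriv]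
    by (simp add: has_real_derivative_iff_has_vector_derivative)
  from field_differentiable_bound[OF convex_UNIV this[THEN DERIV_subset[OF _ subset_UNIV]], of "lip i \<psi>" s s']
  show ?thesis using lip_L1 by simp
qed

lemma lip_sum:
  assumes P: "P tagged_division_of {0..h}"
  shows "(\<Sum>(x, K)\<in>P. lip i (test j n K)) \<le> M + T * M"
proof -
  have fin: "finite P" using P by (rule tagged_division_ofD(1))
  have "(\<Sum>(x, K)\<in>P. integral {0..T} (\<lambda>w. \<bar>L2 w (test j n K) $ i\<bar>)) = integral {0..T} (\<lambda>w. \<Sum>(x, K)\<in>P. \<bar>L2 w (test j n K) $ i\<bar>)"
    unfolding case_prod_unfold
    by (subst integral_sum[OF fin]) (auto intro!: integrable_continuous_interval continuous_intros L2_comp_cont)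
  also have "\<dots> \<le> integral {0..T} (\<lambda>w. M)"
  proof (rule integral_le)
    show "(\<lambda>w. \<Sum>(x, K)\<in>P. \<bar>L2 w (test j n K) $ i\<bar>) integrable_on {0..T}"
      unfolding case_prod_unfold by (intro integrable_continuous_interval continuous_intros L2_comp_cont)
  qed (use test_variation[OF P linear(3) bound(3)] in auto)
  also have "\<dots> = T * M" using T by simp
  finally have "(\<Sum>(x, K)\<in>P. integral {0..T} (\<lambda>w. \<bar>L2 w (test j n K) $ i\<bar>)) \<le> T * M" .
  moreover have "(\<Sum>(x, K)\<in>P. \<bar>L1 0 (test j n K) $ i\<bar>) \<le> M" by (rule test_variation[OF P linear(2) bound(2)])
  ultimately show ?thesis by (simp add: lip_def case_prod_unfold sum.distrib)
qed

text \<open>The evaluation times \<open>s K\<close> and \<open>s' K\<close> may depend on the cell. If they coincide, the quotient is 0.\<close>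

lemma kernel_difference_variation:
  assumes P: "P tagged_division_of {0..h}"
  shows "(\<Sum>(x, K)\<in>P. \<bar>(\<zeta> (s K) (Sup K) $ i $ j - \<zeta> (s K) (Inf K) $ i $ j) - (\<zeta> (s' K) (Sup K) $ i $ j - \<zeta> (s' K) (Inf K) $ i $ j)\<bar> / \<bar>s K - s' K\<bar>)
    \<le> M + T * M"
proof (rule LIMSEQ_le_const2)
  show "(\<lambda>n. \<Sum>(x, K)\<in>P. \<bar>L (s K) (test j n K) $ i - L (s' K) (test j n K) $ i\<bar> / \<bar>s K - s' K\<bar>)
    \<longlonglongrightarrow> (\<Sum>(x, K)\<in>P. \<bar>(\<zeta> (s K) (Sup K) $ i $ j - \<zeta> (s K) (Inf K) $ i $ j) - (\<zeta> (s' K) (Sup K) $ i $ j - \<zeta> (s' K) (Inf K) $ i $ j)\<bar> / \<bar>s K - s' K\<bar>)"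
    unfolding case_prod_unfold divide_inverse
  proof (intro tendsto_sum tendsto_mult tendsto_const tendsto_rabs tendsto_diff test_limit)
    fix p assume p: "p \<in> P"
    show "0 \<le> Inf (snd p)" "Inf (snd p) \<le> h" "0 \<le> Sup (snd p)" "Sup (snd p) \<le> h"
      using tagged_cell(2,3)[OF P, of "fst p" "snd p"] p by auto
    then show "0 \<le> Inf (snd p)" "Inf (snd p) \<le> h" "0 \<le> Sup (snd p)" "Sup (snd p) \<le> h" .
  qed
  have "(\<Sum>(x, K)\<in>P. \<bar>L (s K) (test j n K) $ i - L (s' K) (test j n K) $ i\<bar> / \<bar>s K - s' K\<bar>) \<le> (\<Sum>(x, K)\<in>P. lip i (test j n K))" for n
    unfolding case_prod_unfold
  proof (rule sum_mono)
    fix p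
    show "\<bar>L (s (snd p)) (test j n (snd p)) $ i - L (s' (snd p)) (test j n (snd p)) $ i\<bar> / \<bar>s (snd p) - s' (snd p)\<bar> \<le> lip i (test j n (snd p))"
      using lip_L[of "s (snd p)" "test j n (snd p)" i "s' (snd p)"] lip_nonneg by (cases "s (snd p) = s' (snd p)") (auto simp: field_simps)
  qed
  then show "\<exists>N. \<forall>n\<ge>N. (\<Sum>(x, K)\<in>P. \<bar>L (s K) (test j n K) $ i - L (s' K) (test j n K) $ i\<bar> / \<bar>s K - s' K\<bar>) \<le> M + T * M"
    using lip_sum[OF P] order_trans by blast
qed

lemma kernel_variation:
  assumes P: "P tagged_division_of {0..h}"
  shows "(\<Sum>(x, K)\<in>P. \<bar>\<zeta> (s K) (Sup K) $ i $ j - \<zeta> (s K) (Inf K) $ i $ j\<bar>) \<le> M + (M + T * M) * T"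
proof (rule LIMSEQ_le_const2)
  show "(\<lambda>n. \<Sum>(x, K)\<in>P. \<bar>L (s K) (test j n K) $ i\<bar>)
    \<longlonglongrightarrow> (\<Sum>(x, K)\<in>P. \<bar>\<zeta> (s K) (Sup K) $ i $ j - \<zeta> (s K) (Inf K) $ i $ j\<bar>)"
    unfolding case_prod_unfold
  proof (intro tendsto_sum tendsto_rabs test_limit)
    fix p assume p: "p \<in> P"
    show "0 \<le> Inf (snd p)" "Inf (snd p) \<le> h" "0 \<le> Sup (snd p)" "Sup (snd p) \<le> h"
      using tagged_cell(2,3)[OF P, of "fst p" "snd p"] p by auto
  qed
  have "(\<Sum>(x, K)\<in>P. \<bar>L (s K) (test j n K) $ i\<bar>) \<le> (\<Sum>(x, K)\<in>P. \<bar>L 0 (test j n K) $ i\<bar>) + (\<Sum>(x, K)\<in>P. lip i (test j n K)) * T" for n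
    unfolding case_prod_unfold sum_distrib_right sum.distrib[symmetric]
  proof (rule sum_mono)
    fix p
    obtain r where r: "r \<in> {0..T}" "L (s (snd p)) = L r" by (rule periodic_reduce[of L T "s (snd p)"]) (use per T in auto)
    have "lip i (test j n (snd p)) * \<bar>r - 0\<bar> \<le> lip i (test j n (snd p)) * T"
      using r lip_nonneg by (intro mult_left_mono) auto
    then show "\<bar>L (s (snd p)) (test j n (snd p)) $ i\<bar> \<le> \<bar>L 0 (test j n (snd p)) $ i\<bar> + lip i (test j n (snd p)) * T"
      unfolding r(2) using lip_L[of r "test j n (snd p)" i 0] by linarith
  qed
  also have "\<dots> n \<le> M + (M + T * M) * T" for n
    by (intro add_mono mult_right_mono test_variation[OF P linear(1) bound(1)] lip_sum[OF P]) (use T in auto)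
  finally show "\<exists>N. \<forall>n\<ge>N. (\<Sum>(x, K)\<in>P. \<bar>L (s K) (test j n K) $ i\<bar>) \<le> M + (M + T * M) * T" by blast
qed

text \<open>The common majorant is the sum of two: one for the difference quotients of the increments in time,
  and one for the increments themselves.\<close>

lemma majorant:
  "\<exists>V. (\<forall>s s' \<alpha> \<beta>. 0 \<le> \<alpha> \<longrightarrow> \<alpha> \<le> \<beta> \<longrightarrow> \<beta> \<le> h \<longrightarrow>
      norm ((\<zeta> s \<beta> - \<zeta> s \<alpha>) - (\<zeta> s' \<beta> - \<zeta> s' \<alpha>)) \<le> \<bar>s - s'\<bar> * (V \<beta> - V \<alpha>)) \<and>
    (\<forall>s \<alpha> \<beta>. 0 \<le> \<alpha> \<longrightarrow> \<alpha> \<le> \<beta> \<longrightarrow> \<beta> \<le> h \<longrightarrow> norm (\<zeta> s \<beta> - \<zeta> s \<alpha>) \<le> V \<beta> - V \<alpha>)"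
proof -
  let ?Q1 = "\<lambda>(s, s') \<alpha> \<beta>. norm ((\<zeta> s \<beta> - \<zeta> s \<alpha>) - (\<zeta> s' \<beta> - \<zeta> s' \<alpha>)) / \<bar>s - s'\<bar>"
  let ?Q2 = "\<lambda>s \<alpha> \<beta>. norm (\<zeta> s \<beta> - \<zeta> s \<alpha>)"
  have "\<exists>V. \<forall>c \<alpha> \<beta>. 0 \<le> \<alpha> \<and> \<alpha> \<le> \<beta> \<and> \<beta> \<le> h \<longrightarrow> ?Q1 c \<alpha> \<beta> \<le> V \<beta> - V \<alpha>"
  proof (rule monotone_majorant[OF h])
    fix P and c :: "real set \<Rightarrow> real \<times> real" assume P: "P tagged_division_of {0..h}"
    let ?s = "\<lambda>K. fst (c K)" and ?s' = "\<lambda>K. snd (c K)"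
    have "(\<Sum>(x, K)\<in>P. ?Q1 (c K) (Inf K) (Sup K)) \<le> (\<Sum>(x, K)\<in>P. \<Sum>i\<in>UNIV. \<Sum>j\<in>UNIV.
      \<bar>(\<zeta> (?s K) (Sup K) $ i $ j - \<zeta> (?s K) (Inf K) $ i $ j) - (\<zeta> (?s' K) (Sup K) $ i $ j - \<zeta> (?s' K) (Inf K) $ i $ j)\<bar> / \<bar>?s K - ?s' K\<bar>)"
      unfolding case_prod_unfold sum_divide_distrib[symmetric]
      by (intro sum_mono divide_right_mono order_trans[OF norm_matrix_le]) auto
    also have "\<dots> = (\<Sum>i\<in>UNIV. \<Sum>j\<in>UNIV. \<Sum>(x, K)\<in>P.
      \<bar>(\<zeta> (?s K) (Sup K) $ i $ j - \<zeta> (?s K) (Inf K) $ i $ j) - (\<zeta> (?s' K) (Sup K) $ i $ j - \<zeta> (?s' K) (Inf K) $ i $ j)\<bar> / \<bar>?s K - ?s' K\<bar>)"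
      unfolding case_prod_unfold by (subst sum.swap) (intro sum.cong refl sum.swap)
    also have "\<dots> \<le> (\<Sum>i\<in>(UNIV::'n set). \<Sum>j\<in>(UNIV::'n set). M + T * M)"
      by (intro sum_mono kernel_difference_variation P)
    finally show "(\<Sum>(x, K)\<in>P. ?Q1 (c K) (Inf K) (Sup K)) \<le> (\<Sum>i\<in>(UNIV::'n set). \<Sum>j\<in>(UNIV::'n set). M + T * M)" .
  qed (auto split: prod.splits)
  then obtain V1 where V1: "\<And>c \<alpha> \<beta>. 0 \<le> \<alpha> \<Longrightarrow> \<alpha> \<le> \<beta> \<Longrightarrow> \<beta> \<le> h \<Longrightarrow> ?Q1 c \<alpha> \<beta> \<le> V1 \<beta> - V1 \<alpha>" by blast
  have "\<exists>V. \<forall>c \<alpha> \<beta>. 0 \<le> \<alpha> \<and> \<alpha> \<le> \<beta> \<and> \<beta> \<le> h \<longrightarrow> ?Q2 c \<alpha> \<beta> \<le> V \<beta> - V \<alpha>"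
  proof (rule monotone_majorant[OF h])
    fix P and c :: "real set \<Rightarrow> real" assume P: "P tagged_division_of {0..h}"
    have "(\<Sum>(x, K)\<in>P. ?Q2 (c K) (Inf K) (Sup K)) \<le> (\<Sum>(x, K)\<in>P. \<Sum>i\<in>UNIV. \<Sum>j\<in>UNIV. \<bar>\<zeta> (c K) (Sup K) $ i $ j - \<zeta> (c K) (Inf K) $ i $ j\<bar>)"
      unfolding case_prod_unfold
      by (intro sum_mono order_trans[OF norm_matrix_le]) auto
    also have "\<dots> = (\<Sum>i\<in>UNIV. \<Sum>j\<in>UNIV. \<Sum>(x, K)\<in>P. \<bar>\<zeta> (c K) (Sup K) $ i $ j - \<zeta> (c K) (Inf K) $ i $ j\<bar>)"
      unfolding case_prod_unfold by (subst sum.swap) (intro sum.cong refl sum.swap)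
    also have "\<dots> \<le> (\<Sum>i\<in>(UNIV::'n set). \<Sum>j\<in>(UNIV::'n set). M + (M + T * M) * T)"
      by (intro sum_mono kernel_variation P)
    finally show "(\<Sum>(x, K)\<in>P. ?Q2 (c K) (Inf K) (Sup K)) \<le> (\<Sum>i\<in>(UNIV::'n set). \<Sum>j\<in>(UNIV::'n set). M + (M + T * M) * T)" .
  qed auto
  then obtain V2 where V2: "\<And>c \<alpha> \<beta>. 0 \<le> \<alpha> \<Longrightarrow> \<alpha> \<le> \<beta> \<Longrightarrow> \<beta> \<le> h \<Longrightarrow> ?Q2 c \<alpha> \<beta> \<le> V2 \<beta> - V2 \<alpha>" by blast
  show ?thesis
  proof (intro exI[of _ "\<lambda>\<beta>. V1 \<beta> + V2 \<beta>"] conjI allI impI)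
    fix s s' \<alpha> \<beta> :: real assume le: "0 \<le> \<alpha>" "\<alpha> \<le> \<beta>" "\<beta> \<le> h"
    have 1: "norm ((\<zeta> s \<beta> - \<zeta> s \<alpha>) - (\<zeta> s' \<beta> - \<zeta> s' \<alpha>)) / \<bar>s - s'\<bar> \<le> V1 \<beta> - V1 \<alpha>"
      using V1[OF le, of "(s, s')"] by simp
    have 2: "0 \<le> V2 \<beta> - V2 \<alpha>" using V2[OF le, of s] norm_ge_zero order_trans by blast
    show "norm ((\<zeta> s \<beta> - \<zeta> s \<alpha>) - (\<zeta> s' \<beta> - \<zeta> s' \<alpha>)) \<le> \<bar>s - s'\<bar> * (V1 \<beta> + V2 \<beta> - (V1 \<alpha> + V2 \<alpha>))"
    proof (cases "s = s'")
      case False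
      then have "norm ((\<zeta> s \<beta> - \<zeta> s \<alpha>) - (\<zeta> s' \<beta> - \<zeta> s' \<alpha>)) \<le> \<bar>s - s'\<bar> * (V1 \<beta> - V1 \<alpha>)"
        using 1 by (simp add: pos_divide_le_eq mult.commute)
      also have "\<dots> \<le> \<bar>s - s'\<bar> * (V1 \<beta> + V2 \<beta> - (V1 \<alpha> + V2 \<alpha>))" using 2 by (intro mult_left_mono) auto
      finally show ?thesis .
    qed simp
    have "0 \<le> V1 \<beta> - V1 \<alpha>" using V1[OF le, of "(0, 0)"] by simp
    then show "norm (\<zeta> s \<beta> - \<zeta> s \<alpha>) \<le> V1 \<beta> + V2 \<beta> - (V1 \<alpha> + V2 \<alpha>)" using V2[OF le, of s] by linarith
  qed
qed

end

section \<open>Transposition of the delay term\<close>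

lemma tendsto_by_bound:
  assumes "\<And>s. norm (f s - l) \<le> g s" "(g \<longlongrightarrow> 0) G"
  shows "(f \<longlongrightarrow> l) G"
proof -
  have "\<forall>\<^sub>F s in G. norm (f s - l) \<le> g s" using assms(1) by (intro always_eventually) simp
  then have "((\<lambda>s. f s - l) \<longlongrightarrow> 0) G" using assms(2) by (rule Lim_null_comparison)
  then show ?thesis by (rule LIM_zero_cancel)
qed

lemma periodic_bounded:
  fixes f :: "real \<Rightarrow> 'b::real_normed_vector"
  assumes "continuous_on UNIV f" "\<And>t. norm (f (t + T)) = norm (f t)" "0 < T"
  shows "\<exists>C>0. \<forall>t. norm (f t) \<le> C"
proof -
  have "compact (f ` {0..T})"
    using assms(1) by (intro compact_continuous_image) (auto intro: continuous_on_subset)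
  then obtain C where C: "C > 0" "\<And>x. x \<in> f ` {0..T} \<Longrightarrow> norm x \<le> C"
    using compact_imp_bounded bounded_pos by metis
  have "norm (f t) \<le> C" for t
  proof -
    obtain s where "s \<in> {0..T}" "norm (f t) = norm (f s)"
      by (rule periodic_reduce[of "\<lambda>t. norm (f t)" T t]) (use assms in auto)
    then show ?thesis using C by auto
  qed
  then show ?thesis using C(1) by blast
qed

lemma integral_periodic_shift:
  fixes f :: "real \<Rightarrow> 'b::euclidean_space"
  assumes f: "continuous_on UNIV f" and per: "\<And>t. f (t + T) = f t" and T: "0 < T" and s: "0 \<le> s"
  shows "integral {0..T} (\<lambda>t. f (t + s)) = integral {0..T} f"
proof -
  have sub: "continuous_on S f" for S using f continuous_on_subset by blast
  have int: "f integrable_on {a..b}" for a b by (rule integrable_continuous_interval[OF sub])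
  have "integral {0..T} (f \<circ> (\<lambda>t. t + s)) = integral {s..T + s} f"
    using integral_shift[of 0 s T f] sub by simp
  moreover have "integral {0..s} (f \<circ> (\<lambda>t. t + T)) = integral {T..s + T} f"
    using integral_shift[of 0 T s f] sub by simp
  moreover have "f \<circ> (\<lambda>t. t + T) = f" using per by auto
  moreover have "integral {0..s} f + integral {s..T + s} f = integral {0..T + s} f"
    "integral {0..T} f + integral {T..s + T} f = integral {0..T + s} f"
    using T s by (auto intro!: Henstock_Kurzweil_Integration.integral_combine int simp: add.commute)
  ultimately have "integral {0..T} (f \<circ> (\<lambda>t. t + s)) = integral {0..T} f" by (metis add_left_imp_eq add.commute)
  then show ?thesis by (simp add: o_def)
qed

text \<open>The bilinear product of a complex row vector with a real column vector.\<close>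

definition cdot :: "complex^'n \<Rightarrow> real^'n \<Rightarrow> complex" where
  "cdot p w = (\<Sum>i\<in>UNIV. p $ i * of_real (w $ i))"

lemma pairing_cvec: "pairing T p (cvec \<circ> f) = integral {0..T} (\<lambda>t. cdot (p t) (f t))"
  by (simp add: pairing_def cdot_def cvec_def)

lemma bounded_bilinear_cdot: "bounded_bilinear (cdot :: complex^'n \<Rightarrow> _)"
proof
  show "\<exists>K. \<forall>(a::complex^'n) b. norm (cdot a b) \<le> norm a * norm b * K"
  proof (intro exI allI)
    fix a :: "complex^'n" and b
    have "norm (cdot a b) \<le> (\<Sum>i\<in>(UNIV::'n set). norm a * norm b)"
      unfolding cdot_def
      by (intro sum_norm_le) (simp add: norm_mult mult_mono Finite_Cartesian_Product.norm_nth_le component_le_norm_cart)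
    then show "norm (cdot a b) \<le> norm a * norm b * real CARD('n)" by (simp add: mult_ac)
  qed
qed (auto simp: cdot_def algebra_simps sum.distrib sum_distrib_left scaleR_conv_of_real[where 'a = complex])

lemma norm_le_sum_components:
  fixes A :: "('a::real_normed_vector)^'n"
  shows "norm A \<le> (\<Sum>i\<in>UNIV. norm (A $ i))"
  unfolding norm_vec_def by (rule L2_set_le_sum) auto

lemma norm_matrix_entry: "norm ((A::('a::real_normed_vector)^'n^'m) $ i $ j) \<le> norm A"
  by (rule order_trans[OF Finite_Cartesian_Product.norm_nth_le Finite_Cartesian_Product.norm_nth_le])

lemma bounded_bilinear_row_mult: "bounded_bilinear (\<lambda>(r::real^'m) (A::real^'n^'m). r v* A)"
proof
  show "\<exists>K. \<forall>r (A::real^'n^'m). norm (r v* A) \<le> norm r * norm A * K"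
  proof (intro exI allI)
    fix r :: "real^'m" and A :: "real^'n^'m"
    have "norm ((r v* A) $ j) \<le> (\<Sum>i\<in>(UNIV::'m set). norm r * norm A)" for j
      unfolding vector_matrix_mult_def vec_lambda_beta
      by (rule sum_norm_le)
        (simp add: norm_mult mult_mono Finite_Cartesian_Product.norm_nth_le norm_matrix_entry del: real_norm_def)
    then have "norm (r v* A) \<le> (\<Sum>j\<in>(UNIV::'n set). \<Sum>i\<in>(UNIV::'m set). norm r * norm A)"
      by (intro order_trans[OF norm_le_sum_components] sum_mono)
    then show "norm (r v* A) \<le> norm r * norm A * (real CARD('n) * real CARD('m))" by (simp add: mult_ac)
  qed
qed (auto simp: vec_eq_iff vector_matrix_mult_def algebra_simps sum.distrib sum_distrib_left)

lemma bounded_bilinear_row_mult_cmat: "bounded_bilinear (\<lambda>(r::complex^'m) (A::real^'n^'m). r v* cmat A)"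
proof
  show "\<exists>K. \<forall>r (A::real^'n^'m). norm (r v* cmat A :: complex^'n) \<le> norm r * norm A * K"
  proof (intro exI allI)
    fix r :: "complex^'m" and A :: "real^'n^'m"
    have "norm ((r v* cmat A) $ j) \<le> (\<Sum>i\<in>(UNIV::'m set). norm r * norm A)" for j
      unfolding vector_matrix_mult_def cmat_def vec_lambda_beta
      by (rule sum_norm_le)
        (simp add: norm_mult mult_mono Finite_Cartesian_Product.norm_nth_le norm_matrix_entry[where 'a=real, unfolded real_norm_def])
    then have "norm (r v* cmat A) \<le> (\<Sum>j\<in>(UNIV::'n set). \<Sum>i\<in>(UNIV::'m set). norm r * norm A)"
      by (intro order_trans[OF norm_le_sum_components] sum_mono)
    then show "norm (r v* cmat A) \<le> norm r * norm A * (real CARD('n) * real CARD('m))" by (simp add: mult_ac)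
  qed
qed (auto simp: vec_eq_iff vector_matrix_mult_def cmat_def algebra_simps sum.distrib sum_distrib_left scaleR_conv_of_real[where 'a = complex])

lemma bounded_bilinear_matrix_vector: "bounded_bilinear (\<lambda>(A::real^'n^'m) w. A *v w)"
proof
  show "\<exists>K. \<forall>(A::real^'n^'m) w. norm (A *v w) \<le> norm A * norm w * K"
  proof (intro exI allI)
    fix w :: "real^'n" and A :: "real^'n^'m"
    have "norm ((A *v w) $ i) \<le> (\<Sum>j\<in>(UNIV::'n set). norm A * norm w)" for i
      unfolding matrix_vector_mult_def vec_lambda_beta
      by (rule sum_norm_le)
        (simp add: norm_mult mult_mono Finite_Cartesian_Product.norm_nth_le norm_matrix_entry del: real_norm_def)
    then have "norm (A *v w) \<le> (\<Sum>i\<in>(UNIV::'m set). \<Sum>j\<in>(UNIV::'n set). norm A * norm w)"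
      by (intro order_trans[OF norm_le_sum_components] sum_mono)
    then show "norm (A *v w) \<le> norm A * norm w * (real CARD('n) * real CARD('m))" by (simp add: mult_ac)
  qed
qed (auto simp: vec_eq_iff matrix_vector_mult_def algebra_simps sum.distrib sum_distrib_left)

lemma cdot_row_mult: "cdot (p v* cmat A) w = cdot p (A *v w)"
proof -
  have "cdot (p v* cmat A) w = (\<Sum>j\<in>UNIV. \<Sum>i\<in>UNIV. p $ i * of_real (A $ i $ j) * of_real (w $ j))"
    by (simp add: cdot_def vector_matrix_mult_def cmat_def sum_distrib_right)
  also have "\<dots> = (\<Sum>i\<in>UNIV. \<Sum>j\<in>UNIV. p $ i * of_real (A $ i $ j) * of_real (w $ j))" by (rule sum.swap)
  also have "\<dots> = cdot p (A *v w)"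
    by (simp add: cdot_def matrix_vector_mult_def sum_distrib_left mult.assoc)
  finally show ?thesis .
qed

text \<open>The equidistant grid with \<open>n + 1\<close> cells, and the increments \<open>cell n i s\<close> of \<open>\<zeta> s\<close> over them.\<close>

definition grid :: "real \<Rightarrow> nat \<Rightarrow> nat \<Rightarrow> real" where
  "grid h n i = h * (real i / real (Suc n))"

lemma grid_simps: "grid h n 0 = 0" "grid h n (Suc n) = h"
  by (auto simp: grid_def)

lemma grid_mono: "0 \<le> h \<Longrightarrow> i \<le> j \<Longrightarrow> grid h n i \<le> grid h n j"
  unfolding grid_def by (intro mult_left_mono divide_right_mono) auto

lemma grid_mem: "0 \<le> h \<Longrightarrow> i \<le> Suc n \<Longrightarrow> 0 \<le> grid h n i \<and> grid h n i \<le> h"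
  using grid_mono[of h 0 i n] grid_mono[of h i "Suc n" n] by (simp add: grid_simps)

lemma grid_mesh:
  assumes "d > 0" shows "\<forall>\<^sub>F n in sequentially. \<forall>i. grid h n (Suc i) - grid h n i < d"
proof -
  have "(\<lambda>n. h / real (Suc n)) \<longlonglongrightarrow> 0" using LIMSEQ_Suc[OF lim_const_over_n[of h]] by simp
  then have "\<forall>\<^sub>F n in sequentially. h / real (Suc n) < d" by (rule order_tendstoD) (rule assms)
  then show ?thesis
    by eventually_elim (simp add: grid_def right_diff_distrib[symmetric] diff_divide_distrib[symmetric])
qed

context delay_kernel begin

definition cell :: "nat \<Rightarrow> nat \<Rightarrow> real \<Rightarrow> real^'n^'n" where
  "cell n i s = \<zeta> s (grid h n (Suc i)) - \<zeta> s (grid h n i)"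

lemma cell_cont: assumes "i < Suc n" shows "continuous_on S (cell n i)"
proof -
  obtain V where V: "\<And>s s' \<alpha> \<beta>. 0 \<le> \<alpha> \<Longrightarrow> \<alpha> \<le> \<beta> \<Longrightarrow> \<beta> \<le> h \<Longrightarrow>
      norm ((\<zeta> s \<beta> - \<zeta> s \<alpha>) - (\<zeta> s' \<beta> - \<zeta> s' \<alpha>)) \<le> \<bar>s - s'\<bar> * (V \<beta> - V \<alpha>)"
    using majorant by blast
  let ?c = "V (grid h n (Suc i)) - V (grid h n i)"
  have le: "norm (cell n i s - cell n i s') \<le> \<bar>s - s'\<bar> * ?c" for s s'
    unfolding cell_def by (rule V) (use assms h in \<open>auto simp: grid_mem grid_mono\<close>)
  show ?thesis
    unfolding continuous_on_def
  proof
    fix s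
    have "((\<lambda>s'. \<bar>s' - s\<bar> * ?c) \<longlongrightarrow> \<bar>s - s\<bar> * ?c) (at s within S)" by (intro tendsto_intros)
    then have "((\<lambda>s'. \<bar>s' - s\<bar> * ?c) \<longlongrightarrow> 0) (at s within S)" by simp
    with le show "(cell n i \<longlongrightarrow> cell n i s) (at s within S)" by (rule tendsto_by_bound)
  qed
qed

lemma cell_per: "i < Suc n \<Longrightarrow> cell n i (s + T) = cell n i s"
  using rep grid_mem[OF h0, of i n] grid_mem[OF h0, of "Suc i" n] by (simp add: cell_def represents_kernel_def)

lemma cell_sum: "\<exists>C>0. \<forall>n s. (\<Sum>i<Suc n. norm (cell n i (s i))) \<le> C"
proof -
  obtain V where V: "\<And>s \<alpha> \<beta>. 0 \<le> \<alpha> \<Longrightarrow> \<alpha> \<le> \<beta> \<Longrightarrow> \<beta> \<le> h \<Longrightarrow> norm (\<zeta> s \<beta> - \<zeta> s \<alpha>) \<le> V \<beta> - V \<alpha>"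
    using majorant by blast
  have "(\<Sum>i<Suc n. norm (cell n i (s i))) \<le> \<bar>V h - V 0\<bar> + 1" for n s
  proof -
    have "(\<Sum>i<Suc n. norm (cell n i (s i))) \<le> (\<Sum>i<Suc n. V (grid h n (Suc i)) - V (grid h n i))"
      unfolding cell_def by (intro sum_mono V) (use h in \<open>auto simp: grid_mem grid_mono\<close>)
    also have "\<dots> = V h - V 0"
      using sum_lessThan_telescope[of "\<lambda>i. V (grid h n i)" "Suc n"] by (simp only: grid_simps)
    finally show ?thesis by linarith
  qed
  then show ?thesis by (intro exI[of _ "\<bar>V h - V 0\<bar> + 1"]) auto
qed

lemma grid_sums:
  assumes "has_stieltjes U J 0 h"
  shows "(\<lambda>n. \<Sum>i<Suc n. U (grid h n i) (grid h n (Suc i)) - U (grid h n i) (grid h n i)) \<longlonglongrightarrow> J"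
proof (rule has_stieltjes_sequence[OF assms])
  fix d :: real assume "d > 0"
  from grid_mesh[OF this, of h]
  show "\<forall>\<^sub>F n in sequentially. \<forall>i<Suc n. grid h n (Suc i) - grid h n i < d" by eventually_elim simp
qed (use h in \<open>auto simp: grid_simps grid_mono\<close>)

lemma L_diff: "norm (L s \<psi> - L s' \<psi>) \<le> M * norm \<psi> * \<bar>s - s'\<bar>"
proof -
  have "norm (L s \<psi> - L s' \<psi>) \<le> M * norm \<psi> * norm (s - s')"
  proof (rule differentiable_bound[OF convex_UNIV, of "\<lambda>s. L s \<psi>" "\<lambda>s h. h *\<^sub>R L1 s \<psi>"])
    fix x
    show "((\<lambda>s. L s \<psi>) has_derivative (\<lambda>h. h *\<^sub>R L1 x \<psi>)) (at x)"
      using L_deriv by (simp add: has_vector_derivative_def)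
    show "onorm (\<lambda>h. h *\<^sub>R L1 x \<psi>) \<le> M * norm \<psi>"
    proof (rule onorm_bound)
      fix y
      have "\<bar>y\<bar> * norm (L1 x \<psi>) \<le> \<bar>y\<bar> * (M * norm \<psi>)" by (intro mult_left_mono bound) auto
      then show "norm (y *\<^sub>R L1 x \<psi>) \<le> M * norm \<psi> * norm y" by (simp add: mult_ac)
    qed (use M0 in simp)
  qed auto
  then show ?thesis by simp
qed

lemma L_cont:
  assumes x: "continuous_on S x"
  shows "continuous_on S (\<lambda>t. L t (x t))"
  unfolding continuous_on_def
proof
  fix t assume t: "t \<in> S"
  have xt: "(x \<longlongrightarrow> x t) (at t within S)" using x t by (simp add: continuous_on_def)
  show "((\<lambda>s. L s (x s)) \<longlongrightarrow> L t (x t)) (at t within S)"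
  proof (rule tendsto_by_bound)
    fix s
    have "L s (x s) - L t (x t) = (L s (x s) - L t (x s)) + L t (x s - x t)" by (simp add: linear_diff[OF linear(1)])
    also have "norm \<dots> \<le> norm (L s (x s) - L t (x s)) + norm (L t (x s - x t))" by (rule norm_triangle_ineq)
    also have "\<dots> \<le> M * norm (x s) * \<bar>s - t\<bar> + M * norm (x s - x t)" by (intro add_mono L_diff bound)
    finally show "norm (L s (x s) - L t (x t)) \<le> M * norm (x s) * \<bar>s - t\<bar> + M * norm (x s - x t)" .
    have "((\<lambda>s. M * norm (x s) * \<bar>s - t\<bar> + M * norm (x s - x t)) \<longlongrightarrow> M * norm (x t) * \<bar>t - t\<bar> + M * norm (x t - x t)) (at t within S)"
      by (intro tendsto_intros xt)
    then show "((\<lambda>s. M * norm (x s) * \<bar>s - t\<bar> + M * norm (x s - x t)) \<longlongrightarrow> 0) (at t within S)" by simp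
  qed
qed

lemma kernel_grid_sums:
  assumes g: "continuous_on {0..h} g"
  shows "(\<lambda>n. \<Sum>i<Suc n. cell n i t *v g (grid h n i)) \<longlonglongrightarrow> L t (restrict_state h (\<lambda>\<theta>. g (- \<theta>)))"
proof -
  have c: "continuous_on {-h..0} (\<lambda>\<theta>. g (- \<theta>))"
    by (rule continuous_on_compose2[OF g]) (auto intro!: continuous_intros)
  let ?\<phi> = "restrict_state h (\<lambda>\<theta>. g (- \<theta>))"
  have ap: "apply_bcontfun ?\<phi> (- grid h n i) = g (grid h n i)" if "i < Suc n" for n i
    using grid_mem[OF h0, of i n] that by (simp add: restrict_state_apply[OF h0 c])
  show ?thesis
    using grid_sums[OF kernel_integral[OF restrict_state_mem[OF h0 c]], of t]
    by (rule Lim_transform_eventually)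
      (auto intro!: always_eventually sum.cong simp: ap cell_def matrix_vector_mult_diff_rdistrib simp del: of_nat_Suc sum.lessThan_Suc)
qed

text \<open>Existence of the integrals with integrator \<open>d\<^sub>2 \<zeta>(\<tau> + x, x)\<close>. Along the diagonal this uses that the
  increments of \<open>\<zeta>\<close> are Lipschitz in the first variable relative to a single majorant.\<close>

lemma diagonal_integral_exists:
  fixes f :: "'a::real_normed_vector \<Rightarrow> real^'n^'n \<Rightarrow> 'b::banach"
  assumes f: "bounded_bilinear f" and p: "continuous_on UNIV p" and \<theta>: "0 \<le> \<theta>" "\<theta> \<le> h"
  shows "\<exists>J. has_stieltjes (\<lambda>x s. f (p (\<tau> + x - \<theta>)) (\<zeta> (\<tau> + x - \<theta>) s)) J \<theta> h"
proof -
  interpret f: bounded_bilinear f by (rule f)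
  obtain V where V1: "\<And>s s' \<alpha> \<beta>. 0 \<le> \<alpha> \<Longrightarrow> \<alpha> \<le> \<beta> \<Longrightarrow> \<beta> \<le> h \<Longrightarrow>
      norm ((\<zeta> s \<beta> - \<zeta> s \<alpha>) - (\<zeta> s' \<beta> - \<zeta> s' \<alpha>)) \<le> \<bar>s - s'\<bar> * (V \<beta> - V \<alpha>)"
    and V2: "\<And>s \<alpha> \<beta>. 0 \<le> \<alpha> \<Longrightarrow> \<alpha> \<le> \<beta> \<Longrightarrow> \<beta> \<le> h \<Longrightarrow> norm (\<zeta> s \<beta> - \<zeta> s \<alpha>) \<le> V \<beta> - V \<alpha>"
    using majorant by blast
  have Vmono: "V \<alpha> \<le> V \<beta>" if "0 \<le> \<alpha>" "\<alpha> \<le> \<beta>" "\<beta> \<le> h" for \<alpha> \<beta>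
    using V2[OF that, of 0] norm_ge_zero[of "\<zeta> 0 \<beta> - \<zeta> 0 \<alpha>"] by linarith
  obtain K where K: "K > 0" "\<And>a b. norm (f a b) \<le> norm a * norm b * K" using f.pos_bounded by blast
  let ?I = "{\<tau>..\<tau> + h}"
  have cI: "continuous_on ?I p" using p continuous_on_subset by blast
  then obtain Q where Q: "Q > 0" "\<And>x. x \<in> ?I \<Longrightarrow> norm (p x) \<le> Q"
    using compact_imp_bounded[OF compact_continuous_image[OF cI compact_Icc]] bounded_pos by (metis imageI)
  have uc: "uniformly_continuous_on ?I p" using cI by (intro compact_uniformly_continuous) auto
  show ?thesis
  proof (rule has_stieltjes_exists[where V = V])
    fix e :: real assume e: "e > 0"
    then have e2: "e / (2 * K) > 0" using K by simp
    then obtain d where d: "d > 0" "\<And>x x'. x \<in> ?I \<Longrightarrow> x' \<in> ?I \<Longrightarrow> dist x' x < d \<Longrightarrow> dist (p x') (p x) < e / (2 * K)"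
      using uc unfolding uniformly_continuous_on_def by metis
    define d' where "d' = min d (e / (2 * K * Q))"
    have d': "d' > 0" "d' \<le> d" "d' \<le> e / (2 * K * Q)" using d e K Q by (auto simp: d'_def)
    have "norm ((f (p (\<tau> + x - \<theta>)) (\<zeta> (\<tau> + x - \<theta>) \<beta>) - f (p (\<tau> + x - \<theta>)) (\<zeta> (\<tau> + x - \<theta>) \<alpha>))
       - (f (p (\<tau> + x' - \<theta>)) (\<zeta> (\<tau> + x' - \<theta>) \<beta>) - f (p (\<tau> + x' - \<theta>)) (\<zeta> (\<tau> + x' - \<theta>) \<alpha>))) \<le> e * (V \<beta> - V \<alpha>)"
      if x: "x \<in> {\<theta>..h}" "x' \<in> {\<theta>..h}" "\<bar>x - x'\<bar> < d'" and le: "\<theta> \<le> \<alpha>" "\<alpha> \<le> \<beta>" "\<beta> \<le> h" for x x' \<alpha> \<beta>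
    proof -
      let ?y = "\<tau> + x - \<theta>" and ?y' = "\<tau> + x' - \<theta>"
      have y: "?y \<in> ?I" "?y' \<in> ?I" "\<bar>?y - ?y'\<bar> < d'" using x \<theta> by auto
      have a0: "0 \<le> \<alpha>" using le \<theta> by simp
      have VV: "0 \<le> V \<beta> - V \<alpha>" using Vmono[OF a0 le(2,3)] by simp
      have "(f (p ?y) (\<zeta> ?y \<beta>) - f (p ?y) (\<zeta> ?y \<alpha>)) - (f (p ?y') (\<zeta> ?y' \<beta>) - f (p ?y') (\<zeta> ?y' \<alpha>))
         = f (p ?y - p ?y') (\<zeta> ?y \<beta> - \<zeta> ?y \<alpha>) + f (p ?y') ((\<zeta> ?y \<beta> - \<zeta> ?y \<alpha>) - (\<zeta> ?y' \<beta> - \<zeta> ?y' \<alpha>))"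
        by (simp add: f.diff_left f.diff_right)
      also have "norm \<dots> \<le> norm (p ?y - p ?y') * norm (\<zeta> ?y \<beta> - \<zeta> ?y \<alpha>) * K
          + norm (p ?y') * norm ((\<zeta> ?y \<beta> - \<zeta> ?y \<alpha>) - (\<zeta> ?y' \<beta> - \<zeta> ?y' \<alpha>)) * K"
        by (intro order_trans[OF norm_triangle_ineq] add_mono K)
      also have "\<dots> \<le> e / (2 * K) * (V \<beta> - V \<alpha>) * K + Q * (e / (2 * K * Q) * (V \<beta> - V \<alpha>)) * K"
      proof (intro add_mono mult_right_mono mult_mono)
        show "norm (p ?y - p ?y') \<le> e / (2 * K)"
          using d(2)[OF y(2,1)] y(3) d'(2) by (simp add: dist_norm dist_real_def)
        show "norm (\<zeta> ?y \<beta> - \<zeta> ?y \<alpha>) \<le> V \<beta> - V \<alpha>" by (rule V2) (use a0 le in auto)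
        show "norm (p ?y') \<le> Q" using Q y by blast
        have "norm ((\<zeta> ?y \<beta> - \<zeta> ?y \<alpha>) - (\<zeta> ?y' \<beta> - \<zeta> ?y' \<alpha>)) \<le> \<bar>?y - ?y'\<bar> * (V \<beta> - V \<alpha>)"
          by (rule V1) (use a0 le in auto)
        also have "\<dots> \<le> e / (2 * K * Q) * (V \<beta> - V \<alpha>)" using y(3) d'(3) VV by (intro mult_right_mono) auto
        finally show "norm ((\<zeta> ?y \<beta> - \<zeta> ?y \<alpha>) - (\<zeta> ?y' \<beta> - \<zeta> ?y' \<alpha>)) \<le> e / (2 * K * Q) * (V \<beta> - V \<alpha>)" .
      qed (use e K Q VV in auto)
      also have "\<dots> = e * (V \<beta> - V \<alpha>)" using K Q by (simp add: field_simps)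
      finally show ?thesis .
    qed
    then show "\<exists>d>0. \<forall>x\<in>{\<theta>..h}. \<forall>x'\<in>{\<theta>..h}. \<bar>x - x'\<bar> < d \<longrightarrow>
      (\<forall>\<alpha> \<beta>. \<theta> \<le> \<alpha> \<and> \<alpha> \<le> \<beta> \<and> \<beta> \<le> h \<longrightarrow>
      norm ((f (p (\<tau> + x - \<theta>)) (\<zeta> (\<tau> + x - \<theta>) \<beta>) - f (p (\<tau> + x - \<theta>)) (\<zeta> (\<tau> + x - \<theta>) \<alpha>))
       - (f (p (\<tau> + x' - \<theta>)) (\<zeta> (\<tau> + x' - \<theta>) \<beta>) - f (p (\<tau> + x' - \<theta>)) (\<zeta> (\<tau> + x' - \<theta>) \<alpha>))) \<le> e * (V \<beta> - V \<alpha>))"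
      using d'(1) by blast
  qed (use Vmono \<theta> in auto)
qed

text \<open>The factor \<open>\<sigma> = 1\<close> is the periodic and \<open>\<sigma> = -1\<close> the antiperiodic case. For Riemann sums the
  claim is the invariance of the integral over a period under translation.\<close>

lemma transposed_delay_term:
  fixes p :: "real \<Rightarrow> complex^'n" and v :: "real \<Rightarrow> real^'n" and \<sigma> :: real
  assumes p: "continuous_on UNIV p" "\<And>t. p (t + T) = \<sigma> *\<^sub>R p t"
    and v: "continuous_on UNIV v" "\<And>t. v (t + T) = \<sigma> *\<^sub>R v t"
    and \<sigma>: "\<sigma> * \<sigma> = 1"
    and J: "\<And>t. has_stieltjes (\<lambda>x s. p (t + x) v* cmat (\<zeta> (t + x) s)) (J t) 0 h"
  shows "integral {0..T} (\<lambda>t. cdot (p t) (L t (hist h v t))) = integral {0..T} (\<lambda>t. cdot (J t) (v t))"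
    and "(\<lambda>t. cdot (J t) (v t)) integrable_on {0..T}"
proof -
  interpret cd: bounded_bilinear "cdot :: complex^'n \<Rightarrow> _" by (rule bounded_bilinear_cdot)
  interpret mv: bounded_bilinear "\<lambda>(A::real^'n^'n) w. A *v w" by (rule bounded_bilinear_matrix_vector)
  have "\<bar>\<sigma>\<bar> = 1" using \<sigma> by (metis abs_mult abs_one abs_mult_self_eq mult.right_neutral real_sqrt_abs2 real_sqrt_one)
  then have np: "norm (p (t + T)) = norm (p t)" "norm (v (t + T)) = norm (v t)" for t using p v by auto
  obtain Cp where Cp: "Cp > 0" "\<And>t. norm (p t) \<le> Cp" using periodic_bounded[OF p(1) np(1) T] by blast
  obtain Cv where Cv: "Cv > 0" "\<And>t. norm (v t) \<le> Cv" using periodic_bounded[OF v(1) np(2) T] by blast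
  obtain Cc where Cc: "Cc > 0" "\<And>n s. (\<Sum>i<Suc n. norm (cell n i (s i))) \<le> Cc" using cell_sum by blast
  obtain K1 where K1: "K1 > 0" "\<And>a b. norm (cdot a b :: complex) \<le> norm a * norm (b :: real^'n) * K1" using cd.pos_bounded by blast
  obtain K2 where K2: "K2 > 0" "\<And>(a::real^'n^'n) b. norm (a *v b) \<le> norm a * norm b * K2" using mv.pos_bounded by blast
  define G where "G n i t = cdot (p t) (cell n i t *v v (t - grid h n i))" for n i t
  have G_bound: "norm (G n i t) \<le> Cp * (norm (cell n i t) * Cv * K2) * K1" for n i t
  proof -
    have "norm (G n i t) \<le> norm (p t) * norm (cell n i t *v v (t - grid h n i)) * K1" unfolding G_def by (rule K1)
    also have "\<dots> \<le> Cp * (norm (cell n i t) * Cv * K2) * K1"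
    proof (intro mult_right_mono mult_mono Cp)
      have "norm (cell n i t *v v (t - grid h n i)) \<le> norm (cell n i t) * norm (v (t - grid h n i)) * K2" by (rule K2)
      also have "\<dots> \<le> norm (cell n i t) * Cv * K2" by (intro mult_right_mono mult_left_mono Cv) (use K2 in auto)
      finally show "norm (cell n i t *v v (t - grid h n i)) \<le> norm (cell n i t) * Cv * K2" .
    qed (use K1 Cp in auto)
    finally show ?thesis .
  qed
  define B where "B = Cp * (Cc * Cv * K2) * K1"
  have sum_bound: "norm (\<Sum>i<Suc n. G n i (s i)) \<le> B" for n s
  proof -
    have "norm (\<Sum>i<Suc n. G n i (s i)) \<le> (\<Sum>i<Suc n. Cp * (norm (cell n i (s i)) * Cv * K2) * K1)"
      by (intro sum_norm_le G_bound)
    also have "\<dots> = Cp * ((\<Sum>i<Suc n. norm (cell n i (s i))) * Cv * K2) * K1"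
      by (simp only: sum_distrib_left sum_distrib_right)
    also have "\<dots> \<le> B" unfolding B_def
      by (intro mult_right_mono mult_left_mono Cc) (use Cp Cv K1 K2 in auto)
    finally show ?thesis .
  qed
  have G_cont: "continuous_on S (G n i)" if "i < Suc n" for n i S
    unfolding G_def
    by (intro cd.continuous_on mv.continuous_on cell_cont[OF that] continuous_on_compose2[OF v(1)] continuous_on_subset[OF p(1)] continuous_intros) auto
  have G_per: "G n i (t + T) = G n i t" if "i < Suc n" for n i t
  proof -
    have "v (t + T - grid h n i) = \<sigma> *\<^sub>R v (t - grid h n i)" using v(2)[of "t - grid h n i"] by (simp add: algebra_simps)
    then show ?thesis using p(2)[of t] cell_per[OF that, of t] \<sigma>
      by (simp add: G_def cd.scaleR_left cd.scaleR_right mv.scaleR_right)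
  qed
  have lim1: "(\<lambda>n. \<Sum>i<Suc n. G n i t) \<longlonglongrightarrow> cdot (p t) (L t (hist h v t))" for t
  proof -
    have "continuous_on {0..h} (\<lambda>x. v (t - x))" by (rule continuous_on_compose2[OF v(1)]) (auto intro!: continuous_intros)
    from cd.tendsto[OF tendsto_const[of "p t"] kernel_grid_sums[OF this, of t]]
    show ?thesis by (simp add: G_def hist_def cd.sum_right del: sum.lessThan_Suc)
  qed
  have lim2: "(\<lambda>n. \<Sum>i<Suc n. G n i (t + grid h n i)) \<longlonglongrightarrow> cdot (J t) (v t)" for t
  proof -
    from cd.tendsto[OF grid_sums[OF J[of t]] tendsto_const[of "v t"]]
    show ?thesis
      by (simp add: G_def cd.sum_left cd.diff_left cell_def cdot_row_mult mv.diff_left cd.diff_right del: sum.lessThan_Suc)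
  qed
  have int1: "(\<lambda>t. \<Sum>i<Suc n. G n i t) integrable_on {0..T}" "(\<lambda>t. \<Sum>i<Suc n. G n i (t + grid h n i)) integrable_on {0..T}" for n
    by (intro integrable_continuous_interval continuous_on_sum G_cont continuous_on_compose2[OF G_cont[where S = UNIV]] continuous_intros; auto)+
  have D1: "(\<lambda>n. integral {0..T} (\<lambda>t. \<Sum>i<Suc n. G n i t)) \<longlonglongrightarrow> integral {0..T} (\<lambda>t. cdot (p t) (L t (hist h v t)))"
    by (rule dominated_convergence(2)[where h = "\<lambda>_. B"]) (use int1 sum_bound lim1 in auto)
  have D2: "(\<lambda>n. integral {0..T} (\<lambda>t. \<Sum>i<Suc n. G n i (t + grid h n i))) \<longlonglongrightarrow> integral {0..T} (\<lambda>t. cdot (J t) (v t))"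
    by (rule dominated_convergence(2)[where h = "\<lambda>_. B"]) (use int1 sum_bound lim2 in auto)
  show "(\<lambda>t. cdot (J t) (v t)) integrable_on {0..T}"
    by (rule dominated_convergence(1)[where h = "\<lambda>_. B" and f = "\<lambda>n t. \<Sum>i<Suc n. G n i (t + grid h n i)"]) (use int1 sum_bound lim2 in auto)
  have "integral {0..T} (\<lambda>t. \<Sum>i<Suc n. G n i (t + grid h n i)) = integral {0..T} (\<lambda>t. \<Sum>i<Suc n. G n i t)" for n
  proof -
    have "integral {0..T} (\<lambda>t. \<Sum>i<Suc n. G n i (t + grid h n i)) = (\<Sum>i<Suc n. integral {0..T} (\<lambda>t. G n i (t + grid h n i)))"
      by (intro integral_sum integrable_continuous_interval continuous_on_compose2[OF G_cont[where S = UNIV]] continuous_intros) auto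
    also have "\<dots> = (\<Sum>i<Suc n. integral {0..T} (G n i))"
      by (intro sum.cong refl integral_periodic_shift G_cont G_per T) (use h grid_mem in auto)
    also have "\<dots> = integral {0..T} (\<lambda>t. \<Sum>i<Suc n. G n i t)"
      by (intro integral_sum[symmetric] integrable_continuous_interval G_cont) auto
    finally show ?thesis .
  qed
  then show "integral {0..T} (\<lambda>t. cdot (p t) (L t (hist h v t))) = integral {0..T} (\<lambda>t. cdot (J t) (v t))"
    using LIMSEQ_unique[OF D1] D2 by simp
qed

end

section \<open>The pairing with the adjoint state\<close>

text \<open>The second component \<open>adj \<tau>\<close> of the adjoint state for a continuous periodic function \<open>r\<close>.\<close>

locale adjoint_pairing = delay_kernel h T M \<zeta> L L1 L2
  for h T M :: real and \<zeta> :: "real \<Rightarrow> real \<Rightarrow> real^'n^'n" and L L1 L2 +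
  fixes r :: "real \<Rightarrow> real^'n"
  assumes r_cont: "continuous_on UNIV r" and r_per: "r (t + T) = r t"
begin

definition adj :: "real \<Rightarrow> real \<Rightarrow> real^'n" where
  "adj \<tau> = snd (adjoint_state h \<zeta> r \<tau>)"

text \<open>Riemann sums for the adjoint state over the cells of the grid to the right of \<open>\<theta>\<close>. The part of
  the cell that contains \<open>\<theta>\<close> is left out: it is negligible by right-continuity of the kernel, and
  without it the dependence on \<open>\<theta>\<close> is piecewise continuous.\<close>

definition adj_sum :: "nat \<Rightarrow> real \<Rightarrow> real \<Rightarrow> real^'n" where
  "adj_sum n \<tau> \<theta> = (\<Sum>i<Suc n. if \<theta> \<in> {0..grid h n i}
      then r (\<tau> + grid h n i - \<theta>) v* cell n i (\<tau> + grid h n i - \<theta>) else 0)"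

lemma adj_sum_limit:
  assumes \<theta>: "0 < \<theta>" "\<theta> < h"
  shows "(\<lambda>n. adj_sum n \<tau> \<theta>) \<longlonglongrightarrow> adj \<tau> \<theta>"
proof -
  interpret rm: bounded_bilinear "\<lambda>(r::real^'n) (A::real^'n^'n). r v* A" by (rule bounded_bilinear_row_mult)
  let ?U = "\<lambda>x s. r (\<tau> + x - \<theta>) v* \<zeta> (\<tau> + x - \<theta>) s"
  let ?g = "grid h"
  obtain J where J: "has_stieltjes ?U J \<theta> h"
    using diagonal_integral_exists[OF bounded_bilinear_row_mult r_cont, of \<theta> \<tau>] \<theta> by auto
  have adj: "adj \<tau> \<theta> = J" using stieltjes_eq[OF J] by (simp add: adj_def adjoint_state_def)
  define R where "R n = (\<Sum>i<Suc n. if ?g n i < \<theta> \<and> \<theta> < ?g n (Suc i) then r \<tau> v* (\<zeta> \<tau> (?g n (Suc i)) - \<zeta> \<tau> \<theta>) else 0)" for n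
  have strict: "?g n i < ?g n (Suc i)" for n i
    unfolding grid_def by (intro mult_strict_left_mono divide_strict_right_mono) (use h in auto)
  have S: "(\<lambda>n. \<Sum>i<Suc n. ?U (max \<theta> (?g n i)) (max \<theta> (?g n (Suc i))) - ?U (max \<theta> (?g n i)) (max \<theta> (?g n i))) \<longlonglongrightarrow> J"
  proof (rule has_stieltjes_sequence[OF J])
    fix d :: real assume "d > 0"
    from grid_mesh[OF this, of h]
    show "\<forall>\<^sub>F n in sequentially. \<forall>i<Suc n. max \<theta> (?g n (Suc i)) - max \<theta> (?g n i) < d"
    proof eventually_elim
      case (elim n)
      have "max \<theta> (?g n (Suc i)) - max \<theta> (?g n i) \<le> ?g n (Suc i) - ?g n i" for i
        using strict[of n i] by (auto simp: max_def)
      then show ?case using elim le_less_trans by blast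
    qed
  next
    fix n i
    show "max \<theta> (?g n i) \<le> max \<theta> (?g n (Suc i))" using strict[of n i] by simp
  qed (use \<theta> in \<open>auto simp: grid_simps\<close>)
  have eq: "(\<Sum>i<Suc n. ?U (max \<theta> (?g n i)) (max \<theta> (?g n (Suc i))) - ?U (max \<theta> (?g n i)) (max \<theta> (?g n i))) = adj_sum n \<tau> \<theta> + R n" for n
    unfolding adj_sum_def R_def sum.distrib[symmetric]
  proof (rule sum.cong[OF refl])
    fix i
    consider "\<theta> \<le> ?g n i" | "?g n (Suc i) \<le> \<theta>" "?g n i < \<theta>" | "?g n i < \<theta>" "\<theta> < ?g n (Suc i)"
      using strict[of n i] by linarith
    then show "?U (max \<theta> (?g n i)) (max \<theta> (?g n (Suc i))) - ?U (max \<theta> (?g n i)) (max \<theta> (?g n i))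
      = (if \<theta> \<in> {0..?g n i} then r (\<tau> + ?g n i - \<theta>) v* cell n i (\<tau> + ?g n i - \<theta>) else 0)
       + (if ?g n i < \<theta> \<and> \<theta> < ?g n (Suc i) then r \<tau> v* (\<zeta> \<tau> (?g n (Suc i)) - \<zeta> \<tau> \<theta>) else 0)"
    proof cases
      case 1
      then have "max \<theta> (?g n i) = ?g n i" "max \<theta> (?g n (Suc i)) = ?g n (Suc i)" using strict[of n i] by auto
      then show ?thesis using 1 \<theta> by (simp add: cell_def rm.diff_right)
    next
      case 2
      then have "max \<theta> (?g n i) = \<theta>" "max \<theta> (?g n (Suc i)) = \<theta>" by auto
      then show ?thesis using 2 by simp
    next
      case 3
      then have "max \<theta> (?g n i) = \<theta>" "max \<theta> (?g n (Suc i)) = ?g n (Suc i)" by auto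
      then show ?thesis using 3 by (simp add: rm.diff_right)
    qed
  qed
  have R0: "R \<longlonglongrightarrow> 0"
  proof (rule tendstoI)
    fix e :: real assume e: "e > 0"
    have z: "(\<zeta> \<tau> \<longlongrightarrow> \<zeta> \<tau> \<theta>) (at_right \<theta>)" using kernel_right[of \<theta> \<tau>] \<theta> by (simp add: continuous_within)
    have "((\<lambda>s. r \<tau> v* (\<zeta> \<tau> s - \<zeta> \<tau> \<theta>)) \<longlongrightarrow> r \<tau> v* (\<zeta> \<tau> \<theta> - \<zeta> \<tau> \<theta>)) (at_right \<theta>)"
      by (intro rm.tendsto tendsto_const tendsto_diff z)
    then have "((\<lambda>s. r \<tau> v* (\<zeta> \<tau> s - \<zeta> \<tau> \<theta>)) \<longlongrightarrow> 0) (at_right \<theta>)" by (simp add: rm.zero_right)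
    then have "\<forall>\<^sub>F s in at_right \<theta>. dist (r \<tau> v* (\<zeta> \<tau> s - \<zeta> \<tau> \<theta>)) 0 < e / 2"
      by (rule tendstoD) (use e in simp)
    then obtain b where b: "b > \<theta>" "\<And>s. s > \<theta> \<Longrightarrow> s < b \<Longrightarrow> norm (r \<tau> v* (\<zeta> \<tau> s - \<zeta> \<tau> \<theta>)) < e / 2"
      by (auto simp: eventually_at_right[OF \<theta>(2)])
    have "b - \<theta> > 0" using b by simp
    from grid_mesh[OF this, of h]
    show "\<forall>\<^sub>F n in sequentially. dist (R n) 0 < e"
    proof eventually_elim
      case (elim n)
      let ?S = "{i \<in> {..<Suc n}. ?g n i < \<theta> \<and> \<theta> < ?g n (Suc i)}"
      have fin: "finite ?S" by simp
      have "card ?S \<le> Suc 0"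
        unfolding card_le_Suc0_iff_eq[OF fin]
      proof (intro ballI, rule ccontr)
        fix i j assume ij: "i \<in> ?S" "j \<in> ?S" "i \<noteq> j"
        then consider "Suc i \<le> j" | "Suc j \<le> i" by linarith
        then show False using ij grid_mono[OF h0, of "Suc i" j n] grid_mono[OF h0, of "Suc j" i n] by cases auto
      qed
      have "R n = (\<Sum>i\<in>?S. r \<tau> v* (\<zeta> \<tau> (?g n (Suc i)) - \<zeta> \<tau> \<theta>))"
        unfolding R_def by (simp only: sum.inter_filter[OF finite_lessThan])
      also have "norm \<dots> \<le> real (card ?S) * (e / 2)"
      proof (rule sum_norm_bound)
        fix i assume i: "i \<in> ?S"
        then have "?g n (Suc i) < b" using elim[rule_format, of i] by auto
        then show "norm (r \<tau> v* (\<zeta> \<tau> (?g n (Suc i)) - \<zeta> \<tau> \<theta>)) \<le> e / 2" using b(2)[of "?g n (Suc i)"] i by auto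
      qed
      also have "\<dots> \<le> 1 * (e / 2)" using \<open>card ?S \<le> Suc 0\<close> e by (intro mult_right_mono) auto
      finally show ?case using e by simp
    qed
  qed
  have "(\<lambda>n. (adj_sum n \<tau> \<theta> + R n) - R n) \<longlonglongrightarrow> J - 0"
    using S unfolding eq by (rule tendsto_diff) (rule R0)
  then show ?thesis by (simp add: adj)
qed

lemma adj_sum_bounded: "\<exists>C>0. \<forall>n \<tau> \<theta>. norm (adj_sum n \<tau> \<theta>) \<le> C"
proof -
  interpret rm: bounded_bilinear "\<lambda>(r::real^'n) (A::real^'n^'n). r v* A" by (rule bounded_bilinear_row_mult)
  obtain K where K: "K > 0" "\<And>(a::real^'n) (b::real^'n^'n). norm (a v* b) \<le> norm a * norm b * K" using rm.pos_bounded by blast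
  obtain Cr where Cr: "Cr > 0" "\<And>t. norm (r t) \<le> Cr" using periodic_bounded[OF r_cont _ T] r_per by metis
  obtain Cc where Cc: "Cc > 0" "\<And>n s. (\<Sum>i<Suc n. norm (cell n i (s i))) \<le> Cc" using cell_sum by blast
  have "norm (adj_sum n \<tau> \<theta>) \<le> Cr * K * Cc" for n \<tau> \<theta>
  proof -
    have "norm (adj_sum n \<tau> \<theta>) \<le> (\<Sum>i<Suc n. Cr * K * norm (cell n i (\<tau> + grid h n i - \<theta>)))"
      unfolding adj_sum_def
    proof (rule sum_norm_le)
      fix i
      have "norm (r (\<tau> + grid h n i - \<theta>) v* cell n i (\<tau> + grid h n i - \<theta>)) \<le> norm (r (\<tau> + grid h n i - \<theta>)) * norm (cell n i (\<tau> + grid h n i - \<theta>)) * K"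
        by (rule K)
      also have "\<dots> \<le> Cr * norm (cell n i (\<tau> + grid h n i - \<theta>)) * K"
        by (intro mult_right_mono Cr) (use K in auto)
      finally show "norm (if \<theta> \<in> {0..grid h n i} then r (\<tau> + grid h n i - \<theta>) v* cell n i (\<tau> + grid h n i - \<theta>) else 0)
        \<le> Cr * K * norm (cell n i (\<tau> + grid h n i - \<theta>))" using Cr K by (auto simp: mult_ac)
    qed
    also have "\<dots> = Cr * K * (\<Sum>i<Suc n. norm (cell n i (\<tau> + grid h n i - \<theta>)))"
      by (simp only: sum_distrib_left)
    also have "\<dots> \<le> Cr * K * Cc"
      using Cc(2)[where s = "\<lambda>i. \<tau> + grid h n i - \<theta>" and n = n] Cr K by (intro mult_left_mono) auto
    finally show ?thesis .
  qed
  moreover have "Cr * K * Cc > 0" using Cr K Cc by simp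
  ultimately show ?thesis by blast
qed

context
  fixes f :: "real \<Rightarrow> real^'n" and e :: "real \<Rightarrow> real"
  assumes f: "continuous_on UNIV f" "\<And>t. f (t + T) = f t" and e: "continuous_on UNIV e"
begin

text \<open>The contribution of one grid cell to the Riemann sum of \<open>adj \<tau> \<theta> \<bullet> f (\<tau> - \<theta>)\<close>, as a function of the
  time \<open>u = \<tau> + grid h n i - \<theta>\<close>.\<close>

definition adj_cell :: "nat \<Rightarrow> nat \<Rightarrow> real \<Rightarrow> real" where
  "adj_cell n i u = (r u v* cell n i u) \<bullet> f (u - grid h n i)"

lemma adj_cell_cont: "i < Suc n \<Longrightarrow> continuous_on S (adj_cell n i)"
  unfolding adj_cell_def
  by (intro continuous_intros bounded_bilinear.continuous_on[OF bounded_bilinear_row_mult] cell_cont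
      continuous_on_subset[OF r_cont] continuous_on_compose2[OF f(1)]) auto

lemma adj_cell_per: "i < Suc n \<Longrightarrow> adj_cell n i (u + T) = adj_cell n i u"
  using f(2)[of "u - grid h n i"] r_per[of u] cell_per[of i n u] by (simp add: adj_cell_def algebra_simps)

lemma inner_sum_integral:
  "((\<lambda>\<theta>. adj_sum n \<tau> \<theta> \<bullet> (e \<theta> *\<^sub>R f (\<tau> - \<theta>))) has_integral
     (\<Sum>i<Suc n. integral {0..grid h n i} (\<lambda>\<theta>. e \<theta> * adj_cell n i (\<tau> + grid h n i - \<theta>)))) {0<..<h}"
proof -
  have "((\<lambda>\<theta>. \<Sum>i<Suc n. if \<theta> \<in> {0..grid h n i} then e \<theta> * adj_cell n i (\<tau> + grid h n i - \<theta>) else 0) has_integral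
     (\<Sum>i<Suc n. integral {0..grid h n i} (\<lambda>\<theta>. e \<theta> * adj_cell n i (\<tau> + grid h n i - \<theta>)))) {0..h}"
  proof (intro has_integral_sum finite_lessThan)
    fix i assume i: "i \<in> {..<Suc n}"
    have sub: "{0..grid h n i} \<subseteq> {0..h}" using i grid_mem[OF h0, of i n] by auto
    have "(\<lambda>\<theta>. e \<theta> * adj_cell n i (\<tau> + grid h n i - \<theta>)) integrable_on {0..grid h n i}"
      using i by (intro integrable_continuous_interval continuous_intros continuous_on_subset[OF e] continuous_on_compose2[OF adj_cell_cont[of i n UNIV]]) auto
    then show "((\<lambda>\<theta>. if \<theta> \<in> {0..grid h n i} then e \<theta> * adj_cell n i (\<tau> + grid h n i - \<theta>) else 0) has_integral
      integral {0..grid h n i} (\<lambda>\<theta>. e \<theta> * adj_cell n i (\<tau> + grid h n i - \<theta>))) {0..h}"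
      unfolding has_integral_restrict[OF sub] by (rule integrable_integral)
  qed
  moreover have "(\<lambda>\<theta>. adj_sum n \<tau> \<theta> \<bullet> (e \<theta> *\<^sub>R f (\<tau> - \<theta>)))
     = (\<lambda>\<theta>. \<Sum>i<Suc n. if \<theta> \<in> {0..grid h n i} then e \<theta> * adj_cell n i (\<tau> + grid h n i - \<theta>) else 0)"
    unfolding adj_sum_def inner_sum_left by (intro ext sum.cong refl) (simp add: adj_cell_def)
  ultimately show ?thesis by (simp only: has_integral_Icc_iff_Ioo)
qed

lemma adj_sum_integrand_bounded:
  "\<exists>B>0. \<forall>n \<tau> \<theta>. \<theta> \<in> {0<..<h} \<longrightarrow> norm (adj_sum n \<tau> \<theta> \<bullet> (e \<theta> *\<^sub>R f (\<tau> - \<theta>))) \<le> B"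
proof -
  obtain C where C: "C > 0" "\<And>n \<tau> \<theta>. norm (adj_sum n \<tau> \<theta>) \<le> C" using adj_sum_bounded by blast
  obtain Cf where Cf: "Cf > 0" "\<And>t. norm (f t) \<le> Cf" using periodic_bounded[OF f(1) _ T] f(2) by metis
  have "compact (e ` {0..h})" by (intro compact_continuous_image continuous_on_subset[OF e]) auto
  then obtain Ce where Ce: "Ce > 0" "\<And>\<theta>. \<theta> \<in> {0..h} \<Longrightarrow> norm (e \<theta>) \<le> Ce"
    using compact_imp_bounded bounded_pos by (metis imageI)
  have "norm (adj_sum n \<tau> \<theta> \<bullet> (e \<theta> *\<^sub>R f (\<tau> - \<theta>))) \<le> C * (Ce * Cf)" if "\<theta> \<in> {0<..<h}" for n \<tau> \<theta>
  proof -
    have "norm (adj_sum n \<tau> \<theta> \<bullet> (e \<theta> *\<^sub>R f (\<tau> - \<theta>))) \<le> norm (adj_sum n \<tau> \<theta>) * norm (e \<theta> *\<^sub>R f (\<tau> - \<theta>))"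
      by (simp only: real_norm_def Cauchy_Schwarz_ineq2)
    also have "\<dots> \<le> C * (Ce * Cf)"
      using C Cf Ce(1) Ce(2)[of \<theta>] that by (intro mult_mono) (auto intro!: mult_mono)
    finally show ?thesis .
  qed
  moreover have "C * (Ce * Cf) > 0" using C Cf Ce by simp
  ultimately show ?thesis by blast
qed

lemma adj_inner:
  shows "(\<lambda>\<theta>. adj \<tau> \<theta> \<bullet> (e \<theta> *\<^sub>R f (\<tau> - \<theta>))) integrable_on {0..h}"
    and "(\<lambda>n. \<Sum>i<Suc n. integral {0..grid h n i} (\<lambda>\<theta>. e \<theta> * adj_cell n i (\<tau> + grid h n i - \<theta>)))
       \<longlonglongrightarrow> integral {0..h} (\<lambda>\<theta>. adj \<tau> \<theta> \<bullet> (e \<theta> *\<^sub>R f (\<tau> - \<theta>)))"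
proof -
  obtain B where B: "B > 0" "\<And>n \<tau> \<theta>. \<theta> \<in> {0<..<h} \<Longrightarrow> norm (adj_sum n \<tau> \<theta> \<bullet> (e \<theta> *\<^sub>R f (\<tau> - \<theta>))) \<le> B"
    using adj_sum_integrand_bounded by blast
  have int: "(\<lambda>\<theta>. adj_sum n \<tau> \<theta> \<bullet> (e \<theta> *\<^sub>R f (\<tau> - \<theta>))) integrable_on {0<..<h}" for n
    using inner_sum_integral by blast
  have const: "(\<lambda>_. B) integrable_on {0<..<h}" unfolding integrable_on_open_interval_real by (rule integrable_continuous_interval) (rule continuous_on_const)
  have lim: "(\<lambda>n. adj_sum n \<tau> \<theta> \<bullet> (e \<theta> *\<^sub>R f (\<tau> - \<theta>))) \<longlonglongrightarrow> adj \<tau> \<theta> \<bullet> (e \<theta> *\<^sub>R f (\<tau> - \<theta>))" if "\<theta> \<in> {0<..<h}" for \<theta>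
    using that by (intro tendsto_intros adj_sum_limit) auto
  show "(\<lambda>\<theta>. adj \<tau> \<theta> \<bullet> (e \<theta> *\<^sub>R f (\<tau> - \<theta>))) integrable_on {0..h}"
    using dominated_convergence(1)[OF int const B(2) lim] by (simp only: integrable_on_open_interval_real)
  show "(\<lambda>n. \<Sum>i<Suc n. integral {0..grid h n i} (\<lambda>\<theta>. e \<theta> * adj_cell n i (\<tau> + grid h n i - \<theta>)))
       \<longlonglongrightarrow> integral {0..h} (\<lambda>\<theta>. adj \<tau> \<theta> \<bullet> (e \<theta> *\<^sub>R f (\<tau> - \<theta>)))"
    using dominated_convergence(2)[OF int const B(2) lim]
    unfolding integral_unique[OF inner_sum_integral] integral_open_interval_real .
qed

lemma adj_outer:
  shows "(\<lambda>\<tau>. integral {0..h} (\<lambda>\<theta>. adj \<tau> \<theta> \<bullet> (e \<theta> *\<^sub>R f (\<tau> - \<theta>)))) integrable_on {0..T}"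
    and "(\<lambda>n. integral {0..T} (\<lambda>\<tau>. \<Sum>i<Suc n. integral {0..grid h n i} (\<lambda>\<theta>. e \<theta> * adj_cell n i (\<tau> + grid h n i - \<theta>))))
       \<longlonglongrightarrow> integral {0..T} (\<lambda>\<tau>. integral {0..h} (\<lambda>\<theta>. adj \<tau> \<theta> \<bullet> (e \<theta> *\<^sub>R f (\<tau> - \<theta>))))"
proof -
  let ?I = "\<lambda>n \<tau>. \<Sum>i<Suc n. integral {0..grid h n i} (\<lambda>\<theta>. e \<theta> * adj_cell n i (\<tau> + grid h n i - \<theta>))"
  obtain B where B: "B > 0" "\<And>n \<tau> \<theta>. \<theta> \<in> {0<..<h} \<Longrightarrow> norm (adj_sum n \<tau> \<theta> \<bullet> (e \<theta> *\<^sub>R f (\<tau> - \<theta>))) \<le> B"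
    using adj_sum_integrand_bounded by blast
  have bnd: "norm (?I n \<tau>) \<le> B * h" for n \<tau>
  proof -
    have "norm (?I n \<tau>) \<le> integral {0<..<h} (\<lambda>_. B)"
      unfolding integral_unique[OF inner_sum_integral, symmetric]
    proof (rule integral_norm_bound_integral)
      show "(\<lambda>\<theta>. adj_sum n \<tau> \<theta> \<bullet> (e \<theta> *\<^sub>R f (\<tau> - \<theta>))) integrable_on {0<..<h}"
        using inner_sum_integral by blast
      show "(\<lambda>_. B) integrable_on {0<..<h}"
        unfolding integrable_on_open_interval_real by (rule integrable_continuous_interval) (rule continuous_on_const)
    qed (rule B(2))
    also have "\<dots> = B * h" using h by (simp add: integral_open_interval_real[symmetric])
    finally show ?thesis .
  qed
  have int: "?I n integrable_on {0..T}" for n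
  proof (intro integrable_continuous_interval continuous_on_sum)
    fix i assume i: "i \<in> {..<Suc n}"
    have "continuous_on ({0..T} \<times> cbox 0 (grid h n i)) (\<lambda>(\<tau>, \<theta>). e \<theta> * adj_cell n i (\<tau> + grid h n i - \<theta>))"
      unfolding case_prod_unfold using i
      by (intro continuous_intros continuous_on_compose2[OF e] continuous_on_compose2[OF adj_cell_cont[of i n UNIV]]) auto
    from integral_continuous_on_param[OF this]
    show "continuous_on {0..T} (\<lambda>\<tau>. integral {0..grid h n i} (\<lambda>\<theta>. e \<theta> * adj_cell n i (\<tau> + grid h n i - \<theta>)))" by simp
  qed
  show "(\<lambda>\<tau>. integral {0..h} (\<lambda>\<theta>. adj \<tau> \<theta> \<bullet> (e \<theta> *\<^sub>R f (\<tau> - \<theta>)))) integrable_on {0..T}"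
    by (rule dominated_convergence(1)[where f = ?I and h = "\<lambda>_. B * h"]) (use int bnd adj_inner(2) in auto)
  show "(\<lambda>n. integral {0..T} (?I n)) \<longlonglongrightarrow> integral {0..T} (\<lambda>\<tau>. integral {0..h} (\<lambda>\<theta>. adj \<tau> \<theta> \<bullet> (e \<theta> *\<^sub>R f (\<tau> - \<theta>))))"
    by (rule dominated_convergence(2)[where f = ?I and h = "\<lambda>_. B * h"]) (use int bnd adj_inner(2) in auto)
qed

end

text \<open>The two integrals are exchanged after the translation \<open>u = \<tau> + x - \<theta>\<close>, in which the range of \<open>\<theta>\<close>
  contributes the length \<open>x\<close> and hence the weight of the derivative of the characteristic operator.\<close>

lemma adj_pairing_value:
  assumes f: "continuous_on UNIV f" "\<And>t. f (t + T) = f t"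
  shows "integral {0..T} (\<lambda>\<tau>. integral {0..h} (\<lambda>\<theta>. adj \<tau> \<theta> \<bullet> f (\<tau> - \<theta>)))
     = integral {0..T} (\<lambda>\<tau>. r \<tau> \<bullet> L \<tau> (restrict_state h (\<lambda>\<theta>. (- \<theta>) *\<^sub>R f (\<tau> + \<theta>))))"
proof -
  let ?c = "adj_cell f"
  have one: "continuous_on UNIV (\<lambda>_::real. 1::real)" by (rule continuous_on_const)
  have swap: "integral {0..T} (\<lambda>\<tau>. integral {0..grid h n i} (\<lambda>\<theta>. ?c n i (\<tau> + grid h n i - \<theta>))) = grid h n i * integral {0..T} (?c n i)"
    if i: "i < Suc n" for n i
  proof -
    have c: "continuous_on S (?c n i)" for S by (rule adj_cell_cont[OF f one i])
    have "continuous_on (cbox (0, 0) (T, grid h n i)) (\<lambda>(\<tau>, \<theta>). ?c n i (\<tau> + grid h n i - \<theta>))"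
      unfolding case_prod_unfold by (intro continuous_on_compose2[OF c[of UNIV]] continuous_intros) auto
    from integral_swap_continuous[OF this]
    have "integral {0..T} (\<lambda>\<tau>. integral {0..grid h n i} (\<lambda>\<theta>. ?c n i (\<tau> + grid h n i - \<theta>)))
       = integral {0..grid h n i} (\<lambda>\<theta>. integral {0..T} (\<lambda>\<tau>. ?c n i (\<tau> + grid h n i - \<theta>)))" by simp
    also have "\<dots> = integral {0..grid h n i} (\<lambda>\<theta>. integral {0..T} (?c n i))"
    proof (rule integral_cong)
      fix \<theta> assume "\<theta> \<in> {0..grid h n i}"
      then show "integral {0..T} (\<lambda>\<tau>. ?c n i (\<tau> + grid h n i - \<theta>)) = integral {0..T} (?c n i)"
        using integral_periodic_shift[OF c adj_cell_per[OF f one i] T, of "grid h n i - \<theta>"] by (simp add: algebra_simps)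
    qed
    also have "\<dots> = grid h n i * integral {0..T} (?c n i)" using grid_mem[OF h0, of i n] i by simp
    finally show ?thesis .
  qed
  have c1: "continuous_on S (?c n i)" if "i < Suc n" for S n i by (rule adj_cell_cont[OF f one that])
  define G where "G n \<tau> = (\<Sum>i<Suc n. grid h n i * ?c n i \<tau>)" for n \<tau>
  have "integral {0..T} (\<lambda>\<tau>. \<Sum>i<Suc n. integral {0..grid h n i} (\<lambda>\<theta>. ?c n i (\<tau> + grid h n i - \<theta>))) = integral {0..T} (G n)" for n
  proof -
    have "integral {0..T} (\<lambda>\<tau>. \<Sum>i<Suc n. integral {0..grid h n i} (\<lambda>\<theta>. ?c n i (\<tau> + grid h n i - \<theta>)))
      = (\<Sum>i<Suc n. integral {0..T} (\<lambda>\<tau>. integral {0..grid h n i} (\<lambda>\<theta>. ?c n i (\<tau> + grid h n i - \<theta>))))"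
    proof (intro integral_sum integrable_continuous_interval finite_lessThan)
      fix i assume i: "i \<in> {..<Suc n}"
      have "continuous_on ({0..T} \<times> cbox 0 (grid h n i)) (\<lambda>(\<tau>, \<theta>). ?c n i (\<tau> + grid h n i - \<theta>))"
        unfolding case_prod_unfold using i
        by (intro continuous_on_compose2[OF c1[of i n UNIV]] continuous_intros) auto
      from integral_continuous_on_param[OF this]
      show "continuous_on {0..T} (\<lambda>\<tau>. integral {0..grid h n i} (\<lambda>\<theta>. ?c n i (\<tau> + grid h n i - \<theta>)))" by simp
    qed
    also have "\<dots> = (\<Sum>i<Suc n. integral {0..T} (\<lambda>\<tau>. grid h n i * ?c n i \<tau>))"
      by (intro sum.cong refl) (simp add: swap)
    also have "\<dots> = integral {0..T} (G n)"
      unfolding G_def by (intro integral_sum[symmetric] integrable_continuous_interval continuous_intros c1) auto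
    finally show ?thesis .
  qed
  then have lim1: "(\<lambda>n. integral {0..T} (G n)) \<longlonglongrightarrow> integral {0..T} (\<lambda>\<tau>. integral {0..h} (\<lambda>\<theta>. adj \<tau> \<theta> \<bullet> f (\<tau> - \<theta>)))"
    using adj_outer(2)[OF f one] by simp
  have lim: "(\<lambda>n. G n \<tau>) \<longlonglongrightarrow> r \<tau> \<bullet> L \<tau> (restrict_state h (\<lambda>\<theta>. (- \<theta>) *\<^sub>R f (\<tau> + \<theta>)))" for \<tau>
  proof -
    have "continuous_on {0..h} (\<lambda>x. x *\<^sub>R f (\<tau> - x))"
      by (intro continuous_intros continuous_on_compose2[OF f(1)]) auto
    from tendsto_inner[OF tendsto_const[of "r \<tau>"] kernel_grid_sums[OF this, of \<tau>]]
    show ?thesis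
      by (simp add: G_def adj_cell_def[OF f one] inner_sum_right dot_lmul_matrix matrix_vector_mult_scaleR del: sum.lessThan_Suc)
  qed
  have "(\<lambda>n. integral {0..T} (G n)) \<longlonglongrightarrow> integral {0..T} (\<lambda>\<tau>. r \<tau> \<bullet> L \<tau> (restrict_state h (\<lambda>\<theta>. (- \<theta>) *\<^sub>R f (\<tau> + \<theta>))))"
  proof -
    interpret rm: bounded_bilinear "\<lambda>(r::real^'n) (A::real^'n^'n). r v* A" by (rule bounded_bilinear_row_mult)
    obtain K where K: "K > 0" "\<And>(a::real^'n) (b::real^'n^'n). norm (a v* b) \<le> norm a * norm b * K" using rm.pos_bounded by blast
    obtain Cr where Cr: "Cr > 0" "\<And>t. norm (r t) \<le> Cr" using periodic_bounded[OF r_cont _ T] r_per by metis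
    obtain Cf where Cf: "Cf > 0" "\<And>t. norm (f t) \<le> Cf" using periodic_bounded[OF f(1) _ T] f(2) by metis
    obtain Cc where Cc: "Cc > 0" "\<And>n s. (\<Sum>i<Suc n. norm (cell n i (s i))) \<le> Cc" using cell_sum by blast
    have bnd: "norm (G n \<tau>) \<le> h * (Cr * K * Cf) * Cc" for n \<tau>
    proof -
      have "norm (G n \<tau>) \<le> (\<Sum>i<Suc n. h * (Cr * K * Cf) * norm (cell n i \<tau>))"
        unfolding G_def
      proof (rule sum_norm_le)
        fix i assume i: "i \<in> {..<Suc n}"
        have "norm (?c n i \<tau>) \<le> norm (r \<tau> v* cell n i \<tau>) * norm (f (\<tau> - grid h n i))"
          unfolding adj_cell_def[OF f one] using Cauchy_Schwarz_ineq2 by simp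
        also have "\<dots> \<le> (norm (r \<tau>) * norm (cell n i \<tau>) * K) * Cf" by (intro mult_mono K Cf) (use K in auto)
        also have "\<dots> \<le> (Cr * norm (cell n i \<tau>) * K) * Cf" by (intro mult_right_mono Cr) (use K Cf in auto)
        finally have "norm (?c n i \<tau>) \<le> Cr * K * Cf * norm (cell n i \<tau>)" by (simp add: mult_ac)
        then show "norm (grid h n i * ?c n i \<tau>) \<le> h * (Cr * K * Cf) * norm (cell n i \<tau>)"
          using grid_mem[OF h0, of i n] i unfolding norm_mult mult.assoc[of h] by (intro mult_mono) auto
      qed
      also have "\<dots> = h * (Cr * K * Cf) * (\<Sum>i<Suc n. norm (cell n i \<tau>))" by (simp only: sum_distrib_left)
      also have "\<dots> \<le> h * (Cr * K * Cf) * Cc"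
        using Cc(2)[where s = "\<lambda>_. \<tau>" and n = n] h Cr K Cf by (intro mult_left_mono) auto
      finally show ?thesis .
    qed
    show ?thesis
    proof (rule dominated_convergence(2)[where h = "\<lambda>_. h * (Cr * K * Cf) * Cc"])
      show "G n integrable_on {0..T}" for n
        unfolding G_def by (intro integrable_continuous_interval continuous_intros c1) auto
    qed (use bnd lim in auto)
  qed
  then show ?thesis using LIMSEQ_unique[OF lim1] by simp
qed

end

section \<open>Existence and uniqueness for the delay equation\<close>

lemma norm_hist_le:
  fixes x :: "real \<Rightarrow> 'e::real_normed_vector"
  assumes "0 \<le> h" "continuous_on {t - h..t} x" "\<And>s. s \<in> {t - h..t} \<Longrightarrow> norm (x s) \<le> C"
  shows "norm (hist h x t) \<le> C"
  by (rule norm_bound) (use assms in \<open>auto simp: hist_apply\<close>)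

lemma hist_add:
  fixes x y :: "real \<Rightarrow> 'e::real_normed_vector"
  assumes "0 \<le> h" "continuous_on {t - h..t} x" "continuous_on {t - h..t} y"
  shows "hist h (\<lambda>s. x s + y s) t = hist h x t + hist h y t"
  by (rule bcontfun_eqI) (simp add: hist_apply assms continuous_on_add)

lemma hist_diff:
  fixes x y :: "real \<Rightarrow> 'e::real_normed_vector"
  assumes "0 \<le> h" "continuous_on {t - h..t} x" "continuous_on {t - h..t} y"
  shows "hist h (\<lambda>s. x s - y s) t = hist h x t - hist h y t"
  by (rule bcontfun_eqI) (simp add: hist_apply assms continuous_on_diff)

lemma hist_scaleR:
  fixes x :: "real \<Rightarrow> 'e::real_normed_vector"
  assumes "0 \<le> h" "continuous_on {t - h..t} x"
  shows "hist h (\<lambda>s. c *\<^sub>R x s) t = c *\<^sub>R hist h x t"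
  by (rule bcontfun_eqI) (simp add: hist_apply assms continuous_on_scaleR)

text \<open>Gronwall's argument in the form of an exponentially weighted maximum.\<close>

lemma delay_gronwall:
  fixes z :: "real \<Rightarrow> 'e::real_normed_vector"
  assumes h: "0 \<le> h" and z: "continuous_on {s - h..b} z" and zero: "\<And>u. u \<in> {s - h..s} \<Longrightarrow> z u = 0"
    and deriv: "\<And>u. u \<in> {s..b} \<Longrightarrow> (z has_vector_derivative z' u) (at u within {s..b})"
    and le: "\<And>u. u \<in> {s..b} \<Longrightarrow> norm (z' u) \<le> C * norm (hist h z u)"
    and C: "0 < C" and t: "t \<in> {s..b}"
  shows "z t = 0"
proof -
  let ?E = "\<lambda>u. exp (2 * C * (u - s))"
  have sb: "s \<le> b" using t by simp
  have zs: "continuous_on {s..b} z" using z h by (auto intro: continuous_on_subset)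
  have "continuous_on {s..b} (\<lambda>u. norm (z u) / ?E u)" by (intro continuous_intros zs) auto
  then obtain u0 where u0: "u0 \<in> {s..b}" "\<And>u. u \<in> {s..b} \<Longrightarrow> norm (z u) / ?E u \<le> norm (z u0) / ?E u0"
    using continuous_attains_sup[of "{s..b}" "\<lambda>u. norm (z u) / ?E u"] sb by (auto simp: Ball_def)
  define m where "m = norm (z u0) / ?E u0"
  have m: "0 \<le> m" "\<And>u. u \<in> {s..b} \<Longrightarrow> norm (z u) \<le> m * ?E u"
    using u0(2) by (auto simp: m_def field_simps)
  have hz: "norm (hist h z u) \<le> m * ?E u" if u: "u \<in> {s..b}" for u
  proof (rule norm_hist_le[OF h])
    show "continuous_on {u - h..u} z" using z u by (auto intro: continuous_on_subset)
    fix v assume v: "v \<in> {u - h..u}"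
    show "norm (z v) \<le> m * ?E u"
    proof (cases "v \<le> s")
      case True
      then have "z v = 0" using v u by (intro zero) auto
      then show ?thesis using m(1) by simp
    next
      case False
      then have "norm (z v) \<le> m * ?E v" using m(2)[of v] v u by auto
      also have "\<dots> \<le> m * ?E u" using v C m(1) by (intro mult_left_mono) auto
      finally show ?thesis .
    qed
  qed
  have "m \<le> m / 2"
  proof (cases "u0 = s")
    case True
    then show ?thesis using zero[of s] h by (simp add: m_def)
  next
    case False
    then have lt: "s < u0" using u0 by simp
    have "norm (z u0 - z s) \<le> m / 2 * ?E u0 - m / 2 * ?E s"
    proof (rule differentiable_bound_general[OF lt])
      show "continuous_on {s..u0} z" using zs u0 by (auto intro: continuous_on_subset)
      show "continuous_on {s..u0} (\<lambda>u. m / 2 * ?E u)" by (intro continuous_intros)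
      fix x assume x: "s < x" "x < u0"
      then have xb: "x \<in> {s..b}" "x \<in> interior {s..b}" using u0 by auto
      show "(z has_vector_derivative z' x) (at x)"
        using deriv[OF xb(1)] at_within_interior[OF xb(2)] by simp
      show "((\<lambda>u. m / 2 * ?E u) has_vector_derivative C * (m * ?E x)) (at x)"
        unfolding has_real_derivative_iff_has_vector_derivative[symmetric]
        by (auto intro!: derivative_eq_intros)
      show "norm (z' x) \<le> C * (m * ?E x)"
        using le[OF xb(1)] hz[OF xb(1)] C by (meson mult_left_mono less_imp_le order_trans)
    qed
    then have "norm (z u0) \<le> m / 2 * ?E u0" using zero[of s] h m(1) by simp
    then show ?thesis unfolding m_def by (simp add: field_simps)
  qed
  then have "m = 0" using m(1) by simp
  then show ?thesis using m(2)[OF t] by simp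
qed

lemma exp_integral_bound:
  fixes g :: "real \<Rightarrow> 'e::banach"
  assumes "continuous_on {0..c} g" "\<And>s. s \<in> {0..c} \<Longrightarrow> norm (g s) \<le> A * exp (\<nu> * s)"
    and "0 \<le> c" "0 < \<nu>" "0 \<le> A"
  shows "norm (integral {0..c} g) \<le> A / \<nu> * exp (\<nu> * c)"
proof -
  have "((\<lambda>s. A * exp (\<nu> * s)) has_integral (A / \<nu> * exp (\<nu> * c) - A / \<nu> * exp (\<nu> * 0))) {0..c}"
    by (rule fundamental_theorem_of_calculus[OF assms(3)])
      (use assms in \<open>auto intro!: derivative_eq_intros simp: has_real_derivative_iff_has_vector_derivative[symmetric]\<close>)
  then have I: "((\<lambda>s. A * exp (\<nu> * s)) has_integral (A / \<nu> * exp (\<nu> * c) - A / \<nu>)) {0..c}" by simp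
  from integral_unique[OF I] have "integral {0..c} (\<lambda>s. A * exp (\<nu> * s)) = A / \<nu> * exp (\<nu> * c) - A / \<nu>" .
  moreover have "norm (integral {0..c} g) \<le> integral {0..c} (\<lambda>s. A * exp (\<nu> * s))"
    by (rule integral_norm_bound_integral) (use assms I in \<open>auto intro: integrable_continuous_interval has_integral_integrable\<close>)
  moreover have "0 \<le> A / \<nu>" using assms by simp
  ultimately show ?thesis by linarith
qed

text \<open>Solutions on a given interval exist for initial states close to the one of a solution \<open>\<gamma>\<close>, and
  stay close to it. The difference \<open>z\<close> from \<open>\<gamma>\<close> is the fixed point of a contraction, in the weighted
  norm with weight \<open>exp (- \<nu> t)\<close>: the map acts on \<open>u(t) = exp (- \<nu> t) z(t)\<close>, with \<open>t\<close> clamped to \<open>[0, b]\<close>.\<close>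

lemma dde_exists_near:
  fixes F :: "(real \<Rightarrow>\<^sub>C 'e::banach) \<Rightarrow> 'e"
  assumes h: "0 \<le> h" and b: "0 < b" and F: "continuous_on UNIV F"
    and \<rho>: "0 < \<rho>" and C: "0 \<le> C"
    and lip: "\<And>t y z. y \<in> ball (hist h \<gamma> t) \<rho> \<Longrightarrow> z \<in> ball (hist h \<gamma> t) \<rho> \<Longrightarrow> norm (F y - F z) \<le> C * norm (y - z)"
    and \<gamma>: "continuous_on UNIV \<gamma>" "\<And>t. (\<gamma> has_vector_derivative F (hist h \<gamma> t)) (at t)"
    and \<epsilon>: "0 < \<epsilon>"
  shows "\<exists>\<eta>>0. \<forall>\<psi>\<in>phase_space h. norm (\<psi> - hist h \<gamma> 0) < \<eta> \<longrightarrow>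
     (\<exists>x. dde_solution h F x {0..b} \<and> hist h x 0 = \<psi> \<and> (\<forall>t\<in>{0..b}. norm (hist h x t - hist h \<gamma> t) < \<epsilon>))"
proof -
  define \<nu> where "\<nu> = 2 * (C + 1)"
  have \<nu>: "0 < \<nu>" "C / \<nu> \<le> 1 / 2" using C by (auto simp: \<nu>_def field_simps)
  define \<kappa> where "\<kappa> = min \<epsilon> \<rho> / (2 * exp (\<nu> * b))"
  have \<kappa>: "0 < \<kappa>" "\<kappa> * exp (\<nu> * b) < min \<epsilon> \<rho>" using \<epsilon> \<rho> by (auto simp: \<kappa>_def)
  define cl where "cl t = max 0 (min b t)" for t
  have cl: "cl t \<in> {0..b}" "t \<in> {0..b} \<Longrightarrow> cl t = t" "t \<le> 0 \<Longrightarrow> cl t = 0" for t using b by (auto simp: cl_def)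
  have cl_cont: "continuous_on S cl" for S unfolding cl_def by (intro continuous_intros)
  have cl_mono: "s \<le> t \<Longrightarrow> cl s \<le> cl t" for s t by (auto simp: cl_def)
  let ?E = "\<lambda>t. exp (\<nu> * cl t)"
  have E1: "1 \<le> ?E t" for t using cl(1)[of t] \<nu> by simp
  define Z where "Z u t = ?E t *\<^sub>R apply_bcontfun u t" for u :: "real \<Rightarrow>\<^sub>C 'e" and t
  have Z_cont: "continuous_on S (Z u)" for S u unfolding Z_def by (intro continuous_intros cl_cont) auto
  define G where "G u t = F (hist h \<gamma> t + hist h (Z u) t) - F (hist h \<gamma> t)" for u t
  have hist_cont: "continuous_on S (hist h \<gamma>)" "continuous_on S (hist h (Z u))" for S u
    using hist_continuous[OF h \<gamma>(1)] hist_continuous[OF h Z_cont] continuous_on_subset by blast+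
  have G_cont: "continuous_on S (G u)" for S u
    unfolding G_def by (intro continuous_on_diff continuous_on_compose2[OF F] continuous_on_add hist_cont) auto
  have hist_Z_diff: "norm (hist h (Z u) t - hist h (Z v) t) \<le> norm (u - v) * exp (\<nu> * t)" if t: "t \<in> {0..b}" for u v t
  proof -
    have "norm (hist h (\<lambda>s. Z u s - Z v s) t) \<le> norm (u - v) * exp (\<nu> * t)"
    proof (rule norm_hist_le[OF h])
      fix s assume s: "s \<in> {t - h..t}"
      have "norm (Z u s - Z v s) = ?E s * norm (apply_bcontfun (u - v) s)"
        by (simp add: Z_def scaleR_diff_right[symmetric] del: scaleR_diff_right)
      also have "\<dots> \<le> exp (\<nu> * t) * norm (u - v)"
        using cl_mono[of s t] s cl(2)[OF t] \<nu> by (intro mult_mono norm_bounded) auto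
      finally show "norm (Z u s - Z v s) \<le> norm (u - v) * exp (\<nu> * t)" by (simp add: mult.commute)
    qed (intro continuous_intros Z_cont)
    then show ?thesis by (simp add: hist_diff h Z_cont)
  qed
  have Z0: "Z 0 = (\<lambda>_. 0)" by (auto simp: Z_def)
  have hist0: "hist h (\<lambda>_. 0 :: 'e) t = 0" for t by (rule bcontfun_eqI) (simp add: hist_apply h)
  have small: "norm (hist h (Z u) t) < min \<epsilon> \<rho>" if u: "norm u \<le> \<kappa>" and t: "t \<in> {0..b}" for u t
  proof -
    have "norm (hist h (Z u) t) \<le> norm u * exp (\<nu> * t)" using hist_Z_diff[OF t, of u 0] by (simp add: Z0 hist0)
    also have "\<dots> \<le> \<kappa> * exp (\<nu> * b)" using u t \<nu> \<kappa>(1) by (intro mult_mono) auto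
    finally show ?thesis using \<kappa> by simp
  qed
  have G_diff: "norm (G u t - G v t) \<le> (C * norm (u - v)) * exp (\<nu> * t)"
    if u: "norm u \<le> \<kappa>" "norm v \<le> \<kappa>" and t: "t \<in> {0..b}" for u v t
  proof -
    have "norm (G u t - G v t) \<le> C * norm (hist h (Z u) t - hist h (Z v) t)"
      using lip[of "hist h \<gamma> t + hist h (Z u) t" t "hist h \<gamma> t + hist h (Z v) t"] small[OF u(1) t] small[OF u(2) t]
      by (simp add: G_def dist_norm)
    also have "\<dots> \<le> C * (norm (u - v) * exp (\<nu> * t))" by (intro mult_left_mono hist_Z_diff t C)
    finally show ?thesis by (simp add: mult.assoc)
  qed
  have G0: "G 0 t = 0" for t by (simp add: G_def Z0 hist0)
  show ?thesis
  proof (intro exI[of _ "\<kappa> / 2"] conjI ballI impI)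
    show "0 < \<kappa> / 2" using \<kappa> by simp
    fix \<psi> :: "real \<Rightarrow>\<^sub>C 'e" assume \<psi>: "\<psi> \<in> phase_space h" "norm (\<psi> - hist h \<gamma> 0) < \<kappa> / 2"
    define \<omega> where "\<omega> = \<psi> - hist h \<gamma> 0"
    have \<omega>: "norm \<omega> \<le> \<kappa> / 2" using \<psi> by (simp add: \<omega>_def)
    define P where "P u t = (apply_bcontfun \<omega> (min 0 t) + integral {0..cl t} (G u)) /\<^sub>R ?E t" for u t
    have I_cont: "continuous_on UNIV (\<lambda>t. integral {0..cl t} (G u))" for u
    proof -
      have "continuous_on {0..b} (\<lambda>t. integral {0..t} (G u))"
        by (rule indefinite_integral_continuous_1) (rule integrable_continuous_interval[OF G_cont])
      then show ?thesis by (rule continuous_on_compose2) (use cl cl_cont in auto)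
    qed
    have P_cont: "continuous_on UNIV (P u)" for u
    proof -
      have "continuous_on UNIV (\<lambda>t. apply_bcontfun \<omega> (min 0 t))"
        by (rule continuous_on_compose2[of UNIV "apply_bcontfun \<omega>"]) (auto intro!: continuous_intros)
      then show ?thesis unfolding P_def by (intro continuous_intros I_cont cl_cont) auto
    qed
    have P_diff: "norm (P u t - P v t) \<le> norm (u - v) / 2" if u: "norm u \<le> \<kappa>" "norm v \<le> \<kappa>" for u v t
    proof -
      have "norm (integral {0..cl t} (\<lambda>s. G u s - G v s)) \<le> (C * norm (u - v)) / \<nu> * ?E t"
        by (rule exp_integral_bound) (use cl(1)[of t] G_diff[OF u] C \<nu> in \<open>auto intro!: continuous_intros G_cont\<close>)
      also have "(C * norm (u - v)) / \<nu> * ?E t = (C / \<nu>) * (norm (u - v) * ?E t)" by simp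
      also have "\<dots> \<le> (1 / 2) * (norm (u - v) * ?E t)" using \<nu>(2) by (intro mult_right_mono) auto
      finally have "norm (integral {0..cl t} (G u) - integral {0..cl t} (G v)) \<le> norm (u - v) / 2 * ?E t"
        by (simp add: Henstock_Kurzweil_Integration.integral_diff integrable_continuous_interval[OF G_cont])
      note bnd = this
      have eq: "P u t - P v t = (integral {0..cl t} (G u) - integral {0..cl t} (G v)) /\<^sub>R ?E t"
        by (simp add: P_def scaleR_diff_right[symmetric] del: scaleR_diff_right)
      have "norm (P u t - P v t) = norm (integral {0..cl t} (G u) - integral {0..cl t} (G v)) / ?E t"
        unfolding eq norm_scaleR by (simp add: divide_inverse mult.commute)
      then show ?thesis using bnd exp_gt_zero[of "\<nu> * cl t"] by (simp add: pos_divide_le_eq)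
    qed
    have P0: "norm (P 0 t) \<le> \<kappa> / 2" for t
    proof -
      have "G 0 = (\<lambda>_. 0)" using G0 by (intro ext)
      then have "integral {0..cl t} (G 0) = 0" by simp
      then have "norm (P 0 t) = norm (apply_bcontfun \<omega> (min 0 t)) / ?E t" by (simp add: P_def divide_inverse mult.commute)
      also have "\<dots> \<le> norm (apply_bcontfun \<omega> (min 0 t)) / 1" using E1 by (intro divide_left_mono) auto
      also have "\<dots> \<le> \<kappa> / 2" using norm_bounded[of \<omega> "min 0 t"] \<omega> by simp
      finally show ?thesis .
    qed
    have P_le: "norm (P u t) \<le> \<kappa>" if u: "norm u \<le> \<kappa>" for u t
      using P_diff[of u 0 t] P0[of t] u \<kappa> norm_triangle_sub[of "P u t" "P 0 t"] by simp
    have P_bcont: "P u \<in> bcontfun" if u: "norm u \<le> \<kappa>" for u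
      using P_cont P_le[OF u] by (auto simp: bcontfun_def bounded_iff)
    define \<Psi> where "\<Psi> u = Bcontfun (P u)" for u
    have \<Psi>: "apply_bcontfun (\<Psi> u) = P u" if "norm u \<le> \<kappa>" for u
      using P_bcont[OF that] by (simp add: \<Psi>_def Bcontfun_inverse)
    have "\<exists>!u\<in>cball 0 \<kappa>. \<Psi> u = u"
    proof (rule Banach_fix[where c = "1/2"])
      show "complete (cball (0 :: real \<Rightarrow>\<^sub>C 'e) \<kappa>)" by (simp add: complete_eq_closed)
      show "\<Psi> ` cball 0 \<kappa> \<subseteq> cball 0 \<kappa>"
        using P_le \<Psi> by (auto intro!: norm_bound)
      show "dist (\<Psi> u) (\<Psi> v) \<le> 1 / 2 * dist u v" if "u \<in> cball 0 \<kappa>" "v \<in> cball 0 \<kappa>" for u v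
        using P_diff[of u v] \<Psi>[of u] \<Psi>[of v] that unfolding dist_norm by (intro norm_bound) auto
    qed (use \<kappa> in auto)
    then obtain u where u: "norm u \<le> \<kappa>" "\<Psi> u = u" by auto
    have z: "Z u t = apply_bcontfun \<omega> (min 0 t) + integral {0..cl t} (G u)" for t
    proof -
      have "apply_bcontfun u t = P u t" using \<Psi>[OF u(1)] u(2) by simp
      then show ?thesis by (simp add: Z_def P_def)
    qed
    define x where "x t = \<gamma> t + Z u t" for t
    have x_cont: "continuous_on S x" for S
      unfolding x_def using \<gamma>(1) Z_cont by (intro continuous_on_add) (auto intro: continuous_on_subset)
    have hx: "hist h x t = hist h \<gamma> t + hist h (Z u) t" for t
      unfolding x_def by (rule hist_add) (use h Z_cont \<gamma>(1) in \<open>auto intro: continuous_on_subset\<close>)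
    have "(x has_vector_derivative F (hist h x t)) (at t within {0..b})" if t: "t \<in> {0..b}" for t
    proof -
      have "((\<lambda>t. integral {0..t} (G u)) has_vector_derivative G u t) (at t within {0..b})"
        by (rule integral_has_vector_derivative[OF G_cont t])
      then have "((\<lambda>t. \<gamma> t + (apply_bcontfun \<omega> 0 + integral {0..t} (G u))) has_vector_derivative F (hist h \<gamma> t) + (0 + G u t)) (at t within {0..b})"
        by (intro has_vector_derivative_add has_vector_derivative_const has_vector_derivative_at_within[OF \<gamma>(2)])
      moreover have "x s = \<gamma> s + (apply_bcontfun \<omega> 0 + integral {0..s} (G u))" if "s \<in> {0..b}" for s
        using that cl(2)[OF that] by (simp add: x_def z)
      ultimately have "(x has_vector_derivative F (hist h \<gamma> t) + (0 + G u t)) (at t within {0..b})"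
        using t by (subst has_vector_derivative_cong_ev[where g = "\<lambda>t. \<gamma> t + (apply_bcontfun \<omega> 0 + integral {0..t} (G u))"]) (auto intro: always_eventually)
      then show ?thesis by (simp add: G_def hx)
    qed
    then have "dde_solution h F x {0..b}" using x_cont by (simp add: dde_solution_def)
    moreover have "hist h x 0 = \<psi>"
    proof (rule phase_space_eqI[OF h])
      show "hist h x 0 \<in> phase_space h" by (rule hist_mem[OF h x_cont])
      fix \<theta> assume \<theta>: "\<theta> \<in> {-h..0}"
      have "Z u \<theta> = apply_bcontfun \<omega> \<theta>" using z[of \<theta>] \<theta> cl(3)[of \<theta>] by simp
      moreover have "apply_bcontfun (hist h \<gamma> 0) \<theta> = \<gamma> \<theta>"
        using \<theta> h \<gamma>(1) by (subst hist_apply) (auto intro: continuous_on_subset)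
      moreover have "apply_bcontfun (hist h x 0) \<theta> = x \<theta>"
        using \<theta> by (subst hist_apply[OF h x_cont]) auto
      ultimately show "apply_bcontfun (hist h x 0) \<theta> = apply_bcontfun \<psi> \<theta>" by (simp add: x_def \<omega>_def)
    qed (rule \<psi>)
    moreover have "norm (hist h x t - hist h \<gamma> t) < \<epsilon>" if "t \<in> {0..b}" for t
      using small[OF u(1) that] by (simp add: hx)
    ultimately show "\<exists>x. dde_solution h F x {0..b} \<and> hist h x 0 = \<psi> \<and> (\<forall>t\<in>{0..b}. norm (hist h x t - hist h \<gamma> t) < \<epsilon>)"
      by blast
  qed
qed

section \<open>The characteristic operator and its adjoint\<close>

lemma bounded_linear_cvec: "bounded_linear (cvec :: real^'n \<Rightarrow> complex^'n)"
proof
  show "\<exists>K. \<forall>x::real^'n. norm (cvec x :: complex^'n) \<le> norm x * K"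
    by (intro exI[of _ 1]) (simp add: cvec_def norm_vec_def)
qed (simp_all add: cvec_def vec_eq_iff scaleR_conv_of_real[where 'a = complex])

lemma cvec_inj: "cvec x = cvec y \<longleftrightarrow> x = y"
  by (simp add: cvec_def vec_eq_iff)

lemma cvec_simps: "cvec 0 = 0" "cvec (x + y) = cvec x + cvec y" "cvec (x - y) = cvec x - cvec y"
  "cvec (- x) = - cvec x" "cvec (c *\<^sub>R x) = of_real c *s cvec x"
  by (simp_all add: cvec_def vec_eq_iff)

lemma cmat_mult_cvec: "cmat A *v cvec x = cvec (A *v x)"
  by (simp add: cmat_def cvec_def matrix_vector_mult_def vec_eq_iff)

text \<open>The componentwise real part; it inverts \<open>cvec\<close>.\<close>

definition re_vec :: "complex^'n \<Rightarrow> real^'n" where "re_vec v = (\<chi> i. Re (v $ i))"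

lemma re_vec_cvec: "re_vec (cvec x) = x"
  by (simp add: re_vec_def cvec_def vec_eq_iff)

lemma bounded_linear_re_vec: "bounded_linear (re_vec :: complex^'n \<Rightarrow> real^'n)"
proof
  show "\<exists>K. \<forall>x::complex^'n. norm (re_vec x :: real^'n) \<le> norm x * K"
  proof (intro exI[of _ 1] allI)
    fix x :: "complex^'n"
    show "norm (re_vec x :: real^'n) \<le> norm x * 1"
      unfolding norm_vec_def re_vec_def mult_1_right by (rule L2_set_mono) (auto simp: abs_Re_le_cmod)
  qed
qed (simp_all add: re_vec_def vec_eq_iff)

lemma C1_cvec:
  assumes "(cvec \<circ> q) C1_differentiable_on UNIV"
  obtains q' where "\<And>t. (q has_vector_derivative q' t) (at t)" "continuous_on UNIV q'"
    "\<And>t. vector_derivative (cvec \<circ> q) (at t) = cvec (q' t)"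
proof -
  obtain D where D: "\<And>t. ((cvec \<circ> q) has_vector_derivative D t) (at t)" "continuous_on UNIV D"
    using assms unfolding C1_differentiable_on_def by auto
  have q: "(q has_vector_derivative re_vec (D t)) (at t)" for t
    using bounded_linear.has_vector_derivative[OF bounded_linear_re_vec D(1)[of t]] by (simp add: o_def re_vec_cvec)
  have vd: "vector_derivative (cvec \<circ> q) (at t) = cvec (re_vec (D t))" for t
    using bounded_linear.has_vector_derivative[OF bounded_linear_cvec q[of t]]
    by (simp add: vector_derivative_at o_def)
  have "continuous_on UNIV (\<lambda>t. re_vec (D t))"
    by (rule bounded_linear.continuous_on[OF bounded_linear_re_vec D(2)])
  from that[OF q this vd] show thesis .
qed

lemma has_field_derivative_quadratic:
  fixes f :: "complex \<Rightarrow> complex"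
  assumes "\<And>w. norm w \<le> 1 \<Longrightarrow> norm (f w - f 0 - w * D) \<le> K * (norm w)\<^sup>2"
  shows "(f has_field_derivative D) (at 0)"
  unfolding has_field_derivative_iff
proof (rule LIM_zero_cancel, rule Lim_null_comparison)
  show "((\<lambda>w. K * norm w) \<longlongrightarrow> 0) (at (0::complex))" by (auto intro!: tendsto_eq_intros)
  show "\<forall>\<^sub>F w in at 0. norm ((f w - f 0) / (w - 0) - D) \<le> K * norm w"
    unfolding eventually_at
  proof (intro exI[of _ 1] conjI ballI impI)
    fix w :: complex assume w: "w \<noteq> 0 \<and> dist w 0 < 1"
    have "(f w - f 0) / (w - 0) - D = (f w - f 0 - w * D) / w" using w by (simp add: diff_divide_distrib)
    then have "norm ((f w - f 0) / (w - 0) - D) = norm (f w - f 0 - w * D) / norm w" by (simp add: norm_divide)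
    also have "\<dots> \<le> K * (norm w)\<^sup>2 / norm w" using assms[of w] w by (intro divide_right_mono) auto
    also have "\<dots> = K * norm w" using w by (simp add: power2_eq_square)
    finally show "norm ((f w - f 0) / (w - 0) - D) \<le> K * norm w" .
  qed auto
qed

context delay_kernel begin

lemma complex_kernel_integral:
  assumes f: "continuous_on UNIV f"
  shows "has_stieltjes (\<lambda>x s. cmat (\<zeta> \<tau> s) *v (exp (- w * of_real x) *s cvec (f (\<tau> - x))))
    (cvec (L \<tau> (restrict_state h (\<lambda>\<theta>. Re (exp (w * of_real \<theta>)) *\<^sub>R f (\<tau> + \<theta>))))
      + \<i> *s cvec (L \<tau> (restrict_state h (\<lambda>\<theta>. Im (exp (w * of_real \<theta>)) *\<^sub>R f (\<tau> + \<theta>))))) 0 h"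
proof -
  let ?g = "\<lambda>P \<theta>. P (exp (w * of_real \<theta>)) *\<^sub>R f (\<tau> + \<theta>)"
  have c: "continuous_on {-h..0} (?g Re)" "continuous_on {-h..0} (?g Im)"
    by (intro continuous_intros continuous_on_compose2[OF f]; simp)+
  have ap: "apply_bcontfun (restrict_state h (?g Re)) (- x) = ?g Re (- x)"
    "apply_bcontfun (restrict_state h (?g Im)) (- x) = ?g Im (- x)" if "x \<in> {0..h}" for x
    using that by (simp_all add: restrict_state_apply[OF h0 c(1)] restrict_state_apply[OF h0 c(2)])
  have bl: "bounded_linear (\<lambda>v :: complex^'n. \<i> *s v)"
  proof
    show "\<exists>K. \<forall>x :: complex^'n. norm (\<i> *s x) \<le> norm x * K"
      by (intro exI[of _ 1]) (simp add: norm_vec_def norm_mult)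
  qed (auto simp: vec_eq_iff algebra_simps)
  note H = has_stieltjes_add[OF
     has_stieltjes_bounded_linear[OF bounded_linear_cvec kernel_integral[OF restrict_state_mem[OF h0 c(1)]], of \<tau>]
     has_stieltjes_bounded_linear[OF bl has_stieltjes_bounded_linear[OF bounded_linear_cvec kernel_integral[OF restrict_state_mem[OF h0 c(2)]], of \<tau>]]]
  show ?thesis
  proof (rule has_stieltjes_cong[THEN iffD1, OF _ H])
    fix x s assume x: "x \<in> {0..h}"
    define y where "y = f (\<tau> - x)"
    define E where "E = exp (- (w * of_real x))"
    have 1: "apply_bcontfun (restrict_state h (?g Re)) (- x) = Re E *\<^sub>R y"
      "apply_bcontfun (restrict_state h (?g Im)) (- x) = Im E *\<^sub>R y"
      using ap[OF x] by (simp_all add: y_def E_def)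
    have 2: "exp (- w * of_real x) *s cvec y = cvec (Re E *\<^sub>R y) + \<i> *s cvec (Im E *\<^sub>R y)"
      by (simp add: E_def[symmetric] vec_eq_iff cvec_def complex_eq_iff)
    show "cvec (\<zeta> \<tau> s *v apply_bcontfun (restrict_state h (?g Re)) (- x)) + \<i> *s cvec (\<zeta> \<tau> s *v apply_bcontfun (restrict_state h (?g Im)) (- x))
        = cmat (\<zeta> \<tau> s) *v (exp (- w * of_real x) *s cvec (f (\<tau> - x)))"
      unfolding 1 y_def[symmetric] 2 matrix_vector_right_distrib vector_scalar_commute cmat_mult_cvec ..
  qed
qed

text \<open>On real functions, \<open>\<Delta>(0) v = v' - L v\<^sub>t\<close>.\<close>

lemma char_op_value:
  assumes v: "continuous_on UNIV v" "(v has_vector_derivative v') (at \<tau>)"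
  shows "char_op h \<zeta> 0 (cvec \<circ> v) \<tau> = cvec (v' - L \<tau> (hist h v \<tau>))"
proof -
  have "((cvec \<circ> v) has_vector_derivative cvec v') (at \<tau>)"
    using bounded_linear.has_vector_derivative[OF bounded_linear_cvec v(2)] by (simp add: o_def)
  then have 1: "vector_derivative (cvec \<circ> v) (at \<tau>) = cvec v'" by (rule vector_derivative_at)
  have "restrict_state h (\<lambda>\<theta>. 0 :: real^'n) = 0" by (rule bcontfun_eqI) (simp add: restrict_state_apply h0)
  then have 2: "stieltjes 0 h (\<lambda>x s. cmat (\<zeta> \<tau> s) *v (exp (- 0 * of_real x) *s cvec (v (\<tau> - x)))) = cvec (L \<tau> (hist h v \<tau>))"
    using stieltjes_eq[OF complex_kernel_integral[OF v(1), of \<tau> 0]]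
    by (simp add: hist_def linear_0[OF linear(1)] cvec_simps)
  show ?thesis using 2 by (simp add: char_op_def 1 cvec_simps)
qed

text \<open>The operator \<open>\<Delta>'(0)\<close> on real functions. Differentiating \<open>- exp (- z s)\<close> at \<open>z = 0\<close> gives the delay
  \<open>s\<close> as a weight in the delay term, which is \<open>- \<theta>\<close> at the argument \<open>\<theta> \<in> [-h, 0]\<close> of the state.\<close>

definition D_char :: "(real \<Rightarrow> real^'n) \<Rightarrow> real \<Rightarrow> real^'n" where
  "D_char f \<tau> = f \<tau> + L \<tau> (restrict_state h (\<lambda>\<theta>. (- \<theta>) *\<^sub>R f (\<tau> + \<theta>)))"

lemma char_op_deriv_value:
  assumes f: "continuous_on UNIV f"
  shows "char_op_deriv h \<zeta> 0 (cvec \<circ> f) \<tau> = cvec (D_char f \<tau>)"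
proof -
  define S where "S w = restrict_state h (\<lambda>\<theta>. Re (exp (w * of_real \<theta>)) *\<^sub>R f (\<tau> + \<theta>))" for w :: complex
  define S' where "S' w = restrict_state h (\<lambda>\<theta>. Im (exp (w * of_real \<theta>)) *\<^sub>R f (\<tau> + \<theta>))" for w
  define N where "N = restrict_state h (\<lambda>\<theta>. (- \<theta>) *\<^sub>R f (\<tau> + \<theta>))"
  have cf: "continuous_on {-h..0} (\<lambda>\<theta>. f (\<tau> + \<theta>))" by (intro continuous_on_compose2[OF f] continuous_intros) auto
  have apply_S: "apply_bcontfun (S w) \<theta> = Re (exp (w * of_real (max (-h) (min 0 \<theta>)))) *\<^sub>R f (\<tau> + max (-h) (min 0 \<theta>))"
    "apply_bcontfun (S' w) \<theta> = Im (exp (w * of_real (max (-h) (min 0 \<theta>)))) *\<^sub>R f (\<tau> + max (-h) (min 0 \<theta>))"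
    "apply_bcontfun N \<theta> = (- (max (-h) (min 0 \<theta>))) *\<^sub>R f (\<tau> + max (-h) (min 0 \<theta>))" for w \<theta>
    unfolding S_def S'_def N_def by (subst restrict_state_apply[OF h0]; (intro continuous_intros cf)?; simp)+
  obtain Cf where Cf: "Cf > 0" "\<And>\<theta>. \<theta> \<in> {-h..0} \<Longrightarrow> norm (f (\<tau> + \<theta>)) \<le> Cf"
    using compact_imp_bounded[OF compact_continuous_image[OF cf compact_Icc]] bounded_pos by (metis imageI)
  define K where "K = exp h * h\<^sup>2 * Cf"
  have taylor: "norm (exp (w * of_real \<theta>) - 1 - w * of_real \<theta>) * norm (f (\<tau> + \<theta>)) \<le> K * (norm w)\<^sup>2"
    if w: "norm w \<le> 1" and \<theta>: "\<theta> \<in> {-h..0}" for w :: complex and \<theta>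
  proof -
    let ?z = "w * of_real \<theta>"
    have nz: "norm ?z \<le> norm w * h" unfolding norm_mult using \<theta> by (intro mult_left_mono) auto
    have "norm (exp ?z - (\<Sum>i\<le>1. ?z ^ i / fact i)) \<le> exp \<bar>Re ?z\<bar> * norm ?z ^ Suc 1 / fact 1" by (rule Taylor_exp)
    then have "norm (exp ?z - 1 - ?z) \<le> exp \<bar>Re ?z\<bar> * (norm ?z)\<^sup>2" by (simp add: power2_eq_square algebra_simps)
    also have "\<dots> \<le> exp h * (norm w * h)\<^sup>2"
    proof (intro mult_mono power_mono nz)
      have "\<bar>Re ?z\<bar> \<le> norm ?z" by (rule abs_Re_le_cmod)
      also have "\<dots> \<le> 1 * h" using nz w h by (meson mult_right_mono order_trans less_imp_le)
      finally show "exp \<bar>Re ?z\<bar> \<le> exp h" by simp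
    qed auto
    finally have "norm (exp ?z - 1 - ?z) * norm (f (\<tau> + \<theta>)) \<le> (exp h * (norm w * h)\<^sup>2) * Cf"
      using Cf(2)[OF \<theta>] by (intro mult_mono) auto
    then show ?thesis by (simp add: K_def power_mult_distrib mult_ac)
  qed
  have b1: "norm (S w - S 0 + Re w *\<^sub>R N) \<le> K * (norm w)\<^sup>2" "norm (S' w - S' 0 + Im w *\<^sub>R N) \<le> K * (norm w)\<^sup>2" if w: "norm w \<le> 1" for w
  proof -
    show "norm (S w - S 0 + Re w *\<^sub>R N) \<le> K * (norm w)\<^sup>2"
    proof (rule norm_bound)
      fix \<theta>
      let ?\<theta> = "max (-h) (min 0 \<theta>)"
      have "apply_bcontfun (S w - S 0 + Re w *\<^sub>R N) \<theta> = Re (exp (w * of_real ?\<theta>) - 1 - w * of_real ?\<theta>) *\<^sub>R f (\<tau> + ?\<theta>)"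
        by (simp add: apply_S scaleR_diff_left scaleR_left_distrib)
      then show "norm (apply_bcontfun (S w - S 0 + Re w *\<^sub>R N) \<theta>) \<le> K * (norm w)\<^sup>2"
        using taylor[OF w clamp_mem[OF h0, of \<theta>]] abs_Re_le_cmod[of "exp (w * of_real ?\<theta>) - 1 - w * of_real ?\<theta>"]
        by (simp only: norm_scaleR) (meson mult_right_mono norm_ge_zero order_trans)
    qed
    show "norm (S' w - S' 0 + Im w *\<^sub>R N) \<le> K * (norm w)\<^sup>2"
    proof (rule norm_bound)
      fix \<theta>
      let ?\<theta> = "max (-h) (min 0 \<theta>)"
      have "apply_bcontfun (S' w - S' 0 + Im w *\<^sub>R N) \<theta> = Im (exp (w * of_real ?\<theta>) - 1 - w * of_real ?\<theta>) *\<^sub>R f (\<tau> + ?\<theta>)"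
        by (simp add: apply_S scaleR_diff_left scaleR_left_distrib)
      then show "norm (apply_bcontfun (S' w - S' 0 + Im w *\<^sub>R N) \<theta>) \<le> K * (norm w)\<^sup>2"
        using taylor[OF w clamp_mem[OF h0, of \<theta>]] abs_Im_le_cmod[of "exp (w * of_real ?\<theta>) - 1 - w * of_real ?\<theta>"]
        by (simp only: norm_scaleR) (meson mult_right_mono norm_ge_zero order_trans)
    qed
  qed
  have der: "((\<lambda>w. char_op h \<zeta> w (cvec \<circ> f) \<tau> $ i) has_field_derivative of_real (D_char f \<tau> $ i)) (at 0)" for i
  proof -
    let ?A = "\<lambda>w. complex_of_real (L \<tau> (S w) $ i) + \<i> * of_real (L \<tau> (S' w) $ i)"
    have eq: "char_op h \<zeta> w (cvec \<circ> f) \<tau> $ i = vector_derivative (cvec \<circ> f) (at \<tau>) $ i + w * of_real (f \<tau> $ i) - ?A w" for w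
      using stieltjes_eq[OF complex_kernel_integral[OF f, of \<tau> w]]
      by (simp add: char_op_def S_def S'_def cvec_def)
    have A: "(?A has_field_derivative of_real (- (L \<tau> N $ i))) (at 0)"
    proof (rule has_field_derivative_quadratic)
      fix w :: complex assume w: "norm w \<le> 1"
      have lin: "L \<tau> (S w - S 0 + Re w *\<^sub>R N) = L \<tau> (S w) - L \<tau> (S 0) + Re w *\<^sub>R L \<tau> N"
        "L \<tau> (S' w - S' 0 + Im w *\<^sub>R N) = L \<tau> (S' w) - L \<tau> (S' 0) + Im w *\<^sub>R L \<tau> N"
        by (simp_all add: linear_add[OF linear(1)] linear_diff[OF linear(1)] linear_scale[OF linear(1)])
      have "?A w - ?A 0 - w * of_real (- (L \<tau> N $ i)) = of_real (L \<tau> (S w - S 0 + Re w *\<^sub>R N) $ i) + \<i> * of_real (L \<tau> (S' w - S' 0 + Im w *\<^sub>R N) $ i)"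
        unfolding lin by (simp add: complex_eq_iff)
      also have "norm \<dots> \<le> norm (L \<tau> (S w - S 0 + Re w *\<^sub>R N)) + norm (L \<tau> (S' w - S' 0 + Im w *\<^sub>R N))"
        by (rule order_trans[OF norm_triangle_ineq]) (simp add: norm_mult component_le_norm_cart add_mono)
      also have "\<dots> \<le> M * (K * (norm w)\<^sup>2) + M * (K * (norm w)\<^sup>2)"
        by (intro add_mono order_trans[OF bound(1)] mult_left_mono b1[OF w] M0)
      also have "\<dots> = (2 * M * K) * (norm w)\<^sup>2" by (simp add: mult.assoc)
      finally show "norm (?A w - ?A 0 - w * of_real (- (L \<tau> N $ i))) \<le> (2 * M * K) * (norm w)\<^sup>2" .
    qed
    have "((\<lambda>w. vector_derivative (cvec \<circ> f) (at \<tau>) $ i + w * of_real (f \<tau> $ i) - ?A w) has_field_derivative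
        (0 + of_real (f \<tau> $ i)) - of_real (- (L \<tau> N $ i))) (at 0)"
    proof (intro DERIV_diff DERIV_add DERIV_const A)
      show "((\<lambda>w. w * of_real (f \<tau> $ i)) has_field_derivative of_real (f \<tau> $ i)) (at (0::complex))"
        by (auto intro!: derivative_eq_intros)
    qed
    then show ?thesis unfolding eq by (simp add: D_char_def N_def)
  qed
  show ?thesis
    using DERIV_imp_deriv[OF der] by (simp add: char_op_deriv_def cvec_def)
qed

lemma D_char_cont:
  assumes f: "continuous_on UNIV f" shows "continuous_on UNIV (D_char f)"
proof -
  have cf: "continuous_on {-h..0} (\<lambda>\<theta>. f (\<tau> + \<theta>))" for \<tau> by (intro continuous_on_compose2[OF f] continuous_intros) auto
  have "continuous_on UNIV (hist h (\<lambda>t. t *\<^sub>R f t))" "continuous_on UNIV (hist h f)"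
    by (intro hist_continuous h0 continuous_intros f)+
  then have "continuous_on UNIV (\<lambda>\<tau>. \<tau> *\<^sub>R hist h f \<tau> - hist h (\<lambda>t. t *\<^sub>R f t) \<tau>)"
    by (intro continuous_intros)
  moreover have "\<tau> *\<^sub>R hist h f \<tau> - hist h (\<lambda>t. t *\<^sub>R f t) \<tau> = restrict_state h (\<lambda>\<theta>. (- \<theta>) *\<^sub>R f (\<tau> + \<theta>))" for \<tau>
    unfolding hist_def using cf[of \<tau>]
    by (intro bcontfun_eqI) (simp add: restrict_state_apply h0 continuous_on_scaleR continuous_on_add continuous_on_id continuous_on_const continuous_on_minus scaleR_left_distrib)
  ultimately show ?thesis unfolding D_char_def by (intro continuous_intros L_cont f) simp
qed

lemma adjoint_null_derivative:
  assumes p: "null_function (adj_char_op h \<zeta> 0) p"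
  obtains J where "\<And>t. (p has_vector_derivative - J t) (at t)" "continuous_on UNIV p"
    "\<And>t. has_stieltjes (\<lambda>x s. p (t + x) v* cmat (\<zeta> (t + x) s)) (J t) 0 h"
proof -
  obtain D where D: "\<And>t. (p has_vector_derivative D t) (at t)"
    using p unfolding null_function_def C1_differentiable_on_def by auto
  have cont: "continuous_on UNIV p"
    by (intro continuous_at_imp_continuous_on ballI has_vector_derivative_continuous[OF D])
  have "\<exists>J. has_stieltjes (\<lambda>x s. p (t + x) v* cmat (\<zeta> (t + x) s)) J 0 h" for t
    using diagonal_integral_exists[OF bounded_bilinear_row_mult_cmat cont, of 0 t] h by simp
  then have "\<forall>t. \<exists>J. has_stieltjes (\<lambda>x s. p (t + x) v* cmat (\<zeta> (t + x) s)) J 0 h" ..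
  from choice[OF this] obtain J where "\<forall>t. has_stieltjes (\<lambda>x s. p (t + x) v* cmat (\<zeta> (t + x) s)) (J t) 0 h" ..
  then have J: "\<And>t. has_stieltjes (\<lambda>x s. p (t + x) v* cmat (\<zeta> (t + x) s)) (J t) 0 h" ..
  have DJ: "D t = - J t" for t
  proof -
    have "adj_char_op h \<zeta> 0 p t = 0" using p by (simp add: null_function_def)
    then have "- D t = J t"
      using stieltjes_eq[OF J[of t]] vector_derivative_at[OF D[of t]] by (auto simp: adj_char_op_def)
    from this[symmetric] show ?thesis by simp
  qed
  have "(p has_vector_derivative - J t) (at t)" for t using D[of t] DJ by simp
  from that[OF this cont J] show thesis .
qed

text \<open>Null functions of the adjoint operator annihilate the range of the characteristic operator.\<close>

lemma solvability:
  fixes p :: "real \<Rightarrow> complex^'n" and v :: "real \<Rightarrow> real^'n" and \<sigma> :: real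
  assumes p: "null_function (adj_char_op h \<zeta> 0) p" "\<And>t. p (t + T) = \<sigma> *\<^sub>R p t"
    and v: "\<And>t. (v has_vector_derivative v' t) (at t)" "continuous_on UNIV v'" "\<And>t. v (t + T) = \<sigma> *\<^sub>R v t"
    and \<sigma>: "\<sigma> * \<sigma> = 1"
  shows "integral {0..T} (\<lambda>t. cdot (p t) (v' t - L t (hist h v t))) = 0"
proof -
  interpret cd: bounded_bilinear "cdot :: complex^'n \<Rightarrow> _" by (rule bounded_bilinear_cdot)
  obtain J where J: "\<And>t. (p has_vector_derivative - J t) (at t)" "continuous_on UNIV p"
    "\<And>t. has_stieltjes (\<lambda>x s. p (t + x) v* cmat (\<zeta> (t + x) s)) (J t) 0 h"
    by (rule adjoint_null_derivative[OF p(1)], rule that)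
  have vc: "continuous_on UNIV v"
    by (intro continuous_at_imp_continuous_on ballI has_vector_derivative_continuous[OF v(1)])
  have tr: "integral {0..T} (\<lambda>t. cdot (p t) (L t (hist h v t))) = integral {0..T} (\<lambda>t. cdot (J t) (v t))"
    "(\<lambda>t. cdot (J t) (v t)) integrable_on {0..T}"
    by (rule transposed_delay_term[where p = p and v = v and J = J and \<sigma> = \<sigma>], rule J(2), rule p(2), rule vc, rule v(3), rule \<sigma>, rule J(3))+
  have "((\<lambda>t. cdot (p t) (v t)) has_vector_derivative (cdot (p t) (v' t) + cdot (- J t) (v t))) (at t within {0..T})" for t
    by (rule has_vector_derivative_at_within[OF cd.has_vector_derivative[OF J(1)[of t] v(1)[of t]]])
  then have "((\<lambda>t. cdot (p t) (v' t) + cdot (- J t) (v t)) has_integral (cdot (p T) (v T) - cdot (p 0) (v 0))) {0..T}"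
    using T by (intro fundamental_theorem_of_calculus) auto
  moreover have "cdot (p T) (v T) = cdot (p 0) (v 0)"
    using p(2)[of 0] v(3)[of 0] \<sigma> by (simp add: cd.scaleR_left cd.scaleR_right)
  ultimately have 1: "integral {0..T} (\<lambda>t. cdot (p t) (v' t) - cdot (J t) (v t)) = 0"
    by (simp add: cd.minus_left integral_unique)
  have i1: "(\<lambda>t. cdot (p t) (v' t)) integrable_on {0..T}"
    by (intro integrable_continuous_interval cd.continuous_on continuous_on_subset[OF J(2)] continuous_on_subset[OF v(2)]) auto
  have i2: "(\<lambda>t. cdot (p t) (L t (hist h v t))) integrable_on {0..T}"
    by (intro integrable_continuous_interval cd.continuous_on continuous_on_subset[OF J(2)] L_cont
        continuous_on_subset[OF hist_continuous[OF h0 vc]]) auto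
  have "integral {0..T} (\<lambda>t. cdot (p t) (v' t - L t (hist h v t)))
      = integral {0..T} (\<lambda>t. cdot (p t) (v' t)) - integral {0..T} (\<lambda>t. cdot (p t) (L t (hist h v t)))"
    by (simp add: cd.diff_right Henstock_Kurzweil_Integration.integral_diff[OF i1 i2])
  also have "\<dots> = integral {0..T} (\<lambda>t. cdot (p t) (v' t) - cdot (J t) (v t))"
    by (simp add: tr(1) Henstock_Kurzweil_Integration.integral_diff[OF i1 tr(2)])
  finally show ?thesis using 1 by simp
qed

end

section \<open>The linearization along the periodic solution\<close>

text \<open>The delay equation with a periodic solution. The time derivatives \<open>L1\<close>, \<open>L2\<close> of the linearization
  \<open>L\<close> come from the chain rule, with \<open>\<gamma>1 = \<gamma>'\<close> and \<open>\<gamma>2 = \<gamma>''\<close>; the third derivative of \<open>F\<close> occurs in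
  \<open>L2\<close>.\<close>

locale periodic_dde =
  fixes h T :: real and k :: nat and F :: "(real \<Rightarrow>\<^sub>C (real^'n)) \<Rightarrow> real^'n"
    and \<gamma> :: "real \<Rightarrow> real^'n" and \<zeta> :: "real \<Rightarrow> real \<Rightarrow> real^'n^'n"
  assumes h_pos: "0 < h" and T_pos: "0 < T" and k: "k + 1 \<ge> 3"
    and F_smooth: "smooth_on (k + 1) UNIV F"
    and \<gamma>_sol: "dde_solution h F \<gamma> UNIV" and \<gamma>_periodic: "periodic T \<gamma>"
    and \<zeta>_rep: "represents_kernel h T \<zeta> (\<lambda>t. frechet_derivative F (at (hist h \<gamma> t)))"

sublocale periodic_dde \<subseteq> smooth_map F "k + 1"
  by unfold_locales (rule F_smooth)

context periodic_dde begin

lemma h_nonneg: "0 \<le> h" using h_pos by simp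

definition orbit :: "real \<Rightarrow> (real \<Rightarrow>\<^sub>C (real^'n))" where "orbit t = hist h \<gamma> t"
definition \<gamma>1 :: "real \<Rightarrow> real^'n" where "\<gamma>1 t = F (orbit t)"
definition \<gamma>2 :: "real \<Rightarrow> real^'n" where "\<gamma>2 t = iter_deriv F [hist h \<gamma>1 t] (orbit t)"

definition L :: "real \<Rightarrow> (real \<Rightarrow>\<^sub>C (real^'n)) \<Rightarrow> real^'n" where
  "L t \<psi> = iter_deriv F [\<psi>] (orbit t)"
definition L1 :: "real \<Rightarrow> (real \<Rightarrow>\<^sub>C (real^'n)) \<Rightarrow> real^'n" where
  "L1 t \<psi> = iter_deriv F [hist h \<gamma>1 t, \<psi>] (orbit t)"
definition L2 :: "real \<Rightarrow> (real \<Rightarrow>\<^sub>C (real^'n)) \<Rightarrow> real^'n" where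
  "L2 t \<psi> = iter_deriv F [hist h \<gamma>1 t, hist h \<gamma>1 t, \<psi>] (orbit t) + iter_deriv F [hist h \<gamma>2 t, \<psi>] (orbit t)"

lemma L_frechet: "L = (\<lambda>t. frechet_derivative F (at (hist h \<gamma> t)))"
  by (simp add: L_def fun_eq_iff iter_deriv.simps orbit_def)

lemma F_cont: "continuous_on S F"
  using has_derivative_continuous_on[of S F "\<lambda>x v. iter_deriv F [v] x"] iter_has_derivative[of "[]"] k
  by (auto intro: has_derivative_at_withinI)

lemma \<gamma>_cont: "continuous_on S \<gamma>"
proof -
  have "(\<Union>t. {t - h..t}) = (UNIV::real set)" using h_nonneg by (auto intro!: exI)
  then show ?thesis using \<gamma>_sol continuous_on_subset[of UNIV \<gamma> S] by (simp add: dde_solution_def)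
qed

lemma \<gamma>_per: "\<gamma> (t + T) = \<gamma> t" using \<gamma>_periodic by (simp add: periodic_def)

lemma hist_per: "(\<And>t. x (t + T) = x t) \<Longrightarrow> hist h x (t + T) = hist h x t"
  unfolding hist_def using h_nonneg by (intro restrict_state_cong) (auto simp: add.assoc add.commute[of T], metis add.assoc add.commute)

lemma orbit_per: "orbit (t + T) = orbit t"
  unfolding orbit_def by (rule hist_per) (rule \<gamma>_per)

lemma orbit_cont: "continuous_on S orbit"
  unfolding orbit_def using hist_continuous[OF h_nonneg \<gamma>_cont] continuous_on_subset by blast

lemma \<gamma>_deriv: "(\<gamma> has_vector_derivative \<gamma>1 t) (at t)"
  using \<gamma>_sol by (simp add: dde_solution_def \<gamma>1_def orbit_def)

lemma \<gamma>1_cont: "continuous_on S \<gamma>1"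
  unfolding \<gamma>1_def by (intro continuous_on_compose2[OF F_cont[of UNIV]] orbit_cont) auto

lemma \<gamma>1_per: "\<gamma>1 (t + T) = \<gamma>1 t" by (simp add: \<gamma>1_def orbit_per)

lemma orbit_deriv: "(orbit has_vector_derivative hist h \<gamma>1 t) (at t)"
  unfolding orbit_def by (rule hist_vector_derivative[OF h_nonneg \<gamma>_deriv \<gamma>1_cont])

lemma hist_\<gamma>1_cont: "continuous_on S (hist h \<gamma>1)"
  using hist_continuous[OF h_nonneg \<gamma>1_cont] continuous_on_subset by blast

lemma \<gamma>1_deriv: "(\<gamma>1 has_vector_derivative \<gamma>2 t) (at t)"
proof -
  have eq: "\<gamma>1 = (\<lambda>s. F (orbit s))" by (simp add: fun_eq_iff \<gamma>1_def)
  have "((\<lambda>s. F (orbit s)) has_vector_derivative \<gamma>2 t) (at t)"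
    unfolding \<gamma>2_def using iter_vector_derivative[of "[]" orbit, OF _ orbit_deriv[of t]] k by simp
  then show ?thesis by (subst eq)
qed

lemma iter1_cont:
  "continuous_on S x \<Longrightarrow> continuous_on S u \<Longrightarrow> continuous_on S (\<lambda>s. iter_deriv F [u s] (x s))"
  unfolding continuous_on_def using k by (auto intro: tendsto_iter1)

lemma iter2_cont:
  "continuous_on S x \<Longrightarrow> continuous_on S u \<Longrightarrow> continuous_on S v \<Longrightarrow> continuous_on S (\<lambda>s. iter_deriv F [u s, v s] (x s))"
  unfolding continuous_on_def using k by (auto intro: tendsto_iter2)

lemma iter3_cont:
  "continuous_on S x \<Longrightarrow> continuous_on S u \<Longrightarrow> continuous_on S v \<Longrightarrow> continuous_on S w \<Longrightarrow>
    continuous_on S (\<lambda>s. iter_deriv F [u s, v s, w s] (x s))"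
  unfolding continuous_on_def using k by (auto intro: tendsto_iter3)

lemma \<gamma>2_cont: "continuous_on S \<gamma>2"
  unfolding \<gamma>2_def by (intro iter1_cont orbit_cont hist_\<gamma>1_cont)

lemma \<gamma>2_per: "\<gamma>2 (t + T) = \<gamma>2 t"
  by (simp add: \<gamma>2_def orbit_per hist_per[of \<gamma>1, OF \<gamma>1_per])

lemma hist_\<gamma>2_cont: "continuous_on S (hist h \<gamma>2)"
  using hist_continuous[OF h_nonneg \<gamma>2_cont] continuous_on_subset by blast

lemma compact_orbit: "compact (range orbit)"
proof -
  have "range orbit \<subseteq> orbit ` {0..T}"
  proof
    fix x assume "x \<in> range orbit"
    then obtain t where t: "x = orbit t" by auto
    obtain s where "s \<in> {0..T}" "orbit t = orbit s"
      by (rule periodic_reduce[of orbit T t, OF orbit_per T_pos])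
    then show "x \<in> orbit ` {0..T}" using t by auto
  qed
  then have "range orbit = orbit ` {0..T}" by auto
  then show ?thesis using compact_continuous_image[OF orbit_cont compact_Icc] by metis
qed

lemma bounds_exist:
  "\<exists>M. \<forall>t \<psi>. norm (L t \<psi>) \<le> M * norm \<psi> \<and> norm (L1 t \<psi>) \<le> M * norm \<psi> \<and> norm (L2 t \<psi>) \<le> M * norm \<psi>"
proof -
  obtain C1 where C1: "C1 \<ge> 0" "\<And>t vs. length vs = 1 \<Longrightarrow> norm (iter_deriv F vs (orbit t)) \<le> C1 * prod_list (map norm vs)"
    using iter_bounded_compact[OF compact_orbit, of 1] k by auto
  obtain C2 where C2: "C2 \<ge> 0" "\<And>t vs. length vs = 2 \<Longrightarrow> norm (iter_deriv F vs (orbit t)) \<le> C2 * prod_list (map norm vs)"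
    using iter_bounded_compact[OF compact_orbit, of 2] k by auto
  obtain C3 where C3: "C3 \<ge> 0" "\<And>t vs. length vs = 3 \<Longrightarrow> norm (iter_deriv F vs (orbit t)) \<le> C3 * prod_list (map norm vs)"
    using iter_bounded_compact[OF compact_orbit, of 3] k by auto
  obtain A where A: "A > 0" "\<And>t. norm (hist h \<gamma>1 t) \<le> A"
    using periodic_bounded[OF hist_\<gamma>1_cont _ T_pos] hist_per[of \<gamma>1, OF \<gamma>1_per] by metis
  obtain B where B: "B > 0" "\<And>t. norm (hist h \<gamma>2 t) \<le> B"
    using periodic_bounded[OF hist_\<gamma>2_cont _ T_pos] hist_per[of \<gamma>2, OF \<gamma>2_per] by metis
  have 1: "norm (L t \<psi>) \<le> C1 * norm \<psi>" for t \<psi>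
    using C1(2)[of "[\<psi>]" t] by (simp add: L_def)
  have 2: "norm (L1 t \<psi>) \<le> C2 * A * norm \<psi>" for t \<psi>
  proof -
    have "norm (L1 t \<psi>) \<le> C2 * (norm (hist h \<gamma>1 t) * norm \<psi>)"
      using C2(2)[of "[hist h \<gamma>1 t, \<psi>]" t] by (simp add: L1_def)
    also have "\<dots> \<le> C2 * (A * norm \<psi>)" using A C2 by (intro mult_left_mono mult_right_mono) auto
    finally show ?thesis by (simp add: mult.assoc)
  qed
  have 3: "norm (L2 t \<psi>) \<le> (C3 * A * A + C2 * B) * norm \<psi>" for t \<psi>
  proof -
    have "norm (L2 t \<psi>) \<le> C3 * (norm (hist h \<gamma>1 t) * (norm (hist h \<gamma>1 t) * norm \<psi>)) + C2 * (norm (hist h \<gamma>2 t) * norm \<psi>)"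
      unfolding L2_def
      by (rule order_trans[OF norm_triangle_ineq add_mono])
        (use C3(2)[of "[hist h \<gamma>1 t, hist h \<gamma>1 t, \<psi>]" t] C2(2)[of "[hist h \<gamma>2 t, \<psi>]" t] in auto)
    also have "\<dots> \<le> C3 * (A * (A * norm \<psi>)) + C2 * (B * norm \<psi>)"
      using A B C2 C3 by (intro add_mono mult_left_mono mult_mono mult_right_mono) auto
    finally show ?thesis by (simp add: algebra_simps)
  qed
  let ?M = "C1 + C2 * A + (C3 * A * A + C2 * B)"
  have "0 \<le> C2 * A" "0 \<le> C3 * A * A + C2 * B" using C2 C3 A B by auto
  then have "C1 * norm \<psi> \<le> ?M * norm \<psi>" "C2 * A * norm \<psi> \<le> ?M * norm \<psi>" "(C3 * A * A + C2 * B) * norm \<psi> \<le> ?M * norm \<psi>"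
    for \<psi> :: "real \<Rightarrow>\<^sub>C (real^'n)"
    using C1(1) by (auto intro!: mult_right_mono)
  then show ?thesis using 1 2 3 order_trans by (intro exI[of _ ?M]) blast
qed

text \<open>A bound of the three families of functionals, uniform in time.\<close>

definition bnd :: real where
  "bnd = (SOME M. \<forall>t \<psi>. norm (L t \<psi>) \<le> M * norm \<psi> \<and> norm (L1 t \<psi>) \<le> M * norm \<psi> \<and> norm (L2 t \<psi>) \<le> M * norm \<psi>)"

lemma bnd: "norm (L t \<psi>) \<le> bnd * norm \<psi>" "norm (L1 t \<psi>) \<le> bnd * norm \<psi>" "norm (L2 t \<psi>) \<le> bnd * norm \<psi>"
  using someI_ex[OF bounds_exist] unfolding bnd_def[symmetric] by blast+

lemma iter_linear_snd:
  shows "linear (\<lambda>\<psi>. iter_deriv F [u, \<psi>] x)" "linear (\<lambda>\<psi>. iter_deriv F [u, v, \<psi>] x)"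
  using iter_add[of "[u]" "[]"] iter_scaleR[of "[u]" "[]"] iter_add[of "[u, v]" "[]"] iter_scaleR[of "[u, v]" "[]"] k
  by (auto intro!: linearI)

end

sublocale periodic_dde \<subseteq> delay_kernel h T bnd \<zeta> L L1 L2
proof (rule delay_kernel.intro)
  show "represents_kernel h T \<zeta> L" unfolding L_frechet by (rule \<zeta>_rep)
  fix t :: real and \<psi> :: "real \<Rightarrow>\<^sub>C (real^'n)"
  show "linear (L t)" unfolding L_def using iter_linear[of "[]"] k by simp
  show "linear (L1 t)" unfolding L1_def by (rule iter_linear_snd)
  show "linear (L2 t)" unfolding L2_def by (intro linear_compose_add iter_linear_snd)
  show "((\<lambda>s. L s \<psi>) has_vector_derivative L1 t \<psi>) (at t)"
    unfolding L_def L1_def using iter_vector_derivative[of "[\<psi>]" orbit, OF _ orbit_deriv[of t]] k by simp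
  show "((\<lambda>s. L1 s \<psi>) has_vector_derivative L2 t \<psi>) (at t)"
    unfolding L1_def L2_def
    using iter_head_vector_derivative[OF _ orbit_deriv[of t] hist_vector_derivative[OF h_nonneg \<gamma>1_deriv \<gamma>2_cont, of t], of "[\<psi>]"] k by simp
  show "continuous_on UNIV (\<lambda>s. L2 s \<psi>)"
    unfolding L2_def by (intro continuous_on_add iter3_cont iter2_cont orbit_cont hist_\<gamma>1_cont hist_\<gamma>2_cont continuous_on_const)
  show "L (t + T) = L t" by (simp add: L_def orbit_per fun_eq_iff)
  show "L1 (t + T) = L1 t" by (simp add: L1_def orbit_per hist_per[of \<gamma>1, OF \<gamma>1_per] fun_eq_iff)
qed (use h_pos T_pos bnd in auto)

context periodic_dde begin

lemma bnd_pos: "0 < bnd + 1" using M0 by simp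

text \<open>Solutions of the linearized equation on the whole line.\<close>

definition lin_sol :: "(real \<Rightarrow> real^'n) \<Rightarrow> bool" where
  "lin_sol q \<longleftrightarrow> (\<forall>t. (q has_vector_derivative L t (hist h q t)) (at t))"

lemma lin_sol_deriv: "lin_sol q \<Longrightarrow> (q has_vector_derivative L t (hist h q t)) (at t)"
  by (simp add: lin_sol_def)

lemma lin_sol_cont: "lin_sol q \<Longrightarrow> continuous_on S q"
  by (intro continuous_at_imp_continuous_on ballI has_vector_derivative_continuous[OF lin_sol_deriv])

lemma lin_sol_\<gamma>1: "lin_sol \<gamma>1"
  using \<gamma>1_deriv by (simp add: lin_sol_def L_def \<gamma>2_def)

lemma hist_zero: "hist h (\<lambda>_. 0 :: real^'n) t = 0"
  by (rule bcontfun_eqI) (simp add: hist_apply h_nonneg)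

lemma lin_sol_zero: "lin_sol (\<lambda>_. 0)"
  by (simp add: lin_sol_def hist_zero linear_0[OF linear(1)])

lemma hist_lin_sol_cont: "lin_sol q \<Longrightarrow> continuous_on S (hist h q)"
  using hist_continuous[OF h_nonneg lin_sol_cont] continuous_on_subset by blast

lemma lin_sol_deriv_cont: "lin_sol q \<Longrightarrow> continuous_on S (\<lambda>t. L t (hist h q t))"
  by (intro L_cont hist_lin_sol_cont)

text \<open>Equivalently, \<open>\<Delta>(0) q' = B(\<phi>, \<gamma>')\<close> for \<open>\<phi> = q\<^sub>t\<close>.\<close>

lemma lin_sol_second_deriv:
  assumes q: "lin_sol q"
  shows "((\<lambda>t. L t (hist h q t)) has_vector_derivative
     (iter_deriv F [hist h q t, hist h \<gamma>1 t] (orbit t) + L t (hist h (\<lambda>t. L t (hist h q t)) t))) (at t)"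
proof -
  have "(hist h q has_vector_derivative hist h (\<lambda>t. L t (hist h q t)) t) (at t)"
    by (rule hist_vector_derivative[OF h_nonneg lin_sol_deriv[OF q] lin_sol_deriv_cont[OF q]])
  from iter_head_vector_derivative[OF _ orbit_deriv[of t] this, of "[]"] k
  have "((\<lambda>t. L t (hist h q t)) has_vector_derivative
     (iter_deriv F [hist h \<gamma>1 t, hist h q t] (orbit t) + L t (hist h (\<lambda>t. L t (hist h q t)) t))) (at t)"
    by (simp add: L_def)
  then show ?thesis using iter2_commute[of "hist h \<gamma>1 t" "hist h q t" "orbit t"] k by simp
qed

lemma linear_unique:
  assumes y: "continuous_on {s - h..} y1" "continuous_on {s - h..} y2"
    and d: "\<And>u. u \<ge> s \<Longrightarrow> (y1 has_vector_derivative L u (hist h y1 u)) (at u within {s..})"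
      "\<And>u. u \<ge> s \<Longrightarrow> (y2 has_vector_derivative L u (hist h y2 u)) (at u within {s..})"
    and eq: "\<And>\<theta>. \<theta> \<in> {-h..0} \<Longrightarrow> y1 (s + \<theta>) = y2 (s + \<theta>)" and t: "t \<ge> s - h"
  shows "y1 t = y2 t"
proof (cases "t \<le> s")
  case True
  then show ?thesis using eq[of "t - s"] t by simp
next
  case False
  have sub: "continuous_on {u - h..u} y1" "continuous_on {u - h..u} y2" if "u \<ge> s" for u
    using that by (auto intro: continuous_on_subset[OF y(1)] continuous_on_subset[OF y(2)])
  have "(\<lambda>u. y1 u - y2 u) t = 0"
  proof (rule delay_gronwall[OF h_nonneg, where s = s and b = t and C = "bnd + 1" and z' = "\<lambda>u. L u (hist h y1 u) - L u (hist h y2 u)"])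
    show "continuous_on {s - h..t} (\<lambda>u. y1 u - y2 u)"
      by (intro continuous_on_diff continuous_on_subset[OF y(1)] continuous_on_subset[OF y(2)]) auto
    fix u assume u: "u \<in> {s..t}"
    show "((\<lambda>u. y1 u - y2 u) has_vector_derivative L u (hist h y1 u) - L u (hist h y2 u)) (at u within {s..t})"
      by (intro has_vector_derivative_diff has_vector_derivative_within_subset[OF d(1)] has_vector_derivative_within_subset[OF d(2)]) (use u in auto)
    have "L u (hist h y1 u) - L u (hist h y2 u) = L u (hist h (\<lambda>u. y1 u - y2 u) u)"
      using sub[of u] u by (simp add: hist_diff h_nonneg linear_diff[OF linear(1)])
    then have "norm (L u (hist h y1 u) - L u (hist h y2 u)) \<le> bnd * norm (hist h (\<lambda>u. y1 u - y2 u) u)"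
      using bnd(1) by simp
    also have "\<dots> \<le> (bnd + 1) * norm (hist h (\<lambda>u. y1 u - y2 u) u)" by (intro mult_right_mono) auto
    finally show "norm (L u (hist h y1 u) - L u (hist h y2 u)) \<le> (bnd + 1) * norm (hist h (\<lambda>u. y1 u - y2 u) u)" .
  next
    fix u assume "u \<in> {s - h..s}"
    then show "y1 u - y2 u = 0" using eq[of "u - s"] by simp
  qed (use False bnd_pos in auto)
  then show ?thesis by simp
qed

lemma evolution_lin_sol:
  assumes q: "lin_sol q" and t: "t \<ge> s"
  shows "evolution h L t s (hist h q s) = hist h q t"
  unfolding evolution_def
proof (rule the_equality)
  have ap: "apply_bcontfun (hist h q s) \<theta> = q (s + \<theta>)" if "\<theta> \<in> {-h..0}" for \<theta>
    using that by (simp add: hist_apply[OF h_nonneg lin_sol_cont[OF q]])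
  show "\<exists>y. continuous_on {s - h..} y \<and> (\<forall>\<theta>\<in>{- h..0}. y (s + \<theta>) = hist h q s \<theta>) \<and>
      (\<forall>u\<ge>s. (y has_vector_derivative L u (hist h y u)) (at u within {s..})) \<and> hist h q t = hist h y t"
    by (intro exI[of _ q]) (use ap in \<open>auto intro: lin_sol_cont[OF q] has_vector_derivative_at_within lin_sol_deriv[OF q]\<close>)
  fix \<psi>
  assume "\<exists>y. continuous_on {s - h..} y \<and> (\<forall>\<theta>\<in>{- h..0}. y (s + \<theta>) = hist h q s \<theta>) \<and>
      (\<forall>u\<ge>s. (y has_vector_derivative L u (hist h y u)) (at u within {s..})) \<and> \<psi> = hist h y t"
  then obtain y where y: "continuous_on {s - h..} y" "\<And>\<theta>. \<theta> \<in> {- h..0} \<Longrightarrow> y (s + \<theta>) = hist h q s \<theta>"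
      "\<And>u. u \<ge> s \<Longrightarrow> (y has_vector_derivative L u (hist h y u)) (at u within {s..})" "\<psi> = hist h y t" by auto
  have "y u = q u" if "u \<ge> s - h" for u
    by (rule linear_unique[OF y(1) lin_sol_cont[OF q] y(3)])
      (use y(2) ap that in \<open>auto intro: has_vector_derivative_at_within lin_sol_deriv[OF q]\<close>)
  then show "\<psi> = hist h q t" unfolding y(4) using t h_nonneg by (intro hist_cong) auto
qed

lemma eventually_large: "\<exists>n::nat. s \<le> t + real n * T"
proof -
  obtain n :: nat where "(s - t) / T \<le> real n" using real_arch_simple by blast
  then have "s \<le> t + real n * T" using T_pos by (simp add: field_simps)
  then show ?thesis ..
qed

text \<open>A solution that vanishes on one history interval vanishes afterwards, and by periodicity of its norm
  everywhere.\<close>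

lemma lin_sol_vanishing:
  assumes q: "lin_sol q" and per: "\<And>t. norm (q (t + T)) = norm (q t)" and z: "hist h q s = 0"
  shows "q t = 0"
proof -
  have zero: "q u = 0" if "u \<ge> s" for u
  proof (rule linear_unique[where ?y1.0 = q and ?y2.0 = "\<lambda>_. 0" and s = s])
    fix \<theta> assume "\<theta> \<in> {-h..0}"
    then have "q (s + \<theta>) = apply_bcontfun (hist h q s) \<theta>" by (simp add: hist_apply[OF h_nonneg lin_sol_cont[OF q]])
    then show "q (s + \<theta>) = 0" using z by simp
  qed (use that h_nonneg lin_sol_zero in \<open>auto intro: lin_sol_cont[OF q] has_vector_derivative_at_within lin_sol_deriv[OF q] lin_sol_deriv\<close>)
  obtain n :: nat where n: "s \<le> t + real n * T" using eventually_large by blast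
  have "norm (q t) = norm (q (t + real n * T))"
    using periodic_shift_int[of "\<lambda>t. norm (q t)" T t "int n"] per by simp
  then show ?thesis using zero[OF n] by simp
qed

text \<open>By simplicity of the multiplier 1, the \<open>T\<close>-periodic solutions of the linearization are the
  multiples of \<open>\<gamma>'\<close>.\<close>

lemma periodic_lin_sol:
  assumes simple: "simple_eigenvalue (phase_space h) (monodromy h L T s) 1"
    and w: "lin_sol w" "\<And>t. w (t + T) = w t" and nz: "\<gamma>1 t0 \<noteq> 0"
  shows "\<exists>c. \<forall>t. w t = c *\<^sub>R \<gamma>1 t"
proof -
  let ?A = "monodromy h L T s"
  have fixed: "(hist h q s, 0) \<in> gen_eigenspace (phase_space h) ?A 1" if q: "lin_sol q" "\<And>t. q (t + T) = q t" for q
  proof -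
    have "?A (hist h q s) = hist h q s"
      using evolution_lin_sol[OF q(1), of s "s + T"] T_pos hist_per[of q s, OF q(2)] by (simp add: monodromy_def)
    moreover have "?A 0 = 0"
      using evolution_lin_sol[OF lin_sol_zero, of s "s + T"] T_pos by (simp add: monodromy_def hist_zero)
    moreover have "hist h q s \<in> phase_space h" by (rule hist_mem[OF h_nonneg lin_sol_cont[OF q(1)]])
    moreover have "0 \<in> phase_space h" by (simp add: phase_space_iff[OF h_nonneg])
    ultimately show ?thesis
      by (auto simp: gen_eigenspace_def complexify_def cscale_def zero_prod_def intro!: exI[of _ "Suc 0"])
  qed
  obtain e where e: "gen_eigenspace (phase_space h) ?A 1 = range (\<lambda>z. cscale z e)"
    using simple by (auto simp: simple_eigenvalue_def)
  obtain z1 where z1: "(hist h \<gamma>1 s, 0) = cscale z1 e" using fixed[OF lin_sol_\<gamma>1 \<gamma>1_per] unfolding e by blast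
  obtain z2 where z2: "(hist h w s, 0) = cscale z2 e" using fixed[OF w] unfolding e by blast
  have nz1: "hist h \<gamma>1 s \<noteq> 0" using lin_sol_vanishing[OF lin_sol_\<gamma>1, of s t0] \<gamma>1_per nz by auto
  have "z1 \<noteq> 0" using z1 nz1 by (auto simp: cscale_def)
  have comp: "cscale a (cscale b e) = cscale (a * b) e" for a b
    by (simp add: cscale_def algebra_simps)
  have "(hist h w s, 0) = cscale (z2 / z1) (hist h \<gamma>1 s, 0)"
    unfolding z1 comp using z2 \<open>z1 \<noteq> 0\<close> by simp
  then have c: "hist h w s = Re (z2 / z1) *\<^sub>R hist h \<gamma>1 s" by (simp add: cscale_def)
  let ?c = "Re (z2 / z1)"
  have sol: "lin_sol (\<lambda>t. w t - ?c *\<^sub>R \<gamma>1 t)"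
    unfolding lin_sol_def
  proof
    fix t
    have "hist h (\<lambda>t. w t - ?c *\<^sub>R \<gamma>1 t) t = hist h w t - ?c *\<^sub>R hist h \<gamma>1 t"
      by (simp add: hist_diff hist_scaleR h_nonneg lin_sol_cont[OF w(1)] \<gamma>1_cont continuous_on_scaleR)
    then have "L t (hist h (\<lambda>t. w t - ?c *\<^sub>R \<gamma>1 t) t) = L t (hist h w t) - ?c *\<^sub>R L t (hist h \<gamma>1 t)"
      by (simp add: linear_diff[OF linear(1)] linear_scale[OF linear(1)])
    moreover have "((\<lambda>t. w t - ?c *\<^sub>R \<gamma>1 t) has_vector_derivative L t (hist h w t) - ?c *\<^sub>R L t (hist h \<gamma>1 t)) (at t)"
      by (intro has_vector_derivative_diff bounded_linear.has_vector_derivative[OF bounded_linear_scaleR_right] lin_sol_deriv w(1) lin_sol_\<gamma>1)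
    ultimately show "((\<lambda>t. w t - ?c *\<^sub>R \<gamma>1 t) has_vector_derivative L t (hist h (\<lambda>t. w t - ?c *\<^sub>R \<gamma>1 t) t)) (at t)" by simp
  qed
  have z: "hist h (\<lambda>t. w t - ?c *\<^sub>R \<gamma>1 t) s = 0"
    by (simp add: hist_diff hist_scaleR h_nonneg lin_sol_cont[OF w(1)] \<gamma>1_cont continuous_on_scaleR c)
  have "w t - ?c *\<^sub>R \<gamma>1 t = 0" for t
    by (rule lin_sol_vanishing[OF sol _ z]) (simp only: w(2) \<gamma>1_per)
  then have "w t = ?c *\<^sub>R \<gamma>1 t" for t by (simp only: right_minus_eq)
  then show ?thesis by blast
qed

lemma orbit_lipschitz: "\<exists>C>0. \<forall>s t. norm (F (orbit s) - F (orbit t)) \<le> C * norm (orbit s - orbit t)"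
proof -
  obtain \<rho> C where \<rho>: "\<rho> > 0" and C0: "C \<ge> 0" and lip: "\<forall>x\<in>range orbit. \<forall>y\<in>ball x \<rho>. \<forall>z\<in>ball x \<rho>. norm (F y - F z) \<le> C * norm (y - z)"
    using lipschitz_near_compact[OF compact_orbit] k by force
  have C: "C \<ge> 0" "\<And>x y z. x \<in> range orbit \<Longrightarrow> y \<in> ball x \<rho> \<Longrightarrow> z \<in> ball x \<rho> \<Longrightarrow> norm (F y - F z) \<le> C * norm (y - z)"
    using C0 lip by blast+
  obtain A where A: "A > 0" "\<And>t. norm (\<gamma>1 t) \<le> A" using periodic_bounded[OF \<gamma>1_cont _ T_pos] \<gamma>1_per by metis
  have "norm (F (orbit s) - F (orbit t)) \<le> (C + 2 * A / \<rho> + 1) * norm (orbit s - orbit t)" for s t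
  proof (cases "norm (orbit s - orbit t) < \<rho>")
    case True
    then have "norm (F (orbit s) - F (orbit t)) \<le> C * norm (orbit s - orbit t)"
      using C(2)[of "orbit t" "orbit s" "orbit t"] \<rho> by (simp add: dist_norm norm_minus_commute)
    also have "\<dots> \<le> (C + 2 * A / \<rho> + 1) * norm (orbit s - orbit t)" using A \<rho> by (intro mult_right_mono) auto
    finally show ?thesis .
  next
    case False
    have "norm (F (orbit s) - F (orbit t)) \<le> 2 * A"
      using A(2)[of s] A(2)[of t] norm_triangle_ineq4[of "F (orbit s)" "F (orbit t)"] by (simp add: \<gamma>1_def)
    also have "\<dots> = 2 * A / \<rho> * \<rho>" using \<rho> by simp
    also have "\<dots> \<le> (C + 2 * A / \<rho> + 1) * norm (orbit s - orbit t)"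
      using False C A \<rho> by (intro mult_mono) auto
    finally show ?thesis .
  qed
  moreover have "C + 2 * A / \<rho> + 1 > 0" using C A \<rho> by (simp add: add_nonneg_pos)
  ultimately show ?thesis by blast
qed

text \<open>If the orbit returns to its initial state at time \<open>s\<close>, then \<open>s\<close> is a period of \<open>\<gamma>\<close>.\<close>

lemma orbit_inject:
  assumes eq: "orbit s = orbit 0" shows "\<gamma> (t + s) = \<gamma> t"
proof -
  obtain C where C: "C > 0" "\<And>s t. norm (F (orbit s) - F (orbit t)) \<le> C * norm (orbit s - orbit t)"
    using orbit_lipschitz by blast
  have shift: "hist h (\<lambda>u. \<gamma> (u + s)) u = orbit (u + s)" for u
    unfolding orbit_def hist_def by (rule restrict_state_cong[OF h_nonneg]) (simp add: algebra_simps)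
  have c: "continuous_on S (\<lambda>u. \<gamma> (u + s))" for S
    by (rule continuous_on_compose2[OF \<gamma>_cont[of UNIV]]) (auto intro!: continuous_intros)
  have ge: "\<gamma> (u + s) = \<gamma> u" if u: "u \<ge> 0" for u
  proof -
    have "(\<lambda>u. \<gamma> (u + s) - \<gamma> u) u = 0"
    proof (rule delay_gronwall[OF h_nonneg, where s = 0 and b = u and C = C and z' = "\<lambda>u. \<gamma>1 (u + s) - \<gamma>1 u"])
      show "continuous_on {0 - h..u} (\<lambda>u. \<gamma> (u + s) - \<gamma> u)" by (intro continuous_on_diff c \<gamma>_cont)
      fix v
      have "((\<lambda>u. \<gamma> (u + s)) has_vector_derivative \<gamma>1 (v + s)) (at v)"
      proof -
        have "((\<lambda>u. u + s) has_vector_derivative 1) (at v)" by (auto intro!: derivative_eq_intros)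
        from vector_diff_chain_at[OF this \<gamma>_deriv] show ?thesis by (simp add: o_def)
      qed
      from has_vector_derivative_diff[OF this \<gamma>_deriv[of v]]
      show "((\<lambda>u. \<gamma> (u + s) - \<gamma> u) has_vector_derivative \<gamma>1 (v + s) - \<gamma>1 v) (at v within {0..u})"
        by (rule has_vector_derivative_at_within)
      have "hist h (\<lambda>u. \<gamma> (u + s) - \<gamma> u) v = orbit (v + s) - orbit v"
        using hist_diff[OF h_nonneg c \<gamma>_cont, of v] unfolding shift by (simp add: orbit_def)
      then show "norm (\<gamma>1 (v + s) - \<gamma>1 v) \<le> C * norm (hist h (\<lambda>u. \<gamma> (u + s) - \<gamma> u) v)"
        using C(2)[of "v + s" v] by (simp add: \<gamma>1_def)
    next
      fix v assume v: "v \<in> {0 - h..0}"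
      have "orbit s v = orbit 0 v" by (simp add: eq)
      then show "\<gamma> (v + s) - \<gamma> v = 0"
        using v by (simp add: orbit_def hist_apply h_nonneg \<gamma>_cont add.commute)
    qed (use u C in auto)
    then show ?thesis by simp
  qed
  obtain n :: nat where n: "0 \<le> t + real n * T" using eventually_large by blast
  have "\<gamma> (t + s) = \<gamma> (t + s + real n * T)" "\<gamma> t = \<gamma> (t + real n * T)"
    using periodic_shift_int[of \<gamma> T "t + s" "int n"] periodic_shift_int[of \<gamma> T t "int n"] \<gamma>_per by auto
  then show ?thesis using ge[OF n] by (simp add: algebra_simps)
qed

end

section \<open>Trajectories on the center manifold\<close>

lemma bounded_linear_apply_bcontfun:
  "bounded_linear (\<lambda>\<phi> :: 'a::topological_space \<Rightarrow>\<^sub>C 'b::real_normed_vector. apply_bcontfun \<phi> \<theta>)"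
  by (rule bounded_linear_intro[of _ 1]) (auto simp: norm_bounded)

lemma small_growth:
  fixes \<xi> \<xi>' :: "real \<Rightarrow> real"
  assumes \<xi>: "\<And>t. t \<in> {\<alpha>..\<beta>} \<Longrightarrow> (\<xi> has_real_derivative \<xi>' t) (at t within {\<alpha>..\<beta>})"
    and le: "\<And>t. t \<in> {\<alpha>..\<beta>} \<Longrightarrow> \<bar>\<xi>' t\<bar> \<le> m * \<bar>\<xi> t\<bar>" and m: "0 \<le> m" "m * (\<beta> - \<alpha>) \<le> 1/2"
    and s: "s \<in> {\<alpha>..\<beta>}" and t: "t \<in> {\<alpha>..\<beta>}"
  shows "\<bar>\<xi> t\<bar> \<le> 2 * \<bar>\<xi> s\<bar>"
proof -
  have "continuous_on {\<alpha>..\<beta>} (\<lambda>t. \<bar>\<xi> t\<bar>)"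
    by (intro continuous_on_rabs DERIV_continuous_on[OF \<xi>])
  moreover have "{\<alpha>..\<beta>} \<noteq> {}" using s by auto
  ultimately obtain u where u: "u \<in> {\<alpha>..\<beta>}" "\<And>t. t \<in> {\<alpha>..\<beta>} \<Longrightarrow> \<bar>\<xi> t\<bar> \<le> \<bar>\<xi> u\<bar>"
    using continuous_attains_sup[of "{\<alpha>..\<beta>}" "\<lambda>t. \<bar>\<xi> t\<bar>"] compact_Icc by metis
  have "norm (\<xi> u - \<xi> s) \<le> (m * \<bar>\<xi> u\<bar>) * norm (u - s)"
  proof (rule field_differentiable_bound[of "{\<alpha>..\<beta>}"])
    fix z assume z: "z \<in> {\<alpha>..\<beta>}"
    show "(\<xi> has_real_derivative \<xi>' z) (at z within {\<alpha>..\<beta>})" by (rule \<xi>[OF z])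
    show "norm (\<xi>' z) \<le> m * \<bar>\<xi> u\<bar>" using le[OF z] u(2)[OF z] m(1) by (simp add: order_trans[OF _ mult_left_mono])
  qed (use u s in auto)
  also have "\<dots> \<le> (m * \<bar>\<xi> u\<bar>) * (\<beta> - \<alpha>)" using u(1) s m(1) by (intro mult_left_mono) auto
  also have "\<dots> = m * (\<beta> - \<alpha>) * \<bar>\<xi> u\<bar>" by simp
  also have "\<dots> \<le> 1/2 * \<bar>\<xi> u\<bar>" using m(2) by (intro mult_right_mono) auto
  finally have "\<bar>\<xi> u - \<xi> s\<bar> \<le> \<bar>\<xi> u\<bar> / 2" by simp
  then have "\<bar>\<xi> u\<bar> \<le> 2 * \<bar>\<xi> s\<bar>" by linarith
  then show ?thesis using u(2)[OF t] by linarith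
qed

text \<open>The parametrized center manifold with the dynamics of the normal form. The constants \<open>KH\<close>, \<open>K1\<close>,
  \<open>K2\<close> belong to the fourth order remainders of \<open>H\<close>, of \<open>\<tau>'\<close> and of \<open>\<xi>'\<close>.\<close>

locale pd_setting = periodic_dde h T k F \<gamma> \<zeta>
  for h T :: real and k :: nat and F :: "(real \<Rightarrow>\<^sub>C (real^'n)) \<Rightarrow> real^'n" and \<gamma> \<zeta> +
  fixes a c \<delta> KH K1 K2 :: real and q :: "real \<Rightarrow> real^'n"
    and W :: "(real \<Rightarrow>\<^sub>C (real^'n)) set" and H :: "real \<Rightarrow> real \<Rightarrow> (real \<Rightarrow>\<^sub>C (real^'n))"
    and h2 h3 :: "real \<Rightarrow> (real \<Rightarrow>\<^sub>C (real^'n))" and \<rho>1 \<rho>2 :: "real \<Rightarrow> real \<Rightarrow> real"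
  assumes q_sol: "lin_sol q" and q_anti: "q (t + T) = - q t" and q_nz: "\<exists>t. q t \<noteq> 0"
    and \<gamma>1_nz: "\<exists>t. \<gamma>1 t \<noteq> 0"
    and W_sub: "W \<subseteq> phase_space h" and W_inv: "locally_positively_invariant h F (range (hist h \<gamma>)) W"
    and \<delta>: "0 < \<delta>" and H_mem: "\<bar>\<xi>\<bar> < \<delta> \<Longrightarrow> H \<tau> \<xi> \<in> W"
    and H_cont: "continuous_on (UNIV \<times> {-\<delta><..<\<delta>}) (\<lambda>(\<tau>, \<xi>). H \<tau> \<xi>)"
    and H_exp: "\<bar>\<xi>\<bar> < \<delta> \<Longrightarrow>
          norm (H \<tau> \<xi> - (hist h \<gamma> \<tau> + \<xi> *\<^sub>R hist h q \<tau> + (1/2 * \<xi>\<^sup>2) *\<^sub>R h2 \<tau> + (1/6 * \<xi> ^ 3) *\<^sub>R h3 \<tau>)) \<le> KH * \<xi> ^ 4"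
    and H_per: "\<bar>\<xi>\<bar> < \<delta> \<Longrightarrow> H (\<tau> + 2 * T) \<xi> = H \<tau> \<xi>"
    and H_sym: "\<bar>\<xi>\<bar> < \<delta> \<Longrightarrow> H \<tau> \<xi> = H (\<tau> + T) (- \<xi>)"
    and dyn: "pd_normal_form_dynamics h F (range (hist h \<gamma>)) W H a c \<rho>1 \<rho>2"
    and \<rho>_per: "\<bar>\<xi>\<bar> < \<delta> \<Longrightarrow> \<rho>1 (\<tau> + 2 * T) \<xi> = \<rho>1 \<tau> \<xi>" "\<bar>\<xi>\<bar> < \<delta> \<Longrightarrow> \<rho>2 (\<tau> + 2 * T) \<xi> = \<rho>2 \<tau> \<xi>"
    and \<rho>_bound: "\<bar>\<xi>\<bar> < \<delta> \<Longrightarrow> \<bar>\<rho>1 \<tau> \<xi>\<bar> \<le> K1 * \<xi> ^ 4" "\<bar>\<xi>\<bar> < \<delta> \<Longrightarrow> \<bar>\<rho>2 \<tau> \<xi>\<bar> \<le> K2 * \<xi> ^ 4"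
    and K_nonneg: "0 \<le> KH" "0 \<le> K1" "0 \<le> K2"
begin

abbreviation \<phi> :: "real \<Rightarrow> (real \<Rightarrow>\<^sub>C (real^'n))" where "\<phi> \<equiv> hist h q"

lemma H_zero: "H \<tau> 0 = orbit \<tau>"
  using H_exp[of 0 \<tau>] \<delta> by (simp add: orbit_def)

lemma H_first_order: "\<exists>C. \<forall>\<xi>. \<bar>\<xi>\<bar> < \<delta> \<longrightarrow> norm (H \<tau> \<xi> - orbit \<tau> - \<xi> *\<^sub>R \<phi> \<tau>) \<le> C * \<xi>\<^sup>2"
proof (intro exI[of _ "norm (h2 \<tau>) + \<delta> * norm (h3 \<tau>) + KH * \<delta>\<^sup>2"] allI impI)
  fix \<xi> assume \<xi>: "\<bar>\<xi>\<bar> < \<delta>"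
  have e: "H \<tau> \<xi> - orbit \<tau> - \<xi> *\<^sub>R \<phi> \<tau> = (H \<tau> \<xi> - (hist h \<gamma> \<tau> + \<xi> *\<^sub>R hist h q \<tau> + (1/2 * \<xi>\<^sup>2) *\<^sub>R h2 \<tau> + (1/6 * \<xi> ^ 3) *\<^sub>R h3 \<tau>))
     + (1/2 * \<xi>\<^sup>2) *\<^sub>R h2 \<tau> + (1/6 * \<xi> ^ 3) *\<^sub>R h3 \<tau>" by (simp add: orbit_def)
  have "norm (H \<tau> \<xi> - orbit \<tau> - \<xi> *\<^sub>R \<phi> \<tau>) \<le> KH * \<xi> ^ 4 + norm ((1/2 * \<xi>\<^sup>2) *\<^sub>R h2 \<tau>) + norm ((1/6 * \<xi> ^ 3) *\<^sub>R h3 \<tau>)"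
    unfolding e by (intro order_trans[OF norm_triangle_ineq] add_mono H_exp[OF \<xi>]) auto
  also have "\<dots> \<le> KH * (\<delta>\<^sup>2 * \<xi>\<^sup>2) + \<xi>\<^sup>2 * norm (h2 \<tau>) + (\<delta> * \<xi>\<^sup>2) * norm (h3 \<tau>)"
  proof (intro add_mono)
    have "\<xi> ^ 4 = \<xi>\<^sup>2 * \<xi>\<^sup>2" by (simp add: power2_eq_square power4_eq_xxxx)
    also have "\<dots> \<le> \<delta>\<^sup>2 * \<xi>\<^sup>2" using \<xi> power_mono[of "\<bar>\<xi>\<bar>" \<delta> 2] by (intro mult_right_mono) auto
    finally show "KH * \<xi> ^ 4 \<le> KH * (\<delta>\<^sup>2 * \<xi>\<^sup>2)" using K_nonneg by (intro mult_left_mono)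
    show "norm ((1/2 * \<xi>\<^sup>2) *\<^sub>R h2 \<tau>) \<le> \<xi>\<^sup>2 * norm (h2 \<tau>)" by (simp add: mult_right_mono)
    have "\<bar>1/6 * \<xi> ^ 3\<bar> = 1/6 * (\<bar>\<xi>\<bar> * \<xi>\<^sup>2)" by (simp add: abs_mult power3_eq_cube power2_eq_square)
    also have "\<dots> \<le> \<bar>\<xi>\<bar> * \<xi>\<^sup>2" using mult_nonneg_nonneg[OF abs_ge_zero[of \<xi>] zero_le_power2[of \<xi>]] by linarith
    also have "\<dots> \<le> \<delta> * \<xi>\<^sup>2" using \<xi> by (intro mult_right_mono) auto
    finally show "norm ((1/6 * \<xi> ^ 3) *\<^sub>R h3 \<tau>) \<le> (\<delta> * \<xi>\<^sup>2) * norm (h3 \<tau>)"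
      unfolding norm_scaleR by (intro mult_right_mono) auto
  qed
  finally show "norm (H \<tau> \<xi> - orbit \<tau> - \<xi> *\<^sub>R \<phi> \<tau>) \<le> (norm (h2 \<tau>) + \<delta> * norm (h3 \<tau>) + KH * \<delta>\<^sup>2) * \<xi>\<^sup>2"
    by (simp add: algebra_simps)
qed

text \<open>The states \<open>\<gamma>'\<close> and \<open>\<phi>\<close> are linearly independent, since one of them is periodic and the other
  one antiperiodic.\<close>

lemma independent: "\<phi> 0 \<noteq> \<kappa> *\<^sub>R hist h \<gamma>1 0"
proof
  assume eq: "\<phi> 0 = \<kappa> *\<^sub>R hist h \<gamma>1 0"
  have sol: "lin_sol (\<lambda>t. \<kappa> *\<^sub>R \<gamma>1 t)"
    unfolding lin_sol_def
  proof
    fix t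
    have "L t (hist h (\<lambda>t. \<kappa> *\<^sub>R \<gamma>1 t) t) = \<kappa> *\<^sub>R L t (hist h \<gamma>1 t)"
      by (simp add: hist_scaleR h_nonneg \<gamma>1_cont linear_scale[OF linear(1)])
    then show "((\<lambda>t. \<kappa> *\<^sub>R \<gamma>1 t) has_vector_derivative L t (hist h (\<lambda>t. \<kappa> *\<^sub>R \<gamma>1 t) t)) (at t)"
      using bounded_linear.has_vector_derivative[OF bounded_linear_scaleR_right lin_sol_deriv[OF lin_sol_\<gamma>1, of t]] by simp
  qed
  have q_eq: "q t = \<kappa> *\<^sub>R \<gamma>1 t" if t: "t \<ge> 0" for t
  proof (rule linear_unique[where ?y1.0 = q and ?y2.0 = "\<lambda>t. \<kappa> *\<^sub>R \<gamma>1 t" and s = 0])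
    fix \<theta> assume \<theta>: "\<theta> \<in> {-h..0}"
    have "apply_bcontfun (\<phi> 0) \<theta> = \<kappa> *\<^sub>R apply_bcontfun (hist h \<gamma>1 0) \<theta>" by (simp add: eq)
    then show "q (0 + \<theta>) = \<kappa> *\<^sub>R \<gamma>1 (0 + \<theta>)"
      using \<theta> by (simp add: hist_apply h_nonneg lin_sol_cont[OF q_sol] \<gamma>1_cont)
  qed (use t h_nonneg in \<open>auto intro: lin_sol_cont[OF q_sol] lin_sol_cont[OF sol] has_vector_derivative_at_within lin_sol_deriv[OF q_sol] lin_sol_deriv[OF sol]\<close>)
  have zero: "q t = 0" if t: "t \<ge> 0" for t
  proof -
    have "q (t + T) = q t" using q_eq[of t] q_eq[of "t + T"] t T_pos \<gamma>1_per[of t] by simp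
    then have "q t + q t = 0" using q_anti[of t] by simp
    then have "2 *\<^sub>R q t = 0" by (simp only: scaleR_2)
    then show ?thesis by simp
  qed
  obtain t where t: "q t \<noteq> 0" using q_nz by blast
  obtain n :: nat where n: "0 \<le> t + real n * T" using eventually_large by blast
  have "norm (q (t + real n * T)) = norm (q t)"
    using periodic_shift_int[of "\<lambda>t. norm (q t)" T t "int n"] q_anti by simp
  then show False using zero[OF n] t by simp
qed

text \<open>If \<open>H 0 \<xi>\<close> stayed on the periodic orbit for small \<open>\<xi>\<close>, say \<open>H 0 \<xi> = orbit (s \<xi>)\<close>, then \<open>s \<xi>\<close> would
  accumulate at a return time to \<open>orbit 0\<close> as \<open>\<xi> \<rightarrow> 0\<close>, and the tangent \<open>\<phi> 0\<close> would be a multiple of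
  the derivative of the orbit.\<close>

lemma leaves_orbit:
  assumes \<eta>: "0 < \<eta>"
  shows "\<exists>\<xi>. \<bar>\<xi>\<bar> < \<delta> \<and> norm (H 0 \<xi> - orbit 0) < \<eta> \<and> H 0 \<xi> \<notin> range orbit"
proof (rule ccontr)
  assume contra: "\<not> ?thesis"
  obtain C where C: "\<And>\<xi>. \<bar>\<xi>\<bar> < \<delta> \<Longrightarrow> norm (H 0 \<xi> - orbit 0 - \<xi> *\<^sub>R \<phi> 0) \<le> C * \<xi>\<^sup>2" using H_first_order by blast
  define z where "z n = \<delta> / (2 * real (Suc n))" for n
  have z: "0 < z n" "\<bar>z n\<bar> < \<delta>" for n
  proof -
    show "0 < z n" using \<delta> by (simp add: z_def)
    have "z n \<le> \<delta> / 2" unfolding z_def using \<delta> by (intro divide_left_mono) auto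
    then show "\<bar>z n\<bar> < \<delta>" using \<open>0 < z n\<close> \<delta> by simp
  qed
  have z0: "z \<longlonglongrightarrow> 0"
  proof -
    have "(\<lambda>n. (\<delta> / 2) / real (Suc n)) \<longlonglongrightarrow> 0" using LIMSEQ_Suc[OF lim_const_over_n[of "\<delta> / 2"]] by simp
    then show ?thesis by (simp add: z_def[abs_def])
  qed
  have slope: "(\<lambda>n. (H 0 (z n) - orbit 0) /\<^sub>R z n) \<longlonglongrightarrow> \<phi> 0"
  proof (rule tendsto_by_bound)
    fix n
    have "(H 0 (z n) - orbit 0) /\<^sub>R z n - \<phi> 0 = (H 0 (z n) - orbit 0 - z n *\<^sub>R \<phi> 0) /\<^sub>R z n"
      using z(1)[of n] by (simp add: scaleR_diff_right)
    then have "norm ((H 0 (z n) - orbit 0) /\<^sub>R z n - \<phi> 0) = norm (H 0 (z n) - orbit 0 - z n *\<^sub>R \<phi> 0) / z n"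
      using z(1)[of n] by (simp add: divide_inverse mult.commute)
    also have "\<dots> \<le> C * (z n)\<^sup>2 / z n" using z(1)[of n] by (intro divide_right_mono C z(2)) simp
    also have "\<dots> = C * z n" using z(1)[of n] by (simp add: power2_eq_square)
    finally show "norm ((H 0 (z n) - orbit 0) /\<^sub>R z n - \<phi> 0) \<le> C * z n" .
    show "(\<lambda>n. C * z n) \<longlonglongrightarrow> 0" using tendsto_mult[OF tendsto_const[of C] z0] by simp
  qed
  have H0: "(\<lambda>n. H 0 (z n)) \<longlonglongrightarrow> orbit 0"
  proof -
    have "(\<lambda>n. z n *\<^sub>R ((H 0 (z n) - orbit 0) /\<^sub>R z n)) \<longlonglongrightarrow> 0 *\<^sub>R \<phi> 0" by (intro tendsto_scaleR z0 slope)
    moreover have "z n *\<^sub>R ((H 0 (z n) - orbit 0) /\<^sub>R z n) = H 0 (z n) - orbit 0" for n using z(1)[of n] by simp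
    ultimately have "(\<lambda>n. H 0 (z n) - orbit 0) \<longlonglongrightarrow> 0" by simp
    then show ?thesis by (rule LIM_zero_cancel)
  qed
  then have "\<forall>\<^sub>F n in sequentially. dist (H 0 (z n)) (orbit 0) < \<eta>" by (rule tendstoD) (rule \<eta>)
  then obtain N where N: "\<And>n. n \<ge> N \<Longrightarrow> norm (H 0 (z n) - orbit 0) < \<eta>"
    by (auto simp: eventually_sequentially dist_norm)
  have "\<exists>s\<in>{0..T}. H 0 (z (n + N)) = orbit s" for n
  proof -
    have "H 0 (z (n + N)) \<in> range orbit" using contra z(2)[of "n + N"] N[of "n + N"] by auto
    then obtain t where t: "H 0 (z (n + N)) = orbit t" by auto
    obtain s where "s \<in> {0..T}" "orbit t = orbit s" by (rule periodic_reduce[of orbit T t, OF orbit_per T_pos])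
    then show ?thesis using t by auto
  qed
  then obtain s where s: "\<And>n. s n \<in> {0..T}" "\<And>n. H 0 (z (n + N)) = orbit (s n)" by metis
  obtain sl r where r: "strict_mono (r :: nat \<Rightarrow> nat)" "(s \<circ> r) \<longlonglongrightarrow> sl"
    using compact_Icc[of 0 T, unfolded compact_def] s(1) by blast
  define s' where "s' n = s (r n)" for n
  define z' where "z' n = z (r n + N)" for n
  have s': "s' \<longlonglongrightarrow> sl" using r(2) by (simp add: s'_def[abs_def] o_def)
  have sub: "(\<lambda>n. r n + N) = (\<lambda>n. n + N) \<circ> r" by auto
  have lim_sub: "f \<longlonglongrightarrow> l \<Longrightarrow> (\<lambda>n. f (r n + N)) \<longlonglongrightarrow> l" for f :: "nat \<Rightarrow> 'x::topological_space" and l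
    using LIMSEQ_subseq_LIMSEQ[OF LIMSEQ_ignore_initial_segment[of f l N] r(1)] by (simp add: o_def)
  have Hs: "H 0 (z' n) = orbit (s' n)" for n by (simp add: z'_def s'_def s(2))
  have "(\<lambda>n. orbit (s' n)) \<longlonglongrightarrow> orbit sl"
    using continuous_on_tendsto_compose[OF orbit_cont[of UNIV] s'] by simp
  moreover have "(\<lambda>n. orbit (s' n)) \<longlonglongrightarrow> orbit 0"
    using lim_sub[OF H0] unfolding Hs[symmetric] z'_def .
  ultimately have sl: "orbit sl = orbit 0" by (rule LIMSEQ_unique)
  have per_sl: "\<gamma> (t + sl) = \<gamma> t" for t by (rule orbit_inject[OF sl])
  have "orbit (t + sl) = orbit t" for t
    unfolding orbit_def hist_def
  proof (rule restrict_state_cong[OF h_nonneg])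
    fix \<theta> show "\<gamma> (t + sl + \<theta>) = \<gamma> (t + \<theta>)" using per_sl[of "t + \<theta>"] by (simp add: algebra_simps)
  qed
  then have "\<gamma>1 (t + sl) = \<gamma>1 t" for t by (simp add: \<gamma>1_def)
  then have hsl: "hist h \<gamma>1 sl = hist h \<gamma>1 0"
    unfolding hist_def by (intro restrict_state_cong[OF h_nonneg]) (simp add: add.commute)
  define D where "D n = (if s' n = sl then hist h \<gamma>1 sl else (orbit (s' n) - orbit sl) /\<^sub>R (s' n - sl))" for n
  have D: "orbit (s' n) - orbit sl = (s' n - sl) *\<^sub>R D n" for n by (simp add: D_def)
  have D_lim: "D \<longlonglongrightarrow> hist h \<gamma>1 sl"
  proof -
    let ?f = "\<lambda>y. if y = sl then hist h \<gamma>1 sl else (orbit y - orbit sl) /\<^sub>R (y - sl)"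
    have "((\<lambda>y. (orbit y - orbit sl) /\<^sub>R (y - sl)) \<longlongrightarrow> hist h \<gamma>1 sl) (at sl)"
      using orbit_deriv[of sl] by (simp add: has_vector_derivative_slope)
    then have "(?f \<longlongrightarrow> hist h \<gamma>1 sl) (at sl)"
      by (rule Lim_transform_eventually) (auto simp: eventually_at_filter)
    then have "isCont ?f sl" by (simp add: continuous_at)
    from isCont_tendsto_compose[OF this s'] show ?thesis by (simp add: D_def[abs_def])
  qed
  obtain t0 where "\<gamma>1 t0 \<noteq> 0" using \<gamma>1_nz by blast
  then have "hist h \<gamma>1 0 \<noteq> 0" using lin_sol_vanishing[OF lin_sol_\<gamma>1, of 0 t0] \<gamma>1_per by auto
  then have "\<exists>\<theta>. apply_bcontfun (hist h \<gamma>1 0) \<theta> \<noteq> 0" using bcontfun_eqI[of "hist h \<gamma>1 0" 0] by auto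
  then obtain \<theta> where \<theta>: "apply_bcontfun (hist h \<gamma>1 0) \<theta> \<noteq> 0" ..
  let ?v = "apply_bcontfun (hist h \<gamma>1 0) \<theta>"
  define u where "u n = (s' n - sl) / z' n" for n
  have uD: "(\<lambda>n. u n *\<^sub>R D n) \<longlonglongrightarrow> \<phi> 0"
  proof -
    have "u n *\<^sub>R D n = (H 0 (z' n) - orbit 0) /\<^sub>R z' n" for n
      unfolding Hs sl[symmetric] D u_def by (simp add: divide_inverse mult.commute)
    then show ?thesis using lim_sub[OF slope] by (simp add: z'_def)
  qed
  note ev = bounded_linear.tendsto[OF bounded_linear_apply_bcontfun, of _ _ _ \<theta>]
  have 1: "(\<lambda>n. u n * (D n \<theta> \<bullet> ?v)) \<longlonglongrightarrow> apply_bcontfun (\<phi> 0) \<theta> \<bullet> ?v"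
    using tendsto_inner[OF ev[OF uD] tendsto_const[of ?v]] by simp
  have 2: "(\<lambda>n. D n \<theta> \<bullet> ?v) \<longlonglongrightarrow> ?v \<bullet> ?v"
    using tendsto_inner[OF ev[OF D_lim] tendsto_const[of ?v]] by (simp add: hsl)
  have vv: "?v \<bullet> ?v \<noteq> 0" using \<theta> by simp
  define \<kappa> where "\<kappa> = apply_bcontfun (\<phi> 0) \<theta> \<bullet> ?v / (?v \<bullet> ?v)"
  have "(\<lambda>n. u n * (D n \<theta> \<bullet> ?v) / (D n \<theta> \<bullet> ?v)) \<longlonglongrightarrow> \<kappa>"
    unfolding \<kappa>_def by (rule tendsto_divide[OF 1 2 vv])
  moreover have "\<forall>\<^sub>F n in sequentially. u n * (D n \<theta> \<bullet> ?v) / (D n \<theta> \<bullet> ?v) = u n"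
    using tendsto_imp_eventually_ne[OF 2 vv] by eventually_elim simp
  ultimately have "u \<longlonglongrightarrow> \<kappa>" by (rule Lim_transform_eventually)
  then have "(\<lambda>n. u n *\<^sub>R D n) \<longlonglongrightarrow> \<kappa> *\<^sub>R hist h \<gamma>1 sl" by (intro tendsto_scaleR D_lim)
  then have "\<phi> 0 = \<kappa> *\<^sub>R hist h \<gamma>1 0" using LIMSEQ_unique[OF uD] by (simp add: hsl)
  then show False using independent by blast
qed

text \<open>A solution on the center manifold in normal form coordinates, at phase \<open>\<sigma>\<close> at time \<open>t0\<close>, with
  \<open>\<xi> t0 \<noteq> 0\<close> and \<open>\<bar>\<xi>\<bar> < \<epsilon>\<close>. The time interval contains the history interval of \<open>t0\<close> and unit time after it.\<close>

definition traj :: "real \<Rightarrow> real \<Rightarrow> (real \<Rightarrow> real^'n) \<Rightarrow> (real \<Rightarrow> real) \<Rightarrow> (real \<Rightarrow> real) \<Rightarrow> real \<Rightarrow> bool" where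
  "traj \<epsilon> \<sigma> x \<tau> \<xi> t0 \<longleftrightarrow> \<tau> t0 = \<sigma> \<and> \<xi> t0 \<noteq> 0 \<and> continuous_on {t0 - 2 * h..t0 + 1} x \<and>
     (\<forall>t\<in>{t0 - h..t0 + 1}. hist h x t = H (\<tau> t) (\<xi> t) \<and> \<bar>\<xi> t\<bar> < \<epsilon> \<and>
        (x has_vector_derivative F (hist h x t)) (at t within {t0 - h..t0 + 1}) \<and>
        (\<tau> has_real_derivative 1 + a * (\<xi> t)\<^sup>2 + \<rho>1 (\<tau> t) (\<xi> t)) (at t within {t0 - h..t0 + 1}) \<and>
        (\<xi> has_real_derivative c * (\<xi> t) ^ 3 + \<rho>2 (\<tau> t) (\<xi> t)) (at t within {t0 - h..t0 + 1}))"

lemma cubic_bound: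
  assumes "\<bar>\<xi>\<bar> < \<delta>" "\<bar>\<xi>\<bar> \<le> 1"
  shows "\<bar>a * \<xi>\<^sup>2 + \<rho>1 \<tau> \<xi>\<bar> \<le> (\<bar>a\<bar> + K1) * \<xi>\<^sup>2" "\<bar>c * \<xi> ^ 3 + \<rho>2 \<tau> \<xi>\<bar> \<le> (\<bar>c\<bar> + K2) * \<bar>\<xi>\<bar> ^ 3"
proof -
  have 4: "\<xi> ^ 4 = \<bar>\<xi>\<bar> ^ 4" by simp
  have "\<xi> ^ 4 \<le> \<xi>\<^sup>2" "\<xi> ^ 4 \<le> \<bar>\<xi>\<bar> ^ 3"
    unfolding 4 power2_abs[of \<xi>, symmetric] using assms by (intro power_decreasing; simp)+
  then have "K1 * \<xi> ^ 4 \<le> K1 * \<xi>\<^sup>2" "K2 * \<xi> ^ 4 \<le> K2 * \<bar>\<xi>\<bar> ^ 3" using K_nonneg by (auto intro: mult_left_mono)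
  moreover have "\<bar>a * \<xi>\<^sup>2\<bar> = \<bar>a\<bar> * \<xi>\<^sup>2" "\<bar>c * \<xi> ^ 3\<bar> = \<bar>c\<bar> * \<bar>\<xi>\<bar> ^ 3" by (auto simp: abs_mult power_abs)
  ultimately show "\<bar>a * \<xi>\<^sup>2 + \<rho>1 \<tau> \<xi>\<bar> \<le> (\<bar>a\<bar> + K1) * \<xi>\<^sup>2" "\<bar>c * \<xi> ^ 3 + \<rho>2 \<tau> \<xi>\<bar> \<le> (\<bar>c\<bar> + K2) * \<bar>\<xi>\<bar> ^ 3"
    using \<rho>_bound[OF assms(1), of \<tau>] abs_triangle_ineq[of "a * \<xi>\<^sup>2" "\<rho>1 \<tau> \<xi>"] abs_triangle_ineq[of "c * \<xi> ^ 3" "\<rho>2 \<tau> \<xi>"]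
    unfolding distrib_right by linarith+
qed

text \<open>Trajectories off the periodic orbit pass every phase \<open>\<sigma>\<close> with an arbitrarily small coordinate
  \<open>\<xi>\<close>. This replaces injectivity of the parametrization: it does not matter at which point of the
  parameter space a solution starts, since \<open>\<tau>\<close> runs through a full period \<open>2 T\<close>.\<close>

lemma traj_exists:
  assumes \<epsilon>: "0 < \<epsilon>"
  shows "\<exists>x \<tau> \<xi> t0. traj \<epsilon> \<sigma> x \<tau> \<xi> t0"
proof -
  define b where "b = 4 * T + h + 1"
  have b: "0 < b" using T_pos h_pos by (simp add: b_def)
  define m where "m = 1 / 2 / ((\<bar>a\<bar> + K1) + b * (\<bar>c\<bar> + K2) + 1)"
  have den: "(\<bar>a\<bar> + K1) + b * (\<bar>c\<bar> + K2) + 1 > 0" using K_nonneg b by (simp add: add_nonneg_pos)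
  have m: "0 < m" using den by (simp add: m_def)
  have m1: "(\<bar>a\<bar> + K1) * m \<le> 1/2" "b * ((\<bar>c\<bar> + K2) * m) \<le> 1/2"
  proof -
    have "(\<bar>a\<bar> + K1) * m \<le> ((\<bar>a\<bar> + K1) + b * (\<bar>c\<bar> + K2) + 1) * m"
      "b * (\<bar>c\<bar> + K2) * m \<le> ((\<bar>a\<bar> + K1) + b * (\<bar>c\<bar> + K2) + 1) * m"
      using m K_nonneg b by (intro mult_right_mono; simp)+
    moreover have "((\<bar>a\<bar> + K1) + b * (\<bar>c\<bar> + K2) + 1) * m = 1/2" using den by (simp add: m_def)
    ultimately show "(\<bar>a\<bar> + K1) * m \<le> 1/2" "b * ((\<bar>c\<bar> + K2) * m) \<le> 1/2" by (simp_all add: mult.assoc)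
  qed
  define e where "e = min (min \<epsilon> \<delta>) (min 1 (sqrt m))"
  have e: "0 < e" "e \<le> \<epsilon>" "e \<le> \<delta>" "e \<le> 1" "e \<le> sqrt m" using \<epsilon> \<delta> m by (auto simp: e_def)
  have sq: "\<xi>\<^sup>2 \<le> m" if "\<bar>\<xi>\<bar> < e" for \<xi>
  proof -
    have "\<bar>\<xi>\<bar>\<^sup>2 \<le> (sqrt m)\<^sup>2" using that e by (intro power_mono) auto
    then show ?thesis using m by simp
  qed
  from dyn[unfolded pd_normal_form_dynamics_def, rule_format, OF e(1)]
  obtain N1 where N1: "open N1" "range (hist h \<gamma>) \<subseteq> N1"
    and N1_dyn: "\<forall>x I. is_interval I \<and> dde_solution h F x I \<and> (\<forall>t\<in>I. hist h x t \<in> W \<inter> N1) \<longrightarrow>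
           (\<exists>\<tau> \<xi>. \<forall>t\<in>I. \<bar>\<xi> t\<bar> < e \<and> hist h x t = H (\<tau> t) (\<xi> t) \<and>
              (\<tau> has_real_derivative 1 + a * (\<xi> t)\<^sup>2 + \<rho>1 (\<tau> t) (\<xi> t)) (at t within I) \<and>
              (\<xi> has_real_derivative c * (\<xi> t) ^ 3 + \<rho>2 (\<tau> t) (\<xi> t)) (at t within I))"
    by (elim exE conjE)
  from W_inv[unfolded locally_positively_invariant_def]
  obtain N2 where N2: "open N2" "range (hist h \<gamma>) \<subseteq> N2"
    and N2_inv: "\<forall>x b. dde_solution h F x {0..b} \<and> hist h x 0 \<in> W \<and> (\<forall>t\<in>{0..b}. hist h x t \<in> N2) \<longrightarrow>
           (\<forall>t\<in>{0..b}. hist h x t \<in> W)"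
    by (elim exE conjE)
  have orb: "range (hist h \<gamma>) = range orbit" by (simp add: orbit_def[abs_def])
  obtain r where r: "0 < r" "(\<Union>x\<in>range orbit. ball x r) \<subseteq> N1 \<inter> N2"
    using compact_subset_open_imp_ball_epsilon_subset[OF compact_orbit, of "N1 \<inter> N2"] N1 N2 orb by auto
  obtain \<rho> C where \<rho>: "\<rho> > 0" and C0: "C \<ge> 0" and lip: "\<forall>x\<in>range orbit. \<forall>y\<in>ball x \<rho>. \<forall>z\<in>ball x \<rho>. norm (F y - F z) \<le> C * norm (y - z)"
    using lipschitz_near_compact[OF compact_orbit] k by force
  have lip': "norm (F y - F z) \<le> C * norm (y - z)" if "y \<in> ball (hist h \<gamma> t) \<rho>" "z \<in> ball (hist h \<gamma> t) \<rho>" for t y z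
  proof -
    have "hist h \<gamma> t \<in> range orbit" by (simp add: orbit_def[abs_def])
    then show ?thesis using lip that by blast
  qed
  have "\<exists>\<eta>>0. \<forall>\<psi>\<in>phase_space h. norm (\<psi> - hist h \<gamma> 0) < \<eta> \<longrightarrow>
     (\<exists>x. dde_solution h F x {0..b} \<and> hist h x 0 = \<psi> \<and> (\<forall>t\<in>{0..b}. norm (hist h x t - hist h \<gamma> t) < r))"
    by (rule dde_exists_near[OF h_nonneg b F_cont \<rho> C0 lip' \<gamma>_cont \<gamma>_deriv[unfolded \<gamma>1_def orbit_def] r(1)])
  then obtain \<eta> where \<eta>: "\<eta> > 0" "\<And>\<psi>. \<psi> \<in> phase_space h \<Longrightarrow> norm (\<psi> - hist h \<gamma> 0) < \<eta> \<Longrightarrow>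
     (\<exists>x. dde_solution h F x {0..b} \<and> hist h x 0 = \<psi> \<and> (\<forall>t\<in>{0..b}. norm (hist h x t - hist h \<gamma> t) < r))" by blast
  obtain z where z: "\<bar>z\<bar> < \<delta>" "norm (H 0 z - orbit 0) < \<eta>" "H 0 z \<notin> range orbit" using leaves_orbit[OF \<eta>(1)] by blast
  have "H 0 z \<in> phase_space h" using H_mem[OF z(1)] W_sub by blast
  from \<eta>(2)[OF this] z(2) obtain x where x: "dde_solution h F x {0..b}" "hist h x 0 = H 0 z"
    "\<And>t. t \<in> {0..b} \<Longrightarrow> norm (hist h x t - hist h \<gamma> t) < r" by (auto simp: orbit_def)
  have near: "hist h x t \<in> N1 \<inter> N2" if "t \<in> {0..b}" for t
  proof -
    have "hist h x t \<in> ball (orbit t) r" using x(3)[OF that] by (simp add: orbit_def dist_norm norm_minus_commute)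
    then show ?thesis using r(2) by blast
  qed
  have inW: "hist h x t \<in> W" if "t \<in> {0..b}" for t
    using N2_inv[rule_format, of x b t] x(1) near that H_mem[OF z(1)] x(2) by auto
  obtain \<tau> \<xi> where nf: "\<And>t. t \<in> {0..b} \<Longrightarrow> \<bar>\<xi> t\<bar> < e" "\<And>t. t \<in> {0..b} \<Longrightarrow> hist h x t = H (\<tau> t) (\<xi> t)"
      "\<And>t. t \<in> {0..b} \<Longrightarrow> (\<tau> has_real_derivative 1 + a * (\<xi> t)\<^sup>2 + \<rho>1 (\<tau> t) (\<xi> t)) (at t within {0..b})"
      "\<And>t. t \<in> {0..b} \<Longrightarrow> (\<xi> has_real_derivative c * (\<xi> t) ^ 3 + \<rho>2 (\<tau> t) (\<xi> t)) (at t within {0..b})"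
  proof -
    have "\<exists>\<tau> \<xi>. \<forall>t\<in>{0..b}. \<bar>\<xi> t\<bar> < e \<and> hist h x t = H (\<tau> t) (\<xi> t) \<and>
              (\<tau> has_real_derivative 1 + a * (\<xi> t)\<^sup>2 + \<rho>1 (\<tau> t) (\<xi> t)) (at t within {0..b}) \<and>
              (\<xi> has_real_derivative c * (\<xi> t) ^ 3 + \<rho>2 (\<tau> t) (\<xi> t)) (at t within {0..b})"
      by (rule N1_dyn[rule_format]) (use x(1) near inW in \<open>auto simp: is_interval_cc\<close>)
    then obtain \<tau> \<xi> where "\<forall>t\<in>{0..b}. \<bar>\<xi> t\<bar> < e \<and> hist h x t = H (\<tau> t) (\<xi> t) \<and>
              (\<tau> has_real_derivative 1 + a * (\<xi> t)\<^sup>2 + \<rho>1 (\<tau> t) (\<xi> t)) (at t within {0..b}) \<and>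
              (\<xi> has_real_derivative c * (\<xi> t) ^ 3 + \<rho>2 (\<tau> t) (\<xi> t)) (at t within {0..b})" by (elim exE)
    then show thesis by (intro that[of \<xi> \<tau>]) simp_all
  qed
  have lt_\<delta>: "\<bar>\<xi> t\<bar> < \<delta>" "\<bar>\<xi> t\<bar> \<le> 1" if "t \<in> {0..b}" for t using nf(1)[OF that] e by auto
  have \<xi>_nz: "\<xi> t \<noteq> 0" if t: "t \<in> {0..b}" for t
  proof
    assume "\<xi> t = 0"
    have "\<bar>\<xi> 0\<bar> \<le> 2 * \<bar>\<xi> t\<bar>"
    proof (rule small_growth[OF nf(4), where m = "(\<bar>c\<bar> + K2) * m"])
      fix s assume s: "s \<in> {0..b}"
      have "\<bar>c * \<xi> s ^ 3 + \<rho>2 (\<tau> s) (\<xi> s)\<bar> \<le> (\<bar>c\<bar> + K2) * \<bar>\<xi> s\<bar> ^ 3" by (rule cubic_bound[OF lt_\<delta>[OF s]])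
      also have "\<dots> = (\<bar>c\<bar> + K2) * ((\<xi> s)\<^sup>2 * \<bar>\<xi> s\<bar>)" by (simp add: power3_eq_cube power2_eq_square)
      also have "\<dots> \<le> (\<bar>c\<bar> + K2) * (m * \<bar>\<xi> s\<bar>)"
        using K_nonneg by (intro mult_left_mono mult_right_mono sq nf(1)[OF s]) auto
      finally show "\<bar>c * \<xi> s ^ 3 + \<rho>2 (\<tau> s) (\<xi> s)\<bar> \<le> (\<bar>c\<bar> + K2) * m * \<bar>\<xi> s\<bar>" by (simp add: mult.assoc)
    qed (use m1(2) K_nonneg m b t in \<open>auto simp: mult.commute\<close>)
    then have "\<xi> 0 = 0" using \<open>\<xi> t = 0\<close> by simp
    then have "hist h x 0 = orbit (\<tau> 0)" using nf(2)[of 0] b by (simp add: H_zero)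
    then show False using x(2) z(3) by auto
  qed
  have \<tau>_cont: "continuous_on {0..b} \<tau>" by (rule DERIV_continuous_on[OF nf(3)])
  define t1 where "t1 = b - 1"
  have t1: "h \<le> t1" "t1 \<le> b" "t1 - h = 4 * T" using T_pos by (auto simp: t1_def b_def)
  have grow: "2 * T \<le> \<tau> t1 - \<tau> h"
  proof -
    have "\<exists>y. h < y \<and> y < t1 \<and> \<tau> t1 - \<tau> h = (t1 - h) * (1 + a * (\<xi> y)\<^sup>2 + \<rho>1 (\<tau> y) (\<xi> y))"
    proof (rule MVT2)
      show "h < t1" using t1 T_pos by simp
      fix y assume y: "h \<le> y" "y \<le> t1"
      then have "y \<in> {0..b}" "y \<in> interior {0..b}" using h_pos t1 T_pos by (auto simp: t1_def)
      then show "(\<tau> has_real_derivative 1 + a * (\<xi> y)\<^sup>2 + \<rho>1 (\<tau> y) (\<xi> y)) (at y)"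
        using nf(3)[of y] at_within_interior by metis
    qed
    then obtain y where y: "h < y" "y < t1" "\<tau> t1 - \<tau> h = (t1 - h) * (1 + a * (\<xi> y)\<^sup>2 + \<rho>1 (\<tau> y) (\<xi> y))" by blast
    then have yb: "y \<in> {0..b}" using h_pos t1 by auto
    have "\<bar>a * (\<xi> y)\<^sup>2 + \<rho>1 (\<tau> y) (\<xi> y)\<bar> \<le> (\<bar>a\<bar> + K1) * (\<xi> y)\<^sup>2" by (rule cubic_bound[OF lt_\<delta>[OF yb]])
    also have "\<dots> \<le> (\<bar>a\<bar> + K1) * m" using K_nonneg by (intro mult_left_mono sq nf(1)[OF yb]) auto
    finally have "1 / 2 \<le> 1 + a * (\<xi> y)\<^sup>2 + \<rho>1 (\<tau> y) (\<xi> y)" using m1(1) by linarith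
    then have "(4 * T) * (1 / 2) \<le> (t1 - h) * (1 + a * (\<xi> y)\<^sup>2 + \<rho>1 (\<tau> y) (\<xi> y))"
      unfolding t1(3) using T_pos by (intro mult_left_mono) auto
    then show ?thesis using y(3) by simp
  qed
  define j where "j = \<lceil>(\<tau> h - \<sigma>) / (2 * T)\<rceil>"
  have "(\<tau> h - \<sigma>) / (2 * T) \<le> of_int j" "of_int j < (\<tau> h - \<sigma>) / (2 * T) + 1" unfolding j_def by linarith+
  then have "\<tau> h - \<sigma> \<le> of_int j * (2 * T)" "of_int j * (2 * T) < \<tau> h - \<sigma> + 2 * T"
    using T_pos by (simp_all add: field_simps)
  then have "\<tau> h \<le> \<sigma> + of_int j * (2 * T)" "\<sigma> + of_int j * (2 * T) \<le> \<tau> t1" using grow by auto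
  then obtain t0 where t0: "h \<le> t0" "t0 \<le> t1" "\<tau> t0 = \<sigma> + of_int j * (2 * T)"
    using IVT'[of \<tau> h "\<sigma> + of_int j * (2 * T)" t1] t1 continuous_on_subset[OF \<tau>_cont, of "{h..t1}"] h_pos by auto
  have I: "{t0 - h..t0 + 1} \<subseteq> {0..b}" using t0 h_pos by (auto simp: t1_def)
  let ?\<tau> = "\<lambda>t. \<tau> t - of_int j * (2 * T)"
  have per: "f (\<tau> t - of_int j * (2 * T)) (\<xi> t) = f (\<tau> t) (\<xi> t)"
    if f: "\<And>\<tau> \<xi>. \<bar>\<xi>\<bar> < \<delta> \<Longrightarrow> f (\<tau> + 2 * T) \<xi> = f \<tau> \<xi>" and t: "t \<in> {0..b}" for f :: "real \<Rightarrow> real \<Rightarrow> 'x" and t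
    using periodic_shift_int[of "\<lambda>\<tau>. f \<tau> (\<xi> t)" "2 * T" "\<tau> t" "- j"] f[OF lt_\<delta>(1)[OF t]] by simp
  have "traj \<epsilon> \<sigma> x ?\<tau> \<xi> t0"
    unfolding traj_def
  proof (intro conjI ballI)
    show "?\<tau> t0 = \<sigma>" using t0 by simp
    show "\<xi> t0 \<noteq> 0" using t0 I h_pos by (intro \<xi>_nz) auto
    have "{t0 - 2 * h..t0 + 1} \<subseteq> (\<Union>t\<in>{0..b}. {t - h..t})"
    proof
      fix s assume s: "s \<in> {t0 - 2 * h..t0 + 1}"
      show "s \<in> (\<Union>t\<in>{0..b}. {t - h..t})"
      proof (cases "s \<ge> 0")
        case True
        then have "s \<in> {0..b}" using s t0 by (auto simp: t1_def)
        then show ?thesis using h_pos by (intro UN_I[of s]) auto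
      next
        case False
        then show ?thesis using s t0 b h_pos by (intro UN_I[of 0]) auto
      qed
    qed
    then show "continuous_on {t0 - 2 * h..t0 + 1} x"
      using x(1) continuous_on_subset unfolding dde_solution_def by blast
    fix t assume t: "t \<in> {t0 - h..t0 + 1}"
    then have tb: "t \<in> {0..b}" using I by blast
    show "hist h x t = H (?\<tau> t) (\<xi> t)" using nf(2)[OF tb] per[of H t, OF H_per tb] by simp
    show "\<bar>\<xi> t\<bar> < \<epsilon>" using nf(1)[OF tb] e by simp
    show "(x has_vector_derivative F (hist h x t)) (at t within {t0 - h..t0 + 1})"
      using x(1) tb I unfolding dde_solution_def by (blast intro: has_vector_derivative_within_subset)
    have "(?\<tau> has_real_derivative (1 + a * (\<xi> t)\<^sup>2 + \<rho>1 (\<tau> t) (\<xi> t)) - 0) (at t within {t0 - h..t0 + 1})"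
      by (intro DERIV_diff DERIV_const DERIV_subset[OF nf(3)[OF tb] I])
    then show "(?\<tau> has_real_derivative 1 + a * (\<xi> t)\<^sup>2 + \<rho>1 (?\<tau> t) (\<xi> t)) (at t within {t0 - h..t0 + 1})"
      using per[of \<rho>1 t, OF \<rho>_per(1) tb] by simp
    show "(\<xi> has_real_derivative c * \<xi> t ^ 3 + \<rho>2 (?\<tau> t) (\<xi> t)) (at t within {t0 - h..t0 + 1})"
      using per[of \<rho>2 t, OF \<rho>_per(2) tb] DERIV_subset[OF nf(4)[OF tb] I] by simp
  qed
  then show ?thesis by blast
qed

end

section \<open>The coefficients of the homological equation\<close>

text \<open>Comparison of coefficients: the error is \<open>o(\<xi>\<^sup>3)\<close>, and arbitrarily small \<open>\<xi> \<noteq> 0\<close> suffice.\<close>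

lemma extract_coefficients:
  fixes A B :: "'b::real_normed_vector"
  assumes "\<And>\<kappa> \<epsilon>. 0 < \<kappa> \<Longrightarrow> 0 < \<epsilon> \<Longrightarrow> \<exists>\<xi>. \<xi> \<noteq> 0 \<and> \<bar>\<xi>\<bar> < \<epsilon> \<and> norm (\<xi>\<^sup>2 *\<^sub>R A + \<xi> ^ 3 *\<^sub>R B) \<le> \<kappa> * \<bar>\<xi>\<bar> ^ 3"
  shows "A = 0" "B = 0"
proof -
  have A: "A = 0"
  proof (rule ccontr)
    assume "A \<noteq> 0"
    define \<epsilon> where "\<epsilon> = norm A / (norm B + 1)"
    have nB: "norm B + 1 > 0" by (simp add: add_nonneg_pos)
    have \<epsilon>: "\<epsilon> > 0" using \<open>A \<noteq> 0\<close> nB by (simp add: \<epsilon>_def)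
    obtain \<xi> where \<xi>: "\<xi> \<noteq> 0" "\<bar>\<xi>\<bar> < \<epsilon>" "norm (\<xi>\<^sup>2 *\<^sub>R A + \<xi> ^ 3 *\<^sub>R B) \<le> 1 * \<bar>\<xi>\<bar> ^ 3"
      using assms[OF zero_less_one \<epsilon>] by blast
    have cube: "\<bar>\<xi>\<bar> ^ 3 = \<xi>\<^sup>2 * \<bar>\<xi>\<bar>" by (simp add: power3_eq_cube power2_eq_square)
    have "\<xi>\<^sup>2 * norm A = norm ((\<xi>\<^sup>2 *\<^sub>R A + \<xi> ^ 3 *\<^sub>R B) - \<xi> ^ 3 *\<^sub>R B)" by simp
    also have "\<dots> \<le> \<bar>\<xi>\<bar> ^ 3 + \<bar>\<xi>\<bar> ^ 3 * norm B"
      using norm_triangle_ineq4[of "\<xi>\<^sup>2 *\<^sub>R A + \<xi> ^ 3 *\<^sub>R B" "\<xi> ^ 3 *\<^sub>R B"] \<xi>(3) by (simp add: power_abs)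
    also have "\<dots> = \<xi>\<^sup>2 * (\<bar>\<xi>\<bar> * (norm B + 1))" by (simp add: cube algebra_simps)
    finally have "norm A \<le> \<bar>\<xi>\<bar> * (norm B + 1)" using \<xi>(1) by simp
    also have "\<dots> < \<epsilon> * (norm B + 1)" using \<xi>(2) nB by (intro mult_strict_right_mono)
    also have "\<dots> = norm A" using nB by (simp add: \<epsilon>_def)
    finally show False by simp
  qed
  show "A = 0" by (rule A)
  show "B = 0"
  proof (rule ccontr)
    assume "B \<noteq> 0"
    then have \<kappa>: "norm B / 2 > 0" by simp
    obtain \<xi> where \<xi>: "\<xi> \<noteq> 0" "norm (\<xi>\<^sup>2 *\<^sub>R A + \<xi> ^ 3 *\<^sub>R B) \<le> norm B / 2 * \<bar>\<xi>\<bar> ^ 3"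
      using assms[OF \<kappa> zero_less_one] by blast
    then have "\<bar>\<xi>\<bar> ^ 3 * norm B \<le> \<bar>\<xi>\<bar> ^ 3 * (norm B / 2)" by (simp add: A power_abs mult.commute)
    then have "norm B \<le> norm B / 2" using \<xi>(1) by (simp add: mult_le_cancel_left)
    then show False using \<open>B \<noteq> 0\<close> by simp
  qed
qed

lemma extract_coefficients_quartic:
  fixes A B :: "'b::real_normed_vector"
  assumes \<delta>: "0 < \<delta>" and le: "\<And>\<xi>. \<bar>\<xi>\<bar> < \<delta> \<Longrightarrow> norm (\<xi>\<^sup>2 *\<^sub>R A + \<xi> ^ 3 *\<^sub>R B) \<le> K * \<xi> ^ 4"
  shows "A = 0" "B = 0"
proof -
  have "\<exists>\<xi>. \<xi> \<noteq> 0 \<and> \<bar>\<xi>\<bar> < \<epsilon> \<and> norm (\<xi>\<^sup>2 *\<^sub>R A + \<xi> ^ 3 *\<^sub>R B) \<le> \<kappa> * \<bar>\<xi>\<bar> ^ 3" if \<kappa>: "0 < \<kappa>" "0 < \<epsilon>" for \<kappa> \<epsilon>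
  proof -
    define \<xi> where "\<xi> = min (min \<delta> \<epsilon>) (\<kappa> / (\<bar>K\<bar> + 1)) / 2"
    have pos: "min (min \<delta> \<epsilon>) (\<kappa> / (\<bar>K\<bar> + 1)) > 0" using \<kappa> \<delta> by simp
    moreover have "min (min \<delta> \<epsilon>) (\<kappa> / (\<bar>K\<bar> + 1)) \<le> \<delta>" "min (min \<delta> \<epsilon>) (\<kappa> / (\<bar>K\<bar> + 1)) \<le> \<epsilon>"
      "min (min \<delta> \<epsilon>) (\<kappa> / (\<bar>K\<bar> + 1)) \<le> \<kappa> / (\<bar>K\<bar> + 1)" by (simp_all add: min.coboundedI1)
    moreover have "min (min \<delta> \<epsilon>) (\<kappa> / (\<bar>K\<bar> + 1)) = 2 * \<xi>" by (simp add: \<xi>_def)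
    ultimately have \<xi>: "0 < \<xi>" "\<xi> < \<delta>" "\<xi> < \<epsilon>" "\<xi> < \<kappa> / (\<bar>K\<bar> + 1)" by simp_all
    have "norm (\<xi>\<^sup>2 *\<^sub>R A + \<xi> ^ 3 *\<^sub>R B) \<le> K * \<xi> ^ 4" using \<xi> by (intro le) auto
    also have "\<dots> \<le> (\<bar>K\<bar> + 1) * \<xi> * \<xi> ^ 3" using \<xi>(1) by (simp add: power4_eq_xxxx power3_eq_cube mult.assoc mult_right_mono)
    also have "\<dots> \<le> \<kappa> * \<xi> ^ 3"
      using \<xi> by (intro mult_right_mono) (simp_all add: pos_less_divide_eq mult.commute)
    finally show ?thesis using \<xi> by (intro exI[of _ \<xi>]) auto
  qed
  from extract_coefficients[OF this] show "A = 0" "B = 0" by auto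
qed

lemma antiderivative:
  fixes g :: "real \<Rightarrow> 'b::banach"
  assumes g: "continuous_on UNIV g"
  shows "\<exists>G. \<forall>t. (G has_vector_derivative g t) (at t)"
proof -
  let ?G = "\<lambda>t. integral {0..t} g - integral {t..0} g"
  have int: "g integrable_on {a..b}" for a b :: real
    by (rule integrable_continuous_interval) (rule continuous_on_subset[OF g], simp)
  have "(?G has_vector_derivative g t) (at t)" for t
  proof -
    define R where "R = \<bar>t\<bar> + 1"
    have t: "t \<in> {-R..R}" "t \<in> interior {-R..R}" by (auto simp: R_def)
    have "((\<lambda>s. integral {-R..s} g - integral {-R..0} g) has_vector_derivative g t - 0) (at t within {-R..R})"
      by (intro has_vector_derivative_diff has_vector_derivative_const integral_has_vector_derivative[OF continuous_on_subset[OF g] t(1)]) simp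
    moreover have "integral {-R..s} g - integral {-R..0} g = ?G s" if "s \<in> {-R..R}" for s
    proof (cases "0 \<le> s")
      case True
      then have "integral {-R..0} g + integral {0..s} g = integral {-R..s} g"
        using that by (intro Henstock_Kurzweil_Integration.integral_combine int) auto
      moreover have "integral {s..0} g = 0" using True by (cases "s = 0") auto
      ultimately show ?thesis by (simp add: algebra_simps)
    next
      case False
      then have "integral {-R..s} g + integral {s..0} g = integral {-R..0} g"
        using that by (intro Henstock_Kurzweil_Integration.integral_combine int) auto
      then show ?thesis using False by (simp add: algebra_simps)
    qed
    ultimately have "(?G has_vector_derivative g t) (at t within {-R..R})"
      using has_vector_derivative_transform[of t "{-R..R}" ?G "\<lambda>s. integral {-R..s} g - integral {-R..0} g" "g t"] t(1) by simp
    then show ?thesis using at_within_interior[OF t(2)] by simp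
  qed
  then show ?thesis by blast
qed

lemma lipschitz_increment:
  fixes f :: "real \<Rightarrow> 'b::real_normed_vector"
  assumes "\<And>t. (f has_vector_derivative f' t) (at t)" "\<And>t. norm (f' t) \<le> A" "0 \<le> A"
  shows "norm (f t - f s) \<le> A * \<bar>t - s\<bar>"
proof -
  have "norm (f t - f s) \<le> A * norm (t - s)"
  proof (rule differentiable_bound[OF convex_UNIV, of f "\<lambda>s h. h *\<^sub>R f' s"])
    fix x
    show "(f has_derivative (\<lambda>h. h *\<^sub>R f' x)) (at x)" using assms(1) by (simp add: has_vector_derivative_def)
    show "onorm (\<lambda>h. h *\<^sub>R f' x) \<le> A"
      by (rule onorm_bound) (use assms(2)[of x] assms(3) in \<open>auto simp: mult.commute[of A] intro: mult_left_mono\<close>)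
  qed auto
  then show ?thesis by simp
qed

lemma taylor_increment:
  fixes f :: "real \<Rightarrow> 'b::real_normed_vector"
  assumes f: "\<And>t. (f has_vector_derivative f' t) (at t)" and f': "\<And>t s. norm (f' t - f' s) \<le> A * \<bar>t - s\<bar>" and A: "0 \<le> A"
  shows "norm (f t - f s - (t - s) *\<^sub>R f' s) \<le> A * (t - s)\<^sup>2"
proof -
  have "norm (f t - f s - (t - s) *\<^sub>R f' s) \<le> norm (t - s) * (A * \<bar>t - s\<bar>)"
  proof (rule vector_differentiable_bound_linearization[where f' = f' and ?x0.0 = s and S = "closed_segment s t"])
    fix x assume x: "x \<in> closed_segment s t"
    show "(f has_vector_derivative f' x) (at x within closed_segment s t)" by (rule has_vector_derivative_at_within[OF f])
    have "\<bar>x - s\<bar> \<le> \<bar>t - s\<bar>" using x by (auto simp: closed_segment_eq_real_ivl split: if_splits)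
    then have "A * \<bar>x - s\<bar> \<le> A * \<bar>t - s\<bar>" using A by (rule mult_left_mono)
    then show "norm (f' x - f' s) \<le> A * \<bar>t - s\<bar>" using f'[of x s] by linarith
  qed auto
  then show ?thesis by (simp add: power2_eq_square mult_ac)
qed

lemma norm_diff_mono: "norm x \<le> r \<Longrightarrow> norm y \<le> s \<Longrightarrow> norm (x - y) \<le> r + s"
  for x y :: "'b::real_normed_vector"
  by (rule order_trans[OF norm_triangle_ineq4 add_mono])

lemma norm_scaleR_le: "\<bar>r\<bar> \<le> R \<Longrightarrow> norm u \<le> A \<Longrightarrow> norm (r *\<^sub>R u) \<le> R * A"
  by (simp add: mult_mono')

context pd_setting begin

text \<open>The fourth order remainder of the parametrization.\<close>

definition rem :: "real \<Rightarrow> real \<Rightarrow> (real \<Rightarrow>\<^sub>C (real^'n))" where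
  "rem \<tau> \<xi> = H \<tau> \<xi> - (orbit \<tau> + \<xi> *\<^sub>R \<phi> \<tau> + (1/2 * \<xi>\<^sup>2) *\<^sub>R h2 \<tau> + (1/6 * \<xi> ^ 3) *\<^sub>R h3 \<tau>)"

lemma rem_le: "\<bar>\<xi>\<bar> < \<delta> \<Longrightarrow> norm (rem \<tau> \<xi>) \<le> KH * \<xi> ^ 4"
  using H_exp by (simp add: rem_def orbit_def)

lemma H_eq: "H \<tau> \<xi> = orbit \<tau> + \<xi> *\<^sub>R \<phi> \<tau> + (1/2 * \<xi>\<^sup>2) *\<^sub>R h2 \<tau> + (1/6 * \<xi> ^ 3) *\<^sub>R h3 \<tau> + rem \<tau> \<xi>"
  by (simp add: rem_def)

lemma hist_anti:
  assumes x: "continuous_on UNIV x" "\<And>t. x (t + T) = - x t"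
  shows "hist h x (\<tau> + T) = - hist h (x :: real \<Rightarrow> real^'n) \<tau>"
proof -
  have "hist h x (\<tau> + T) = hist h (\<lambda>s. (- 1) *\<^sub>R x s) \<tau>"
    unfolding hist_def
  proof (rule restrict_state_cong[OF h_nonneg])
    fix \<theta> show "x (\<tau> + T + \<theta>) = (- 1) *\<^sub>R x (\<tau> + \<theta>)" using x(2)[of "\<tau> + \<theta>"] by (simp add: algebra_simps)
  qed
  also have "\<dots> = (- 1) *\<^sub>R hist h x \<tau>" by (rule hist_scaleR[OF h_nonneg continuous_on_subset[OF x(1)]]) simp
  finally show ?thesis by simp
qed

lemma \<phi>_anti: "\<phi> (\<tau> + T) = - \<phi> \<tau>"
  by (rule hist_anti[OF lin_sol_cont[OF q_sol] q_anti])

lemma h2_per: "h2 (\<tau> + T) = h2 \<tau>" and h3_anti: "h3 (\<tau> + T) = - h3 \<tau>"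
proof -
  have "norm (\<xi>\<^sup>2 *\<^sub>R ((1/2) *\<^sub>R (h2 \<tau> - h2 (\<tau> + T))) + \<xi> ^ 3 *\<^sub>R ((1/6) *\<^sub>R (h3 \<tau> + h3 (\<tau> + T)))) \<le> (2 * KH) * \<xi> ^ 4"
    if \<xi>: "\<bar>\<xi>\<bar> < \<delta>" for \<xi>
  proof -
    have "rem (\<tau> + T) (- \<xi>) - rem \<tau> \<xi> = \<xi>\<^sup>2 *\<^sub>R ((1/2) *\<^sub>R (h2 \<tau> - h2 (\<tau> + T))) + \<xi> ^ 3 *\<^sub>R ((1/6) *\<^sub>R (h3 \<tau> + h3 (\<tau> + T)))"
      unfolding rem_def H_sym[OF \<xi>, of \<tau>] \<phi>_anti orbit_per by (simp add: algebra_simps)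
    moreover have "norm (rem (\<tau> + T) (- \<xi>) - rem \<tau> \<xi>) \<le> KH * (- \<xi>) ^ 4 + KH * \<xi> ^ 4"
      by (rule order_trans[OF norm_triangle_ineq4 add_mono]) (use rem_le[of \<xi>] rem_le[of "- \<xi>"] \<xi> in auto)
    ultimately show ?thesis by simp
  qed
  from extract_coefficients_quartic[OF \<delta> this] show "h2 (\<tau> + T) = h2 \<tau>" "h3 (\<tau> + T) = - h3 \<tau>"
    by (auto simp: eq_neg_iff_add_eq_0 add.commute)
qed

lemma H_cont_\<tau>: "\<bar>\<xi>\<bar> < \<delta> \<Longrightarrow> continuous_on UNIV (\<lambda>\<tau>. H \<tau> \<xi>)"
proof -
  assume \<xi>: "\<bar>\<xi>\<bar> < \<delta>"
  have "continuous_on UNIV (\<lambda>\<tau>::real. (\<tau>, \<xi>))" by (intro continuous_on_Pair continuous_on_id continuous_on_const)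
  moreover have "(\<lambda>\<tau>::real. (\<tau>, \<xi>)) ` UNIV \<subseteq> UNIV \<times> {-\<delta><..<\<delta>}" using \<xi> by auto
  ultimately show ?thesis using continuous_on_compose2[OF H_cont, of UNIV "\<lambda>\<tau>. (\<tau>, \<xi>)"] by simp
qed

lemma uniform_continuous_limit:
  fixes f :: "real \<Rightarrow> 'b::real_normed_vector"
  assumes "\<And>z. 0 < z \<Longrightarrow> z < \<delta> \<Longrightarrow> continuous_on UNIV (g z)"
    and "\<And>z \<tau>. 0 < z \<Longrightarrow> z < \<delta> \<Longrightarrow> norm (g z \<tau> - f \<tau>) \<le> K * z"
  shows "continuous_on UNIV f"
proof (rule uniform_limit_theorem[where F = "at_right 0"])
  have ev: "\<forall>\<^sub>F z in at_right 0. 0 < z \<and> z < \<delta>" using \<delta> by (auto simp: eventually_at_right[OF \<delta>])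
  then show "\<forall>\<^sub>F z in at_right 0. continuous_on UNIV (g z)" by eventually_elim (use assms(1) in auto)
  show "uniform_limit UNIV g f (at_right 0)"
  proof (rule uniform_limitI)
    fix e :: real assume e: "e > 0"
    have "((\<lambda>z. K * z) \<longlongrightarrow> K * 0) (at_right 0)" by (intro tendsto_intros)
    then have "((\<lambda>z. K * z) \<longlongrightarrow> 0) (at_right 0)" by simp
    then have "\<forall>\<^sub>F z in at_right 0. K * z < e" using e by (rule order_tendstoD(2))
    with ev show "\<forall>\<^sub>F z in at_right 0. \<forall>x\<in>UNIV. dist (g z x) (f x) < e"
      by eventually_elim (use assms(2) in \<open>auto simp: dist_norm intro: le_less_trans\<close>)
  qed
qed simp

lemma \<phi>_cont: "continuous_on S \<phi>" by (rule hist_lin_sol_cont[OF q_sol])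

lemma h2_cont_UNIV: "continuous_on UNIV h2"
proof (rule uniform_continuous_limit)
  fix z :: real assume z: "0 < z" "z < \<delta>"
  have z': "\<bar>z\<bar> < \<delta>" "\<bar>- z\<bar> < \<delta>" using z by auto
  let ?g = "\<lambda>z \<tau>. (1 / z\<^sup>2) *\<^sub>R (H \<tau> z + H \<tau> (- z) - 2 *\<^sub>R orbit \<tau>)"
  show "continuous_on UNIV (?g z)" by (intro continuous_intros H_cont_\<tau> z' orbit_cont)
  fix \<tau>
  have "H \<tau> z + H \<tau> (- z) - 2 *\<^sub>R orbit \<tau> = z\<^sup>2 *\<^sub>R h2 \<tau> + (rem \<tau> z + rem \<tau> (- z))"
    unfolding H_eq[of \<tau> z] H_eq[of \<tau> "- z"] by (simp add: algebra_simps scaleR_2 flip: scaleR_left_distrib)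
  then have "?g z \<tau> - h2 \<tau> = (1 / z\<^sup>2) *\<^sub>R (rem \<tau> z + rem \<tau> (- z))" using z by (simp add: scaleR_right_distrib)
  then have "norm (?g z \<tau> - h2 \<tau>) = norm (rem \<tau> z + rem \<tau> (- z)) / z\<^sup>2" by simp
  also have "\<dots> \<le> (KH * z ^ 4 + KH * (- z) ^ 4) / z\<^sup>2"
    by (intro divide_right_mono order_trans[OF norm_triangle_ineq] add_mono rem_le z') simp
  also have "\<dots> = 2 * KH * z * z" using z by (simp add: power4_eq_xxxx power2_eq_square)
  also have "\<dots> \<le> 2 * KH * \<delta> * z" using z K_nonneg by (intro mult_right_mono mult_left_mono) auto
  finally show "norm (?g z \<tau> - h2 \<tau>) \<le> 2 * KH * \<delta> * z" .
qed

lemma h3_cont_UNIV: "continuous_on UNIV h3"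
proof (rule uniform_continuous_limit)
  fix z :: real assume z: "0 < z" "z < \<delta>"
  have z': "\<bar>z\<bar> < \<delta>" using z by auto
  let ?g = "\<lambda>z \<tau>. (6 / z ^ 3) *\<^sub>R (H \<tau> z - orbit \<tau> - z *\<^sub>R \<phi> \<tau> - (1/2 * z\<^sup>2) *\<^sub>R h2 \<tau>)"
  show "continuous_on UNIV (?g z)" by (intro continuous_intros H_cont_\<tau> z' orbit_cont \<phi>_cont h2_cont_UNIV)
  fix \<tau>
  have "H \<tau> z - orbit \<tau> - z *\<^sub>R \<phi> \<tau> - (1/2 * z\<^sup>2) *\<^sub>R h2 \<tau> = (1/6 * z ^ 3) *\<^sub>R h3 \<tau> + rem \<tau> z"
    unfolding H_eq[of \<tau> z] by simp
  then have "?g z \<tau> - h3 \<tau> = (6 / z ^ 3) *\<^sub>R rem \<tau> z" using z by (simp add: scaleR_right_distrib)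
  then have "norm (?g z \<tau> - h3 \<tau>) = 6 / z ^ 3 * norm (rem \<tau> z)" using z by simp
  also have "\<dots> \<le> 6 / z ^ 3 * (KH * z ^ 4)" by (intro mult_left_mono rem_le z') (use z in simp)
  also have "\<dots> = 6 * KH * z" using z by (simp add: power4_eq_xxxx power3_eq_cube)
  finally show "norm (?g z \<tau> - h3 \<tau>) \<le> 6 * KH * z" .
qed

lemma h2_cont: "continuous_on S h2" and h3_cont: "continuous_on S h3"
  using h2_cont_UNIV h3_cont_UNIV continuous_on_subset by blast+

text \<open>The multilinear terms \<open>B(\<phi>,\<phi>)\<close>, \<open>B(\<phi>,h\<^sub>2)\<close>, \<open>C(\<phi>,\<phi>,\<phi>)\<close>, the derivative \<open>q1 = q'\<close>, the values \<open>v\<close> and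
  \<open>w\<close> of \<open>h\<^sub>2\<close> and \<open>h\<^sub>3\<close> at \<open>\<theta> = 0\<close>, and the right-hand sides \<open>G2\<close> and \<open>G3\<close> of the equations \<open>v' = G2\<close>
  and \<open>w' = G3\<close> of second and third order in \<open>\<xi>\<close>.\<close>

definition Bq :: "real \<Rightarrow> real^'n" where "Bq \<tau> = iter_deriv F [\<phi> \<tau>, \<phi> \<tau>] (orbit \<tau>)"
definition Bh :: "real \<Rightarrow> real^'n" where "Bh \<tau> = iter_deriv F [\<phi> \<tau>, h2 \<tau>] (orbit \<tau>)"
definition Cq :: "real \<Rightarrow> real^'n" where "Cq \<tau> = iter_deriv F [\<phi> \<tau>, \<phi> \<tau>, \<phi> \<tau>] (orbit \<tau>)"
definition q1 :: "real \<Rightarrow> real^'n" where "q1 \<tau> = L \<tau> (\<phi> \<tau>)"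
definition v :: "real \<Rightarrow> real^'n" where "v \<tau> = h2 \<tau> 0"
definition w :: "real \<Rightarrow> real^'n" where "w \<tau> = h3 \<tau> 0"
definition G2 :: "real \<Rightarrow> real^'n" where "G2 \<tau> = L \<tau> (h2 \<tau>) + Bq \<tau> - (2 * a) *\<^sub>R \<gamma>1 \<tau>"
definition G3 :: "real \<Rightarrow> real^'n" where
  "G3 \<tau> = L \<tau> (h3 \<tau>) + 3 *\<^sub>R Bh \<tau> + Cq \<tau> - (6 * a) *\<^sub>R q1 \<tau> - (6 * c) *\<^sub>R q \<tau>"

lemma Bq_cont: "continuous_on S Bq" and Bh_cont: "continuous_on S Bh" and Cq_cont: "continuous_on S Cq"
  and q1_cont: "continuous_on S q1"
  unfolding Bq_def Bh_def Cq_def q1_def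
  by (intro iter2_cont iter3_cont orbit_cont \<phi>_cont h2_cont L_cont)+

lemma G2_cont: "continuous_on S G2" and G3_cont: "continuous_on S G3"
  unfolding G2_def G3_def
  by (intro continuous_on_add continuous_on_diff continuous_on_scaleR continuous_on_const L_cont h2_cont h3_cont
      Bq_cont Bh_cont Cq_cont q1_cont \<gamma>1_cont lin_sol_cont[OF q_sol])+

lemma q1_deriv: "(q has_vector_derivative q1 t) (at t)"
  unfolding q1_def by (rule lin_sol_deriv[OF q_sol])

lemma anti_norm: "(\<And>t. f (t + T) = - f t) \<Longrightarrow> norm (f (t + T)) = norm (f t)" for f :: "real \<Rightarrow> 'x::real_normed_vector"
  by simp

lemma q1_anti: "q1 (\<tau> + T) = - q1 \<tau>"
  by (simp add: q1_def per \<phi>_anti linear_neg[OF linear(1)])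

lemma neg_iter2: "iter_deriv F [- u, - u'] x = iter_deriv F [u, u'] x" "iter_deriv F [- u, u'] x = - iter_deriv F [u, u'] x"
  "iter_deriv F [u, - u'] x = - iter_deriv F [u, u'] x"
proof -
  interpret b: bounded_bilinear "\<lambda>u u'. iter_deriv F [u, u'] x" using k by (intro iter_bounded_bilinear) simp
  show "iter_deriv F [- u, - u'] x = iter_deriv F [u, u'] x" "iter_deriv F [- u, u'] x = - iter_deriv F [u, u'] x"
    "iter_deriv F [u, - u'] x = - iter_deriv F [u, u'] x"
    by (simp_all add: b.minus_left b.minus_right)
qed

lemma scale_iter3: "iter_deriv F [r *\<^sub>R u, r *\<^sub>R u', r *\<^sub>R u''] x = (r * r * r) *\<^sub>R iter_deriv F [u, u', u''] x"
  using iter_scaleR[of "[]" "[r *\<^sub>R u', r *\<^sub>R u'']" r u] iter_scaleR[of "[u]" "[r *\<^sub>R u'']" r u'] iter_scaleR[of "[u, u']" "[]" r u''] k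
  by simp

lemma Bq_per: "Bq (\<tau> + T) = Bq \<tau>" and Bh_anti: "Bh (\<tau> + T) = - Bh \<tau>" and Cq_anti: "Cq (\<tau> + T) = - Cq \<tau>"
  using scale_iter3[of "- 1" "\<phi> \<tau>" "\<phi> \<tau>" "\<phi> \<tau>" "orbit \<tau>"]
  by (simp_all add: Bq_def Bh_def Cq_def \<phi>_anti orbit_per h2_per neg_iter2)

lemma G2_per: "G2 (\<tau> + T) = G2 \<tau>" and G3_anti: "G3 (\<tau> + T) = - G3 \<tau>"
  by (simp_all add: G2_def G3_def h2_per h3_anti Bq_per Bh_anti Cq_anti q1_anti q_anti per \<gamma>1_per linear_neg[OF linear(1)])

lemma uniform_bounds:
  "\<exists>A\<ge>1. \<forall>\<tau>. norm (\<phi> \<tau>) \<le> A \<and> norm (h2 \<tau>) \<le> A \<and> norm (h3 \<tau>) \<le> A \<and> norm (G2 \<tau>) \<le> A \<and> norm (G3 \<tau>) \<le> A \<and>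
     norm (\<gamma>1 \<tau>) \<le> A \<and> norm (\<gamma>2 \<tau>) \<le> A \<and> norm (q \<tau>) \<le> A \<and> norm (q1 \<tau>) \<le> A \<and> KH \<le> A"
proof -
  obtain A1 where A1: "A1 > 0" "\<And>\<tau>. norm (\<phi> \<tau>) \<le> A1" using periodic_bounded[OF \<phi>_cont anti_norm[of \<phi>, OF \<phi>_anti] T_pos] by blast
  obtain A2 where A2: "A2 > 0" "\<And>\<tau>. norm (h2 \<tau>) \<le> A2" using periodic_bounded[OF h2_cont _ T_pos] h2_per by metis
  obtain A3 where A3: "A3 > 0" "\<And>\<tau>. norm (h3 \<tau>) \<le> A3" using periodic_bounded[OF h3_cont anti_norm[of h3, OF h3_anti] T_pos] by blast
  obtain A4 where A4: "A4 > 0" "\<And>\<tau>. norm (G2 \<tau>) \<le> A4" using periodic_bounded[OF G2_cont _ T_pos] G2_per by metis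
  obtain A5 where A5: "A5 > 0" "\<And>\<tau>. norm (G3 \<tau>) \<le> A5" using periodic_bounded[OF G3_cont anti_norm[of G3, OF G3_anti] T_pos] by blast
  obtain A6 where A6: "A6 > 0" "\<And>\<tau>. norm (\<gamma>1 \<tau>) \<le> A6" using periodic_bounded[OF \<gamma>1_cont _ T_pos] \<gamma>1_per by metis
  obtain A7 where A7: "A7 > 0" "\<And>\<tau>. norm (\<gamma>2 \<tau>) \<le> A7" using periodic_bounded[OF \<gamma>2_cont _ T_pos] \<gamma>2_per by metis
  obtain A8 where A8: "A8 > 0" "\<And>\<tau>. norm (q \<tau>) \<le> A8" using periodic_bounded[OF lin_sol_cont[OF q_sol] anti_norm[of q, OF q_anti] T_pos] by blast
  obtain A9 where A9: "A9 > 0" "\<And>\<tau>. norm (q1 \<tau>) \<le> A9" using periodic_bounded[OF q1_cont anti_norm[of q1, OF q1_anti] T_pos] by blast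
  let ?A = "1 + A1 + A2 + A3 + A4 + A5 + A6 + A7 + A8 + A9 + KH"
  have "A1 \<le> ?A" "A2 \<le> ?A" "A3 \<le> ?A" "A4 \<le> ?A" "A5 \<le> ?A" "A6 \<le> ?A" "A7 \<le> ?A" "A8 \<le> ?A" "A9 \<le> ?A" "KH \<le> ?A" "1 \<le> ?A"
    using A1(1) A2(1) A3(1) A4(1) A5(1) A6(1) A7(1) A8(1) A9(1) K_nonneg(1) by linarith+
  then show ?thesis
    using A1(2) A2(2) A3(2) A4(2) A5(2) A6(2) A7(2) A8(2) A9(2) by (intro exI[of _ ?A]) (meson order_trans)
qed

text \<open>The third order expansion of \<open>F\<close> along the parametrization; its error is \<open>o(\<xi>\<^sup>3)\<close> uniformly in \<open>\<tau>\<close>.\<close>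

definition F_jet :: "real \<Rightarrow> real \<Rightarrow> real^'n" where
  "F_jet \<tau> \<xi> = \<gamma>1 \<tau> + \<xi> *\<^sub>R q1 \<tau> + (1/2 * \<xi>\<^sup>2) *\<^sub>R (L \<tau> (h2 \<tau>) + Bq \<tau>)
     + (1/6 * \<xi> ^ 3) *\<^sub>R (L \<tau> (h3 \<tau>) + 3 *\<^sub>R Bh \<tau> + Cq \<tau>)"

lemma F_expansion:
  assumes e: "0 < e"
  shows "\<exists>d>0. d \<le> \<delta> \<and> (\<forall>\<tau> \<xi>. \<bar>\<xi>\<bar> < d \<longrightarrow> norm (F (H \<tau> \<xi>) - F_jet \<tau> \<xi>) \<le> e * \<bar>\<xi>\<bar> ^ 3)"
proof -
  obtain A where A: "A \<ge> 1" "\<And>\<tau>. norm (\<phi> \<tau>) \<le> A" "\<And>\<tau>. norm (h2 \<tau>) \<le> A" "\<And>\<tau>. norm (h3 \<tau>) \<le> A" "KH \<le> A"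
    using uniform_bounds by blast
  obtain C2 where C2: "C2 \<ge> 0" "\<And>t vs. length vs = 2 \<Longrightarrow> norm (iter_deriv F vs (orbit t)) \<le> C2 * prod_list (map norm vs)"
    using iter_bounded_compact[OF compact_orbit, of 2] k by auto
  obtain C3 where C3: "C3 \<ge> 0" "\<And>t vs. length vs = 3 \<Longrightarrow> norm (iter_deriv F vs (orbit t)) \<le> C3 * prod_list (map norm vs)"
    using iter_bounded_compact[OF compact_orbit, of 3] k by auto
  define e1 where "e1 = e / (128 * A ^ 3)"
  have e1: "e1 > 0" "e1 * (64 * A ^ 3) = e / 2" using e A(1) by (auto simp: e1_def)
  obtain d1 where d1: "d1 > 0" "\<And>t y vs. dist y (orbit t) < d1 \<Longrightarrow> length vs = 3 \<Longrightarrow>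
      norm (iter_deriv F vs y - iter_deriv F vs (orbit t)) \<le> e1 * prod_list (map norm vs)"
    using iter_close_compact[OF compact_orbit, of 3 e1] k e1(1) by auto
  define KK where "KK = bnd * A + (1/2) * (13 * A\<^sup>2 * C2) + (1/6) * (144 * C3 * A ^ 3)"
  have KK: "KK \<ge> 0" using M0 A(1) C2(1) C3(1) by (simp add: KK_def)
  define d where "d = min (min \<delta> 1) (min (d1 / (4 * A)) (e / (2 * (KK + 1))))"
  have d: "d > 0" "d \<le> \<delta>" "d \<le> 1" "d \<le> d1 / (4 * A)" "d \<le> e / (2 * (KK + 1))"
    using \<delta> A(1) d1(1) e KK by (auto simp: d_def)
  have main: "norm (F (H \<tau> \<xi>) - F_jet \<tau> \<xi>) \<le> e * \<bar>\<xi>\<bar> ^ 3" if \<xi>: "\<bar>\<xi>\<bar> < d" for \<tau> \<xi>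
  proof -
    let ?z = "\<bar>\<xi>\<bar>"
    have z: "0 \<le> ?z" "?z \<le> 1" "?z < \<delta>" using \<xi> d by auto
    have pw: "?z ^ 2 \<le> ?z" "?z ^ 3 \<le> ?z ^ 2" "?z ^ 4 \<le> ?z ^ 3" "?z ^ 6 \<le> ?z ^ 4"
      using power_decreasing[of 1 2 ?z] power_decreasing[of 2 3 ?z] power_decreasing[of 3 4 ?z] power_decreasing[of 4 6 ?z] z
      by (simp_all only: power_one_right)
    interpret b: bounded_bilinear "\<lambda>u u'. iter_deriv F [u, u'] (orbit \<tau>)" using k by (intro iter_bounded_bilinear) simp
    let ?D2 = "\<lambda>u u'. iter_deriv F [u, u'] (orbit \<tau>)" and ?D3 = "\<lambda>u u' u''. iter_deriv F [u, u', u''] (orbit \<tau>)"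
    have D2: "norm (?D2 x y) \<le> C2 * (norm x * norm y)" for x y using C2(2)[of "[x, y]" \<tau>] by simp
    have D3: "norm (?D3 x y y') \<le> C3 * (norm x * (norm y * norm y'))" for x y y' using C3(2)[of "[x, y, y']" \<tau>] by simp
    define R where "R = rem \<tau> \<xi>"
    define s where "s = \<xi> *\<^sub>R \<phi> \<tau> + (1/2 * \<xi>\<^sup>2) *\<^sub>R h2 \<tau>"
    define r3 where "r3 = (1/6 * \<xi> ^ 3) *\<^sub>R h3 \<tau> + R"
    define u where "u = s + r3"
    have Hu: "H \<tau> \<xi> = orbit \<tau> + u" using H_eq[of \<tau> \<xi>] by (simp add: u_def s_def r3_def R_def)
    have R: "norm R \<le> A * ?z ^ 4"
    proof -
      have "norm R \<le> KH * \<xi> ^ 4" unfolding R_def by (rule rem_le) (use z in simp)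
      also have "\<dots> \<le> A * \<xi> ^ 4" by (intro mult_right_mono A) simp
      finally show ?thesis by simp
    qed
    have n2: "norm ((1/2 * \<xi>\<^sup>2) *\<^sub>R h2 \<tau>) \<le> (1/2) * A * ?z ^ 2"
    proof -
      have "norm ((1/2 * \<xi>\<^sup>2) *\<^sub>R h2 \<tau>) = (1/2 * ?z ^ 2) * norm (h2 \<tau>)" by simp
      also have "\<dots> \<le> (1/2 * ?z ^ 2) * A" by (intro mult_left_mono A) simp
      finally show ?thesis by (simp add: mult.commute)
    qed
    have n3: "norm ((1/6 * \<xi> ^ 3) *\<^sub>R h3 \<tau>) \<le> A * ?z ^ 3"
    proof -
      have "norm ((1/6 * \<xi> ^ 3) *\<^sub>R h3 \<tau>) = (1/6 * ?z ^ 3) * norm (h3 \<tau>)" by (simp add: power_abs abs_mult)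
      also have "\<dots> \<le> (1 * ?z ^ 3) * A" by (intro mult_mono A) auto
      finally show ?thesis by (simp add: mult.commute)
    qed
    have n1: "norm (\<xi> *\<^sub>R \<phi> \<tau>) \<le> A * ?z" using A(2)[of \<tau>] by (simp add: mult.commute[of A] mult_left_mono)
    have Apw: "A * ?z ^ 2 \<le> A * ?z" "A * ?z ^ 3 \<le> A * ?z ^ 2" "A * ?z ^ 4 \<le> A * ?z ^ 3" "0 \<le> A * ?z" "0 \<le> A * ?z ^ 2"
      using A(1) pw by (auto intro: mult_left_mono)
    have r3: "norm r3 \<le> 2 * A * ?z ^ 3"
      unfolding r3_def using norm_triangle_ineq[of "(1/6 * \<xi> ^ 3) *\<^sub>R h3 \<tau>" R] n3 R Apw by linarith
    have s: "norm s \<le> 2 * A * ?z"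
      unfolding s_def using norm_triangle_ineq[of "\<xi> *\<^sub>R \<phi> \<tau>" "(1/2 * \<xi>\<^sup>2) *\<^sub>R h2 \<tau>"] n1 n2 Apw by linarith
    have u_\<phi>: "norm (u - \<xi> *\<^sub>R \<phi> \<tau>) \<le> 3 * A * ?z ^ 2"
    proof -
      have "u - \<xi> *\<^sub>R \<phi> \<tau> = (1/2 * \<xi>\<^sup>2) *\<^sub>R h2 \<tau> + r3" by (simp add: u_def s_def)
      then have "norm (u - \<xi> *\<^sub>R \<phi> \<tau>) = norm ((1/2 * \<xi>\<^sup>2) *\<^sub>R h2 \<tau> + r3)" by (rule arg_cong)
      then show ?thesis using norm_triangle_ineq[of "(1/2 * \<xi>\<^sup>2) *\<^sub>R h2 \<tau>" r3] n2 r3 Apw by linarith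
    qed
    have u: "norm u \<le> 4 * A * ?z"
      unfolding u_def using norm_triangle_ineq[of s r3] s r3 Apw by linarith
    have taylor: "norm (F (orbit \<tau> + u) - (F (orbit \<tau>) + iter_deriv F [u] (orbit \<tau>) + (1/2) *\<^sub>R ?D2 u u + (1/6) *\<^sub>R ?D3 u u u)) \<le> (e / 2) * ?z ^ 3"
    proof (rule taylor3)
      fix l :: real assume l: "l \<in> {0..1}"
      have "norm (l *\<^sub>R u) \<le> norm u" using l by (simp add: mult_left_le_one_le)
      also have "\<dots> \<le> 4 * A * ?z" by (rule u)
      also have "\<dots> < 4 * A * d" using \<xi> A(1) by (intro mult_strict_left_mono) auto
      also have "\<dots> \<le> d1" using d(4) A(1) by (simp add: field_simps)
      finally have "norm (iter_deriv F [u, u, u] (orbit \<tau> + l *\<^sub>R u) - ?D3 u u u) \<le> e1 * (norm u * (norm u * norm u))"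
        using d1(2)[of "orbit \<tau> + l *\<^sub>R u" \<tau> "[u, u, u]"] by (simp add: dist_norm)
      also have "\<dots> \<le> e1 * ((4 * A * ?z) * ((4 * A * ?z) * (4 * A * ?z)))"
        using u e1(1) A(1) by (intro mult_left_mono mult_mono mult_nonneg_nonneg) auto
      also have "\<dots> = (e1 * (64 * A ^ 3)) * ?z ^ 3" by (simp add: power3_eq_cube)
      also have "\<dots> = (e / 2) * ?z ^ 3" unfolding e1(2) ..
      finally show "norm (iter_deriv F [u, u, u] (orbit \<tau> + l *\<^sub>R u) - ?D3 u u u) \<le> (e / 2) * ?z ^ 3" .
    qed (use k in simp)
    have L_u: "L \<tau> u = \<xi> *\<^sub>R q1 \<tau> + (1/2 * \<xi>\<^sup>2) *\<^sub>R L \<tau> (h2 \<tau>) + (1/6 * \<xi> ^ 3) *\<^sub>R L \<tau> (h3 \<tau>) + L \<tau> R"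
      by (simp add: u_def s_def r3_def q1_def linear_add[OF linear(1)] linear_scale[OF linear(1)])
    have LR: "norm (L \<tau> R) \<le> bnd * A * ?z ^ 4"
      using bnd(1)[of \<tau> R] mult_left_mono[OF R M0] by (simp add: mult.assoc)
    define E2 where "E2 = (1/4 * \<xi> ^ 4) *\<^sub>R ?D2 (h2 \<tau>) (h2 \<tau>) + (?D2 s r3 + ?D2 r3 s + ?D2 r3 r3)"
    have D2_u: "?D2 u u = \<xi>\<^sup>2 *\<^sub>R Bq \<tau> + \<xi> ^ 3 *\<^sub>R Bh \<tau> + E2"
    proof -
      have ss: "?D2 s s = \<xi>\<^sup>2 *\<^sub>R Bq \<tau> + \<xi> ^ 3 *\<^sub>R Bh \<tau> + (1/4 * \<xi> ^ 4) *\<^sub>R ?D2 (h2 \<tau>) (h2 \<tau>)"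
      proof -
        have comm: "?D2 (h2 \<tau>) (\<phi> \<tau>) = ?D2 (\<phi> \<tau>) (h2 \<tau>)" using iter2_commute k by simp
        have "?D2 s s = (\<xi> * \<xi>) *\<^sub>R Bq \<tau> + (\<xi> * (1/2 * \<xi>\<^sup>2)) *\<^sub>R Bh \<tau> + ((1/2 * \<xi>\<^sup>2) * \<xi>) *\<^sub>R Bh \<tau> + ((1/2 * \<xi>\<^sup>2) * (1/2 * \<xi>\<^sup>2)) *\<^sub>R ?D2 (h2 \<tau>) (h2 \<tau>)"
          unfolding s_def b.add_left b.add_right b.scaleR_left b.scaleR_right Bq_def Bh_def comm by (simp only: scaleR_right_distrib scaleR_scaleR add.assoc)
        also have "\<dots> = (\<xi> * \<xi>) *\<^sub>R Bq \<tau> + (\<xi> * (1/2 * \<xi>\<^sup>2) + (1/2 * \<xi>\<^sup>2) * \<xi>) *\<^sub>R Bh \<tau> + ((1/2 * \<xi>\<^sup>2) * (1/2 * \<xi>\<^sup>2)) *\<^sub>R ?D2 (h2 \<tau>) (h2 \<tau>)"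
          by (simp only: scaleR_left_distrib add.assoc)
        also have "\<xi> * (1/2 * \<xi>\<^sup>2) + (1/2 * \<xi>\<^sup>2) * \<xi> = \<xi> ^ 3" by (simp add: power2_eq_square power3_eq_cube)
        also have "(1/2 * \<xi>\<^sup>2) * (1/2 * \<xi>\<^sup>2) = 1/4 * \<xi> ^ 4" by (simp add: power2_eq_square power4_eq_xxxx)
        finally show ?thesis by (simp add: power2_eq_square)
      qed
      have "?D2 u u = ?D2 s s + (?D2 s r3 + ?D2 r3 s + ?D2 r3 r3)" unfolding u_def b.add_left b.add_right by simp
      then show ?thesis unfolding ss E2_def by simp
    qed
    have E2: "norm E2 \<le> 13 * A\<^sup>2 * C2 * ?z ^ 4"
    proof -
      have A0: "0 \<le> A" using A(1) by simp
      have "norm ((1/4 * \<xi> ^ 4) *\<^sub>R ?D2 (h2 \<tau>) (h2 \<tau>)) \<le> (1 * ?z ^ 4) * (C2 * (A * A))"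
        unfolding norm_scaleR by (intro mult_mono order_trans[OF D2] mult_left_mono A C2) (auto simp: A0 C2)
      moreover have "norm (?D2 s r3) \<le> C2 * ((2 * A * ?z) * (2 * A * ?z ^ 3))"
        by (intro order_trans[OF D2] mult_left_mono mult_mono s r3 C2) (auto simp: A0)
      moreover have "norm (?D2 r3 s) \<le> C2 * ((2 * A * ?z ^ 3) * (2 * A * ?z))"
        by (intro order_trans[OF D2] mult_left_mono mult_mono s r3 C2) (auto simp: A0)
      moreover have "norm (?D2 r3 r3) \<le> C2 * ((2 * A * ?z ^ 3) * (2 * A * ?z ^ 3))"
        by (intro order_trans[OF D2] mult_left_mono mult_mono s r3 C2) (auto simp: A0)
      moreover have "C2 * ((2 * A * ?z ^ 3) * (2 * A * ?z ^ 3)) \<le> 4 * (A\<^sup>2 * C2 * ?z ^ 4)"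
      proof -
        have "C2 * ((2 * A * ?z ^ 3) * (2 * A * ?z ^ 3)) = 4 * (A\<^sup>2 * C2) * ?z ^ 6"
          by (simp add: power2_eq_square mult_ac flip: power_add)
        also have "\<dots> \<le> 4 * (A\<^sup>2 * C2) * ?z ^ 4" using pw(4) C2 by (intro mult_left_mono) auto
        finally show ?thesis by simp
      qed
      moreover have "C2 * ((2 * A * ?z) * (2 * A * ?z ^ 3)) = 4 * (A\<^sup>2 * C2 * ?z ^ 4)" "C2 * ((2 * A * ?z ^ 3) * (2 * A * ?z)) = 4 * (A\<^sup>2 * C2 * ?z ^ 4)"
        "(1 * ?z ^ 4) * (C2 * (A * A)) = A\<^sup>2 * C2 * ?z ^ 4"
        by (simp_all add: power2_eq_square power3_eq_cube power4_eq_xxxx)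
      moreover note norm_triangle_ineq[of "(1/4 * \<xi> ^ 4) *\<^sub>R ?D2 (h2 \<tau>) (h2 \<tau>)" "?D2 s r3 + ?D2 r3 s + ?D2 r3 r3"]
        norm_triangle_ineq[of "?D2 s r3 + ?D2 r3 s" "?D2 r3 r3"] norm_triangle_ineq[of "?D2 s r3" "?D2 r3 s"]
      ultimately have "norm E2 \<le> 13 * (A\<^sup>2 * C2 * ?z ^ 4)" unfolding E2_def by linarith
      then show ?thesis by (simp only: mult.assoc)
    qed
    define y d where "y = \<xi> *\<^sub>R \<phi> \<tau>" and "d = u - y"
    define E3 where "E3 = ?D3 d u u + ?D3 y d u + ?D3 y y d"
    have D3_u: "?D3 u u u = \<xi> ^ 3 *\<^sub>R Cq \<tau> + E3"
    proof -
      have "?D3 d u u = ?D3 u u u - ?D3 y u u" "?D3 y d u = ?D3 y u u - ?D3 y y u" "?D3 y y d = ?D3 y y u - ?D3 y y y"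
        using iter_diff[of "[]" "[u, u]" u y] iter_diff[of "[y]" "[u]" u y] iter_diff[of "[y, y]" "[]" u y] k by (simp_all add: d_def)
      moreover have "?D3 y y y = \<xi> ^ 3 *\<^sub>R Cq \<tau>"
        using scale_iter3[of \<xi> "\<phi> \<tau>" "\<phi> \<tau>" "\<phi> \<tau>" "orbit \<tau>"] by (simp add: Cq_def y_def power3_eq_cube)
      ultimately show ?thesis by (simp add: E3_def)
    qed
    have E3: "norm E3 \<le> 144 * C3 * A ^ 3 * ?z ^ 4"
    proof -
      have A0: "0 \<le> A" using A(1) by simp
      have y: "norm y \<le> 4 * A * ?z" and d: "norm d \<le> 3 * A * ?z ^ 2" using n1 u_\<phi> Apw unfolding y_def d_def by linarith+
      have "norm E3 \<le> C3 * ((3 * A * ?z ^ 2) * ((4 * A * ?z) * (4 * A * ?z))) + C3 * ((4 * A * ?z) * ((3 * A * ?z ^ 2) * (4 * A * ?z)))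
        + C3 * ((4 * A * ?z) * ((4 * A * ?z) * (3 * A * ?z ^ 2)))"
        unfolding E3_def by (intro norm_triangle_mono order_trans[OF D3] mult_left_mono mult_mono u d y C3) (simp_all add: A0)
      also have "\<dots> = 144 * (C3 * A ^ 3 * ?z ^ 4)" by (simp add: power2_eq_square power3_eq_cube power4_eq_xxxx)
      finally show ?thesis by (simp only: mult.assoc)
    qed
    let ?X = "F (H \<tau> \<xi>) - F_jet \<tau> \<xi>"
    let ?Y = "F (orbit \<tau> + u) - (F (orbit \<tau>) + iter_deriv F [u] (orbit \<tau>) + (1/2) *\<^sub>R ?D2 u u + (1/6) *\<^sub>R ?D3 u u u)"
    have "iter_deriv F [u] (orbit \<tau>) = L \<tau> u" by (simp add: L_def)
    then have XY: "?X = ?Y + (L \<tau> R + ((1/2) *\<^sub>R E2 + (1/6) *\<^sub>R E3))"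
      unfolding Hu D2_u D3_u by (simp add: L_u \<gamma>1_def F_jet_def scaleR_right_distrib)
    have half: "norm (r *\<^sub>R x) \<le> r * b" if "norm x \<le> b" "0 \<le> r" for r b and x :: "real^'n" using that by (simp add: mult_left_mono)
    have "norm ?X \<le> (e / 2) * ?z ^ 3 + (bnd * A * ?z ^ 4 + ((1/2) * (13 * A\<^sup>2 * C2 * ?z ^ 4) + (1/6) * (144 * C3 * A ^ 3 * ?z ^ 4)))"
      unfolding XY by (intro norm_triangle_mono taylor LR half E2 E3) auto
    also have "\<dots> = (e / 2) * ?z ^ 3 + KK * ?z * ?z ^ 3" by (simp add: KK_def algebra_simps power4_eq_xxxx power3_eq_cube)
    also have "KK * ?z * ?z ^ 3 \<le> (e / 2) * ?z ^ 3"
    proof (rule mult_right_mono)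
      have "KK * ?z \<le> (KK + 1) * (e / (2 * (KK + 1)))" using \<xi> d(5) KK by (intro mult_mono) auto
      also have "\<dots> = e / 2" using KK by (simp add: field_simps)
      finally show "KK * ?z \<le> e / 2" .
    qed simp
    finally show ?thesis by simp
  qed
  show ?thesis using d main by blast
qed

end

section \<open>Comparison along trajectories on the center manifold\<close>

lemma increment_bound:
  fixes f :: "real \<Rightarrow> 'b::real_normed_vector"
  assumes f: "\<And>t. t \<in> {\<alpha>..\<beta>} \<Longrightarrow> (f has_vector_derivative f' t) (at t within {\<alpha>..\<beta>})"
    and le: "\<And>t. t \<in> {\<alpha>..\<beta>} \<Longrightarrow> norm (f' t - m) \<le> E"
    and s: "s \<in> {\<alpha>..\<beta>}" and t: "t \<in> {\<alpha>..\<beta>}"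
  shows "norm (f t - f s - (t - s) *\<^sub>R m) \<le> E * \<bar>t - s\<bar>"
proof -
  have E: "0 \<le> E" using order_trans[OF norm_ge_zero le[OF s]] .
  have "norm ((f t - t *\<^sub>R m) - (f s - s *\<^sub>R m)) \<le> E * norm (t - s)"
  proof (rule differentiable_bound[of "{\<alpha>..\<beta>}" "\<lambda>t. f t - t *\<^sub>R m" "\<lambda>t h. h *\<^sub>R (f' t - m)"])
    fix x assume x: "x \<in> {\<alpha>..\<beta>}"
    have "((\<lambda>t. t *\<^sub>R m) has_vector_derivative m) (at x within {\<alpha>..\<beta>})" by (auto intro!: derivative_eq_intros)
    from has_vector_derivative_diff[OF f[OF x] this]
    show "((\<lambda>t. f t - t *\<^sub>R m) has_derivative (\<lambda>h. h *\<^sub>R (f' x - m))) (at x within {\<alpha>..\<beta>})"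
      by (simp add: has_vector_derivative_def)
    show "onorm (\<lambda>h. h *\<^sub>R (f' x - m)) \<le> E"
      by (rule onorm_bound) (use le[OF x] E in \<open>auto simp: mult.commute[of E] intro: mult_left_mono\<close>)
  qed (use s t in auto)
  moreover have "(f t - t *\<^sub>R m) - (f s - s *\<^sub>R m) = f t - f s - (t - s) *\<^sub>R m" by (simp add: algebra_simps)
  ultimately show ?thesis by simp
qed

lemma real_increment_bound:
  fixes f :: "real \<Rightarrow> real"
  assumes f: "\<And>t. t \<in> {\<alpha>..\<beta>} \<Longrightarrow> (f has_real_derivative f' t) (at t within {\<alpha>..\<beta>})"
    and le: "\<And>t. t \<in> {\<alpha>..\<beta>} \<Longrightarrow> \<bar>f' t - m\<bar> \<le> E"
    and s: "s \<in> {\<alpha>..\<beta>}" and t: "t \<in> {\<alpha>..\<beta>}"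
  shows "\<bar>f t - f s - (t - s) * m\<bar> \<le> E * \<bar>t - s\<bar>"
  using increment_bound[of \<alpha> \<beta> f f' m E s t] assms by (simp add: has_real_derivative_iff_has_vector_derivative)

lemma chain_vector_derivative:
  assumes "(g has_vector_derivative g') (at (\<tau> t))" "(\<tau> has_real_derivative p) (at t within S)"
  shows "((\<lambda>t. g (\<tau> t)) has_vector_derivative p *\<^sub>R g') (at t within S)"
  using vector_diff_chain_within[OF assms(2)[unfolded has_real_derivative_iff_has_vector_derivative] has_vector_derivative_at_within[OF assms(1)]]
  by (simp add: o_def)

lemma power_difference_bounds:
  fixes x y z D :: real
  assumes "\<bar>x - y\<bar> \<le> D" "\<bar>x\<bar> \<le> 2 * z" "\<bar>y\<bar> \<le> z"
  shows "\<bar>x\<^sup>2 - y\<^sup>2\<bar> \<le> D * (3 * z)" "\<bar>x ^ 3 - y ^ 3\<bar> \<le> D * (7 * z\<^sup>2)"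
proof -
  have D: "0 \<le> D" and z: "0 \<le> z" using assms by linarith+
  have "x\<^sup>2 - y\<^sup>2 = (x - y) * (x + y)" by (simp add: power2_eq_square algebra_simps)
  also have "\<bar>\<dots>\<bar> \<le> D * (3 * z)" unfolding abs_mult using assms D z by (intro mult_mono) linarith+
  finally show "\<bar>x\<^sup>2 - y\<^sup>2\<bar> \<le> D * (3 * z)" .
  have "\<bar>x * x\<bar> \<le> (2 * z) * (2 * z)" "\<bar>x * y\<bar> \<le> (2 * z) * z" "\<bar>y * y\<bar> \<le> z * z"
    unfolding abs_mult using assms z by (intro mult_mono; simp)+
  then have "\<bar>x * x + x * y + y * y\<bar> \<le> 7 * z\<^sup>2" unfolding power2_eq_square by linarith
  moreover have "x ^ 3 - y ^ 3 = (x - y) * (x * x + x * y + y * y)" by (simp add: power3_eq_cube algebra_simps)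
  ultimately show "\<bar>x ^ 3 - y ^ 3\<bar> \<le> D * (7 * z\<^sup>2)"
    unfolding abs_mult using assms(1) D by (auto simp: abs_mult intro!: mult_mono)
qed

context pd_setting begin

lemma trajD:
  assumes "traj \<epsilon> \<sigma> x \<tau> \<xi> t0"
  shows "\<tau> t0 = \<sigma>" "\<xi> t0 \<noteq> 0" "continuous_on {t0 - 2 * h..t0 + 1} x"
    "t \<in> {t0 - h..t0 + 1} \<Longrightarrow> hist h x t = H (\<tau> t) (\<xi> t)"
    "t \<in> {t0 - h..t0 + 1} \<Longrightarrow> \<bar>\<xi> t\<bar> < \<epsilon>"
    "t \<in> {t0 - h..t0 + 1} \<Longrightarrow> (x has_vector_derivative F (hist h x t)) (at t within {t0 - h..t0 + 1})"
    "t \<in> {t0 - h..t0 + 1} \<Longrightarrow> (\<tau> has_real_derivative 1 + a * (\<xi> t)\<^sup>2 + \<rho>1 (\<tau> t) (\<xi> t)) (at t within {t0 - h..t0 + 1})"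
    "t \<in> {t0 - h..t0 + 1} \<Longrightarrow> (\<xi> has_real_derivative c * (\<xi> t) ^ 3 + \<rho>2 (\<tau> t) (\<xi> t)) (at t within {t0 - h..t0 + 1})"
  using assms unfolding traj_def by blast+

lemma traj_mono: "traj \<epsilon> \<sigma> x \<tau> \<xi> t0 \<Longrightarrow> \<epsilon> \<le> \<epsilon>' \<Longrightarrow> traj \<epsilon>' \<sigma> x \<tau> \<xi> t0"
  unfolding traj_def by force

lemma traj_value:
  assumes "traj \<epsilon> \<sigma> x \<tau> \<xi> t0" and t: "t \<in> {t0 - h..t0 + 1}" and \<theta>: "\<theta> \<in> {-h..0}"
  shows "x (t + \<theta>) = apply_bcontfun (H (\<tau> t) (\<xi> t)) \<theta>"
proof -
  have "continuous_on {t - h..t} x" by (rule continuous_on_subset[OF trajD(3)[OF assms(1)]]) (use t in auto)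
  from hist_apply[OF h_nonneg this, of \<theta>] show ?thesis using trajD(4)[OF assms(1) t] \<theta> by simp
qed

text \<open>The coordinates of a trajectory during a time interval of fixed length, with errors of fourth
  order in the value of \<open>\<xi>\<close> at the reference time \<open>t0\<close>.\<close>

definition estimates :: "real \<Rightarrow> real \<Rightarrow> (real \<Rightarrow> real) \<Rightarrow> (real \<Rightarrow> real) \<Rightarrow> real \<Rightarrow> real \<Rightarrow> bool" where
  "estimates C \<sigma> \<tau> \<xi> t0 t \<longleftrightarrow>
     \<bar>\<xi> t\<bar> \<le> 2 * \<bar>\<xi> t0\<bar> \<and>
     \<bar>(\<xi> t)\<^sup>2 - (\<xi> t0)\<^sup>2\<bar> \<le> C * \<bar>\<xi> t0\<bar> ^ 4 \<and>
     \<bar>(\<xi> t) ^ 3 - (\<xi> t0) ^ 3\<bar> \<le> C * \<bar>\<xi> t0\<bar> ^ 4 \<and>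
     \<bar>\<xi> t - \<xi> t0 - (t - t0) * (c * (\<xi> t0) ^ 3)\<bar> \<le> C * \<bar>\<xi> t0\<bar> ^ 4 \<and>
     \<bar>\<tau> t - \<sigma> - (t - t0) * (1 + a * (\<xi> t0)\<^sup>2)\<bar> \<le> C * \<bar>\<xi> t0\<bar> ^ 4 \<and>
     \<bar>\<tau> t - \<sigma> - (t - t0)\<bar> \<le> C * \<bar>\<xi> t0\<bar> ^ 2 \<and>
     \<bar>a * (\<xi> t)\<^sup>2 + \<rho>1 (\<tau> t) (\<xi> t)\<bar> \<le> C * \<bar>\<xi> t0\<bar> ^ 2 \<and>
     \<bar>\<rho>1 (\<tau> t) (\<xi> t)\<bar> \<le> C * \<bar>\<xi> t0\<bar> ^ 4 \<and>
     \<bar>\<rho>2 (\<tau> t) (\<xi> t)\<bar> \<le> C * \<bar>\<xi> t0\<bar> ^ 4"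

lemma traj_estimates:
  "\<exists>\<epsilon>1 C. 0 < \<epsilon>1 \<and> \<epsilon>1 \<le> \<delta> \<and> \<epsilon>1 \<le> 1 \<and> 1 \<le> C \<and>
     (\<forall>\<sigma> x \<tau> \<xi> t0. traj \<epsilon>1 \<sigma> x \<tau> \<xi> t0 \<longrightarrow> (\<forall>t\<in>{t0 - h..t0 + 1}. estimates C \<sigma> \<tau> \<xi> t0 t))"
proof -
  define \<Lambda> where "\<Lambda> = h + 1"
  define Q where "Q = \<bar>c\<bar> + K2"
  define P where "P = \<bar>a\<bar> + K1"
  have Q: "0 \<le> Q" and P: "0 \<le> P" and \<Lambda>: "1 \<le> \<Lambda>" using K_nonneg h_pos by (auto simp: Q_def P_def \<Lambda>_def)
  have Q\<Lambda>: "0 \<le> Q * \<Lambda>" using Q \<Lambda> by simp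
  define e0 where "e0 = 1 / (2 * (Q * \<Lambda> + 1))"
  have e0: "0 < e0" "Q * \<Lambda> * e0 \<le> 1/2" using Q\<Lambda> by (auto simp: e0_def field_simps add_nonneg_pos)
  define \<epsilon>1 where "\<epsilon>1 = min (min \<delta> 1) e0"
  have \<epsilon>1: "0 < \<epsilon>1" "\<epsilon>1 \<le> \<delta>" "\<epsilon>1 \<le> 1" "\<epsilon>1 \<le> e0" using \<delta> e0 by (auto simp: \<epsilon>1_def)
  define c2 c3 c4 c5 c6 where "c2 = 24 * Q * \<Lambda>" and "c3 = 56 * Q * \<Lambda>" and "c4 = (\<bar>c\<bar> * c3 + 16 * K2) * \<Lambda>"
    and "c5 = (\<bar>a\<bar> * c2 + 16 * K1) * \<Lambda>" and "c6 = 4 * P * \<Lambda>"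
  have cc: "0 \<le> c2" "0 \<le> c3" using Q\<Lambda> by (auto simp: c2_def c3_def mult.assoc)
  then have cc': "0 \<le> c4" "0 \<le> c5" "0 \<le> c6" "4 * P \<le> c6"
    using K_nonneg \<Lambda> P mult_left_mono[OF \<Lambda> P] by (auto simp: c4_def c5_def c6_def)
  define C where "C = 1 + c2 + c3 + c4 + c5 + c6 + 16 * K1 + 16 * K2"
  have C: "1 \<le> C" "c2 \<le> C" "c3 \<le> C" "c4 \<le> C" "c5 \<le> C" "c6 \<le> C" "4 * P \<le> C" "16 * K1 \<le> C" "16 * K2 \<le> C"
    using cc cc' K_nonneg unfolding C_def by linarith+
  have main: "estimates C \<sigma> \<tau> \<xi> t0 t" if tr: "traj \<epsilon>1 \<sigma> x \<tau> \<xi> t0" and t: "t \<in> {t0 - h..t0 + 1}" for \<sigma> x \<tau> \<xi> t0 t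
  proof -
    let ?I = "{t0 - h..t0 + 1}"
    define z where "z = \<bar>\<xi> t0\<bar>"
    have t0: "t0 \<in> ?I" using h_pos by auto
    have len: "\<bar>s - t0\<bar> \<le> \<Lambda>" if "s \<in> ?I" for s using that h_pos by (auto simp: \<Lambda>_def)
    have small: "\<bar>\<xi> s\<bar> < \<delta>" "\<bar>\<xi> s\<bar> \<le> 1" "\<bar>\<xi> s\<bar> \<le> e0" if "s \<in> ?I" for s
      using trajD(5)[OF tr that] \<epsilon>1 by auto
    have z: "0 \<le> z" "z \<le> 1" using small(2)[OF t0] by (auto simp: z_def)
    have z4: "z ^ 5 \<le> z ^ 4" by (rule power_decreasing) (use z in auto)
    have z4pos: "0 \<le> z ^ 4" "0 \<le> z ^ 3" "0 \<le> z ^ 2" using z by auto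
    note d\<tau> = trajD(7)[OF tr] and d\<xi> = trajD(8)[OF tr]
    have \<xi>': "\<bar>c * \<xi> s ^ 3 + \<rho>2 (\<tau> s) (\<xi> s)\<bar> \<le> Q * \<bar>\<xi> s\<bar> ^ 3" if "s \<in> ?I" for s
      unfolding Q_def by (rule cubic_bound[OF small(1,2)[OF that]])
    have twice: "\<bar>\<xi> s\<bar> \<le> 2 * z" if s: "s \<in> ?I" for s
      unfolding z_def
    proof (rule small_growth[OF d\<xi> _ _ _ t0 s, where m = "Q * e0"])
      fix r assume r: "r \<in> ?I"
      have "\<bar>\<xi> r\<bar> ^ 3 = \<bar>\<xi> r\<bar> * (\<bar>\<xi> r\<bar> * \<bar>\<xi> r\<bar>)" by (simp add: power3_eq_cube)
      also have "\<dots> \<le> e0 * (1 * \<bar>\<xi> r\<bar>)" using small[OF r] by (intro mult_mono) auto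
      finally have "Q * \<bar>\<xi> r\<bar> ^ 3 \<le> Q * (e0 * \<bar>\<xi> r\<bar>)" using Q by (simp add: mult_left_mono)
      then show "\<bar>c * \<xi> r ^ 3 + \<rho>2 (\<tau> r) (\<xi> r)\<bar> \<le> Q * e0 * \<bar>\<xi> r\<bar>" using \<xi>'[OF r] by (simp add: mult.assoc)
    next
      show "0 \<le> Q * e0" using Q e0 by simp
      show "Q * e0 * (t0 + 1 - (t0 - h)) \<le> 1 / 2" using e0(2) by (simp add: \<Lambda>_def mult_ac add.commute)
    qed
    have pow: "\<bar>\<xi> s\<bar> ^ n \<le> 2 ^ n * z ^ n" if "s \<in> ?I" for s n
      using power_mono[OF twice[OF that], of n] by (simp add: power_mult_distrib)
    have diff: "\<bar>\<xi> s - \<xi> t0\<bar> \<le> 8 * Q * \<Lambda> * z ^ 3" if s: "s \<in> ?I" for s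
    proof -
      have "\<bar>\<xi> s - \<xi> t0 - (s - t0) * 0\<bar> \<le> 8 * Q * z ^ 3 * \<bar>s - t0\<bar>"
      proof (rule real_increment_bound[OF d\<xi> _ t0 s])
        fix r assume r: "r \<in> ?I"
        have "Q * \<bar>\<xi> r\<bar> ^ 3 \<le> Q * (2 ^ 3 * z ^ 3)" by (intro mult_left_mono pow r Q)
        then show "\<bar>c * \<xi> r ^ 3 + \<rho>2 (\<tau> r) (\<xi> r) - 0\<bar> \<le> 8 * Q * z ^ 3" using \<xi>'[OF r] by simp
      qed
      also have "\<dots> \<le> 8 * Q * z ^ 3 * \<Lambda>" using Q z4pos by (intro mult_left_mono len s) auto
      finally show ?thesis by (simp add: mult_ac)
    qed
    have \<xi>0: "\<bar>\<xi> t0\<bar> \<le> z" by (simp add: z_def)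
    have sq: "\<bar>(\<xi> s)\<^sup>2 - (\<xi> t0)\<^sup>2\<bar> \<le> c2 * z ^ 4" if s: "s \<in> ?I" for s
      using power_difference_bounds(1)[OF diff[OF s] twice[OF s] \<xi>0] by (simp add: c2_def power4_eq_xxxx power3_eq_cube mult_ac)
    have cu: "\<bar>(\<xi> s) ^ 3 - (\<xi> t0) ^ 3\<bar> \<le> c3 * z ^ 4" if s: "s \<in> ?I" for s
    proof -
      have "\<bar>(\<xi> s) ^ 3 - (\<xi> t0) ^ 3\<bar> \<le> 8 * Q * \<Lambda> * z ^ 3 * (7 * z\<^sup>2)"
        by (rule power_difference_bounds(2)[OF diff[OF s] twice[OF s] \<xi>0])
      also have "\<dots> = c3 * z ^ 5" by (simp add: c3_def flip: power_add)
      also have "\<dots> \<le> c3 * z ^ 4" using cc z4 by (intro mult_left_mono)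
      finally show ?thesis .
    qed
    have \<rho>: "\<bar>\<rho>1 (\<tau> s) (\<xi> s)\<bar> \<le> 16 * K1 * z ^ 4" "\<bar>\<rho>2 (\<tau> s) (\<xi> s)\<bar> \<le> 16 * K2 * z ^ 4" if s: "s \<in> ?I" for s
    proof -
      have "K1 * \<xi> s ^ 4 \<le> K1 * (2 ^ 4 * z ^ 4)" "K2 * \<xi> s ^ 4 \<le> K2 * (2 ^ 4 * z ^ 4)"
        using pow[OF s, of 4] K_nonneg by (intro mult_left_mono; simp)+
      then show "\<bar>\<rho>1 (\<tau> s) (\<xi> s)\<bar> \<le> 16 * K1 * z ^ 4" "\<bar>\<rho>2 (\<tau> s) (\<xi> s)\<bar> \<le> 16 * K2 * z ^ 4"
        using \<rho>_bound[OF small(1)[OF s], of "\<tau> s"] by simp_all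
    qed
    have p: "\<bar>a * (\<xi> s)\<^sup>2 + \<rho>1 (\<tau> s) (\<xi> s)\<bar> \<le> 4 * P * z\<^sup>2" if s: "s \<in> ?I" for s
    proof -
      have "P * (\<xi> s)\<^sup>2 \<le> P * (2\<^sup>2 * z\<^sup>2)" using pow[OF s, of 2] by (intro mult_left_mono P) simp
      then show ?thesis using cubic_bound(1)[OF small(1,2)[OF s], of "\<tau> s", folded P_def] unfolding power2_eq_square by linarith
    qed
    have e4: "\<bar>\<xi> t - \<xi> t0 - (t - t0) * (c * (\<xi> t0) ^ 3)\<bar> \<le> c4 * z ^ 4"
    proof -
      have "\<bar>\<xi> t - \<xi> t0 - (t - t0) * (c * (\<xi> t0) ^ 3)\<bar> \<le> (\<bar>c\<bar> * c3 + 16 * K2) * z ^ 4 * \<bar>t - t0\<bar>"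
      proof (rule real_increment_bound[OF d\<xi> _ t0 t])
        fix r assume r: "r \<in> ?I"
        have "c * \<xi> r ^ 3 + \<rho>2 (\<tau> r) (\<xi> r) - c * \<xi> t0 ^ 3 = c * (\<xi> r ^ 3 - \<xi> t0 ^ 3) + \<rho>2 (\<tau> r) (\<xi> r)" by (simp add: algebra_simps)
        moreover have "\<bar>c * (\<xi> r ^ 3 - \<xi> t0 ^ 3)\<bar> \<le> \<bar>c\<bar> * (c3 * z ^ 4)" unfolding abs_mult by (intro mult_left_mono cu r) simp
        ultimately show "\<bar>c * \<xi> r ^ 3 + \<rho>2 (\<tau> r) (\<xi> r) - c * \<xi> t0 ^ 3\<bar> \<le> (\<bar>c\<bar> * c3 + 16 * K2) * z ^ 4"
          using \<rho>(2)[OF r] unfolding distrib_right mult.assoc by linarith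
      qed
      also have "\<dots> \<le> (\<bar>c\<bar> * c3 + 16 * K2) * z ^ 4 * \<Lambda>"
        using cc K_nonneg z4pos by (intro mult_left_mono len t) auto
      finally show ?thesis by (simp add: c4_def mult_ac)
    qed
    have e5: "\<bar>\<tau> t - \<sigma> - (t - t0) * (1 + a * (\<xi> t0)\<^sup>2)\<bar> \<le> c5 * z ^ 4"
    proof -
      have "\<bar>\<tau> t - \<tau> t0 - (t - t0) * (1 + a * (\<xi> t0)\<^sup>2)\<bar> \<le> (\<bar>a\<bar> * c2 + 16 * K1) * z ^ 4 * \<bar>t - t0\<bar>"
      proof (rule real_increment_bound[OF d\<tau> _ t0 t])
        fix r assume r: "r \<in> ?I"
        have "1 + a * (\<xi> r)\<^sup>2 + \<rho>1 (\<tau> r) (\<xi> r) - (1 + a * (\<xi> t0)\<^sup>2) = a * ((\<xi> r)\<^sup>2 - (\<xi> t0)\<^sup>2) + \<rho>1 (\<tau> r) (\<xi> r)" by (simp add: algebra_simps)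
        moreover have "\<bar>a * ((\<xi> r)\<^sup>2 - (\<xi> t0)\<^sup>2)\<bar> \<le> \<bar>a\<bar> * (c2 * z ^ 4)" unfolding abs_mult by (intro mult_left_mono sq r) simp
        ultimately show "\<bar>1 + a * (\<xi> r)\<^sup>2 + \<rho>1 (\<tau> r) (\<xi> r) - (1 + a * (\<xi> t0)\<^sup>2)\<bar> \<le> (\<bar>a\<bar> * c2 + 16 * K1) * z ^ 4"
          using \<rho>(1)[OF r] unfolding distrib_right mult.assoc by linarith
      qed
      also have "\<dots> \<le> (\<bar>a\<bar> * c2 + 16 * K1) * z ^ 4 * \<Lambda>"
        using cc K_nonneg z4pos by (intro mult_left_mono len t) auto
      finally show ?thesis using trajD(1)[OF tr] by (simp add: c5_def mult_ac)
    qed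
    have e6: "\<bar>\<tau> t - \<sigma> - (t - t0)\<bar> \<le> c6 * z\<^sup>2"
    proof -
      have "\<bar>\<tau> t - \<tau> t0 - (t - t0) * 1\<bar> \<le> 4 * P * z\<^sup>2 * \<bar>t - t0\<bar>"
      proof (rule real_increment_bound[OF d\<tau> _ t0 t])
        fix r assume r: "r \<in> ?I"
        have "1 + a * (\<xi> r)\<^sup>2 + \<rho>1 (\<tau> r) (\<xi> r) - 1 = a * (\<xi> r)\<^sup>2 + \<rho>1 (\<tau> r) (\<xi> r)" by simp
        then show "\<bar>1 + a * (\<xi> r)\<^sup>2 + \<rho>1 (\<tau> r) (\<xi> r) - 1\<bar> \<le> 4 * P * z\<^sup>2" using p[OF r] by simp
      qed
      also have "\<dots> \<le> 4 * P * z\<^sup>2 * \<Lambda>" using P z4pos by (intro mult_left_mono len t) auto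
      finally show ?thesis using trajD(1)[OF tr] by (simp add: c6_def mult_ac)
    qed
    note m4 = mult_right_mono[OF _ z4pos(1)] and m2 = mult_right_mono[OF _ z4pos(3)]
    show ?thesis
      unfolding estimates_def z_def[symmetric]
      using twice[OF t] order_trans[OF sq[OF t] m4[OF C(2)]] order_trans[OF cu[OF t] m4[OF C(3)]] order_trans[OF e4 m4[OF C(4)]]
        order_trans[OF e5 m4[OF C(5)]] order_trans[OF e6 m2[OF C(6)]] order_trans[OF p[OF t] m2[OF C(7)]]
        order_trans[OF \<rho>(1)[OF t] m4[OF C(8)]] order_trans[OF \<rho>(2)[OF t] m4[OF C(9)]] by (intro conjI)
  qed
  show ?thesis using \<epsilon>1(1-3) C(1) main by blast
qed

lemma H_value:
  assumes \<xi>: "\<bar>\<xi>\<bar> < \<delta>" and \<theta>: "\<theta> \<in> {-h..0}"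
  shows "norm (H \<tau> \<xi> \<theta> - (\<gamma> (\<tau> + \<theta>) + \<xi> *\<^sub>R q (\<tau> + \<theta>) + (1/2 * \<xi>\<^sup>2) *\<^sub>R h2 \<tau> \<theta>
     + (1/6 * \<xi> ^ 3) *\<^sub>R h3 \<tau> \<theta>)) \<le> KH * \<bar>\<xi>\<bar> ^ 4"
proof -
  have "orbit \<tau> \<theta> = \<gamma> (\<tau> + \<theta>)" "apply_bcontfun (\<phi> \<tau>) \<theta> = q (\<tau> + \<theta>)"
    using \<theta> by (simp_all add: orbit_def hist_apply h_nonneg \<gamma>_cont lin_sol_cont[OF q_sol])
  then have "rem \<tau> \<xi> \<theta> = H \<tau> \<xi> \<theta> - (\<gamma> (\<tau> + \<theta>) + \<xi> *\<^sub>R q (\<tau> + \<theta>) + (1/2 * \<xi>\<^sup>2) *\<^sub>R h2 \<tau> \<theta>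
     + (1/6 * \<xi> ^ 3) *\<^sub>R h3 \<tau> \<theta>)"
    by (simp add: rem_def)
  then show ?thesis using order_trans[OF norm_bounded[of "rem \<tau> \<xi>" \<theta>] rem_le[OF \<xi>, of \<tau>]] by simp
qed

text \<open>With antiderivatives \<open>V2\<close> and \<open>V3\<close> of \<open>G2\<close> and \<open>G3\<close>, and the powers of \<open>\<xi>\<close> in front of them frozen at
  \<open>\<xi>0 = \<xi> t0\<close>, the function \<open>Y = x - \<gamma>(\<tau>) - \<xi> q(\<tau>) - \<xi>0\<^sup>2/2 V2(\<tau>) - \<xi>0\<^sup>3/6 V3(\<tau>)\<close> has a derivative of
  order \<open>o(\<xi>0\<^sup>3)\<close>. As \<open>x\<close> is given by the expansion of \<open>H\<close> at both ends, the increments of \<open>v\<close> and \<open>V2\<close>,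
  and of \<open>w\<close> and \<open>V3\<close>, agree.\<close>

lemma time_increments:
  assumes V2: "\<And>t. (V2 has_vector_derivative G2 t) (at t)" and V3: "\<And>t. (V3 has_vector_derivative G3 t) (at t)"
    and \<sigma>1: "\<sigma> \<le> \<sigma>1" "\<sigma>1 \<le> \<sigma> + 1/2"
  shows "v \<sigma>1 - v \<sigma> = V2 \<sigma>1 - V2 \<sigma>" "w \<sigma>1 - w \<sigma> = V3 \<sigma>1 - V3 \<sigma>"
proof -
  obtain A where A: "A \<ge> 1" "\<And>\<tau>. norm (h2 \<tau>) \<le> A" "\<And>\<tau>. norm (h3 \<tau>) \<le> A" "\<And>\<tau>. norm (G2 \<tau>) \<le> A" "\<And>\<tau>. norm (G3 \<tau>) \<le> A"
    "\<And>\<tau>. norm (\<gamma>1 \<tau>) \<le> A" "\<And>\<tau>. norm (q \<tau>) \<le> A" "\<And>\<tau>. norm (q1 \<tau>) \<le> A" "KH \<le> A"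
    using uniform_bounds by blast
  have vw: "norm (v \<tau>) \<le> A" "norm (w \<tau>) \<le> A" for \<tau>
    unfolding v_def w_def by (rule order_trans[OF norm_bounded A(2)], rule order_trans[OF norm_bounded A(3)])
  obtain \<epsilon>1 C where \<epsilon>1: "0 < \<epsilon>1" "\<epsilon>1 \<le> \<delta>" "\<epsilon>1 \<le> 1" and C: "1 \<le> C"
    and est: "\<And>\<sigma> x \<tau> \<xi> t0 t. traj \<epsilon>1 \<sigma> x \<tau> \<xi> t0 \<Longrightarrow> t \<in> {t0 - h..t0 + 1} \<Longrightarrow> estimates C \<sigma> \<tau> \<xi> t0 t"
    using traj_estimates by blast
  have CA: "1 \<le> C * A" using mult_mono[OF C A(1)] C by simp
  have main: "\<exists>\<xi>. \<xi> \<noteq> 0 \<and> \<bar>\<xi>\<bar> < \<epsilon> \<and> norm (\<xi>\<^sup>2 *\<^sub>R ((1/2) *\<^sub>R ((v \<sigma>1 - v \<sigma>) - (V2 \<sigma>1 - V2 \<sigma>)))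
      + \<xi> ^ 3 *\<^sub>R ((1/6) *\<^sub>R ((w \<sigma>1 - w \<sigma>) - (V3 \<sigma>1 - V3 \<sigma>)))) \<le> \<kappa> * \<bar>\<xi>\<bar> ^ 3"
    if \<kappa>: "0 < \<kappa>" and \<epsilon>: "0 < \<epsilon>" for \<kappa> \<epsilon>
  proof -
    define e where "e = \<kappa> / 16"
    have e: "0 < e" using \<kappa> by (simp add: e_def)
    obtain d where d: "d > 0" and Fexp: "\<And>\<tau> \<xi>. \<bar>\<xi>\<bar> < d \<Longrightarrow> norm (F (H \<tau> \<xi>) - F_jet \<tau> \<xi>) \<le> e * \<bar>\<xi>\<bar> ^ 3"
      using F_expansion[OF e] by blast
    define \<epsilon>' where "\<epsilon>' = min (min \<epsilon> \<epsilon>1) (min d (min (1 / (2 * C)) (\<kappa> / (80 * (C * A)))))"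
    have \<epsilon>': "0 < \<epsilon>'" "\<epsilon>' \<le> \<epsilon>" "\<epsilon>' \<le> \<epsilon>1" "\<epsilon>' \<le> d" "\<epsilon>' \<le> 1 / (2 * C)" "\<epsilon>' \<le> \<kappa> / (80 * (C * A))"
      using \<epsilon> \<epsilon>1 d C CA \<kappa> by (auto simp: \<epsilon>'_def)
    obtain x \<tau> \<xi> t0 where tr: "traj \<epsilon>' \<sigma> x \<tau> \<xi> t0" using traj_exists[OF \<epsilon>'(1)] by blast
    let ?I = "{t0 - h..t0 + 1}"
    have t0: "t0 \<in> ?I" using h_pos by auto
    define \<xi>0 where "\<xi>0 = \<xi> t0"
    define z where "z = \<bar>\<xi>0\<bar>"
    have \<xi>_lt: "\<bar>\<xi> t\<bar> < \<delta>" "\<bar>\<xi> t\<bar> < d" if "t \<in> ?I" for t using trajD(5)[OF tr that] \<epsilon>' \<epsilon>1 by auto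
    have z: "0 \<le> z" "z \<le> 1" "z < \<epsilon>'" using trajD(5)[OF tr t0] \<epsilon>' \<epsilon>1 by (auto simp: z_def \<xi>0_def)
    note E = est[OF traj_mono[OF tr \<epsilon>'(3)], unfolded estimates_def \<xi>0_def[symmetric], folded z_def]
    have E1: "\<bar>\<xi> t\<bar> \<le> 2 * z" "\<bar>(\<xi> t)\<^sup>2 - \<xi>0\<^sup>2\<bar> \<le> C * z ^ 4" "\<bar>(\<xi> t) ^ 3 - \<xi>0 ^ 3\<bar> \<le> C * z ^ 4"
      "\<bar>\<tau> t - \<sigma> - (t - t0)\<bar> \<le> C * z ^ 2" "\<bar>a * (\<xi> t)\<^sup>2 + \<rho>1 (\<tau> t) (\<xi> t)\<bar> \<le> C * z ^ 2"
      "\<bar>\<rho>1 (\<tau> t) (\<xi> t)\<bar> \<le> C * z ^ 4" "\<bar>\<rho>2 (\<tau> t) (\<xi> t)\<bar> \<le> C * z ^ 4" if "t \<in> ?I" for t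
      using E[OF that] by simp_all
    have z5: "z ^ 5 \<le> z ^ 4" by (rule power_decreasing) (use z in auto)
    have zz: "0 \<le> z ^ 4" "0 \<le> z ^ 3" using z by auto
    have Cz: "C * z ^ 5 \<le> C * z ^ 4" using z5 C by simp
    \<comment> \<open>\<open>\<tau>\<close> advances by at least \<open>1/2\<close> in unit time, so it takes the value \<open>\<sigma>1\<close>.\<close>
    obtain t1 where t1: "t0 \<le> t1" "t1 \<le> t0 + 1" "\<tau> t1 = \<sigma>1"
    proof -
      have "continuous_on {t0..t0 + 1} \<tau>"
        by (rule continuous_on_subset[OF DERIV_continuous_on[OF trajD(7)[OF tr]]]) (use h_pos in auto)
      moreover have "\<sigma> + 1/2 \<le> \<tau> (t0 + 1)"
      proof -
        have "z ^ 2 \<le> z ^ 1" by (rule power_decreasing) (use z in auto)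
        then have "C * z ^ 2 \<le> C * z" using C by simp
        also have "\<dots> \<le> C * (1 / (2 * C))" using z \<epsilon>'(5) C by (intro mult_left_mono) auto
        also have "\<dots> = 1/2" using C by simp
        finally show ?thesis using E1(4)[of "t0 + 1"] h_pos by auto
      qed
      ultimately show ?thesis using IVT'[of \<tau> t0 \<sigma>1 "t0 + 1"] trajD(1)[OF tr] \<sigma>1 that by auto
    qed
    then have t1I: "t1 \<in> ?I" using h_pos by auto
    define Y where "Y t = x t - \<gamma> (\<tau> t) - \<xi> t *\<^sub>R q (\<tau> t) - (1/2 * \<xi>0\<^sup>2) *\<^sub>R V2 (\<tau> t) - (1/6 * \<xi>0 ^ 3) *\<^sub>R V3 (\<tau> t)" for t
    define p where "p t = a * (\<xi> t)\<^sup>2 + \<rho>1 (\<tau> t) (\<xi> t)" for t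
    define s where "s t = c * (\<xi> t) ^ 3 + \<rho>2 (\<tau> t) (\<xi> t)" for t
    define D where "D t = F (H (\<tau> t) (\<xi> t)) - (1 + p t) *\<^sub>R \<gamma>1 (\<tau> t) - (\<xi> t *\<^sub>R ((1 + p t) *\<^sub>R q1 (\<tau> t)) + s t *\<^sub>R q (\<tau> t))
       - (1/2 * \<xi>0\<^sup>2) *\<^sub>R ((1 + p t) *\<^sub>R G2 (\<tau> t)) - (1/6 * \<xi>0 ^ 3) *\<^sub>R ((1 + p t) *\<^sub>R G3 (\<tau> t))" for t
    have Y_deriv: "(Y has_vector_derivative D t) (at t within ?I)" if t: "t \<in> ?I" for t
    proof -
      have \<tau>': "(\<tau> has_real_derivative 1 + p t) (at t within ?I)" using trajD(7)[OF tr t] by (simp add: p_def add.assoc)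
      have \<xi>': "(\<xi> has_real_derivative s t) (at t within ?I)" using trajD(8)[OF tr t] by (simp add: s_def)
      have x': "(x has_vector_derivative F (H (\<tau> t) (\<xi> t))) (at t within ?I)"
        using trajD(6)[OF tr t] trajD(4)[OF tr t] by simp
      note ch = chain_vector_derivative[OF _ \<tau>']
      note sc = bounded_linear.has_vector_derivative[OF bounded_linear_scaleR_right]
      show ?thesis
        unfolding Y_def D_def
        by (rule has_vector_derivative_diff[OF has_vector_derivative_diff[OF has_vector_derivative_diff[OF has_vector_derivative_diff[OF x'
             ch[OF \<gamma>_deriv]] has_vector_derivative_scaleR[OF \<xi>' ch[OF q1_deriv]]] sc[OF ch[OF V2]]] sc[OF ch[OF V3]]])
    qed
    have D_le: "norm (D t - 0) \<le> 8 * e * z ^ 3 + 6 * (C * A) * z ^ 4" if t: "t \<in> ?I" for t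
    proof -
      define E where "E = F (H (\<tau> t) (\<xi> t)) - F_jet (\<tau> t) (\<xi> t)"
      have E: "norm E \<le> 8 * e * z ^ 3"
      proof -
        have "norm E \<le> e * \<bar>\<xi> t\<bar> ^ 3" unfolding E_def by (rule Fexp[OF \<xi>_lt(2)[OF t]])
        also have "\<dots> \<le> e * (2 * z) ^ 3" using e E1(1)[OF t] by (intro mult_left_mono power_mono) auto
        finally show ?thesis by (simp add: power_mult_distrib)
      qed
      have G: "L (\<tau> t) (h2 (\<tau> t)) + Bq (\<tau> t) = G2 (\<tau> t) + (2 * a) *\<^sub>R \<gamma>1 (\<tau> t)"
        "L (\<tau> t) (h3 (\<tau> t)) + 3 *\<^sub>R Bh (\<tau> t) + Cq (\<tau> t) = G3 (\<tau> t) + (6 * a) *\<^sub>R q1 (\<tau> t) + (6 * c) *\<^sub>R q (\<tau> t)"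
        by (simp_all add: G2_def G3_def)
      have Fe: "F (H (\<tau> t) (\<xi> t)) = E + (\<gamma>1 (\<tau> t) + \<xi> t *\<^sub>R q1 (\<tau> t) + (1/2 * (\<xi> t)\<^sup>2) *\<^sub>R (G2 (\<tau> t) + (2 * a) *\<^sub>R \<gamma>1 (\<tau> t))
       + (1/6 * (\<xi> t) ^ 3) *\<^sub>R (G3 (\<tau> t) + (6 * a) *\<^sub>R q1 (\<tau> t) + (6 * c) *\<^sub>R q (\<tau> t)))"
        unfolding E_def F_jet_def G by simp
      let ?r1 = "\<rho>1 (\<tau> t) (\<xi> t)" and ?r2 = "\<rho>2 (\<tau> t) (\<xi> t)"
      have D: "D t = E + (1/2 * ((\<xi> t)\<^sup>2 - \<xi>0\<^sup>2)) *\<^sub>R G2 (\<tau> t) + (1/6 * ((\<xi> t) ^ 3 - \<xi>0 ^ 3)) *\<^sub>R G3 (\<tau> t)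
        - ?r1 *\<^sub>R \<gamma>1 (\<tau> t) - ?r2 *\<^sub>R q (\<tau> t) - (\<xi> t * ?r1) *\<^sub>R q1 (\<tau> t) - (1/2 * (\<xi>0\<^sup>2 * p t)) *\<^sub>R G2 (\<tau> t) - (1/6 * (\<xi>0 ^ 3 * p t)) *\<^sub>R G3 (\<tau> t)"
        (is "_ = ?R")
      proof (rule vec_eq_iff[THEN iffD2], rule allI)
        fix i
        define e' g2 g3 y1 y q' where "e' = E $ i" and "g2 = G2 (\<tau> t) $ i" and "g3 = G3 (\<tau> t) $ i" and "y1 = \<gamma>1 (\<tau> t) $ i" and "y = q (\<tau> t) $ i" and "q' = q1 (\<tau> t) $ i"
        show "D t $ i = ?R $ i"
          unfolding D_def Fe p_def s_def by (simp add: e'_def[symmetric] g2_def[symmetric] g3_def[symmetric] y1_def[symmetric] y_def[symmetric] q'_def[symmetric]) (simp add: field_simps power2_eq_square power3_eq_cube)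
      qed
      have "\<bar>\<xi> t * ?r1\<bar> \<le> (2 * z) * (C * z ^ 4)" unfolding abs_mult using E1[OF t] by (intro mult_mono) (auto simp: z)
      also have "\<dots> \<le> 2 * (C * z ^ 4)" using Cz by (simp add: power_Suc[of z 4, symmetric] mult_ac del: power_Suc)
      finally have b1: "\<bar>\<xi> t * ?r1\<bar> \<le> 2 * (C * z ^ 4)" .
      have "\<bar>\<xi>0\<^sup>2 * p t\<bar> \<le> z\<^sup>2 * (C * z\<^sup>2)" unfolding abs_mult p_def using E1(5)[OF t] by (intro mult_mono) (auto simp: z_def)
      also have "\<dots> = C * z ^ 4" by (simp add: power4_eq_xxxx power2_eq_square)
      finally have b2: "\<bar>\<xi>0\<^sup>2 * p t\<bar> \<le> C * z ^ 4" .
      have "\<bar>\<xi>0 ^ 3 * p t\<bar> \<le> z ^ 3 * (C * z\<^sup>2)" unfolding abs_mult p_def using E1(5)[OF t] by (intro mult_mono) (auto simp: z_def power_abs)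
      also have "\<dots> = C * z ^ 5" by (simp flip: power_add)
      also note Cz
      finally have b3: "\<bar>\<xi>0 ^ 3 * p t\<bar> \<le> C * z ^ 4" .
      have half': "\<bar>1/2 * r\<bar> \<le> 1/2 * (C * z ^ 4)" "\<bar>1/6 * r\<bar> \<le> 1/6 * (C * z ^ 4)" if "\<bar>r\<bar> \<le> C * z ^ 4" for r using that by auto
      have "norm (D t) \<le> 8 * e * z ^ 3 + 1/2 * (C * z ^ 4) * A + 1/6 * (C * z ^ 4) * A + C * z ^ 4 * A + C * z ^ 4 * A + 2 * (C * z ^ 4) * A + 1/2 * (C * z ^ 4) * A + 1/6 * (C * z ^ 4) * A"
        unfolding D by (intro norm_triangle_mono norm_diff_mono E norm_scaleR_le half' E1(2,3,6,7)[OF t] b1 b2 b3 A)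
      also have "\<dots> \<le> 8 * e * z ^ 3 + 6 * (C * A) * z ^ 4"
      proof -
        have "0 \<le> C * z ^ 4 * A" using C A(1) zz by simp
        then show ?thesis by (simp add: mult_ac)
      qed
      finally show ?thesis by simp
    qed
    have Y_inc: "norm (Y t1 - Y t0) \<le> 8 * e * z ^ 3 + 6 * (C * A) * z ^ 4"
    proof -
      have "norm (Y t1 - Y t0 - (t1 - t0) *\<^sub>R 0) \<le> (8 * e * z ^ 3 + 6 * (C * A) * z ^ 4) * \<bar>t1 - t0\<bar>"
        by (rule increment_bound[OF Y_deriv D_le t0 t1I])
      also have "\<dots> \<le> (8 * e * z ^ 3 + 6 * (C * A) * z ^ 4) * 1"
        using t1 e C A(1) zz by (intro mult_left_mono add_nonneg_nonneg mult_nonneg_nonneg) auto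
      finally show ?thesis by simp
    qed
    define R where "R t = x t - (\<gamma> (\<tau> t) + \<xi> t *\<^sub>R q (\<tau> t) + (1/2 * (\<xi> t)\<^sup>2) *\<^sub>R v (\<tau> t) + (1/6 * (\<xi> t) ^ 3) *\<^sub>R w (\<tau> t))" for t
    have R_le: "norm (R t) \<le> 16 * (A * z ^ 4)" if t: "t \<in> ?I" for t
    proof -
      have "norm (R t) \<le> KH * \<bar>\<xi> t\<bar> ^ 4"
        using H_value[OF \<xi>_lt(1)[OF t], of 0 "\<tau> t"] traj_value[OF tr t, of 0] h_nonneg by (simp add: R_def v_def w_def)
      also have "\<dots> \<le> A * (2 * z) ^ 4" using A(1,9) E1(1)[OF t] by (intro mult_mono power_mono) auto
      finally show ?thesis by (simp add: power_mult_distrib mult_ac)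
    qed
    let ?Z = "\<xi>0\<^sup>2 *\<^sub>R ((1/2) *\<^sub>R ((v \<sigma>1 - v \<sigma>) - (V2 \<sigma>1 - V2 \<sigma>))) + \<xi>0 ^ 3 *\<^sub>R ((1/6) *\<^sub>R ((w \<sigma>1 - w \<sigma>) - (V3 \<sigma>1 - V3 \<sigma>)))"
    have Z: "?Z = (Y t1 - Y t0) - R t1 + R t0 - (1/2 * ((\<xi> t1)\<^sup>2 - \<xi>0\<^sup>2)) *\<^sub>R v \<sigma>1 - (1/6 * ((\<xi> t1) ^ 3 - \<xi>0 ^ 3)) *\<^sub>R w \<sigma>1"
      unfolding Y_def R_def t1(3) trajD(1)[OF tr] \<xi>0_def[symmetric] by (simp add: vec_eq_iff field_simps)
    have half': "\<bar>1/2 * r\<bar> \<le> 1/2 * (C * z ^ 4)" "\<bar>1/6 * r\<bar> \<le> 1/6 * (C * z ^ 4)" if "\<bar>r\<bar> \<le> C * z ^ 4" for r using that by auto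
    have "norm ?Z \<le> (8 * e * z ^ 3 + 6 * (C * A) * z ^ 4) + 16 * (A * z ^ 4) + 16 * (A * z ^ 4) + 1/2 * (C * z ^ 4) * A + 1/6 * (C * z ^ 4) * A"
      unfolding Z by (intro norm_triangle_mono norm_diff_mono Y_inc R_le t1I t0 norm_scaleR_le half' E1(2,3) vw)
    also have "\<dots> \<le> 8 * e * z ^ 3 + 40 * (C * A) * z ^ 4"
    proof -
      have "1 * (A * z ^ 4) \<le> C * (A * z ^ 4)" using C A(1) zz by (intro mult_right_mono) auto
      moreover have "0 \<le> A * z ^ 4" using A(1) zz by simp
      ultimately show ?thesis by (simp add: mult_ac)
    qed
    also have "\<dots> = (\<kappa> / 2 + 40 * (C * A) * z) * z ^ 3" by (simp add: e_def power4_eq_xxxx power3_eq_cube algebra_simps)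
    also have "\<dots> \<le> \<kappa> * z ^ 3"
    proof (rule mult_right_mono)
      have "40 * (C * A) * z \<le> 40 * (C * A) * (\<kappa> / (80 * (C * A)))" using z \<epsilon>'(6) CA by (intro mult_left_mono) auto
      also have "\<dots> = \<kappa> / 2" using C A(1) by (simp add: field_simps)
      finally show "\<kappa> / 2 + 40 * (C * A) * z \<le> \<kappa>" by simp
    qed (use zz in simp)
    finally show ?thesis using trajD(2)[OF tr] z \<epsilon>'(2) by (intro exI[of _ \<xi>0]) (auto simp: z_def \<xi>0_def)
  qed
  show "v \<sigma>1 - v \<sigma> = V2 \<sigma>1 - V2 \<sigma>" "w \<sigma>1 - w \<sigma> = V3 \<sigma>1 - V3 \<sigma>"
    using extract_coefficients[OF main] by auto
qed

end

context pd_setting begin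

lemma v_deriv: "(v has_vector_derivative G2 t) (at t)" and w_deriv: "(w has_vector_derivative G3 t) (at t)"
proof -
  obtain V2 where V2: "\<And>t. (V2 has_vector_derivative G2 t) (at t)" using antiderivative[OF G2_cont] by blast
  obtain V3 where V3: "\<And>t. (V3 has_vector_derivative G3 t) (at t)" using antiderivative[OF G3_cont] by blast
  let ?\<sigma> = "t - 1/4"
  let ?S = "{?\<sigma><..<?\<sigma> + 1/2}"
  have inc: "v ?\<sigma> - V2 ?\<sigma> + V2 s = v s" "w ?\<sigma> - V3 ?\<sigma> + V3 s = w s" if "s \<in> ?S" for s
    using time_increments[OF V2 V3, of ?\<sigma> s] that by (auto simp: algebra_simps)
  have "((\<lambda>s. v ?\<sigma> - V2 ?\<sigma> + V2 s) has_vector_derivative 0 + G2 t) (at t)"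
    "((\<lambda>s. w ?\<sigma> - V3 ?\<sigma> + V3 s) has_vector_derivative 0 + G3 t) (at t)"
    by (rule has_vector_derivative_add[OF has_vector_derivative_const V2], rule has_vector_derivative_add[OF has_vector_derivative_const V3])
  then show "(v has_vector_derivative G2 t) (at t)" "(w has_vector_derivative G3 t) (at t)"
    using has_vector_derivative_transform_within_open[of _ "G2 t" t ?S v, OF _ _ _ inc(1)]
      has_vector_derivative_transform_within_open[of _ "G3 t" t ?S w, OF _ _ _ inc(2)] by simp_all
qed

lemma v_cont: "continuous_on S v" and w_cont: "continuous_on S w"
  by (intro continuous_at_imp_continuous_on ballI has_vector_derivative_continuous[OF v_deriv] has_vector_derivative_continuous[OF w_deriv])+

lemma v_per: "v (t + T) = v t" and w_anti: "w (t + T) = - w t"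
  by (simp_all add: v_def w_def h2_per h3_anti)

text \<open>The second derivative of \<open>q\<close>.\<close>

definition q2 :: "real \<Rightarrow> real^'n" where
  "q2 t = iter_deriv F [\<phi> t, hist h \<gamma>1 t] (orbit t) + L t (hist h q1 t)"

lemma q2_deriv: "(q1 has_vector_derivative q2 t) (at t)"
proof -
  have "q1 = (\<lambda>t. L t (\<phi> t))" by (simp add: q1_def fun_eq_iff)
  then show ?thesis using lin_sol_second_deriv[OF q_sol, of t] by (simp add: q2_def)
qed

lemma hist_q1_cont: "continuous_on S (hist h q1)"
  using hist_continuous[OF h_nonneg q1_cont] continuous_on_subset by blast

lemma q2_cont: "continuous_on S q2"
  unfolding q2_def by (intro continuous_on_add iter2_cont orbit_cont \<phi>_cont hist_\<gamma>1_cont L_cont hist_q1_cont)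

lemma q2_anti: "q2 (t + T) = - q2 t"
  by (simp add: q2_def \<phi>_anti hist_per[of \<gamma>1, OF \<gamma>1_per] orbit_per neg_iter2 hist_anti[OF q1_cont q1_anti] per linear_neg[OF linear(1)])

text \<open>The state of a trajectory at a time \<open>t0\<close> and its values at the times \<open>t0 + \<theta>\<close> are both known from
  the parametrization. Comparing them expresses the coefficients \<open>h2\<close> and \<open>h3\<close> as functions of \<open>\<theta>\<close>
  by their values at \<open>\<theta> = 0\<close>.\<close>

lemma state_relations:
  assumes \<theta>: "\<theta> \<in> {-h..0}"
  shows "h2 \<sigma> \<theta> = v (\<sigma> + \<theta>) + (2 * a * \<theta>) *\<^sub>R \<gamma>1 (\<sigma> + \<theta>)"
    and "h3 \<sigma> \<theta> = w (\<sigma> + \<theta>) + (6 * a * \<theta>) *\<^sub>R q1 (\<sigma> + \<theta>) + (6 * c * \<theta>) *\<^sub>R q (\<sigma> + \<theta>)"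
proof -
  obtain A0 where A0: "A0 \<ge> 1" "\<And>\<tau>. norm (h2 \<tau>) \<le> A0" "\<And>\<tau>. norm (h3 \<tau>) \<le> A0" "\<And>\<tau>. norm (G2 \<tau>) \<le> A0" "\<And>\<tau>. norm (G3 \<tau>) \<le> A0"
    "\<And>\<tau>. norm (\<gamma>1 \<tau>) \<le> A0" "\<And>\<tau>. norm (\<gamma>2 \<tau>) \<le> A0" "\<And>\<tau>. norm (q \<tau>) \<le> A0" "\<And>\<tau>. norm (q1 \<tau>) \<le> A0" "KH \<le> A0"
    using uniform_bounds by blast
  obtain Aq where Aq: "Aq > 0" "\<And>\<tau>. norm (q2 \<tau>) \<le> Aq" using periodic_bounded[OF q2_cont anti_norm[of q2, OF q2_anti] T_pos] by blast
  define A where "A = A0 + Aq"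
  have AA: "A0 \<le> A" "Aq \<le> A" using A0(1) Aq(1) by (auto simp: A_def)
  have A: "A \<ge> 1" "norm (h2 \<tau>) \<le> A" "norm (h3 \<tau>) \<le> A" "norm (G2 \<tau>) \<le> A" "norm (G3 \<tau>) \<le> A"
    "norm (\<gamma>1 \<tau>) \<le> A" "norm (\<gamma>2 \<tau>) \<le> A" "norm (q \<tau>) \<le> A" "norm (q1 \<tau>) \<le> A" "KH \<le> A" "norm (q2 \<tau>) \<le> A" for \<tau>
    using A0(1,10) Aq(1) by (auto simp: A_def intro: order_trans[OF _ AA(1)[unfolded A_def]] order_trans[OF _ AA(2)[unfolded A_def]] A0 Aq)
  have Anon: "0 \<le> A" using A(1) by simp
  have vw: "norm (v \<tau>) \<le> A" "norm (w \<tau>) \<le> A" for \<tau>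
    unfolding v_def w_def by (rule order_trans[OF norm_bounded A(2)], rule order_trans[OF norm_bounded A(3)])
  note lip_v = lipschitz_increment[OF v_deriv A(4) Anon] and lip_w = lipschitz_increment[OF w_deriv A(5) Anon]
    and lip_q = lipschitz_increment[OF q1_deriv A(9) Anon]
    and tay_\<gamma> = taylor_increment[OF \<gamma>_deriv lipschitz_increment[OF \<gamma>1_deriv A(7) Anon] Anon]
    and tay_q = taylor_increment[OF q1_deriv lipschitz_increment[OF q2_deriv A(11) Anon] Anon]
  obtain \<epsilon>1 C where \<epsilon>1: "0 < \<epsilon>1" "\<epsilon>1 \<le> \<delta>" "\<epsilon>1 \<le> 1" and C: "1 \<le> C"
    and est: "\<And>\<sigma> x \<tau> \<xi> t0 t. traj \<epsilon>1 \<sigma> x \<tau> \<xi> t0 \<Longrightarrow> t \<in> {t0 - h..t0 + 1} \<Longrightarrow> estimates C \<sigma> \<tau> \<xi> t0 t"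
    using traj_estimates by blast
  let ?s = "\<sigma> + \<theta>"
  define KK where "KK = 17 * A + 2 * (A * C\<^sup>2) + 5 * (C * A) + \<bar>c\<bar> * h * (A * C)"
  have KK: "0 < KK" using A(1) C h_pos by (auto simp: KK_def intro!: add_pos_nonneg mult_nonneg_nonneg)
  have main: "\<exists>\<xi>. \<xi> \<noteq> 0 \<and> \<bar>\<xi>\<bar> < \<epsilon> \<and> norm (\<xi>\<^sup>2 *\<^sub>R ((1/2) *\<^sub>R (h2 \<sigma> \<theta> - (v ?s + (2 * a * \<theta>) *\<^sub>R \<gamma>1 ?s)))
      + \<xi> ^ 3 *\<^sub>R ((1/6) *\<^sub>R (h3 \<sigma> \<theta> - (w ?s + (6 * a * \<theta>) *\<^sub>R q1 ?s + (6 * c * \<theta>) *\<^sub>R q ?s)))) \<le> \<kappa> * \<bar>\<xi>\<bar> ^ 3"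
    if \<kappa>: "0 < \<kappa>" and \<epsilon>: "0 < \<epsilon>" for \<kappa> \<epsilon>
  proof -
    define \<epsilon>' where "\<epsilon>' = min (min \<epsilon> \<epsilon>1) (\<kappa> / KK)"
    have \<epsilon>': "0 < \<epsilon>'" "\<epsilon>' \<le> \<epsilon>" "\<epsilon>' \<le> \<epsilon>1" "\<epsilon>' \<le> \<kappa> / KK" using \<epsilon> \<epsilon>1 \<kappa> KK by (auto simp: \<epsilon>'_def)
    obtain x \<tau> \<xi> t0 where tr: "traj \<epsilon>' \<sigma> x \<tau> \<xi> t0" using traj_exists[OF \<epsilon>'(1)] by blast
    let ?I = "{t0 - h..t0 + 1}"
    define t where "t = t0 + \<theta>"
    have t0: "t0 \<in> ?I" and t: "t \<in> ?I" using h_pos \<theta> by (auto simp: t_def)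
    have tt: "t - t0 = \<theta>" by (simp add: t_def)
    define \<xi>0 where "\<xi>0 = \<xi> t0"
    define z where "z = \<bar>\<xi>0\<bar>"
    have \<xi>_lt: "\<bar>\<xi> r\<bar> < \<delta>" if "r \<in> ?I" for r using trajD(5)[OF tr that] \<epsilon>' \<epsilon>1 by auto
    have z: "0 \<le> z" "z \<le> 1" "z < \<epsilon>'" using trajD(5)[OF tr t0] \<epsilon>' \<epsilon>1 by (auto simp: z_def \<xi>0_def)
    have E: "\<bar>\<xi> t\<bar> \<le> 2 * z" "\<bar>(\<xi> t)\<^sup>2 - \<xi>0\<^sup>2\<bar> \<le> C * z ^ 4" "\<bar>(\<xi> t) ^ 3 - \<xi>0 ^ 3\<bar> \<le> C * z ^ 4"
      "\<bar>\<xi> t - \<xi>0 - \<theta> * (c * \<xi>0 ^ 3)\<bar> \<le> C * z ^ 4" "\<bar>\<tau> t - \<sigma> - \<theta> * (1 + a * \<xi>0\<^sup>2)\<bar> \<le> C * z ^ 4"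
      "\<bar>\<tau> t - \<sigma> - \<theta>\<bar> \<le> C * z ^ 2"
      using est[OF traj_mono[OF tr \<epsilon>'(3)] t, unfolded estimates_def \<xi>0_def[symmetric], folded z_def] by (simp_all add: tt)
    have zz: "0 \<le> z ^ 4" "0 \<le> z ^ 3" "0 \<le> z ^ 2" using z by auto
    have z45: "z ^ 5 \<le> z ^ 4" by (rule power_decreasing) (use z in auto)
    have Cz: "C * z ^ 5 \<le> C * z ^ 4" using C z45 by simp
    define \<Delta> where "\<Delta> = \<tau> t - ?s"
    have \<Delta>: "\<bar>\<Delta>\<bar> \<le> C * z ^ 2" "\<bar>\<Delta> - a * \<xi>0\<^sup>2 * \<theta>\<bar> \<le> C * z ^ 4" using E(5,6) by (simp_all add: \<Delta>_def algebra_simps)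
    have \<Delta>2: "\<Delta>\<^sup>2 \<le> C\<^sup>2 * z ^ 4"
    proof -
      have "\<bar>\<Delta>\<bar>\<^sup>2 \<le> (C * z ^ 2)\<^sup>2" using \<Delta>(1) by (intro power_mono) auto
      then show ?thesis by (simp add: power_mult_distrib flip: power_mult)
    qed
    have A\<Delta>: "A * \<bar>\<Delta>\<bar> \<le> A * (C * z ^ 2)" using \<Delta>(1) Anon by (intro mult_left_mono)
    define T\<gamma> where "T\<gamma> = \<gamma> (\<tau> t) - \<gamma> ?s - \<Delta> *\<^sub>R \<gamma>1 ?s"
    define Tq where "Tq = q (\<tau> t) - q ?s - \<Delta> *\<^sub>R q1 ?s"
    have T\<gamma>: "norm T\<gamma> \<le> A * C\<^sup>2 * z ^ 4" and Tq: "norm Tq \<le> A * C\<^sup>2 * z ^ 4"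
      using tay_\<gamma>[of "\<tau> t" ?s] tay_q[of "\<tau> t" ?s] mult_left_mono[OF \<Delta>2 Anon] unfolding T\<gamma>_def Tq_def \<Delta>_def mult.assoc by linarith+
    have dv: "norm (v (\<tau> t) - v ?s) \<le> A * (C * z ^ 2)" and dw: "norm (w (\<tau> t) - w ?s) \<le> A * (C * z ^ 2)"
      and dq: "norm (q (\<tau> t) - q ?s) \<le> A * (C * z ^ 2)"
      using lip_v[of "\<tau> t" ?s] lip_w[of "\<tau> t" ?s] lip_q[of "\<tau> t" ?s] A\<Delta> unfolding \<Delta>_def by linarith+
    define R0 where "R0 = x t - (\<gamma> ?s + \<xi>0 *\<^sub>R q ?s + (1/2 * \<xi>0\<^sup>2) *\<^sub>R h2 \<sigma> \<theta> + (1/6 * \<xi>0 ^ 3) *\<^sub>R h3 \<sigma> \<theta>)"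
    define R1 where "R1 = x t - (\<gamma> (\<tau> t) + \<xi> t *\<^sub>R q (\<tau> t) + (1/2 * (\<xi> t)\<^sup>2) *\<^sub>R v (\<tau> t) + (1/6 * (\<xi> t) ^ 3) *\<^sub>R w (\<tau> t))"
    have R0: "norm R0 \<le> 1 * z ^ 4 * A"
    proof -
      have "norm R0 \<le> KH * z ^ 4"
        using H_value[OF \<xi>_lt[OF t0] \<theta>, of \<sigma>] traj_value[OF tr t0 \<theta>] trajD(1)[OF tr]
        by (simp add: R0_def t_def z_def \<xi>0_def)
      also have "\<dots> \<le> A * z ^ 4" by (intro mult_right_mono A zz)
      finally show ?thesis by (simp add: mult.commute)
    qed
    have R1: "norm R1 \<le> 16 * z ^ 4 * A"
    proof -
      have "norm R1 \<le> KH * \<bar>\<xi> t\<bar> ^ 4"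
        using H_value[OF \<xi>_lt[OF t], of 0 "\<tau> t"] traj_value[OF tr t, of 0] h_nonneg by (simp add: R1_def v_def w_def)
      also have "\<dots> \<le> A * (2 * z) ^ 4" using A(1,10) E(1) by (intro mult_mono power_mono) auto
      finally show ?thesis by (simp add: power_mult_distrib mult_ac)
    qed
    let ?Z = "\<xi>0\<^sup>2 *\<^sub>R ((1/2) *\<^sub>R (h2 \<sigma> \<theta> - (v ?s + (2 * a * \<theta>) *\<^sub>R \<gamma>1 ?s)))
      + \<xi>0 ^ 3 *\<^sub>R ((1/6) *\<^sub>R (h3 \<sigma> \<theta> - (w ?s + (6 * a * \<theta>) *\<^sub>R q1 ?s + (6 * c * \<theta>) *\<^sub>R q ?s)))"
    have Z: "?Z = R1 - R0 + T\<gamma> + (\<Delta> - a * \<xi>0\<^sup>2 * \<theta>) *\<^sub>R \<gamma>1 ?s + (\<xi> t - \<xi>0 - \<theta> * (c * \<xi>0 ^ 3)) *\<^sub>R q (\<tau> t)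
       + (c * \<theta> * \<xi>0 ^ 3) *\<^sub>R (q (\<tau> t) - q ?s) + \<xi>0 *\<^sub>R Tq + (\<xi>0 * (\<Delta> - a * \<xi>0\<^sup>2 * \<theta>)) *\<^sub>R q1 ?s
       + (1/2 * ((\<xi> t)\<^sup>2 - \<xi>0\<^sup>2)) *\<^sub>R v (\<tau> t) + (1/2 * \<xi>0\<^sup>2) *\<^sub>R (v (\<tau> t) - v ?s)
       + (1/6 * ((\<xi> t) ^ 3 - \<xi>0 ^ 3)) *\<^sub>R w (\<tau> t) + (1/6 * \<xi>0 ^ 3) *\<^sub>R (w (\<tau> t) - w ?s)"
      (is "_ = ?R")
    proof (rule vec_eq_iff[THEN iffD2], rule allI)
      fix i
      define H2 H3 g g' gs v' v'' w' w'' y y' y1 X where "H2 = h2 \<sigma> \<theta> $ i" and "H3 = h3 \<sigma> \<theta> $ i"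
        and "g = \<gamma> (\<tau> t) $ i" and "g' = \<gamma>1 ?s $ i" and "gs = \<gamma> ?s $ i" and "v' = v (\<tau> t) $ i" and "v'' = v ?s $ i"
        and "w' = w (\<tau> t) $ i" and "w'' = w ?s $ i" and "y = q (\<tau> t) $ i" and "y' = q ?s $ i" and "y1 = q1 ?s $ i" and "X = x t $ i"
      note defs = this
      show "?Z $ i = ?R $ i"
        unfolding R0_def R1_def T\<gamma>_def Tq_def by (simp only: vector_minus_component vector_add_component vector_scaleR_component real_scaleR_def defs[symmetric]) algebra
    qed
    have b1: "norm ((c * \<theta> * \<xi>0 ^ 3) *\<^sub>R (q (\<tau> t) - q ?s)) \<le> \<bar>c\<bar> * h * (A * C) * z ^ 4"
    proof -
      have "\<bar>c * \<theta> * \<xi>0 ^ 3\<bar> \<le> \<bar>c\<bar> * h * z ^ 3" unfolding abs_mult using \<theta> by (intro mult_mono) (auto simp: z_def power_abs)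
      then have "norm ((c * \<theta> * \<xi>0 ^ 3) *\<^sub>R (q (\<tau> t) - q ?s)) \<le> (\<bar>c\<bar> * h * z ^ 3) * (A * (C * z ^ 2))" by (rule norm_scaleR_le[OF _ dq])
      also have "\<dots> = \<bar>c\<bar> * h * (A * C) * z ^ 5" by (simp flip: power_add)
      also have "\<dots> \<le> \<bar>c\<bar> * h * (A * C) * z ^ 4" using z45 C Anon h_pos by (intro mult_left_mono) auto
      finally show ?thesis .
    qed
    have b2: "norm (\<xi>0 *\<^sub>R Tq) \<le> 1 * (A * C\<^sup>2 * z ^ 4)" using z by (intro norm_scaleR_le Tq) (simp add: z_def)
    have b3: "\<bar>\<xi>0 * (\<Delta> - a * \<xi>0\<^sup>2 * \<theta>)\<bar> \<le> 1 * (C * z ^ 4)" unfolding abs_mult using z \<Delta>(2) by (intro mult_mono) (auto simp: z_def)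
    have b4: "norm ((1/2 * \<xi>0\<^sup>2) *\<^sub>R (v (\<tau> t) - v ?s)) \<le> 1/2 * (C * z ^ 4) * A"
    proof -
      have "norm ((1/2 * \<xi>0\<^sup>2) *\<^sub>R (v (\<tau> t) - v ?s)) \<le> (1/2 * z\<^sup>2) * (A * (C * z ^ 2))" by (intro norm_scaleR_le dv) (simp add: z_def)
      also have "\<dots> = 1/2 * (C * z ^ 4) * A" by (simp add: power2_eq_square power4_eq_xxxx)
      finally show ?thesis .
    qed
    have b5: "norm ((1/6 * \<xi>0 ^ 3) *\<^sub>R (w (\<tau> t) - w ?s)) \<le> 1/6 * (C * z ^ 4) * A"
    proof -
      have "norm ((1/6 * \<xi>0 ^ 3) *\<^sub>R (w (\<tau> t) - w ?s)) \<le> (1/6 * z ^ 3) * (A * (C * z ^ 2))" by (intro norm_scaleR_le dw) (simp add: z_def abs_mult power_abs)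
      also have "\<dots> = 1/6 * (C * z ^ 5) * A" by (simp flip: power_add)
      also have "\<dots> \<le> 1/6 * (C * z ^ 4) * A" by (intro mult_right_mono mult_left_mono Cz Anon) simp
      finally show ?thesis .
    qed
    have half': "\<bar>1/2 * r\<bar> \<le> 1/2 * (C * z ^ 4)" "\<bar>1/6 * r\<bar> \<le> 1/6 * (C * z ^ 4)" if "\<bar>r\<bar> \<le> C * z ^ 4" for r using that by auto
    have "norm ?Z \<le> 16 * z ^ 4 * A + 1 * z ^ 4 * A + A * C\<^sup>2 * z ^ 4 + C * z ^ 4 * A + C * z ^ 4 * A + \<bar>c\<bar> * h * (A * C) * z ^ 4 + 1 * (A * C\<^sup>2 * z ^ 4)
       + 1 * (C * z ^ 4) * A + 1/2 * (C * z ^ 4) * A + 1/2 * (C * z ^ 4) * A + 1/6 * (C * z ^ 4) * A + 1/6 * (C * z ^ 4) * A"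
      unfolding Z by (intro norm_triangle_mono norm_diff_mono R1 R0 T\<gamma> norm_scaleR_le[OF \<Delta>(2)] norm_scaleR_le[OF E(4)] b1 b2 norm_scaleR_le[OF b3] norm_scaleR_le[OF half'(1)] norm_scaleR_le[OF half'(2)] E(2,3) b4 b5 A vw)
    also have "\<dots> \<le> KK * z ^ 4"
    proof -
      have "0 \<le> C * z ^ 4 * A" using C Anon zz by simp
      then show ?thesis unfolding KK_def distrib_right by (simp add: mult_ac)
    qed
    also have "\<dots> = (KK * z) * z ^ 3" by (simp add: power4_eq_xxxx power3_eq_cube)
    also have "\<dots> \<le> \<kappa> * z ^ 3"
    proof (rule mult_right_mono)
      have "KK * z \<le> KK * (\<kappa> / KK)" using z \<epsilon>'(4) KK by (intro mult_left_mono) auto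
      then show "KK * z \<le> \<kappa>" using KK by simp
    qed (use zz in simp)
    finally show ?thesis using trajD(2)[OF tr] z \<epsilon>'(2) by (intro exI[of _ \<xi>0]) (auto simp: z_def \<xi>0_def)
  qed
  show "h2 \<sigma> \<theta> = v (\<sigma> + \<theta>) + (2 * a * \<theta>) *\<^sub>R \<gamma>1 (\<sigma> + \<theta>)"
    "h3 \<sigma> \<theta> = w (\<sigma> + \<theta>) + (6 * a * \<theta>) *\<^sub>R q1 (\<sigma> + \<theta>) + (6 * c * \<theta>) *\<^sub>R q (\<sigma> + \<theta>)"
    using extract_coefficients[OF main] by auto
qed

text \<open>The states \<open>H \<sigma> \<xi>\<close> are in the phase space, hence so are the coefficients of their expansion.\<close>

lemma h2_phase: "h2 \<sigma> \<in> phase_space h" and h3_phase: "h3 \<sigma> \<in> phase_space h"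
proof -
  have "h2 \<sigma> \<theta> = h2 \<sigma> (max (-h) (min 0 \<theta>)) \<and>
    h3 \<sigma> \<theta> = h3 \<sigma> (max (-h) (min 0 \<theta>))" for \<theta>
  proof -
    let ?\<theta> = "max (-h) (min 0 \<theta>)"
    have le: "norm (\<xi>\<^sup>2 *\<^sub>R ((1/2) *\<^sub>R (h2 \<sigma> \<theta> - h2 \<sigma> ?\<theta>))
      + \<xi> ^ 3 *\<^sub>R ((1/6) *\<^sub>R (h3 \<sigma> \<theta> - h3 \<sigma> ?\<theta>))) \<le> (2 * KH) * \<xi> ^ 4" if \<xi>: "\<bar>\<xi>\<bar> < \<delta>" for \<xi>
    proof -
      have inv: "H \<sigma> \<xi> \<theta> = H \<sigma> \<xi> ?\<theta>" "orbit \<sigma> \<theta> = orbit \<sigma> ?\<theta>"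
        "apply_bcontfun (\<phi> \<sigma>) \<theta> = apply_bcontfun (\<phi> \<sigma>) ?\<theta>"
        using H_mem[OF \<xi>, of \<sigma>] W_sub hist_mem[OF h_nonneg \<gamma>_cont, of \<sigma>] hist_mem[OF h_nonneg lin_sol_cont[OF q_sol], of \<sigma>]
        unfolding phase_space_iff[OF h_nonneg] orbit_def by (auto simp: phase_space_iff[OF h_nonneg])
      have "\<xi>\<^sup>2 *\<^sub>R ((1/2) *\<^sub>R (h2 \<sigma> \<theta> - h2 \<sigma> ?\<theta>))
        + \<xi> ^ 3 *\<^sub>R ((1/6) *\<^sub>R (h3 \<sigma> \<theta> - h3 \<sigma> ?\<theta>))
        = rem \<sigma> \<xi> ?\<theta> - rem \<sigma> \<xi> \<theta>"
        by (simp add: rem_def inv algebra_simps)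
      also have "norm \<dots> \<le> KH * \<xi> ^ 4 + KH * \<xi> ^ 4"
        by (intro order_trans[OF norm_triangle_ineq4] add_mono order_trans[OF norm_bounded rem_le[OF \<xi>]])
      finally show ?thesis by simp
    qed
    show ?thesis using extract_coefficients_quartic[OF \<delta> le] by simp
  qed
  then show "h2 \<sigma> \<in> phase_space h" "h3 \<sigma> \<in> phase_space h" by (simp_all add: phase_space_iff[OF h_nonneg])
qed

lemma shift_cont: "continuous_on UNIV f \<Longrightarrow> continuous_on S (\<lambda>\<theta>::real. f (\<sigma> + \<theta> :: real) :: real^'n)"
  by (rule continuous_on_compose2[of UNIV f S "\<lambda>\<theta>. \<sigma> + \<theta>"]) (auto intro: continuous_intros)

lemma h2_eq: "h2 \<sigma> = h2_of h a \<gamma>1 v \<sigma>"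
  unfolding h2_of_def
proof (rule phase_space_eqI[OF h_nonneg h2_phase])
  have c: "continuous_on {-h..0} (\<lambda>\<theta>. v (\<sigma> + \<theta>) + (2 * a * \<theta>) *\<^sub>R \<gamma>1 (\<sigma> + \<theta>))"
    by (intro continuous_intros shift_cont[OF v_cont] shift_cont[OF \<gamma>1_cont])
  show "restrict_state h (\<lambda>\<theta>. v (\<sigma> + \<theta>) + (2 * a * \<theta>) *\<^sub>R \<gamma>1 (\<sigma> + \<theta>)) \<in> phase_space h" by (rule restrict_state_mem[OF h_nonneg c])
  fix \<theta> assume "\<theta> \<in> {-h..0}"
  then show "h2 \<sigma> \<theta> = apply_bcontfun (restrict_state h (\<lambda>\<theta>. v (\<sigma> + \<theta>) + (2 * a * \<theta>) *\<^sub>R \<gamma>1 (\<sigma> + \<theta>))) \<theta>"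
    unfolding restrict_state_apply[OF h_nonneg c] by (simp add: state_relations)
qed

lemma h3_eq: "h3 \<sigma> = restrict_state h (\<lambda>\<theta>. w (\<sigma> + \<theta>) + (6 * a * \<theta>) *\<^sub>R q1 (\<sigma> + \<theta>) + (6 * c * \<theta>) *\<^sub>R q (\<sigma> + \<theta>))"
proof (rule phase_space_eqI[OF h_nonneg h3_phase])
  have c: "continuous_on {-h..0} (\<lambda>\<theta>. w (\<sigma> + \<theta>) + (6 * a * \<theta>) *\<^sub>R q1 (\<sigma> + \<theta>) + (6 * c * \<theta>) *\<^sub>R q (\<sigma> + \<theta>))"
    by (intro continuous_intros shift_cont[OF w_cont] shift_cont[OF q1_cont] shift_cont[OF lin_sol_cont[OF q_sol]])
  show "restrict_state h (\<lambda>\<theta>. w (\<sigma> + \<theta>) + (6 * a * \<theta>) *\<^sub>R q1 (\<sigma> + \<theta>) + (6 * c * \<theta>) *\<^sub>R q (\<sigma> + \<theta>)) \<in> phase_space h" by (rule restrict_state_mem[OF h_nonneg c])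
  fix \<theta> assume "\<theta> \<in> {-h..0}"
  then show "h3 \<sigma> \<theta> = apply_bcontfun (restrict_state h (\<lambda>\<theta>. w (\<sigma> + \<theta>) + (6 * a * \<theta>) *\<^sub>R q1 (\<sigma> + \<theta>) + (6 * c * \<theta>) *\<^sub>R q (\<sigma> + \<theta>))) \<theta>"
    unfolding restrict_state_apply[OF h_nonneg c] by (simp add: state_relations)
qed

lemma L_weighted:
  assumes f: "continuous_on UNIV f"
  shows "L t (restrict_state h (\<lambda>\<theta>. (b * \<theta>) *\<^sub>R f (t + \<theta>))) = b *\<^sub>R f t - b *\<^sub>R D_char f t"
proof -
  have "restrict_state h (\<lambda>\<theta>. (b * \<theta>) *\<^sub>R f (t + \<theta>)) = restrict_state h (\<lambda>\<theta>. (- b) *\<^sub>R ((- \<theta>) *\<^sub>R f (t + \<theta>)))" by simp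
  also have "\<dots> = (- b) *\<^sub>R restrict_state h (\<lambda>\<theta>. (- \<theta>) *\<^sub>R f (t + \<theta>))"
    by (rule restrict_state_scaleR[OF h_nonneg]) (intro continuous_intros shift_cont[OF f])
  finally show ?thesis by (simp add: D_char_def linear_neg[OF linear(1)] linear_scale[OF linear(1)] algebra_simps)
qed

lemma v_equation: "G2 t - L t (hist h v t) = Bq t - (2 * a) *\<^sub>R D_char \<gamma>1 t"
proof -
  have "h2 t = hist h v t + restrict_state h (\<lambda>\<theta>. (2 * a * \<theta>) *\<^sub>R \<gamma>1 (t + \<theta>))"
    unfolding h2_eq[of t] h2_of_def hist_def by (rule restrict_state_add[OF h_nonneg]) (intro continuous_intros shift_cont[OF v_cont] shift_cont[OF \<gamma>1_cont])+
  then show ?thesis by (simp add: G2_def linear_add[OF linear(1)] L_weighted[OF \<gamma>1_cont])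
qed

lemma w_equation: "G3 t - L t (hist h w t) = 3 *\<^sub>R Bh t + Cq t - (6 * a) *\<^sub>R D_char q1 t - (6 * c) *\<^sub>R D_char q t"
proof -
  have "h3 t = restrict_state h (\<lambda>\<theta>. w (t + \<theta>) + (6 * a * \<theta>) *\<^sub>R q1 (t + \<theta>)) + restrict_state h (\<lambda>\<theta>. (6 * c * \<theta>) *\<^sub>R q (t + \<theta>))"
    unfolding h3_eq[of t] by (rule restrict_state_add[OF h_nonneg]) (intro continuous_intros shift_cont[OF w_cont] shift_cont[OF q1_cont] shift_cont[OF lin_sol_cont[OF q_sol]])+
  also have "restrict_state h (\<lambda>\<theta>. w (t + \<theta>) + (6 * a * \<theta>) *\<^sub>R q1 (t + \<theta>)) = hist h w t + restrict_state h (\<lambda>\<theta>. (6 * a * \<theta>) *\<^sub>R q1 (t + \<theta>))"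
    unfolding hist_def by (rule restrict_state_add[OF h_nonneg]) (intro continuous_intros shift_cont[OF w_cont] shift_cont[OF q1_cont])+
  finally show ?thesis by (simp add: G3_def linear_add[OF linear(1)] L_weighted[OF q1_cont] L_weighted[OF lin_sol_cont[OF q_sol]])
qed

end

section \<open>Solvability conditions and the selection of the second order term\<close>

lemma cdot_cvec: "cdot (cvec r) w = of_real (r \<bullet> w)"
  by (simp add: cdot_def cvec_def inner_vec_def)

lemma integral_cdot_cvec:
  fixes r f :: "real \<Rightarrow> real^'n"
  assumes "continuous_on UNIV r" "continuous_on UNIV f"
  shows "integral {\<alpha>..\<beta>} (\<lambda>t. cdot (cvec (r t)) (f t)) = of_real (integral {\<alpha>..\<beta>} (\<lambda>t. r t \<bullet> f t))"
proof -
  have "(\<lambda>t. r t \<bullet> f t) integrable_on {\<alpha>..\<beta>}"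
    by (intro integrable_continuous_interval continuous_intros continuous_on_subset[OF assms(1)] continuous_on_subset[OF assms(2)]) auto
  from integral_linear[OF this bounded_linear_of_real[where 'a = complex]] show ?thesis by (simp add: cdot_cvec o_def)
qed

lemma cdot_integrable:
  fixes p :: "real \<Rightarrow> complex^'n"
  shows "continuous_on UNIV p \<Longrightarrow> continuous_on UNIV f \<Longrightarrow> (\<lambda>t. cdot (p t) (f t)) integrable_on {\<alpha>..\<beta>}"
  by (intro integrable_continuous_interval bounded_bilinear.continuous_on[OF bounded_bilinear_cdot])
    (auto intro: continuous_on_subset)

context periodic_dde begin

lemma null_function_lin_sol:
  assumes "null_function (char_op h \<zeta> 0) (cvec \<circ> q)"
  shows "lin_sol q" "\<exists>t. q t \<noteq> 0"
proof -
  obtain q' where q': "\<And>t. (q has_vector_derivative q' t) (at t)"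
    by (rule C1_cvec[of q]) (use assms in \<open>auto simp: null_function_def\<close>)
  have c: "continuous_on UNIV q" by (intro continuous_at_imp_continuous_on ballI has_vector_derivative_continuous[OF q'])
  have "q' t = L t (hist h q t)" for t
  proof -
    have "cvec (q' t - L t (hist h q t)) = cvec 0"
      using char_op_value[OF c q', of t] assms by (simp add: null_function_def cvec_simps)
    then show ?thesis by (simp add: cvec_inj)
  qed
  then show "lin_sol q" using q' by (simp add: lin_sol_def)
  obtain t where "(cvec \<circ> q) t \<noteq> 0" using assms by (auto simp: null_function_def)
  then have "q t \<noteq> 0" by (auto simp: cvec_simps)
  then show "\<exists>t. q t \<noteq> 0" ..
qed

lemma D_char_diff:
  assumes f: "continuous_on UNIV f" and g: "continuous_on UNIV g"
  shows "D_char (\<lambda>t. f t - b *\<^sub>R g t) t = D_char f t - b *\<^sub>R D_char g t"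
proof -
  have c: "continuous_on {-h..0} (\<lambda>\<theta>. x (t + \<theta>))" if "continuous_on UNIV x" for x :: "real \<Rightarrow> real^'n"
    by (rule continuous_on_compose2[OF that]) (auto intro: continuous_intros)
  have "restrict_state h (\<lambda>\<theta>. (- \<theta>) *\<^sub>R (f (t + \<theta>) - b *\<^sub>R g (t + \<theta>)))
    = restrict_state h (\<lambda>\<theta>. (- \<theta>) *\<^sub>R f (t + \<theta>) - b *\<^sub>R ((- \<theta>) *\<^sub>R g (t + \<theta>)))"
    by (intro restrict_state_cong[OF h_nonneg]) (simp add: algebra_simps)
  also have "\<dots> = restrict_state h (\<lambda>\<theta>. (- \<theta>) *\<^sub>R f (t + \<theta>)) - restrict_state h (\<lambda>\<theta>. b *\<^sub>R ((- \<theta>) *\<^sub>R g (t + \<theta>)))"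
    by (rule restrict_state_diff[OF h_nonneg]) (intro continuous_on_scaleR continuous_on_minus continuous_on_id continuous_on_const c f g)+
  also have "restrict_state h (\<lambda>\<theta>. b *\<^sub>R ((- \<theta>) *\<^sub>R g (t + \<theta>))) = b *\<^sub>R restrict_state h (\<lambda>\<theta>. (- \<theta>) *\<^sub>R g (t + \<theta>))"
    by (rule restrict_state_scaleR[OF h_nonneg]) (intro continuous_on_scaleR continuous_on_minus continuous_on_id continuous_on_const c g)+
  finally show ?thesis unfolding D_char_def linear_diff[OF linear(1)] linear_scale[OF linear(1)] by (simp only: linear_diff[OF linear(1)] linear_scale[OF linear(1)] scaleR_right_distrib) (simp add: linear_diff[OF linear(1)] linear_scale[OF linear(1)])
qed

text \<open>The functional that selects the second order term depends on \<open>v\<close> only through the pairing of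
  \<open>r\<close> with \<open>\<Delta>'(0) v\<close>, up to a constant.\<close>

lemma sun_pairing_h2_of:
  assumes r: "continuous_on UNIV r" "\<And>t. r (t + T) = r t"
  shows "\<exists>K. \<forall>f. continuous_on UNIV f \<longrightarrow> (\<forall>t. f (t + T) = f t) \<longrightarrow>
     sun_pairing h T (adjoint_state h \<zeta> r) (h2_of h b \<gamma>1 f) = integral {0..T} (\<lambda>t. r t \<bullet> D_char f t) + K"
proof -
  interpret adj: adjoint_pairing h T bnd \<zeta> L L1 L2 r
    by unfold_locales (use r in auto)
  let ?e = "\<lambda>\<theta>::real. 2 * b * (- \<theta>)"
  define J where "J e f \<tau> = integral {0..h} (\<lambda>\<theta>. adj.adj \<tau> \<theta> \<bullet> (e \<theta> *\<^sub>R f (\<tau> - \<theta>)))" for e and f :: "real \<Rightarrow> real^'n" and \<tau>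
  have e: "continuous_on UNIV ?e" by (intro continuous_intros)
  have one: "continuous_on UNIV (\<lambda>_::real. 1::real)" by (rule continuous_on_const)
  have main: "sun_pairing h T (adjoint_state h \<zeta> r) (h2_of h b \<gamma>1 f) = integral {0..T} (\<lambda>t. r t \<bullet> D_char f t) + integral {0..T} (J ?e \<gamma>1)"
    if f: "continuous_on UNIV f" "\<And>t. f (t + T) = f t" for f
  proof -
    note in1 = adj.adj_inner(1)[OF f one] and in2 = adj.adj_inner(1)[OF \<gamma>1_cont \<gamma>1_per e]
    note out1 = adj.adj_outer(1)[OF f one] and out2 = adj.adj_outer(1)[OF \<gamma>1_cont \<gamma>1_per e]
    have val: "apply_bcontfun (h2_of h b \<gamma>1 f \<tau>) \<theta> = f (\<tau> + \<theta>) + (2 * b * \<theta>) *\<^sub>R \<gamma>1 (\<tau> + \<theta>)" if "\<theta> \<in> {-h..0}" for \<tau> \<theta>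
    proof -
      have "continuous_on {-h..0} (\<lambda>\<theta>. f (\<tau> + \<theta>) + (2 * b * \<theta>) *\<^sub>R \<gamma>1 (\<tau> + \<theta>))"
        by (intro continuous_intros continuous_on_compose2[OF f(1)] continuous_on_compose2[OF \<gamma>1_cont[of UNIV]]) auto
      then show ?thesis using that unfolding h2_of_def by (simp add: restrict_state_apply[OF h_nonneg])
    qed
    have inner: "integral {0..h} (\<lambda>\<theta>. adj.adj \<tau> \<theta> \<bullet> apply_bcontfun (h2_of h b \<gamma>1 f \<tau>) (- \<theta>)) = J (\<lambda>_. 1) f \<tau> + J ?e \<gamma>1 \<tau>" for \<tau>
    proof -
      have "integral {0..h} (\<lambda>\<theta>. adj.adj \<tau> \<theta> \<bullet> apply_bcontfun (h2_of h b \<gamma>1 f \<tau>) (- \<theta>))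
        = integral {0..h} (\<lambda>\<theta>. adj.adj \<tau> \<theta> \<bullet> (1 *\<^sub>R f (\<tau> - \<theta>)) + adj.adj \<tau> \<theta> \<bullet> (?e \<theta> *\<^sub>R \<gamma>1 (\<tau> - \<theta>)))"
        by (intro integral_cong) (simp add: val inner_diff_right)
      also have "\<dots> = J (\<lambda>_. 1) f \<tau> + J ?e \<gamma>1 \<tau>" unfolding J_def by (rule integral_add[OF in1 in2])
      finally show ?thesis .
    qed
    have rf: "(\<lambda>\<tau>. r \<tau> \<bullet> f \<tau>) integrable_on {0..T}"
      by (intro integrable_continuous_interval continuous_intros continuous_on_subset[OF r(1)] continuous_on_subset[OF f(1)]) auto
    have Jint: "J (\<lambda>_. 1) f integrable_on {0..T}" "J ?e \<gamma>1 integrable_on {0..T}" using out1 out2 by (simp_all add: J_def[abs_def])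
    have "sun_pairing h T (adjoint_state h \<zeta> r) (h2_of h b \<gamma>1 f)
      = integral {0..T} (\<lambda>\<tau>. (r \<tau> \<bullet> f \<tau> + J (\<lambda>_. 1) f \<tau>) + J ?e \<gamma>1 \<tau>)"
      unfolding sun_pairing_def adj.adj_def[symmetric] inner
      by (intro integral_cong) (simp add: val h_nonneg adjoint_state_def)
    also have "\<dots> = integral {0..T} (\<lambda>\<tau>. r \<tau> \<bullet> f \<tau>) + integral {0..T} (J (\<lambda>_. 1) f) + integral {0..T} (J ?e \<gamma>1)"
      by (subst integral_add[OF integrable_add[OF rf Jint(1)] Jint(2)], subst integral_add[OF rf Jint(1)]) simp
    also have "integral {0..T} (J (\<lambda>_. 1) f) = integral {0..T} (\<lambda>\<tau>. r \<tau> \<bullet> L \<tau> (restrict_state h (\<lambda>\<theta>. (- \<theta>) *\<^sub>R f (\<tau> + \<theta>))))"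
      using adj.adj_pairing_value[OF f] by (simp add: J_def[abs_def])
    also have "\<dots> = integral {0..T} (\<lambda>\<tau>. r \<tau> \<bullet> (D_char f \<tau> - f \<tau>))" by (simp add: D_char_def)
    also have "integral {0..T} (\<lambda>\<tau>. r \<tau> \<bullet> f \<tau>) + \<dots> = integral {0..T} (\<lambda>\<tau>. r \<tau> \<bullet> f \<tau> + r \<tau> \<bullet> (D_char f \<tau> - f \<tau>))"
      by (rule integral_add[symmetric, OF rf])
        (intro integrable_continuous_interval continuous_intros continuous_on_subset[OF r(1)] continuous_on_subset[OF f(1)] continuous_on_subset[OF D_char_cont[OF f(1)]]; simp)
    also have "(\<lambda>\<tau>. r \<tau> \<bullet> f \<tau> + r \<tau> \<bullet> (D_char f \<tau> - f \<tau>)) = (\<lambda>\<tau>. r \<tau> \<bullet> D_char f \<tau>)" by (simp add: fun_eq_iff inner_diff_right)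
    finally show ?thesis .
  qed
  then show ?thesis by blast
qed

lemma h2_of_add_\<gamma>1:
  assumes f: "continuous_on UNIV f"
  shows "h2_of h b \<gamma>1 (\<lambda>t. f t + \<kappa> *\<^sub>R \<gamma>1 t) \<tau> = h2_of h b \<gamma>1 f \<tau> + \<kappa> *\<^sub>R hist h \<gamma>1 \<tau>"
proof -
  have c: "continuous_on {-h..0} (\<lambda>\<theta>. x (\<tau> + \<theta>))" if "continuous_on UNIV x" for x :: "real \<Rightarrow> real^'n"
    by (rule continuous_on_compose2[OF that]) (auto intro: continuous_intros)
  have "h2_of h b \<gamma>1 (\<lambda>t. f t + \<kappa> *\<^sub>R \<gamma>1 t) \<tau> = restrict_state h (\<lambda>\<theta>. (f (\<tau> + \<theta>) + (2 * b * \<theta>) *\<^sub>R \<gamma>1 (\<tau> + \<theta>)) + \<kappa> *\<^sub>R \<gamma>1 (\<tau> + \<theta>))"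
    unfolding h2_of_def by (intro restrict_state_cong[OF h_nonneg]) simp
  also have "\<dots> = restrict_state h (\<lambda>\<theta>. f (\<tau> + \<theta>) + (2 * b * \<theta>) *\<^sub>R \<gamma>1 (\<tau> + \<theta>)) + restrict_state h (\<lambda>\<theta>. \<kappa> *\<^sub>R \<gamma>1 (\<tau> + \<theta>))"
    by (rule restrict_state_add[OF h_nonneg]) (intro continuous_on_add continuous_on_scaleR continuous_on_mult continuous_on_id continuous_on_const c f \<gamma>1_cont)+
  also have "restrict_state h (\<lambda>\<theta>. \<kappa> *\<^sub>R \<gamma>1 (\<tau> + \<theta>)) = \<kappa> *\<^sub>R hist h \<gamma>1 \<tau>"
    unfolding hist_def by (rule restrict_state_scaleR[OF h_nonneg c[OF \<gamma>1_cont]])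
  finally show ?thesis by (simp add: h2_of_def)
qed

end

text \<open>The setting with the adjoint null functions and their normalizations.\<close>

locale pd_adjoint = pd_setting h T k F \<gamma> \<zeta> a c \<delta> KH K1 K2 q W H h2 h3 \<rho>1 \<rho>2
  for h T :: real and k :: nat and F :: "(real \<Rightarrow>\<^sub>C (real^'n)) \<Rightarrow> real^'n" and \<gamma> \<zeta>
    and a c \<delta> KH K1 K2 q W H h2 h3 \<rho>1 \<rho>2 +
  fixes s0 :: real and r :: "real \<Rightarrow> real^'n" and p :: "real \<Rightarrow> complex^'n"
  assumes simple: "simple_eigenvalue (phase_space h) (monodromy h L T s0) 1"
    and r_null: "null_function (adj_char_op h \<zeta> 0) (cvec \<circ> r)" and r_per: "r (t + T) = r t"
    and r_norm: "pairing T (cvec \<circ> r) (char_op_deriv h \<zeta> 0 (cvec \<circ> \<gamma>1)) = 1"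
    and p_null: "null_function (adj_char_op h \<zeta> 0) p" and p_anti: "p (t + T) = - p t"
    and p_norm: "pairing T p (char_op_deriv h \<zeta> 0 (cvec \<circ> q)) = 1"
begin

lemma r_cont: "continuous_on UNIV r"
proof -
  obtain r' where "\<And>t. (r has_vector_derivative r' t) (at t)"
    by (rule C1_cvec[of r]) (use r_null in \<open>auto simp: null_function_def\<close>)
  then show ?thesis by (intro continuous_at_imp_continuous_on ballI has_vector_derivative_continuous)
qed

lemma p_cont: "continuous_on UNIV p"
  by (rule adjoint_null_derivative[OF p_null])

lemma char_op_deriv_cvec: "continuous_on UNIV f \<Longrightarrow> char_op_deriv h \<zeta> 0 (cvec \<circ> f) = cvec \<circ> D_char f"
  using char_op_deriv_value by (simp add: fun_eq_iff)

lemma r_D_char: "integral {0..T} (\<lambda>t. r t \<bullet> D_char \<gamma>1 t) = 1"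
proof -
  have "of_real (integral {0..T} (\<lambda>t. r t \<bullet> D_char \<gamma>1 t)) = (1 :: complex)"
    using r_norm integral_cdot_cvec[OF r_cont D_char_cont[OF \<gamma>1_cont], of 0 T]
    by (simp add: char_op_deriv_cvec[OF \<gamma>1_cont] pairing_cvec)
  then show ?thesis by (simp only: of_real_eq_1_iff)
qed

lemma p_D_char: "integral {0..T} (\<lambda>t. cdot (p t) (D_char q t)) = 1"
  using p_norm unfolding char_op_deriv_cvec[OF lin_sol_cont[OF q_sol]] pairing_cvec .

lemma a_formula: "of_real a = 1/2 * pairing T (cvec \<circ> r) (cvec \<circ> Bq)"
proof -
  interpret cd: bounded_bilinear "cdot :: complex^'n \<Rightarrow> _" by (rule bounded_bilinear_cdot)
  have rc: "continuous_on UNIV (cvec \<circ> r)"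
    by (rule adjoint_null_derivative[OF r_null])
  have "integral {0..T} (\<lambda>t. cdot ((cvec \<circ> r) t) (G2 t - L t (hist h v t))) = 0"
    by (rule solvability[OF r_null _ v_deriv G2_cont, where \<sigma> = 1]) (simp_all add: r_per v_per)
  then have "0 = integral {0..T} (\<lambda>t. cdot ((cvec \<circ> r) t) (Bq t) - (2 * a) *\<^sub>R cdot ((cvec \<circ> r) t) (D_char \<gamma>1 t))"
    by (simp add: v_equation cd.diff_right cd.scaleR_right)
  also have "\<dots> = integral {0..T} (\<lambda>t. cdot ((cvec \<circ> r) t) (Bq t)) - integral {0..T} (\<lambda>t. (2 * a) *\<^sub>R cdot ((cvec \<circ> r) t) (D_char \<gamma>1 t))"
    by (rule integral_diff) (intro integrable_cmul cdot_integrable rc Bq_cont D_char_cont \<gamma>1_cont)+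
  also have "integral {0..T} (\<lambda>t. (2 * a) *\<^sub>R cdot ((cvec \<circ> r) t) (D_char \<gamma>1 t)) = (2 * a) *\<^sub>R 1"
    using integral_cdot_cvec[OF r_cont D_char_cont[OF \<gamma>1_cont], of 0 T] by (simp add: r_D_char)
  finally show ?thesis by (simp add: pairing_cvec scaleR_conv_of_real)
qed

text \<open>The second order term may be changed by a multiple of \<open>\<gamma>'\<close> in the formula for \<open>c\<close>, since
  \<open>B(\<phi>, \<gamma>') = \<Delta>(0) q'\<close>.\<close>

lemma p_kernel: "integral {0..T} (\<lambda>t. cdot (p t) (iter_deriv F [\<phi> t, hist h \<gamma>1 t] (orbit t))) = 0"
proof -
  have "integral {0..T} (\<lambda>t. cdot (p t) (q2 t - L t (hist h q1 t))) = 0"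
    by (rule solvability[OF p_null _ q2_deriv q2_cont, where \<sigma> = "-1"]) (simp_all add: p_anti q1_anti)
  then show ?thesis by (simp add: q2_def)
qed

lemma c_formula:
  assumes v: "\<And>t. v t = u t + \<kappa> *\<^sub>R \<gamma>1 t" and u: "continuous_on UNIV u"
  shows "of_real c = 1/6 * integral {0..T} (\<lambda>t. cdot (p t)
     (Cq t + 3 *\<^sub>R iter_deriv F [\<phi> t, h2_of h a \<gamma>1 u t] (orbit t) - (6 * a) *\<^sub>R D_char q1 t))"
proof -
  interpret cd: bounded_bilinear "cdot :: complex^'n \<Rightarrow> _" by (rule bounded_bilinear_cdot)
  let ?X = "\<lambda>t. Cq t + 3 *\<^sub>R iter_deriv F [\<phi> t, h2_of h a \<gamma>1 u t] (orbit t) - (6 * a) *\<^sub>R D_char q1 t"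
  let ?Y = "\<lambda>t. iter_deriv F [\<phi> t, hist h \<gamma>1 t] (orbit t)"
  have v': "v = (\<lambda>t. u t + \<kappa> *\<^sub>R \<gamma>1 t)" using v by (simp add: fun_eq_iff)
  have h2: "h2 t = h2_of h a \<gamma>1 u t + \<kappa> *\<^sub>R hist h \<gamma>1 t" for t
    using h2_eq[of t] h2_of_add_\<gamma>1[OF u, of a \<kappa> t] by (simp only: v'[symmetric])
  have Bh: "Bh t = iter_deriv F [\<phi> t, h2_of h a \<gamma>1 u t] (orbit t) + \<kappa> *\<^sub>R ?Y t" for t
  proof -
    interpret b: bounded_bilinear "\<lambda>u u'. iter_deriv F [u, u'] (orbit t)" using k by (intro iter_bounded_bilinear) simp
    show ?thesis by (simp add: Bh_def h2 b.add_right b.scaleR_right)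
  qed
  have Yc: "continuous_on UNIV ?Y" by (intro iter2_cont orbit_cont \<phi>_cont hist_\<gamma>1_cont)
  have "?X = (\<lambda>t. Cq t + 3 *\<^sub>R (Bh t - \<kappa> *\<^sub>R ?Y t) - (6 * a) *\<^sub>R D_char q1 t)" by (simp add: Bh)
  then have Xc: "continuous_on UNIV ?X"
    by (simp only:) (intro continuous_on_add continuous_on_diff continuous_on_scaleR continuous_on_const Cq_cont Bh_cont Yc D_char_cont q1_cont)
  have Dc: "continuous_on UNIV (D_char q)" by (intro D_char_cont lin_sol_cont[OF q_sol])
  have "integral {0..T} (\<lambda>t. cdot (p t) (G3 t - L t (hist h w t))) = 0"
    by (rule solvability[OF p_null _ w_deriv G3_cont, where \<sigma> = "-1"]) (simp_all add: p_anti w_anti)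
  moreover have "cdot (p t) (G3 t - L t (hist h w t))
    = cdot (p t) (?X t) + (3 * \<kappa>) *\<^sub>R cdot (p t) (?Y t) - (6 * c) *\<^sub>R cdot (p t) (D_char q t)" for t
  proof -
    have "G3 t - L t (hist h w t) = ?X t + (3 * \<kappa>) *\<^sub>R ?Y t - (6 * c) *\<^sub>R D_char q t"
      unfolding w_equation Bh by (simp add: algebra_simps)
    then show ?thesis by (simp only: cd.add_right cd.diff_right cd.scaleR_right)
  qed
  ultimately have "0 = integral {0..T} (\<lambda>t. cdot (p t) (?X t) + (3 * \<kappa>) *\<^sub>R cdot (p t) (?Y t) - (6 * c) *\<^sub>R cdot (p t) (D_char q t))"
    by (simp only:)
  also have "\<dots> = integral {0..T} (\<lambda>t. cdot (p t) (?X t) + (3 * \<kappa>) *\<^sub>R cdot (p t) (?Y t)) - integral {0..T} (\<lambda>t. (6 * c) *\<^sub>R cdot (p t) (D_char q t))"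
    by (rule integral_diff) (intro integrable_add integrable_cmul cdot_integrable p_cont Xc Yc Dc)+
  also have "integral {0..T} (\<lambda>t. cdot (p t) (?X t) + (3 * \<kappa>) *\<^sub>R cdot (p t) (?Y t))
    = integral {0..T} (\<lambda>t. cdot (p t) (?X t)) + integral {0..T} (\<lambda>t. (3 * \<kappa>) *\<^sub>R cdot (p t) (?Y t))"
    by (rule integral_add) (intro integrable_cmul cdot_integrable p_cont Xc Yc)+
  finally have "0 = integral {0..T} (\<lambda>t. cdot (p t) (?X t)) + (3 * \<kappa>) *\<^sub>R 0 - (6 * c) *\<^sub>R 1"
    by (simp only: integral_cmul p_kernel p_D_char)
  then show ?thesis by (simp add: scaleR_conv_of_real)
qed

text \<open>The periodic solutions of \<open>\<Delta>(0) u = B(\<phi>,\<phi>) - 2 a \<Delta>'(0) \<gamma>'\<close>, and the functional that selects one of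
  them.\<close>

definition solves2 :: "(real \<Rightarrow> real^'n) \<Rightarrow> bool" where
  "solves2 u \<longleftrightarrow> u C1_differentiable_on UNIV \<and> (\<forall>t. u (t + T) = u t) \<and>
     (\<forall>\<tau>. char_op h \<zeta> 0 (cvec \<circ> u) \<tau> = cvec (Bq \<tau> - (2 * a) *\<^sub>R D_char \<gamma>1 \<tau>))"

abbreviation sun :: "(real \<Rightarrow> real^'n) \<Rightarrow> real" where
  "sun u \<equiv> sun_pairing h T (adjoint_state h \<zeta> r) (h2_of h a \<gamma>1 u)"

lemma solves2_cont: "solves2 u \<Longrightarrow> continuous_on UNIV u"
  unfolding solves2_def by (auto intro: C1_differentiable_imp_continuous_on)

lemma solves2_unique:
  assumes u: "solves2 u"
  obtains \<kappa> where "\<And>t. v t = u t + \<kappa> *\<^sub>R \<gamma>1 t"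
proof -
  obtain u' where u': "\<And>t. (u has_vector_derivative u' t) (at t)"
    using u unfolding solves2_def C1_differentiable_on_def by auto
  note uc = solves2_cont[OF u]
  have eq: "u' t - L t (hist h u t) = G2 t - L t (hist h v t)" for t
    using char_op_value[OF uc u', of t] u unfolding v_equation solves2_def by (simp add: cvec_inj)
  have "lin_sol (\<lambda>t. v t - u t)"
    unfolding lin_sol_def
  proof
    fix t
    have "L t (hist h (\<lambda>t. v t - u t) t) = G2 t - u' t"
      using eq[of t] by (simp add: hist_diff[OF h_nonneg v_cont continuous_on_subset[OF uc]] linear_diff[OF linear(1)] algebra_simps)
    then show "((\<lambda>t. v t - u t) has_vector_derivative L t (hist h (\<lambda>t. v t - u t) t)) (at t)"
      using has_vector_derivative_diff[OF v_deriv u'] by simp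
  qed
  moreover obtain t0 where "\<gamma>1 t0 \<noteq> 0" using \<gamma>1_nz by blast
  ultimately obtain \<kappa> where "\<forall>t. v t - u t = \<kappa> *\<^sub>R \<gamma>1 t"
    using periodic_lin_sol[OF simple, of "\<lambda>t. v t - u t" t0] u v_per unfolding solves2_def by auto
  then have "v t = u t + \<kappa> *\<^sub>R \<gamma>1 t" for t using spec[of _ t] by (metis diff_add_cancel add.commute)
  then show thesis by (rule that)
qed

text \<open>The functional is normalized on \<open>\<gamma>'\<close> by \<open>\<langle>r, \<Delta>'(0) \<gamma>'\<rangle> = 1\<close>.\<close>

lemma sun_shift:
  assumes "solves2 u" and v: "\<And>t. v t = u t + \<kappa> *\<^sub>R \<gamma>1 t"
  shows "sun u = sun v - \<kappa>"
proof -
  obtain K where K: "\<And>f. continuous_on UNIV f \<Longrightarrow> (\<And>t. f (t + T) = f t) \<Longrightarrow> sun f = integral {0..T} (\<lambda>t. r t \<bullet> D_char f t) + K"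
    using sun_pairing_h2_of[OF r_cont r_per, of a] by blast
  note uc = solves2_cont[OF assms(1)]
  have u: "u = (\<lambda>t. v t - \<kappa> *\<^sub>R \<gamma>1 t)" using v by (simp add: fun_eq_iff)
  have D: "D_char u t = D_char v t - \<kappa> *\<^sub>R D_char \<gamma>1 t" for t
    unfolding u by (rule D_char_diff[OF v_cont \<gamma>1_cont])
  have int: "(\<lambda>t. r t \<bullet> D_char f t) integrable_on {0..T}" if "continuous_on UNIV f" for f
    by (intro integrable_continuous_interval continuous_on_inner continuous_on_subset[OF r_cont] continuous_on_subset[OF D_char_cont[OF that]]) auto
  have "integral {0..T} (\<lambda>t. r t \<bullet> D_char u t) = integral {0..T} (\<lambda>t. r t \<bullet> D_char v t - \<kappa> *\<^sub>R (r t \<bullet> D_char \<gamma>1 t))"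
    by (simp add: D inner_diff_right)
  also have "\<dots> = integral {0..T} (\<lambda>t. r t \<bullet> D_char v t) - integral {0..T} (\<lambda>t. \<kappa> *\<^sub>R (r t \<bullet> D_char \<gamma>1 t))"
    by (rule integral_diff) (intro int integrable_cmul v_cont \<gamma>1_cont)+
  also have "integral {0..T} (\<lambda>t. \<kappa> *\<^sub>R (r t \<bullet> D_char \<gamma>1 t)) = \<kappa>" unfolding integral_cmul r_D_char by simp
  finally show ?thesis using K[OF uc] K[OF v_cont v_per] assms(1) unfolding solves2_def by simp
qed

lemma solves2_exists: "solves2 (\<lambda>t. v t - \<kappa> *\<^sub>R \<gamma>1 t)"
proof -
  let ?u = "\<lambda>t. v t - \<kappa> *\<^sub>R \<gamma>1 t"
  have d: "(?u has_vector_derivative G2 t - \<kappa> *\<^sub>R \<gamma>2 t) (at t)" for t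
    by (rule has_vector_derivative_diff[OF v_deriv bounded_linear.has_vector_derivative[OF bounded_linear_scaleR_right \<gamma>1_deriv]])
  have c: "continuous_on UNIV ?u" by (intro continuous_intros v_cont \<gamma>1_cont)
  have "?u C1_differentiable_on UNIV"
    unfolding C1_differentiable_on_def
    by (rule exI[of _ "\<lambda>t. G2 t - \<kappa> *\<^sub>R \<gamma>2 t"]) (use d in \<open>auto intro!: continuous_intros G2_cont \<gamma>2_cont\<close>)
  moreover have "char_op h \<zeta> 0 (cvec \<circ> ?u) \<tau> = cvec (Bq \<tau> - (2 * a) *\<^sub>R D_char \<gamma>1 \<tau>)" for \<tau>
  proof -
    have "\<gamma>2 \<tau> = L \<tau> (hist h \<gamma>1 \<tau>)" by (simp add: \<gamma>2_def L_def)
    moreover have "hist h ?u \<tau> = hist h v \<tau> - \<kappa> *\<^sub>R hist h \<gamma>1 \<tau>"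
      using hist_diff[OF h_nonneg v_cont, where y = "\<lambda>t. \<kappa> *\<^sub>R \<gamma>1 t" and t = \<tau>] hist_scaleR[OF h_nonneg \<gamma>1_cont, where t = \<tau> and c = \<kappa>] by (simp add: continuous_on_scaleR \<gamma>1_cont)
    ultimately have "(G2 \<tau> - \<kappa> *\<^sub>R \<gamma>2 \<tau>) - L \<tau> (hist h ?u \<tau>) = G2 \<tau> - L \<tau> (hist h v \<tau>)"
      by (simp add: linear_diff[OF linear(1)] linear_scale[OF linear(1)])
    then show ?thesis unfolding char_op_value[OF c d] v_equation by simp
  qed
  ultimately show ?thesis by (simp add: solves2_def v_per \<gamma>1_per)
qed

lemma selected_unique: "\<exists>!u. solves2 u \<and> sun u = 0"
proof (rule ex1I[of _ "\<lambda>t. v t - sun v *\<^sub>R \<gamma>1 t"])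
  have "sun (\<lambda>t. v t - sun v *\<^sub>R \<gamma>1 t) = sun v - sun v" by (rule sun_shift[OF solves2_exists]) simp
  then show "solves2 (\<lambda>t. v t - sun v *\<^sub>R \<gamma>1 t) \<and> sun (\<lambda>t. v t - sun v *\<^sub>R \<gamma>1 t) = 0" using solves2_exists by simp
  fix u assume u: "solves2 u \<and> sun u = 0"
  then obtain \<kappa> where \<kappa>: "\<And>t. v t = u t + \<kappa> *\<^sub>R \<gamma>1 t" using solves2_unique by blast
  then have "sun v = \<kappa>" using sun_shift[OF conjunct1[OF u] \<kappa>] u by simp
  then show "u = (\<lambda>t. v t - sun v *\<^sub>R \<gamma>1 t)" using \<kappa> by (simp add: fun_eq_iff)
qed

lemma h2_selected:
  assumes u: "solves2 u" "sun u = 0" and "sun_pairing h T (adjoint_state h \<zeta> r) h2 = 0"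
  shows "h2 = h2_of h a \<gamma>1 u"
proof -
  obtain \<kappa> where \<kappa>: "\<And>t. v t = u t + \<kappa> *\<^sub>R \<gamma>1 t" using solves2_unique[OF u(1)] by blast
  have h2: "h2 = h2_of h a \<gamma>1 v" using h2_eq by (intro ext)
  then have "sun v = 0" using assms(3) by (simp only:)
  then have "\<kappa> = 0" using sun_shift[OF u(1) \<kappa>] u(2) by simp
  then have "v = u" using \<kappa> by (simp add: fun_eq_iff)
  then show ?thesis using h2 by (simp only:)
qed

end

section \<open>The normal form coefficients\<close>

lemma smooth_on_continuous:
  assumes "smooth_on m S f"
  shows "continuous_on S f"
  unfolding continuous_on_iff
proof (intro ballI allI impI)
  fix x and e :: real assume x: "x \<in> S" and e: "0 < e"
  have "\<exists>d>0. \<forall>y\<in>S. dist y x < d \<longrightarrow> (\<forall>vs. length vs = 0 \<longrightarrow>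
      norm (iter_deriv f vs y - iter_deriv f vs x) \<le> (e / 2) * prod_list (map norm vs))"
    using assms x e unfolding smooth_on_def by (metis half_gt_zero le0)
  then obtain d where "d > 0" "\<And>y. y \<in> S \<Longrightarrow> dist y x < d \<Longrightarrow> norm (f y - f x) \<le> e / 2" by force
  then show "\<exists>d>0. \<forall>y\<in>S. dist y x < d \<longrightarrow> dist (f y) (f x) < e"
    using e by (intro exI[of _ d]) (force simp: dist_norm)
qed

theorem mainTheorem2:
  fixes h T a c \<delta> s\<^sub>0 :: real and k :: nat
    and F :: "(real \<Rightarrow>\<^sub>C (real^'n)) \<Rightarrow> real^'n"
    and \<gamma> q q\<^sub>0 r :: "real \<Rightarrow> real^'n"
    and p :: "real \<Rightarrow> complex^'n"
    and \<zeta> :: "real \<Rightarrow> real \<Rightarrow> real^'n^'n"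
    and L :: "real \<Rightarrow> (real \<Rightarrow>\<^sub>C (real^'n)) \<Rightarrow> real^'n"
    and \<phi> h2 h3 :: "real \<Rightarrow> (real \<Rightarrow>\<^sub>C (real^'n))"
    and \<Gamma> W :: "(real \<Rightarrow>\<^sub>C (real^'n)) set"
    and H :: "real \<Rightarrow> real \<Rightarrow> (real \<Rightarrow>\<^sub>C (real^'n))"
    and \<rho>\<^sub>1 \<rho>\<^sub>2 :: "real \<Rightarrow> real \<Rightarrow> real"
    and B :: "(real \<Rightarrow> (real \<Rightarrow>\<^sub>C (real^'n))) \<Rightarrow> (real \<Rightarrow> (real \<Rightarrow>\<^sub>C (real^'n))) \<Rightarrow> real \<Rightarrow> real^'n"
    and C :: "(real \<Rightarrow> (real \<Rightarrow>\<^sub>C (real^'n))) \<Rightarrow> (real \<Rightarrow> (real \<Rightarrow>\<^sub>C (real^'n))) \<Rightarrow> (real \<Rightarrow> (real \<Rightarrow>\<^sub>C (real^'n))) \<Rightarrow> real \<Rightarrow> real^'n"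
  assumes h: "0 < h" and k: "k + 1 \<ge> 3" and T: "0 < T"
    and F: "phase_functional h F" "smooth_on (k + 1) UNIV F"
    and \<gamma>: "dde_solution h F \<gamma> UNIV" "periodic T \<gamma>"
    and \<Gamma>: "\<Gamma> = range (hist h \<gamma>)"
    and L: "L = (\<lambda>t. frechet_derivative F (at (hist h \<gamma> t)))"
    and \<zeta>: "represents_kernel h T \<zeta> L"
    and B: "B = (\<lambda>\<psi>\<^sub>1 \<psi>\<^sub>2 \<tau>. iter_deriv F [\<psi>\<^sub>1 \<tau>, \<psi>\<^sub>2 \<tau>] (hist h \<gamma> \<tau>))"
    and C: "C = (\<lambda>\<psi>\<^sub>1 \<psi>\<^sub>2 \<psi>\<^sub>3 \<tau>. iter_deriv F [\<psi>\<^sub>1 \<tau>, \<psi>\<^sub>2 \<tau>, \<psi>\<^sub>3 \<tau>] (hist h \<gamma> \<tau>))"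
    and multipliers: "{\<mu>. floquet_multiplier h L T s\<^sub>0 \<mu> \<and> norm \<mu> = 1} = {1, -1}"
      "simple_eigenvalue (phase_space h) (monodromy h L T s\<^sub>0) 1"
      "simple_eigenvalue (phase_space h) (monodromy h L T s\<^sub>0) (-1)"
    and q: "null_function (char_op h \<zeta> 0) (cvec \<circ> q)" "antiperiodic T q"
      "pairing T (\<lambda>\<tau>. \<chi> i. cnj (cvec (q \<tau>) $ i)) (cvec \<circ> q) = 1"
    and p: "null_function (adj_char_op h \<zeta> 0) p" "antiperiodic T p"
      "pairing T p (char_op_deriv h \<zeta> 0 (cvec \<circ> q)) = 1"
    and \<phi>: "\<phi> = hist h q"
    and q\<^sub>0: "q\<^sub>0 = (\<lambda>\<tau>. vector_derivative \<gamma> (at \<tau>))"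
    and r: "null_function (adj_char_op h \<zeta> 0) (cvec \<circ> r)" "periodic T r"
      "pairing T (cvec \<circ> r) (char_op_deriv h \<zeta> 0 (cvec \<circ> q\<^sub>0)) = 1"
    and W: "local_center_manifold k h F T \<gamma> W"
    and \<delta>: "0 < \<delta>"
    and H: "parametrizes_near \<Gamma> W H \<delta>" "smooth_on k (UNIV \<times> {-\<delta><..<\<delta>}) (\<lambda>(\<tau>, \<xi>). H \<tau> \<xi>)"
    and H_expansion: "\<exists>K. \<forall>\<tau> \<xi>. \<bar>\<xi>\<bar> < \<delta> \<longrightarrow>
          norm (H \<tau> \<xi> - (hist h \<gamma> \<tau> + \<xi> *\<^sub>R \<phi> \<tau> + (1/2 * \<xi>\<^sup>2) *\<^sub>R h2 \<tau> + (1/6 * \<xi> ^ 3) *\<^sub>R h3 \<tau>))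
            \<le> K * \<xi> ^ 4"
    and H_symmetry: "\<And>\<tau> \<xi>. \<bar>\<xi>\<bar> < \<delta> \<Longrightarrow> H (\<tau> + 2 * T) \<xi> = H \<tau> \<xi>"
      "\<And>\<tau> \<xi>. \<bar>\<xi>\<bar> < \<delta> \<Longrightarrow> H \<tau> \<xi> = H (\<tau> + T) (- \<xi>)"
    and dynamics: "pd_normal_form_dynamics h F \<Gamma> W H a c \<rho>\<^sub>1 \<rho>\<^sub>2"
      "normal_form_remainder k T \<delta> \<rho>\<^sub>1" "normal_form_remainder k T \<delta> \<rho>\<^sub>2"
  defines "selected \<equiv> \<lambda>v. v C1_differentiable_on UNIV \<and> periodic T v \<and>
      (\<forall>\<tau>. char_op h \<zeta> 0 (cvec \<circ> v) \<tau>
           = cvec (B \<phi> \<phi> \<tau>) - (2 * of_real a) *s char_op_deriv h \<zeta> 0 (cvec \<circ> q\<^sub>0) \<tau>) \<and>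
      sun_pairing h T (adjoint_state h \<zeta> r) (h2_of h a q\<^sub>0 v) = 0"
  shows "of_real a = 1/2 * pairing T (cvec \<circ> r) (cvec \<circ> B \<phi> \<phi>) \<and>
    (\<exists>!v\<^sub>0. selected v\<^sub>0) \<and>
    (\<forall>v\<^sub>0. selected v\<^sub>0 \<longrightarrow>
       of_real c = 1/6 * pairing T p (\<lambda>\<tau>.
         cvec (C \<phi> \<phi> \<phi> \<tau> + 3 *\<^sub>R B \<phi> (h2_of h a q\<^sub>0 v\<^sub>0) \<tau>)
         - (6 * of_real a) *s char_op_deriv h \<zeta> 0 (\<lambda>t. cvec (vector_derivative q (at t))) \<tau>) \<and>
       (sun_pairing h T (adjoint_state h \<zeta> r) h2 = 0 \<longrightarrow> h2 = h2_of h a q\<^sub>0 v\<^sub>0))"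
proof -
  interpret per: periodic_dde h T k F \<gamma> \<zeta>
    by unfold_locales (use h T k F \<gamma> \<zeta> L in simp_all)
  have LL: "L = per.L" unfolding L per.L_frechet ..
  have q0: "q\<^sub>0 = per.\<gamma>1" unfolding q\<^sub>0 by (intro ext vector_derivative_at per.\<gamma>_deriv)
  note q_sol = per.null_function_lin_sol[OF q(1)]
  have \<gamma>1_nz: "\<exists>t. per.\<gamma>1 t \<noteq> 0"
  proof (rule ccontr)
    assume "\<not> (\<exists>t. per.\<gamma>1 t \<noteq> 0)"
    then have z: "per.\<gamma>1 t = 0" for t by blast
    have "per.D_char per.\<gamma>1 t = 0" for t
      using per.hist_zero[of 0] unfolding per.D_char_def hist_def by (simp add: z linear_0[OF per.linear(1)])
    then have "char_op_deriv h \<zeta> 0 (cvec \<circ> per.\<gamma>1) = (\<lambda>_. 0)"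
      using per.char_op_deriv_value[OF per.\<gamma>1_cont] by (simp add: fun_eq_iff cvec_simps)
    then show False using r(3) unfolding q0 by (simp add: pairing_def)
  qed
  obtain KH where KH: "\<And>\<tau> \<xi>. \<bar>\<xi>\<bar> < \<delta> \<Longrightarrow>
      norm (H \<tau> \<xi> - (hist h \<gamma> \<tau> + \<xi> *\<^sub>R \<phi> \<tau> + (1/2 * \<xi>\<^sup>2) *\<^sub>R h2 \<tau> + (1/6 * \<xi> ^ 3) *\<^sub>R h3 \<tau>)) \<le> KH * \<xi> ^ 4"
    using H_expansion by blast
  obtain K1 K2 where K1: "\<And>\<tau> \<xi>. \<bar>\<xi>\<bar> < \<delta> \<Longrightarrow> \<bar>\<rho>\<^sub>1 \<tau> \<xi>\<bar> \<le> K1 * \<xi> ^ 4"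
    and K2: "\<And>\<tau> \<xi>. \<bar>\<xi>\<bar> < \<delta> \<Longrightarrow> \<bar>\<rho>\<^sub>2 \<tau> \<xi>\<bar> \<le> K2 * \<xi> ^ 4"
    using dynamics(2,3) unfolding normal_form_remainder_def by blast
  have K_abs: "K * \<xi> ^ 4 \<le> \<bar>K\<bar> * \<xi> ^ 4" for K \<xi> :: real by (intro mult_right_mono) auto
  interpret pd: pd_adjoint h T k F \<gamma> \<zeta> a c \<delta> "\<bar>KH\<bar>" "\<bar>K1\<bar>" "\<bar>K2\<bar>" q W H h2 h3 \<rho>\<^sub>1 \<rho>\<^sub>2 s\<^sub>0 r p
  proof unfold_locales
    fix t \<tau> \<xi> :: real
    show "per.lin_sol q" "\<exists>t. q t \<noteq> 0" "\<exists>t. per.\<gamma>1 t \<noteq> 0" by (fact q_sol \<gamma>1_nz)+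
    show "q (t + T) = - q t" "p (t + T) = - p t" "r (t + T) = r t"
      using q(2) p(2) r(2) by (simp_all add: antiperiodic_def periodic_def)
    show "W \<subseteq> phase_space h" "locally_positively_invariant h F (range (hist h \<gamma>)) W"
      using W by (simp_all add: local_center_manifold_def)
    show "0 < \<delta>" by (fact \<delta>)
    show "continuous_on (UNIV \<times> {-\<delta><..<\<delta>}) (\<lambda>(\<tau>, \<xi>). H \<tau> \<xi>)" by (rule smooth_on_continuous[OF H(2)])
    show "pd_normal_form_dynamics h F (range (hist h \<gamma>)) W H a c \<rho>\<^sub>1 \<rho>\<^sub>2" using dynamics(1) unfolding \<Gamma> .
    show "0 \<le> \<bar>KH\<bar>" "0 \<le> \<bar>K1\<bar>" "0 \<le> \<bar>K2\<bar>" by simp_all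
    show "simple_eigenvalue (phase_space h) (monodromy h per.L T s\<^sub>0) 1" using multipliers(2) unfolding LL .
    show "null_function (adj_char_op h \<zeta> 0) (cvec \<circ> r)" "null_function (adj_char_op h \<zeta> 0) p" by (fact r(1) p(1))+
    show "pairing T (cvec \<circ> r) (char_op_deriv h \<zeta> 0 (cvec \<circ> per.\<gamma>1)) = 1" using r(3) unfolding q0 .
    show "pairing T p (char_op_deriv h \<zeta> 0 (cvec \<circ> q)) = 1" by (fact p(3))
    assume \<xi>: "\<bar>\<xi>\<bar> < \<delta>"
    show "H \<tau> \<xi> \<in> W" using H(1) \<xi> by (simp add: parametrizes_near_def)
    show "norm (H \<tau> \<xi> - (hist h \<gamma> \<tau> + \<xi> *\<^sub>R hist h q \<tau> + (1/2 * \<xi>\<^sup>2) *\<^sub>R h2 \<tau> + (1/6 * \<xi> ^ 3) *\<^sub>R h3 \<tau>)) \<le> \<bar>KH\<bar> * \<xi> ^ 4"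
      using order_trans[OF KH[OF \<xi>, of \<tau>] K_abs] unfolding \<phi> .
    show "H (\<tau> + 2 * T) \<xi> = H \<tau> \<xi>" "H \<tau> \<xi> = H (\<tau> + T) (- \<xi>)" by (fact H_symmetry[OF \<xi>])+
    show "\<rho>\<^sub>1 (\<tau> + 2 * T) \<xi> = \<rho>\<^sub>1 \<tau> \<xi>" "\<rho>\<^sub>2 (\<tau> + 2 * T) \<xi> = \<rho>\<^sub>2 \<tau> \<xi>"
      using dynamics(2,3) \<xi> by (simp_all add: normal_form_remainder_def)
    show "\<bar>\<rho>\<^sub>1 \<tau> \<xi>\<bar> \<le> \<bar>K1\<bar> * \<xi> ^ 4" "\<bar>\<rho>\<^sub>2 \<tau> \<xi>\<bar> \<le> \<bar>K2\<bar> * \<xi> ^ 4"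
      using order_trans[OF K1[OF \<xi>] K_abs] order_trans[OF K2[OF \<xi>] K_abs] by blast+
  qed
  have Bq: "B \<phi> \<phi> = pd.Bq" by (simp add: B \<phi> pd.Bq_def per.orbit_def fun_eq_iff)
  have D\<gamma>1: "char_op_deriv h \<zeta> 0 (cvec \<circ> per.\<gamma>1) \<tau> = cvec (per.D_char per.\<gamma>1 \<tau>)" for \<tau>
    by (rule per.char_op_deriv_value[OF per.\<gamma>1_cont])
  have sel: "selected u \<longleftrightarrow> pd.solves2 u \<and> pd.sun u = 0" for u
    unfolding selected_def pd.solves2_def Bq q0 D\<gamma>1 by (auto simp: periodic_def cvec_simps)
  have "of_real a = 1/2 * pairing T (cvec \<circ> r) (cvec \<circ> B \<phi> \<phi>)" unfolding Bq by (rule pd.a_formula)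
  moreover have "\<exists>!v\<^sub>0. selected v\<^sub>0" unfolding sel by (rule pd.selected_unique)
  moreover have "of_real c = 1/6 * pairing T p (\<lambda>\<tau>.
         cvec (C \<phi> \<phi> \<phi> \<tau> + 3 *\<^sub>R B \<phi> (h2_of h a q\<^sub>0 u) \<tau>)
         - (6 * of_real a) *s char_op_deriv h \<zeta> 0 (\<lambda>t. cvec (vector_derivative q (at t))) \<tau>)" if u: "selected u" for u
  proof -
    have u2: "pd.solves2 u" using u sel by blast
    obtain \<kappa> where \<kappa>: "\<And>t. pd.v t = u t + \<kappa> *\<^sub>R per.\<gamma>1 t" using pd.solves2_unique[OF u2] by blast
    have q1: "(\<lambda>t. cvec (vector_derivative q (at t))) = cvec \<circ> pd.q1"
      by (simp add: fun_eq_iff vector_derivative_at[OF pd.q1_deriv])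
    let ?X = "\<lambda>t. pd.Cq t + 3 *\<^sub>R iter_deriv F [hist h q t, h2_of h a per.\<gamma>1 u t] (per.orbit t) - (6 * a) *\<^sub>R per.D_char pd.q1 t"
    have "(\<lambda>\<tau>. cvec (C \<phi> \<phi> \<phi> \<tau> + 3 *\<^sub>R B \<phi> (h2_of h a q\<^sub>0 u) \<tau>)
         - (6 * of_real a) *s char_op_deriv h \<zeta> 0 (\<lambda>t. cvec (vector_derivative q (at t))) \<tau>) = cvec \<circ> ?X"
      unfolding q1 per.char_op_deriv_value[OF pd.q1_cont] q0
      by (simp add: fun_eq_iff B C \<phi> pd.Cq_def per.orbit_def cvec_simps)
    then show ?thesis using pd.c_formula[OF \<kappa> pd.solves2_cont[OF u2]] by (simp only: pairing_cvec)
  qed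
  moreover have "h2 = h2_of h a q\<^sub>0 u" if "selected u" "sun_pairing h T (adjoint_state h \<zeta> r) h2 = 0" for u
    using pd.h2_selected[of u] that unfolding sel q0 by blast
  ultimately show ?thesis by blast
qed

end
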